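(* Let $\mathcal H$ be a separable Hilbert space and let $(t,\alpha)\mapsto H_\alpha(t)$, $(t,\alpha)\in[0,1]\times[0,1]$, be a family of bounded self-adjoint operators on $\mathcal H$ satisfying the Regularity assumption and the Gap hypothesis stated in the context. Let $Q_\alpha(t)$ be the charge operator, and let $P_\alpha, K_\alpha, W_\alpha,\Phi_\alpha$ and $H^{(1)}_\alpha, P^{(1)}_\alpha, W^{(1)}_\alpha,\Phi^{(1)}_\alpha$ be as defined in the context. Then for any $(t,\alpha)\in[0,1]\times[0,1]$, as $\epsilon\to 0$ (in operator norm), $$ \begin{aligned} &P_\alpha(0)\,Q_\alpha(t)\,P_\alpha(0)\\ &=P_\alpha(0)\left(\frac1\epsilon\int_0^t \Phi^{(1)}_\alpha(s)^{-1}\,W^{(1)}_\alpha(s)^{-1}\,P^{(1)}_\alpha(s)\,\big(\partial_\alpha H^{(1)}_\alpha(s)\big)\,P^{(1)}_\alpha(s)\,W^{(1)}_\alpha(s)\,\Phi^{(1)}_\alpha(s)\,ds\right)P_\alpha(0)\\ &\quad+P_\alpha(0)\left(\int_0^t \Phi_\alpha(s)^{-1}\,W_\alpha(s)^{-1}\,\big(\partial_\alpha K_\alpha(s)\big)\,W_\alpha(s)\,\Phi_\alpha(s)\,ds\right)P_\alpha(0)+O(\epsilon). \end{aligned} $$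
   Context: Throughout, $\epsilon>0$ is a small parameter, a dot denotes $\partial_t$, $\mathbb I$ is the identity, and $[A,B]=AB-BA$. Regularity assumption: the map $(t,\alpha)\mapsto H_\alpha(t)$ is $C^3$ in the norm sense, as a bounded-operator-valued function on $[0,1]\times[0,1]$. Gap hypothesis: the spectrum of $H_\alpha(t)$ is a disjoint union $\sigma(H_\alpha(t))=\sigma_\alpha(t)\cup\overline{\sigma_\alpha}(t)$ with $\inf_{(t,\alpha)\in[0,1]^2}\mathrm{dist}(\sigma_\alpha(t),\overline{\sigma_\alpha}(t))=g>0$ (here $\overline{\sigma_\alpha}(t)$ denotes the other part of the spectrum, not a closure). The spectral projector of $H_\alpha(t)$ associated with $\sigma_\alpha(t)$ is $$P_\alpha(t)=-\frac1{2\pi i}\int_\gamma (H_\alpha(t)-z)^{-1}\,dz,$$ where $\gamma$ is a loop in the complex plane encircling $\sigma_\alpha(t)$ only, which can be chosen locally independent of $(t,\alpha)$; $\overline{P_\alpha}(t)=\mathbb I-P_\alpha(t)$. Evolution and charge operator: $U_\alpha(t)$ (depending on $\epsilon$) is the solution of $i\epsilon\,\dot U_\alpha(t)=H_\alpha(t)U_\alpha(t)$, $U_\alpha(0)=\mathbb I$, and $$Q_\alpha(t)=\frac1\epsilon\int_0^t U_\alpha(s)^{-1}\big(\partial_\alpha H_\alpha(s)\big)U_\alpha(s)\,ds .$$ First-order objects: $K_\alpha(t)=i[\dot P_\alpha(t),P_\alpha(t)]$; $W_\alpha$ and $\Phi_\alpha$ are the unitary solutions of $$i\dot W_\alpha(t)=K_\alpha(t)W_\alpha(t),\quad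 W_\alpha(0)=\mathbb I,\qquad i\epsilon\dot\Phi_\alpha(t)=W_\alpha(t)^{-1}H_\alpha(t)W_\alpha(t)\Phi_\alpha(t),\quad \Phi_\alpha(0)=\mathbb I.$$ Second-order objects: $H^{(1)}_\alpha(t)=H_\alpha(t)-\epsilon K_\alpha(t)$. For $\epsilon$ small enough its spectrum still splits into two separated parts $\sigma^{(1)}_\alpha(t)\cup\overline{\sigma^{(1)}_\alpha}(t)$, the part $\sigma^{(1)}_\alpha(t)$ being the one encircled by the loop $\gamma$ above, and $P^{(1)}_\alpha(t)=-\frac1{2\pi i}\int_\gamma(H^{(1)}_\alpha(t)-z)^{-1}dz$ is the corresponding spectral projector, $\overline{P^{(1)}_\alpha}(t)=\mathbb I-P^{(1)}_\alpha(t)$. Set $K^{(1)}_\alpha(t)=i[\dot P^{(1)}_\alpha(t),P^{(1)}_\alpha(t)]$ and, for bounded $B$, $\mathcal D^1_\alpha(B)(t)=P^{(1)}_\alpha(t)BP^{(1)}_\alpha(t)+\overline{P^{(1)}_\alpha}(t)B\overline{P^{(1)}_\alpha}(t)$. Then $W^{(1)}_\alpha$ and $\Phi^{(1)}_\alpha$ are the unitary solutions of $$i\dot W^{(1)}_\alpha(t)=K^{(1)}_\alpha(t)W^{(1)}_\alpha(t),\quad W^{(1)}_\alpha(0)=\mathbb I,$$ $$i\epsilon\dot\Phi^{(1)}_\alpha(t)=W^{(1)}_\alpha(t)^{-1}\Big(H^{(1)}_\alpha(t)+\epsilon\,\mathcal D^1_\alpha(K_\alpha(t))(t)\Big)W^{(1)}_\alpha(t)\,\Phi^{(1)}_\alpha(t),\quad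 \Phi^{(1)}_\alpha(0)=\mathbb I.$$ *)

theory Defs
  imports "HOL-Complex_Analysis.Complex_Analysis" "HOL-Library.Landau_Symbols"
begin

section \<open>Complex Hilbert spaces\<close>

text \<open>
  HOL-Analysis has real Hilbert spaces only.  The complex structure is put on top of the real one,
  so that norm, completeness, derivatives and integrals are those of the library; the real inner
  product is the real part of the complex one.  The complex inner product is conjugate linear in
  its first argument.
\<close>

class complex_vector = real_vector +
  fixes scaleC :: "complex \<Rightarrow> 'a \<Rightarrow> 'a" (infixr \<open>*\<^sub>C\<close> 75)
  assumes scaleC_add_right: "c *\<^sub>C (x + y) = c *\<^sub>C x + c *\<^sub>C y"
    and scaleC_add_left: "(c + d) *\<^sub>C x = c *\<^sub>C x + d *\<^sub>C x"
    and scaleC_scaleC: "c *\<^sub>C (d *\<^sub>C x) = (c * d) *\<^sub>C x"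
    and scaleC_of_real: "complex_of_real r *\<^sub>C x = r *\<^sub>R x"

class complex_normed_vector = complex_vector + real_normed_vector +
  assumes norm_scaleC: "norm (c *\<^sub>C x) = cmod c * norm x"

class complex_inner = complex_vector + real_inner +
  fixes cinner :: "'a \<Rightarrow> 'a \<Rightarrow> complex"
  assumes cinner_commute: "cinner y x = cnj (cinner x y)"
    and cinner_add_right: "cinner x (y + z) = cinner x y + cinner x z"
    and cinner_scaleC_right: "cinner x (c *\<^sub>C y) = c * cinner x y"
    and Re_cinner: "Re (cinner x y) = inner x y"
begin

lemma cinner_scaleC_left: "cinner (c *\<^sub>C x) y = cnj c * cinner x y"
  by (metis cinner_commute cinner_scaleC_right complex_cnj_mult)

subclass complex_normed_vector
proof
  fix c and x :: 'a
  have "inner (c *\<^sub>C x) (c *\<^sub>C x) = Re (cnj c * (c * cinner x x))"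
    by (metis Re_cinner cinner_scaleC_left cinner_scaleC_right mult.left_commute)
  also have "cnj c * (c * cinner x x) = complex_of_real ((cmod c)\<^sup>2) * cinner x x"
    using complex_norm_square[of c] by (simp add: mult.assoc mult.left_commute)
  also have "Re \<dots> = (cmod c)\<^sup>2 * inner x x"
    unfolding Re_cinner[symmetric] by simp
  finally show "norm (c *\<^sub>C x) = cmod c * norm x"
    by (simp add: norm_eq_sqrt_inner real_sqrt_mult)
qed

end

class chilbert_space = complex_inner + banach

instantiation complex :: chilbert_space
begin
definition scaleC_complex :: "complex \<Rightarrow> complex \<Rightarrow> complex" where "scaleC_complex c x = c * x"
definition cinner_complex :: "complex \<Rightarrow> complex \<Rightarrow> complex" where "cinner_complex x y = cnj x * y"
instance
  by standard
    (auto simp: scaleC_complex_def cinner_complex_def algebra_simps scaleR_conv_of_real inner_complex_def)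
end

section \<open>Bounded operators\<close>

text \<open>
  Operators are elements of the library type of bounded (real-)linear maps with the operator norm.
  Complex linearity need not be imposed separately: it follows for self-adjoint operators, is
  inherited by inverses, limits and integrals, and by the solutions of the evolution equations
  below.
\<close>

instantiation blinfun :: (real_normed_vector, complex_normed_vector) complex_normed_vector
begin

lift_definition scaleC_blinfun :: "complex \<Rightarrow> ('a \<Rightarrow>\<^sub>L 'b) \<Rightarrow> ('a \<Rightarrow>\<^sub>L 'b)"
  is "\<lambda>c f x. c *\<^sub>C f x"
proof -
  fix c :: complex and f :: "'a \<Rightarrow> 'b"
  assume "bounded_linear f"
  then interpret bounded_linear f .
  obtain K where K: "\<And>x. norm (f x) \<le> norm x * K"
    using bounded by blast
  show "bounded_linear (\<lambda>x. c *\<^sub>C f x)"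
  proof
    show "c *\<^sub>C f (x + y) = c *\<^sub>C f x + c *\<^sub>C f y" for x y
      by (simp add: add scaleC_add_right)
    show "c *\<^sub>C f (r *\<^sub>R x) = r *\<^sub>R c *\<^sub>C f x" for r x
      by (simp add: scaleR scaleC_of_real[symmetric] scaleC_scaleC mult.commute)
    show "\<exists>K. \<forall>x. norm (c *\<^sub>C f x) \<le> norm x * K"
    proof (intro exI allI)
      fix x
      have "cmod c * norm (f x) \<le> cmod c * (norm x * K)"
        using K by (simp add: mult_left_mono)
      then show "norm (c *\<^sub>C f x) \<le> norm x * (cmod c * K)"
        by (simp add: norm_scaleC mult_ac)
    qed
  qed
qed

instance
proof
  fix c d :: complex and r :: real and f g :: "'a \<Rightarrow>\<^sub>L 'b"
  show "c *\<^sub>C (f + g) = c *\<^sub>C f + c *\<^sub>C g" "(c + d) *\<^sub>C f = c *\<^sub>C f + d *\<^sub>C f"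
    "c *\<^sub>C d *\<^sub>C f = (c * d) *\<^sub>C f" "complex_of_real r *\<^sub>C f = r *\<^sub>R f"
    by (transfer; simp add: fun_eq_iff scaleC_add_right scaleC_add_left scaleC_scaleC scaleC_of_real)+
  have le: "norm (c *\<^sub>C f) \<le> cmod c * norm f" for c and f :: "'a \<Rightarrow>\<^sub>L 'b"
  proof (rule norm_blinfun_bound)
    show "norm (blinfun_apply (c *\<^sub>C f) x) \<le> cmod c * norm f * norm x" for x
      using mult_left_mono[OF norm_blinfun[of f x] norm_ge_zero[of c]]
      by (simp add: scaleC_blinfun.rep_eq norm_scaleC mult_ac)
  qed simp
  show "norm (c *\<^sub>C f) = cmod c * norm f"
  proof (cases "c = 0")
    case True
    then show ?thesis
      using le[of 0 f] by simp
  next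
    case False
    have "inverse c *\<^sub>C c *\<^sub>C f = f"
      using False by (transfer, simp add: fun_eq_iff scaleC_scaleC scaleC_of_real[of 1, simplified])
    then have "norm f \<le> cmod (inverse c) * norm (c *\<^sub>C f)"
      using le[of "inverse c" "c *\<^sub>C f"] by simp
    then have "cmod c * norm f \<le> norm (c *\<^sub>C f)"
      using False by (simp add: norm_inverse norm_divide field_simps)
    then show ?thesis
      using le[of c f] by simp
  qed
qed

end

definition self_adjoint :: "('a::complex_inner \<Rightarrow>\<^sub>L 'a) \<Rightarrow> bool" where
  "self_adjoint T \<longleftrightarrow> (\<forall>x y. cinner (T x) y = cinner x (T y))"

definition op_invertible :: "('a::real_normed_vector \<Rightarrow>\<^sub>L 'a) \<Rightarrow> bool" where
  "op_invertible T \<longleftrightarrow> (\<exists>S. S o\<^sub>L T = id_blinfun \<and> T o\<^sub>L S = id_blinfun)"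

definition op_inverse :: "('a::real_normed_vector \<Rightarrow>\<^sub>L 'a) \<Rightarrow> ('a \<Rightarrow>\<^sub>L 'a)" where
  "op_inverse T = (THE S. S o\<^sub>L T = id_blinfun \<and> T o\<^sub>L S = id_blinfun)"

definition op_spectrum :: "('a::complex_normed_vector \<Rightarrow>\<^sub>L 'a) \<Rightarrow> complex set" where
  "op_spectrum T = {z. \<not> op_invertible (T - z *\<^sub>C id_blinfun)}"

definition commutator :: "('a::real_normed_vector \<Rightarrow>\<^sub>L 'a) \<Rightarrow> ('a \<Rightarrow>\<^sub>L 'a) \<Rightarrow> ('a \<Rightarrow>\<^sub>L 'a)" where
  "commutator A B = (A o\<^sub>L B) - (B o\<^sub>L A)"

section \<open>Loops and spectral projectors\<close>

text \<open>The vector-valued analogue of the library's \<^const>\<open>contour_integral\<close>.\<close>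

definition vector_contour_integral ::
    "(real \<Rightarrow> complex) \<Rightarrow> (complex \<Rightarrow> 'b::complex_normed_vector) \<Rightarrow> 'b" where
  "vector_contour_integral \<gamma> f =
     integral {0..1} (\<lambda>x. vector_derivative \<gamma> (at x within {0..1}) *\<^sub>C f (\<gamma> x))"

definition spectral_projector ::
    "('a::complex_normed_vector \<Rightarrow>\<^sub>L 'a) \<Rightarrow> (real \<Rightarrow> complex) \<Rightarrow> ('a \<Rightarrow>\<^sub>L 'a)" where
  "spectral_projector T \<gamma> =
     (- (1 / (2 * of_real pi * \<i>))) *\<^sub>C
       vector_contour_integral \<gamma> (\<lambda>z. op_inverse (T - z *\<^sub>C id_blinfun))"

definition encircles_only :: "(real \<Rightarrow> complex) \<Rightarrow> complex set \<Rightarrow> complex set \<Rightarrow> bool" where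
  "encircles_only \<gamma> A B \<longleftrightarrow>
     valid_path \<gamma> \<and> pathfinish \<gamma> = pathstart \<gamma> \<and> path_image \<gamma> \<inter> (A \<union> B) = {} \<and>
     (\<forall>z\<in>A. winding_number \<gamma> z = 1) \<and> (\<forall>z\<in>B. winding_number \<gamma> z = 0)"

section \<open>Differential calculus on the unit interval and the unit square\<close>

text \<open>The derivative on the unit interval, one-sided at the end points.\<close>

abbreviation deriv01 :: "(real \<Rightarrow> 'b::real_normed_vector) \<Rightarrow> real \<Rightarrow> 'b" where
  "deriv01 f x \<equiv> vector_derivative f (at x within {0..1})"

text \<open>
  \<open>Ck_on k S f\<close>: on \<open>S\<close> the function \<open>f\<close> of two real variables is \<open>k\<close> times continuously
  (Frechet) differentiable in norm, where \<open>f1\<close>, \<open>f2\<close> are the two partial derivatives and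
  differentiability is relative to \<open>S\<close> (one-sided on the boundary of a square).
\<close>

primrec Ck_on :: "nat \<Rightarrow> (real \<times> real) set \<Rightarrow> (real \<times> real \<Rightarrow> 'b::real_normed_vector) \<Rightarrow> bool" where
  "Ck_on 0 S f \<longleftrightarrow> continuous_on S f"
| "Ck_on (Suc k) S f \<longleftrightarrow>
     (\<exists>f1 f2. (\<forall>p\<in>S. (f has_derivative (\<lambda>h. fst h *\<^sub>R f1 p + snd h *\<^sub>R f2 p)) (at p within S)) \<and>
              Ck_on k S f1 \<and> Ck_on k S f2)"

text \<open>
  \<open>V\<close> solves \<open>\<i> \<epsilon> V' = G V\<close>, \<open>V 0 = 1\<close> on the unit interval.  For continuous \<open>G\<close> such a \<open>V\<close>
  exists, is unique on the unit interval, and is unitary if \<open>\<epsilon>\<close> is real and nonzero and \<open>G\<close> is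
  self-adjoint.
\<close>

definition is_evolution ::
    "real \<Rightarrow> (real \<Rightarrow> ('a::complex_normed_vector \<Rightarrow>\<^sub>L 'a)) \<Rightarrow> (real \<Rightarrow> ('a \<Rightarrow>\<^sub>L 'a)) \<Rightarrow> bool" where
  "is_evolution \<epsilon> G V \<longleftrightarrow> V 0 = id_blinfun \<and>
     (\<forall>t\<in>{0..1}. \<exists>D. (V has_vector_derivative D) (at t within {0..1}) \<and>
                     (\<i> * of_real \<epsilon>) *\<^sub>C D = G t o\<^sub>L V t)"

definition block_diagonal ::
    "('a::real_normed_vector \<Rightarrow>\<^sub>L 'a) \<Rightarrow> ('a \<Rightarrow>\<^sub>L 'a) \<Rightarrow> ('a \<Rightarrow>\<^sub>L 'a)" where
  "block_diagonal P B =
     (P o\<^sub>L B o\<^sub>L P) + ((id_blinfun - P) o\<^sub>L B o\<^sub>L (id_blinfun - P))"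

end

theory Submission
  imports Defs
begin

text \<open>
  Write \<open>R(z) = (H - z)\<^sup>-\<^sup>1\<close>, \<open>P = c \<integral> R(z) dz\<close> with \<open>c = - 1 / (2 \<pi> \<i>)\<close>.  For any differentiable \<open>Z\<close> the
  operator \<open>Y = c \<integral> R(z) Z R(z) dz\<close> satisfies \<open>[Y, H] = [P, Z]\<close>, so that
  \<open>U\<^sup>-\<^sup>1 [P, Z] U = \<i> \<epsilon> ((U\<^sup>-\<^sup>1 Y U)' - U\<^sup>-\<^sup>1 Y' U)\<close> has an integral of order \<open>\<epsilon>\<close>.  The evolutions
  \<open>V = W \<Phi>\<close> and \<open>V1 = W1 \<Phi>1\<close> are generated by \<open>H + \<epsilon> K\<close> and \<open>H + \<epsilon> E\<close>, where
  \<open>K = [P, - \<i> P']\<close> and \<open>E = K1 - K + D1(K)\<close> is of order \<open>\<epsilon>\<close> and off-diagonal for \<open>P1\<close>.  Averaging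
  out these off-diagonal terms gives \<open>V = U (1 + O(\<epsilon>))\<close> and \<open>V1 = U (1 + O(\<epsilon>\<^sup>2))\<close>.  Now split
  \<open>\<partial>H = \<partial>H1 + \<epsilon> \<partial>K\<close>, replace \<open>U\<close> by \<open>V1\<close> in the first part and by \<open>V\<close> in the second.  Since \<open>V1\<close>
  intertwines \<open>P1(0)\<close> and \<open>P1(s)\<close> and \<open>P1(0) = P(0) + O(\<epsilon>)\<close>, the block off-diagonal contributions
  are again averaged out.
\<close>

text \<open>The prefactor \<open>1 / \<epsilon>\<close> of the charge dictates the accuracy: an
  evolution equal to \<open>U\<close> only up to O(\<epsilon>) would change the leading integral by
  O(1), so this integral needs \<open>V1\<close>, while the \<partial>K part, free of the prefactor,
  tolerates \<open>V\<close>. The mismatch \<open>P(0) - P1(0)\<close> is only of order \<epsilon>;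
  it is harmless because each error term contains it twice, or once together with an averaged
  off-diagonal block. The loops are the technical obstacle. They change with the parameters, and
  integrals along them need not converge absolutely. Near each point of the square they are replaced
  by one polynomial loop, along which resolvent integrals can be estimated and differentiated under
  the integral sign; local bounds are made uniform in time by bisection. The replacement passes to
  matrix elements and joins two loops inside the resolvent set, which is connected because the
  spectrum is real. Unitarity enters only through \<open>U\<close>; bounds on \<open>V\<close> and
  \<open>V1\<close> follow from their comparison with \<open>U\<close>.\<close>

lemma blinfun_compose_id [simp]: "id_blinfun o\<^sub>L T = T" "T o\<^sub>L id_blinfun = T"
  by (auto intro: blinfun_eqI)

lemma blinfun_compose_assoc: "(A o\<^sub>L B) o\<^sub>L C = A o\<^sub>L (B o\<^sub>L C)"
  by (auto intro: blinfun_eqI)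

lemmas blinfun_compose_linear =
  bounded_bilinear.add_left[OF bounded_bilinear_blinfun_compose]
  bounded_bilinear.add_right[OF bounded_bilinear_blinfun_compose]
  bounded_bilinear.diff_left[OF bounded_bilinear_blinfun_compose]
  bounded_bilinear.diff_right[OF bounded_bilinear_blinfun_compose]
  bounded_bilinear.minus_left[OF bounded_bilinear_blinfun_compose]
  bounded_bilinear.minus_right[OF bounded_bilinear_blinfun_compose]
  bounded_bilinear.scaleR_left[OF bounded_bilinear_blinfun_compose]
  bounded_bilinear.scaleR_right[OF bounded_bilinear_blinfun_compose]

section \<open>Complex scalars and complex-linear operators\<close>

lemma scaleC_zero_left [simp]: "0 *\<^sub>C x = (0 :: 'a :: complex_vector)"
  using scaleC_of_real[of 0 x] by simp

lemma scaleC_one [simp]: "1 *\<^sub>C x = (x :: 'a :: complex_vector)"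
  using scaleC_of_real[of 1 x] by simp

lemma scaleC_minus_left: "(- c) *\<^sub>C x = - (c *\<^sub>C (x :: 'a :: complex_vector))"
  by (metis add.right_inverse add_eq_0_iff scaleC_add_left scaleC_zero_left)

lemma scaleC_diff_left: "(c - d) *\<^sub>C x = c *\<^sub>C x - d *\<^sub>C (x :: 'a :: complex_vector)"
  using scaleC_add_left[of c "- d" x] by (simp add: scaleC_minus_left)

lemma scaleC_scaleR: "c *\<^sub>C (r *\<^sub>R x) = r *\<^sub>R (c *\<^sub>C (x :: 'a :: complex_vector))"
  by (simp add: scaleC_of_real[symmetric] scaleC_scaleC mult.commute)

lemma scaleR_scaleC: "(r *\<^sub>R c) *\<^sub>C x = r *\<^sub>R (c *\<^sub>C (x :: 'a :: complex_vector))"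
  by (simp add: scaleC_of_real[symmetric] scaleC_scaleC scaleC_complex_def)

lemma bounded_bilinear_scaleC:
  "bounded_bilinear (\<lambda>(c::complex) (x::'a::complex_normed_vector). c *\<^sub>C x)"
  by (rule bounded_bilinear.intro)
    (auto simp: scaleC_add_left scaleC_add_right scaleC_scaleR scaleR_scaleC norm_scaleC
          intro!: exI[of _ 1])

lemmas scaleC_right_simps =
  bounded_bilinear.zero_right[OF bounded_bilinear_scaleC]
  bounded_bilinear.diff_right[OF bounded_bilinear_scaleC]
  bounded_bilinear.minus_right[OF bounded_bilinear_scaleC]

lemma scaleC_blinfun_compose_left: "(c *\<^sub>C A) o\<^sub>L B = c *\<^sub>C (A o\<^sub>L B)"
  by (rule blinfun_eqI) (simp add: scaleC_blinfun.rep_eq)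

text \<open>As an element of its type an operator is only real linear. A complex scalar moves out of
  the right factor of a composition past a left factor with this property, so the property is
  carried along for the operators that occur.\<close>

definition clin :: "('a::complex_normed_vector \<Rightarrow>\<^sub>L 'a) \<Rightarrow> bool" where
  "clin T \<longleftrightarrow> (\<forall>c x. T (c *\<^sub>C x) = c *\<^sub>C T x)"

lemma clinD: "clin T \<Longrightarrow> T (c *\<^sub>C x) = c *\<^sub>C T x"
  by (simp add: clin_def)

lemma clin_compose_scaleC: "clin A \<Longrightarrow> A o\<^sub>L (c *\<^sub>C B) = c *\<^sub>C (A o\<^sub>L B)"
  by (rule blinfun_eqI) (simp add: scaleC_blinfun.rep_eq clinD)

lemma clin_simps [simp, intro]:
  "clin id_blinfun" "clin 0"
  "clin A \<Longrightarrow> clin B \<Longrightarrow> clin (A + B)" "clin A \<Longrightarrow> clin B \<Longrightarrow> clin (A - B)"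
  "clin A \<Longrightarrow> clin (- A)"
  "clin A \<Longrightarrow> clin B \<Longrightarrow> clin (A o\<^sub>L B)" "clin A \<Longrightarrow> clin (c *\<^sub>C A)" "clin A \<Longrightarrow> clin (r *\<^sub>R A)"
  by (auto simp: clin_def blinfun.bilinear_simps scaleC_add_right scaleC_right_simps
      scaleC_blinfun.rep_eq scaleC_scaleC scaleC_scaleR mult.commute)

text \<open>This form exhibits the complex-linear operators as the common kernel of bounded
  real-linear maps, one for each scalar. Complex linearity therefore survives derivatives, integrals
  and the flow of linear equations.\<close>

lemma clin_iff_compose: "clin T \<longleftrightarrow> (\<forall>c. (T o\<^sub>L (c *\<^sub>C id_blinfun)) - c *\<^sub>C T = 0)"
proof
  assume "\<forall>c. (T o\<^sub>L (c *\<^sub>C id_blinfun)) - c *\<^sub>C T = 0"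
  then have "(T o\<^sub>L (c *\<^sub>C id_blinfun)) x = (c *\<^sub>C T) x" for c x
    by simp
  then show "clin T"
    by (simp add: clin_def scaleC_blinfun.rep_eq)
qed (auto intro!: blinfun_eqI simp: clin_def scaleC_blinfun.rep_eq blinfun.bilinear_simps)

lemma bounded_linear_clin_defect:
  "bounded_linear (\<lambda>T :: 'a::complex_normed_vector \<Rightarrow>\<^sub>L 'a. (T o\<^sub>L (c *\<^sub>C id_blinfun)) - c *\<^sub>C T)"
proof -
  have "bounded_linear (\<lambda>T :: 'a \<Rightarrow>\<^sub>L 'a. T o\<^sub>L (c *\<^sub>C id_blinfun))"
    by (rule bounded_bilinear.bounded_linear_left[OF bounded_bilinear_blinfun_compose])
  moreover have "bounded_linear (\<lambda>T :: 'a \<Rightarrow>\<^sub>L 'a. c *\<^sub>C T)"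
    by (rule bounded_bilinear.bounded_linear_right[OF bounded_bilinear_scaleC])
  ultimately show ?thesis
    by (rule bounded_linear_sub)
qed

text \<open>The defect map sends \<open>f\<close> to the zero function on \<open>S\<close>, and
  derivatives are unique because \<open>x\<close> is not isolated in \<open>S\<close>.\<close>

lemma clin_has_vector_derivative:
  assumes "(f has_vector_derivative D) (at x within S)" "x \<in> S" "at x within S \<noteq> bot"
    and "\<And>y. y \<in> S \<Longrightarrow> clin (f y)"
  shows "clin D"
  unfolding clin_iff_compose
proof
  fix c
  let ?L = "\<lambda>T. (T o\<^sub>L (c *\<^sub>C id_blinfun)) - c *\<^sub>C T"
  have "((\<lambda>y. ?L (f y)) has_vector_derivative ?L D) (at x within S)"
    using bounded_linear.has_vector_derivative[OF bounded_linear_clin_defect assms(1)] .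
  moreover have "((\<lambda>y. ?L (f y)) has_vector_derivative 0) (at x within S)"
    by (rule has_vector_derivative_transform[OF assms(2) _ has_vector_derivative_const[of 0]])
      (use assms(4) in \<open>auto simp: clin_iff_compose\<close>)
  ultimately show "?L D = 0"
    using assms(3) vector_derivative_unique_within by blast
qed

lemma clin_integral:
  assumes "\<And>y. y \<in> S \<Longrightarrow> clin (f y)"
  shows "clin (integral S f)"
proof (cases "f integrable_on S")
  case True
  show ?thesis
    unfolding clin_iff_compose
  proof
    fix c
    let ?L = "\<lambda>T. (T o\<^sub>L (c *\<^sub>C id_blinfun)) - c *\<^sub>C T"
    have "?L (integral S f) = integral S (\<lambda>y. ?L (f y))"
      using integral_linear[OF True bounded_linear_clin_defect[of c]] by (simp add: o_def)
    also have "\<dots> = 0"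
      by (intro integral_unique has_integral_is_0) (use assms in \<open>auto simp: clin_iff_compose\<close>)
    finally show "?L (integral S f) = 0" .
  qed
\<comment> \<open>Without integrability the integral has the default value 0, which is complex
  linear as well.\<close>
qed (simp add: not_integrable_integral)

section \<open>Inverses of bounded operators\<close>

lemma op_inverse_eqI:
  assumes "S o\<^sub>L T = id_blinfun" "T o\<^sub>L S = id_blinfun"
  shows "op_inverse T = S"
  unfolding op_inverse_def
proof (rule the_equality)
  fix S' assume "S' o\<^sub>L T = id_blinfun \<and> T o\<^sub>L S' = id_blinfun"
  then show "S' = S"
    by (metis assms(2) blinfun_compose_assoc blinfun_compose_id)
qed (use assms in auto)

lemma op_inverse_compose:
  assumes "op_invertible T"
  shows "op_inverse T o\<^sub>L T = id_blinfun" "T o\<^sub>L op_inverse T = id_blinfun"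
  using assms op_inverse_eqI unfolding op_invertible_def by metis+

lemma op_inverse_apply:
  assumes "op_invertible T"
  shows "op_inverse T (T x) = x" "T (op_inverse T x) = x"
  using op_inverse_compose[OF assms] by (metis blinfun_apply_blinfun_compose id_blinfun.rep_eq id_apply)+

lemma op_inverse_compose_left [simp]:
  assumes "op_invertible T"
  shows "op_inverse T o\<^sub>L (T o\<^sub>L A) = A" "T o\<^sub>L (op_inverse T o\<^sub>L A) = A"
  using op_inverse_compose[OF assms] by (metis blinfun_compose_assoc blinfun_compose_id(1))+

lemma op_invertibleI: "S o\<^sub>L T = id_blinfun \<Longrightarrow> T o\<^sub>L S = id_blinfun \<Longrightarrow> op_invertible T"
  unfolding op_invertible_def by blast

lemma op_invertible_compose:
  assumes "op_invertible A" "op_invertible B"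
  shows "op_invertible (A o\<^sub>L B)" "op_inverse (A o\<^sub>L B) = op_inverse B o\<^sub>L op_inverse A"
proof -
  have *: "(op_inverse B o\<^sub>L op_inverse A) o\<^sub>L (A o\<^sub>L B) = id_blinfun"
    "(A o\<^sub>L B) o\<^sub>L (op_inverse B o\<^sub>L op_inverse A) = id_blinfun"
    using assms by (simp_all add: blinfun_compose_assoc op_inverse_compose)
  show "op_invertible (A o\<^sub>L B)" "op_inverse (A o\<^sub>L B) = op_inverse B o\<^sub>L op_inverse A"
    using op_invertibleI[OF *] op_inverse_eqI[OF *] .
qed

lemma op_inverse_invertible:
  assumes "op_invertible A"
  shows "op_invertible (op_inverse A)" "op_inverse (op_inverse A) = A"
  using op_invertibleI op_inverse_eqI op_inverse_compose[OF assms] by metis+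

lemma op_invertible_id [simp]: "op_invertible id_blinfun" "op_inverse id_blinfun = id_blinfun"
  by (auto intro: op_invertibleI op_inverse_eqI)

lemma clin_op_inverse [simp, intro]:
  assumes "op_invertible A" "clin A"
  shows "clin (op_inverse A)"
  unfolding clin_def
proof (intro allI)
  fix c x
  have "op_inverse A (c *\<^sub>C A (op_inverse A x)) = op_inverse A (A (c *\<^sub>C op_inverse A x))"
    using assms(2) by (simp add: clinD)
  then show "op_inverse A (c *\<^sub>C x) = c *\<^sub>C op_inverse A x"
    using assms(1) by (simp add: op_inverse_apply)
qed

lemma op_invertible_scaleC_id:
  assumes "c \<noteq> 0"
  shows "op_invertible (c *\<^sub>C id_blinfun :: 'a::complex_normed_vector \<Rightarrow>\<^sub>L 'a)"
    "op_inverse (c *\<^sub>C id_blinfun :: 'a \<Rightarrow>\<^sub>L 'a) = inverse c *\<^sub>C id_blinfun"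
proof -
  have *: "(inverse c *\<^sub>C id_blinfun :: 'a \<Rightarrow>\<^sub>L 'a) o\<^sub>L (c *\<^sub>C id_blinfun) = id_blinfun"
    "(c *\<^sub>C id_blinfun :: 'a \<Rightarrow>\<^sub>L 'a) o\<^sub>L (inverse c *\<^sub>C id_blinfun) = id_blinfun"
    by (intro blinfun_eqI; simp add: scaleC_blinfun.rep_eq scaleC_scaleC assms)+
  show "op_invertible (c *\<^sub>C id_blinfun :: 'a \<Rightarrow>\<^sub>L 'a)"
    "op_inverse (c *\<^sub>C id_blinfun :: 'a \<Rightarrow>\<^sub>L 'a) = inverse c *\<^sub>C id_blinfun"
    using op_invertibleI[OF *] op_inverse_eqI[OF *] .
qed

lemma norm_id_blinfun_le: "norm (id_blinfun :: 'a::real_normed_vector \<Rightarrow>\<^sub>L 'a) \<le> 1"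
  by (rule norm_blinfun_bound) auto

lemma norm_compose3_le: "norm (A o\<^sub>L B o\<^sub>L C) \<le> norm A * norm B * norm C"
  by (meson mult_right_mono norm_blinfun_compose norm_ge_zero order_trans)

text \<open>The Neumann series of \<open>id_blinfun - T\<close> converges in operator norm and
  inverts \<open>T\<close> from both sides.\<close>

lemma op_invertible_near_id:
  fixes T :: "'a::banach \<Rightarrow>\<^sub>L 'a"
  assumes "norm (T - id_blinfun) < 1"
  shows "op_invertible T"
proof -
  define A where "A = id_blinfun - T"
  have nA: "norm A < 1"
    using assms by (simp add: A_def norm_minus_commute)
  define pw where "pw n = (((o\<^sub>L) A) ^^ n) id_blinfun" for n
  have pw_Suc: "pw (Suc n) = A o\<^sub>L pw n" for n
    by (simp add: pw_def)
  have pw_Suc': "pw (Suc n) = pw n o\<^sub>L A" for n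
    by (induction n) (simp add: pw_def, metis pw_Suc blinfun_compose_assoc)
  have "norm (pw n) \<le> norm A ^ n" for n
  proof (induction n)
    case (Suc n)
    then show ?case
      unfolding pw_Suc by (simp add: mult_left_mono order_trans[OF norm_blinfun_compose])
  qed (simp add: pw_def norm_id_blinfun_le)
  then have "summable (\<lambda>n. norm (pw n))"
    using nA by (intro summable_comparison_test[OF _ summable_geometric[of "norm A"]]) auto
  then have sm: "summable pw"
    by (rule summable_norm_cancel)
  define S where "S = suminf pw"
  \<comment> \<open>Composing the series with \<open>A\<close> on either side shifts it by one
    index, so both products equal \<open>S - id_blinfun\<close>; this says that \<open>S\<close> is
    a two-sided inverse of \<open>id_blinfun - A\<close>.\<close>
  have "(\<lambda>n. pw (Suc n)) sums (S - pw 0)"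
    using sm S_def sums_Suc_iff[of pw] by (simp add: summable_sums)
  moreover have "(\<lambda>n. pw (Suc n)) sums (A o\<^sub>L S)"
    unfolding pw_Suc S_def
    by (intro bounded_linear.sums[OF bounded_bilinear.bounded_linear_right[OF bounded_bilinear_blinfun_compose]] summable_sums sm)
  moreover have "(\<lambda>n. pw (Suc n)) sums (S o\<^sub>L A)"
    unfolding pw_Suc' S_def
    by (intro bounded_linear.sums[OF bounded_bilinear.bounded_linear_left[OF bounded_bilinear_blinfun_compose]] summable_sums sm)
  ultimately have "A o\<^sub>L S = S - id_blinfun" "S o\<^sub>L A = S - id_blinfun"
    by (auto simp: pw_def dest: sums_unique2)
  then have "S o\<^sub>L T = id_blinfun" "T o\<^sub>L S = id_blinfun"
    unfolding A_def by (simp_all add: blinfun_compose_linear)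
  then show ?thesis
    by (rule op_invertibleI)
qed

text \<open>Factor \<open>B\<close> as \<open>B o\<^sub>L op_inverse A\<close> followed on the right
  by \<open>A\<close>: the first factor differs from the identity by
  \<open>(B - A) o\<^sub>L op_inverse A\<close>, whose norm is below one.\<close>

lemma op_invertible_near:
  fixes A B :: "'a::banach \<Rightarrow>\<^sub>L 'a"
  assumes "op_invertible A" "norm (B - A) * norm (op_inverse A) < 1"
  shows "op_invertible B"
proof -
  have "(B o\<^sub>L op_inverse A) - id_blinfun = (B - A) o\<^sub>L op_inverse A"
    by (simp add: blinfun_compose_linear op_inverse_compose assms(1))
  then have "op_invertible (B o\<^sub>L op_inverse A)"
    using assms(2) norm_blinfun_compose[of "B - A" "op_inverse A"] by (intro op_invertible_near_id) simp
  then have "op_invertible ((B o\<^sub>L op_inverse A) o\<^sub>L A)"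
    using assms(1) by (rule op_invertible_compose)
  then show ?thesis
    by (simp add: blinfun_compose_assoc op_inverse_compose assms(1))
qed

text \<open>The second resolvent identity. Continuity and differentiability of the inverse, the
  first resolvent identity and the perturbation formula behind \<open>P1\<close> all come from
  it.\<close>

lemma op_inverse_diff:
  assumes "op_invertible A" "op_invertible B"
  shows "op_inverse B - op_inverse A = - (op_inverse B o\<^sub>L (B - A) o\<^sub>L op_inverse A)"
  using assms by (simp add: blinfun_compose_linear blinfun_compose_assoc op_inverse_compose)

text \<open>By the difference formula the two inverses differ by at most half the norm of the
  unknown inverse, and this half is absorbed on the left. The result is an a priori bound, needed
  before continuity of the inverse is known.\<close>

lemma norm_op_inverse_near:
  assumes "op_invertible A" "op_invertible B" "norm (B - A) * norm (op_inverse A) \<le> 1 / 2"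
  shows "norm (op_inverse B) \<le> 2 * norm (op_inverse A)"
proof -
  have "norm (op_inverse B - op_inverse A) \<le> norm (op_inverse B) * norm (B - A) * norm (op_inverse A)"
    unfolding op_inverse_diff[OF assms(1,2)] norm_minus_cancel by (rule norm_compose3_le)
  also have "\<dots> \<le> norm (op_inverse B) * (1 / 2)"
    using mult_left_mono[OF assms(3), of "norm (op_inverse B)"] by (simp add: mult.assoc)
  finally show ?thesis
    using norm_triangle_sub[of "op_inverse B" "op_inverse A"] by linarith
qed

lemma tendsto_op_inverse:
  fixes f :: "'b \<Rightarrow> 'a::banach \<Rightarrow>\<^sub>L 'a"
  assumes f: "(f \<longlongrightarrow> A) F" and A: "op_invertible A"
  shows "eventually (\<lambda>x. op_invertible (f x)) F" "((\<lambda>x. op_inverse (f x)) \<longlongrightarrow> op_inverse A) F"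
proof -
  have "((\<lambda>x. norm (f x - A) * norm (op_inverse A)) \<longlongrightarrow> norm (A - A) * norm (op_inverse A)) F"
    by (intro tendsto_intros f)
  then have "((\<lambda>x. norm (f x - A) * norm (op_inverse A)) \<longlongrightarrow> 0) F"
    by simp
  then have ev: "eventually (\<lambda>x. norm (f x - A) * norm (op_inverse A) < 1 / 2) F"
    by (rule order_tendstoD) simp
  then show inv: "eventually (\<lambda>x. op_invertible (f x)) F"
    by eventually_elim (rule op_invertible_near[OF A], simp)
  have "eventually (\<lambda>x. norm (op_inverse (f x) - op_inverse A) \<le> 2 * norm (op_inverse A) * norm (f x - A) * norm (op_inverse A)) F"
    using ev inv
  proof eventually_elim
    case (elim x)
    have "norm (op_inverse (f x) - op_inverse A) \<le> norm (op_inverse (f x)) * norm (f x - A) * norm (op_inverse A)"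
      unfolding op_inverse_diff[OF A elim(2)] norm_minus_cancel by (rule norm_compose3_le)
    also have "\<dots> \<le> 2 * norm (op_inverse A) * norm (f x - A) * norm (op_inverse A)"
      using norm_op_inverse_near[OF A elim(2)] elim(1) by (intro mult_right_mono) auto
    finally show ?case .
  qed
  moreover have "((\<lambda>x. 2 * norm (op_inverse A) * norm (f x - A) * norm (op_inverse A)) \<longlongrightarrow>
      2 * norm (op_inverse A) * norm (A - A) * norm (op_inverse A)) F"
    by (intro tendsto_intros f)
  then have "((\<lambda>x. 2 * norm (op_inverse A) * norm (f x - A) * norm (op_inverse A)) \<longlongrightarrow> 0) F"
    by simp
  ultimately have "((\<lambda>x. op_inverse (f x) - op_inverse A) \<longlongrightarrow> 0) F"
    by (rule Lim_null_comparison)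
  then show "((\<lambda>x. op_inverse (f x)) \<longlongrightarrow> op_inverse A) F"
    using LIM_zero_cancel[of "\<lambda>x. op_inverse (f x)" "op_inverse A" F] by blast
qed

lemma continuous_on_op_inverse:
  fixes f :: "'b::topological_space \<Rightarrow> 'a::banach \<Rightarrow>\<^sub>L 'a"
  assumes "continuous_on S f" "\<And>x. x \<in> S \<Longrightarrow> op_invertible (f x)"
  shows "continuous_on S (\<lambda>x. op_inverse (f x))"
  unfolding continuous_on_def
proof
  fix x assume "x \<in> S"
  then have "(f \<longlongrightarrow> f x) (at x within S)"
    using assms(1) by (simp add: continuous_on_def)
  then show "((\<lambda>x. op_inverse (f x)) \<longlongrightarrow> op_inverse (f x)) (at x within S)"
    by (rule tendsto_op_inverse(2)[OF _ assms(2)[OF \<open>x \<in> S\<close>]])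
qed

text \<open>The derivative is taken relative to \<open>S\<close> and invertibility is asked on
  \<open>S\<close>, so that the formula applies up to the boundary of the unit square.\<close>

lemma has_derivative_op_inverse:
  fixes f :: "'b::real_normed_vector \<Rightarrow> 'a::banach \<Rightarrow>\<^sub>L 'a"
  assumes f: "(f has_derivative f') (at x within S)" and x: "x \<in> S"
    and inv: "\<And>y. y \<in> S \<Longrightarrow> op_invertible (f y)"
  shows "((\<lambda>y. op_inverse (f y)) has_derivative
           (\<lambda>h. - (op_inverse (f x) o\<^sub>L f' h o\<^sub>L op_inverse (f x)))) (at x within S)"
proof -
  let ?J = "\<lambda>y. op_inverse (f y)"
  note comp = bounded_bilinear_blinfun_compose
  have bl: "bounded_linear f'"
    using f by (rule has_derivative_bounded_linear)
  have cont: "(f \<longlongrightarrow> f x) (at x within S)"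
    using has_derivative_continuous[OF f] by (simp add: continuous_within)
  have Jx: "(?J \<longlongrightarrow> ?J x) (at x within S)"
    by (rule tendsto_op_inverse[OF cont inv[OF x]])
  obtain Kb where Kb: "\<And>h. norm (f' h) \<le> norm h * Kb"
    using bounded_linear.bounded[OF bl] by blast
  \<comment> \<open>The remainder of the inverse splits into two parts. Here \<open>r\<close> is the
    normalised remainder of \<open>f\<close>, which tends to 0; \<open>q\<close> below is the
    normalised linear part, which is merely bounded but is multiplied by
    \<open>?J y - ?J x\<close>.\<close>
  define r where "r y = (f y - f x - f' (y - x)) /\<^sub>R norm (y - x)" for y
  have r0: "(r \<longlongrightarrow> 0) (at x within S)"
    using f unfolding has_derivative_within r_def inverse_eq_divide diff_diff_eq by (rule conjunct2)
  define q where "q y = inverse (norm (y - x)) *\<^sub>R f' (y - x)" for y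
  have qb: "norm (q y) \<le> \<bar>Kb\<bar>" for y
  proof (cases "y = x")
    case True then show ?thesis by (simp add: q_def)
  next
    case False
    have "norm (f' (y - x)) \<le> norm (y - x) * \<bar>Kb\<bar>"
      using Kb[of "y - x"] by (meson abs_ge_self mult_left_mono norm_ge_zero order_trans)
    then show ?thesis
      using False by (simp add: q_def field_simps)
  qed
  have "((\<lambda>y. (?J y - ?J x - (- (?J x o\<^sub>L f' (y - x) o\<^sub>L ?J x))) /\<^sub>R norm (y - x)) \<longlongrightarrow> 0) (at x within S)"
  proof (rule Lim_transform_eventually)
    have "((\<lambda>y. norm (?J y - ?J x) * \<bar>Kb\<bar> * norm (?J x)) \<longlongrightarrow> norm (?J x - ?J x) * \<bar>Kb\<bar> * norm (?J x)) (at x within S)"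
      by (intro tendsto_intros Jx)
    then have l1: "((\<lambda>y. norm (?J y - ?J x) * \<bar>Kb\<bar> * norm (?J x)) \<longlongrightarrow> 0) (at x within S)"
      by simp
    have "((\<lambda>y. (?J y - ?J x) o\<^sub>L q y o\<^sub>L ?J x) \<longlongrightarrow> 0) (at x within S)"
    proof (rule Lim_null_comparison[OF _ l1], rule always_eventually, rule allI)
      fix y
      show "norm ((?J y - ?J x) o\<^sub>L q y o\<^sub>L ?J x) \<le> norm (?J y - ?J x) * \<bar>Kb\<bar> * norm (?J x)"
        by (rule order_trans[OF norm_compose3_le]) (intro mult_right_mono mult_left_mono qb; simp)
    qed
    moreover have "((\<lambda>y. ?J y o\<^sub>L r y o\<^sub>L ?J x) \<longlongrightarrow> ?J x o\<^sub>L 0 o\<^sub>L ?J x) (at x within S)"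
      by (intro bounded_bilinear.tendsto[OF comp] tendsto_const Jx r0)
    ultimately have "((\<lambda>y. - ((?J y - ?J x) o\<^sub>L q y o\<^sub>L ?J x) - (?J y o\<^sub>L r y o\<^sub>L ?J x)) \<longlongrightarrow> - 0 - (?J x o\<^sub>L 0 o\<^sub>L ?J x)) (at x within S)"
      by (intro tendsto_diff tendsto_minus)
    then show "((\<lambda>y. - ((?J y - ?J x) o\<^sub>L q y o\<^sub>L ?J x) - (?J y o\<^sub>L r y o\<^sub>L ?J x)) \<longlongrightarrow> 0) (at x within S)"
      by (simp add: blinfun_compose_zero)
    show "\<forall>\<^sub>F y in at x within S. - ((?J y - ?J x) o\<^sub>L q y o\<^sub>L ?J x) - (?J y o\<^sub>L r y o\<^sub>L ?J x) =
        (?J y - ?J x - (- (?J x o\<^sub>L f' (y - x) o\<^sub>L ?J x))) /\<^sub>R norm (y - x)"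
    proof (rule eventually_mono[OF eventually_at_topological[THEN iffD2]])
      \<comment> \<open>Taking the whole space as neighbourhood extracts the membership of
        \<open>y\<close> in \<open>S\<close>, which makes \<open>f y\<close> invertible.\<close>
      show "\<exists>T. open T \<and> x \<in> T \<and> (\<forall>y\<in>T. y \<noteq> x \<longrightarrow> y \<in> S \<longrightarrow> y \<in> S)"
        by (intro exI[of _ UNIV]) auto
      fix y assume y: "y \<in> S"
      have *: "?J y - ?J x = - (?J y o\<^sub>L (f y - f x) o\<^sub>L ?J x)"
        using inv x y by (intro op_inverse_diff) auto
      show "- ((?J y - ?J x) o\<^sub>L q y o\<^sub>L ?J x) - (?J y o\<^sub>L r y o\<^sub>L ?J x) =
        (?J y - ?J x - (- (?J x o\<^sub>L f' (y - x) o\<^sub>L ?J x))) /\<^sub>R norm (y - x)"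
      proof -
        have "(?J y - ?J x) o\<^sub>L q y o\<^sub>L ?J x =
            inverse (norm (y - x)) *\<^sub>R ((?J y o\<^sub>L f' (y - x) o\<^sub>L ?J x) - (?J x o\<^sub>L f' (y - x) o\<^sub>L ?J x))"
          by (simp only: q_def blinfun_compose_linear)
        moreover have "?J y o\<^sub>L r y o\<^sub>L ?J x =
            inverse (norm (y - x)) *\<^sub>R ((?J y o\<^sub>L (f y - f x) o\<^sub>L ?J x) - (?J y o\<^sub>L f' (y - x) o\<^sub>L ?J x))"
          by (simp only: r_def blinfun_compose_linear)
        ultimately show ?thesis
          unfolding * by (simp only: scaleR_diff_right scaleR_minus_right minus_diff_eq) simp
      qed
    qed
  qed
  moreover have "bounded_linear (\<lambda>h. - (?J x o\<^sub>L f' h o\<^sub>L ?J x))"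
    by (intro bounded_linear_minus
        bounded_linear_compose[OF bounded_bilinear.bounded_linear_left[OF comp]]
        bounded_linear_compose[OF bounded_bilinear.bounded_linear_right[OF comp]] bl)
  ultimately show ?thesis
    unfolding has_derivative_within inverse_eq_divide diff_diff_eq by (rule conjI[rotated])
qed

lemma has_vector_derivative_op_inverse:
  fixes f :: "real \<Rightarrow> 'a::banach \<Rightarrow>\<^sub>L 'a"
  assumes "(f has_vector_derivative f') (at x within S)" "x \<in> S" "\<And>y. y \<in> S \<Longrightarrow> op_invertible (f y)"
  shows "((\<lambda>y. op_inverse (f y)) has_vector_derivative
           - (op_inverse (f x) o\<^sub>L f' o\<^sub>L op_inverse (f x))) (at x within S)"
  using has_derivative_op_inverse[OF assms(1)[unfolded has_vector_derivative_def] assms(2,3)]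
  by (simp add: has_vector_derivative_def blinfun_compose_linear)

lemma has_vector_derivative_compose:
  fixes f g :: "real \<Rightarrow> 'a::real_normed_vector \<Rightarrow>\<^sub>L 'a"
  assumes "(f has_vector_derivative f') (at x within S)" "(g has_vector_derivative g') (at x within S)"
  shows "((\<lambda>y. f y o\<^sub>L g y) has_vector_derivative (f x o\<^sub>L g') + (f' o\<^sub>L g x)) (at x within S)"
  using bounded_bilinear.has_vector_derivative[OF bounded_bilinear_blinfun_compose assms] .

section \<open>Resolvents and the spectrum\<close>

definition resolvent :: "('a::complex_normed_vector \<Rightarrow>\<^sub>L 'a) \<Rightarrow> complex \<Rightarrow> ('a \<Rightarrow>\<^sub>L 'a)" where
  "resolvent A z = op_inverse (A - z *\<^sub>C id_blinfun)"

lemma not_in_spectrum_iff: "z \<notin> op_spectrum A \<longleftrightarrow> op_invertible (A - z *\<^sub>C id_blinfun)"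
  by (simp add: op_spectrum_def)

lemma clin_resolvent [simp, intro]: "clin A \<Longrightarrow> z \<notin> op_spectrum A \<Longrightarrow> clin (resolvent A z)"
  unfolding resolvent_def by (intro clin_op_inverse) (auto simp: not_in_spectrum_iff)

text \<open>Both formulas rewrite that the resolvent inverts \<open>A - z\<close>; in the first one
  the scalar has to pass the resolvent, hence \<open>clin A\<close>. That the two right-hand sides
  coincide gives commutation with \<open>A\<close> and later makes the terms with \<open>z\<close>
  cancel in a commutator.\<close>

lemma resolvent_compose:
  assumes "clin A" "z \<notin> op_spectrum A"
  shows "resolvent A z o\<^sub>L A = id_blinfun + z *\<^sub>C resolvent A z"
    and "A o\<^sub>L resolvent A z = id_blinfun + z *\<^sub>C resolvent A z"
proof -
  have inv: "op_invertible (A - z *\<^sub>C id_blinfun)"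
    using assms by (simp add: not_in_spectrum_iff)
  have "(A - z *\<^sub>C id_blinfun) o\<^sub>L resolvent A z = id_blinfun"
    unfolding resolvent_def by (rule op_inverse_compose(2)[OF inv])
  then have "(A o\<^sub>L resolvent A z) - z *\<^sub>C resolvent A z = id_blinfun"
    by (simp only: blinfun_compose_linear scaleC_blinfun_compose_left blinfun_compose_id)
  then show "A o\<^sub>L resolvent A z = id_blinfun + z *\<^sub>C resolvent A z"
    by (simp add: algebra_simps)
  have "resolvent A z o\<^sub>L (A - z *\<^sub>C id_blinfun) = id_blinfun"
    unfolding resolvent_def by (rule op_inverse_compose(1)[OF inv])
  then have "(resolvent A z o\<^sub>L A) - z *\<^sub>C resolvent A z = id_blinfun"
    by (simp only: blinfun_compose_linear clin_compose_scaleC[OF clin_resolvent[OF assms]] blinfun_compose_id)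
  then show "resolvent A z o\<^sub>L A = id_blinfun + z *\<^sub>C resolvent A z"
    by (simp add: algebra_simps)
qed

lemma resolvent_commute:
  assumes "clin A" "z \<notin> op_spectrum A"
  shows "resolvent A z o\<^sub>L A = A o\<^sub>L resolvent A z"
  using resolvent_compose[OF assms] by simp

lemma resolvent_identity:
  assumes A: "clin A" and zw: "z \<notin> op_spectrum A" "w \<notin> op_spectrum A"
  shows "resolvent A w - resolvent A z = (w - z) *\<^sub>C (resolvent A w o\<^sub>L resolvent A z)"
proof -
  have "resolvent A w - resolvent A z =
      - (resolvent A w o\<^sub>L ((A - w *\<^sub>C id_blinfun) - (A - z *\<^sub>C id_blinfun)) o\<^sub>L resolvent A z)"
    unfolding resolvent_def by (rule op_inverse_diff) (use zw in \<open>auto simp: not_in_spectrum_iff\<close>)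
  also have "(A - w *\<^sub>C id_blinfun) - (A - z *\<^sub>C id_blinfun) = (z - w) *\<^sub>C id_blinfun"
    by (simp add: scaleC_diff_left)
  also have "resolvent A w o\<^sub>L ((z - w) *\<^sub>C id_blinfun) = (z - w) *\<^sub>C resolvent A w"
    using clin_compose_scaleC[of "resolvent A w" "z - w" id_blinfun] A zw by simp
  also have "- ((z - w) *\<^sub>C resolvent A w o\<^sub>L resolvent A z) = (w - z) *\<^sub>C (resolvent A w o\<^sub>L resolvent A z)"
    by (simp add: scaleC_blinfun_compose_left scaleC_minus_left[symmetric])
  finally show ?thesis .
qed

lemma tendsto_scaleC_id: "(f \<longlongrightarrow> z) F \<Longrightarrow> ((\<lambda>x. f x *\<^sub>C T) \<longlongrightarrow> z *\<^sub>C (T :: 'a::complex_normed_vector)) F"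
  by (rule bounded_bilinear.tendsto[OF bounded_bilinear_scaleC _ tendsto_const])

lemma continuous_on_scaleC:
  "continuous_on S f \<Longrightarrow> continuous_on S g \<Longrightarrow> continuous_on S (\<lambda>x. f x *\<^sub>C (g x :: 'a::complex_normed_vector))"
  by (rule bounded_bilinear.continuous_on[OF bounded_bilinear_scaleC])

lemma open_resolvent_set: "open (- op_spectrum (A :: 'a::{complex_normed_vector, banach} \<Rightarrow>\<^sub>L 'a))"
proof (subst open_subopen, intro ballI)
  fix z assume "z \<in> - op_spectrum A"
  then have inv: "op_invertible (A - z *\<^sub>C id_blinfun)"
    by (simp add: not_in_spectrum_iff)
  have "((\<lambda>w. A - w *\<^sub>C id_blinfun) \<longlongrightarrow> A - z *\<^sub>C id_blinfun) (nhds z)"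
    by (intro tendsto_diff tendsto_const tendsto_scaleC_id) (simp add: filterlim_ident)
  then have "eventually (\<lambda>w. op_invertible (A - w *\<^sub>C id_blinfun)) (nhds z)"
    using inv by (rule tendsto_op_inverse(1))
  then obtain S where "open S" "z \<in> S" "\<And>w. w \<in> S \<Longrightarrow> op_invertible (A - w *\<^sub>C id_blinfun)"
    unfolding eventually_nhds by blast
  then show "\<exists>T. open T \<and> z \<in> T \<and> T \<subseteq> - op_spectrum A"
    by (intro exI[of _ S]) (auto simp: op_spectrum_def)
qed

text \<open>For \<open>z\<close> of modulus above \<open>norm A\<close> the operator
  \<open>A - z\<close> is a perturbation of the invertible scalar \<open>- z\<close> of relative
  size below one.\<close>

lemma spectrum_bounded:
  fixes A :: "'a::{complex_normed_vector, banach} \<Rightarrow>\<^sub>L 'a"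
  assumes "z \<in> op_spectrum A"
  shows "cmod z \<le> norm A"
proof (rule ccontr)
  assume *: "\<not> cmod z \<le> norm A"
  then have z: "- z \<noteq> 0"
    by auto
  have "norm (op_inverse ((- z) *\<^sub>C id_blinfun :: 'a \<Rightarrow>\<^sub>L 'a)) \<le> inverse (cmod z)"
    unfolding op_invertible_scaleC_id(2)[OF z]
    by (simp add: norm_scaleC norm_inverse mult_left_le norm_id_blinfun_le)
  then have "norm A * norm (op_inverse ((- z) *\<^sub>C id_blinfun :: 'a \<Rightarrow>\<^sub>L 'a)) \<le> norm A * inverse (cmod z)"
    by (intro mult_left_mono) auto
  also have "\<dots> < 1"
    using * norm_ge_zero[of A] by (simp add: not_le divide_inverse[symmetric] divide_less_eq)
  finally have "op_invertible (A - z *\<^sub>C id_blinfun)"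
    by (intro op_invertible_near[OF op_invertible_scaleC_id(1)[OF z]]) (simp add: scaleC_minus_left)
  then show False
    using assms by (simp add: op_spectrum_def)
qed

lemma continuous_on_resolvent:
  fixes A :: "'b::topological_space \<Rightarrow> 'a::{complex_normed_vector, banach} \<Rightarrow>\<^sub>L 'a"
  assumes "continuous_on S A" "continuous_on S f" "\<And>x. x \<in> S \<Longrightarrow> f x \<notin> op_spectrum (A x)"
  shows "continuous_on S (\<lambda>x. resolvent (A x) (f x))"
  unfolding resolvent_def
  by (intro continuous_on_op_inverse continuous_on_diff assms continuous_on_scaleC continuous_on_const)
    (use assms(3) in \<open>auto simp: not_in_spectrum_iff\<close>)

text \<open>The resolvent is bounded on the compact set \<open>C\<close>, and the inverse of this
  bound is the admissible size of a perturbation. Below, \<open>C\<close> consists of points that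
  the spectrum of a perturbed operator must avoid: loops and points with an unwanted winding
  number.\<close>

lemma spectrum_stable:
  fixes A :: "'a::{complex_normed_vector, banach} \<Rightarrow>\<^sub>L 'a"
  assumes "compact C" "C \<inter> op_spectrum A = {}"
  obtains \<delta> where "\<delta> > 0" "\<And>B. norm (B - A) < \<delta> \<Longrightarrow> C \<inter> op_spectrum B = {}"
proof -
  have "compact (resolvent A ` C)"
    by (intro compact_continuous_image continuous_on_resolvent[where A = "\<lambda>_. A" and f = "\<lambda>z. z"]
        continuous_on_const continuous_on_id assms(1)) (use assms(2) in auto)
  then obtain M where M: "M > 0" "\<And>z. z \<in> C \<Longrightarrow> norm (resolvent A z) \<le> M"
    using bounded_pos[of "resolvent A ` C"] compact_imp_bounded by auto
  show ?thesis
  proof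
    show "inverse M > 0"
      using M by simp
    fix B assume B: "norm (B - A) < inverse M"
    have "z \<notin> op_spectrum B" if "z \<in> C" for z
      unfolding not_in_spectrum_iff
    proof (rule op_invertible_near)
      show "op_invertible (A - z *\<^sub>C id_blinfun)"
        using that assms(2) by (auto simp: not_in_spectrum_iff[symmetric])
      have "norm (B - A) * norm (resolvent A z) \<le> norm (B - A) * M"
        using M(2)[OF that] by (intro mult_left_mono) auto
      also have "\<dots> < 1"
        using B M by (simp add: field_simps)
      finally show "norm (B - z *\<^sub>C id_blinfun - (A - z *\<^sub>C id_blinfun)) *
          norm (op_inverse (A - z *\<^sub>C id_blinfun)) < 1"
        by (simp add: resolvent_def)
    qed
    then show "C \<inter> op_spectrum B = {}"
      by auto
  qed
qed

section \<open>Self-adjoint operators: real spectrum and connected resolvent set\<close>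

lemma inner_scaleC_i: "inner (\<i> *\<^sub>C x) y = Im (cinner x (y :: 'a::complex_inner))"
  by (simp add: Re_cinner[symmetric] cinner_scaleC_left)

lemma cinner_ext:
  assumes "\<And>y. cinner x y = cinner x' (y :: 'a::complex_inner)"
  shows "x = x'"
  by (metis Re_cinner assms vector_eq_rdot inner_commute)

lemma self_adjoint_clin:
  assumes "self_adjoint T"
  shows "clin T"
  unfolding clin_def
proof (intro allI)
  fix c x
  show "T (c *\<^sub>C x) = c *\<^sub>C T x"
  proof (rule cinner_ext)
  fix y
  show "cinner (T (c *\<^sub>C x)) y = cinner (c *\<^sub>C T x) y"
    using assms by (simp add: self_adjoint_def cinner_scaleC_left)
  qed
qed

lemma cinner_self_real: "Im (cinner x (x :: 'a::complex_inner)) = 0"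
  using arg_cong[OF cinner_commute[of x x], of Im] by simp

lemma cinner_diff_right: "cinner x (y - z :: 'a::complex_inner) = cinner x y - cinner x z"
proof -
  have "cinner x y = cinner x ((y - z) + z)"
    by simp
  then show ?thesis
    unfolding cinner_add_right by simp
qed

lemma cinner_norm_le: "\<bar>Im (cinner x y)\<bar> \<le> norm x * norm (y :: 'a::complex_inner)"
  using Cauchy_Schwarz_ineq2[of "\<i> *\<^sub>C x" y] by (simp add: inner_scaleC_i norm_scaleC)

text \<open>The number \<open>cinner x (T x)\<close> is real, so only the scalar \<open>z\<close>
  contributes to the imaginary part of the inner product of \<open>x\<close> with its image under
  \<open>T - z\<close>; the Cauchy-Schwarz inequality bounds this imaginary part by the norm on the
  right.\<close>

lemma self_adjoint_lower_bound:
  assumes "self_adjoint T"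
  shows "\<bar>Im z\<bar> * norm x \<le> norm ((T - z *\<^sub>C id_blinfun) x)"
proof -
  have "cinner (T x) x = cnj (cinner (T x) x)"
    using assms by (metis cinner_commute self_adjoint_def)
  then have r: "Im (cinner (T x) x) = 0"
    by (metis Im_complex_of_real Reals_cnj_iff complex_is_Real_iff)
  then have r': "Im (cinner x (T x)) = 0"
    using assms by (simp add: self_adjoint_def)
  have "Im (cinner x ((T - z *\<^sub>C id_blinfun) x)) = - (Im z * Re (cinner x x))"
    by (simp add: blinfun.bilinear_simps scaleC_blinfun.rep_eq cinner_diff_right cinner_scaleC_right r' cinner_self_real)
  also have "Re (cinner x x) = norm x * norm x"
    by (simp add: Re_cinner power2_norm_eq_inner[symmetric] power2_eq_square)
  finally have "\<bar>Im z\<bar> * norm x * norm x \<le> norm x * norm ((T - z *\<^sub>C id_blinfun) x)"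
    using cinner_norm_le[of x "(T - z *\<^sub>C id_blinfun) x"] by (simp add: abs_mult)
  then have "norm x * (\<bar>Im z\<bar> * norm x) \<le> norm x * norm ((T - z *\<^sub>C id_blinfun) x)"
    by (simp add: mult_ac)
  then show ?thesis
    by (cases "x = 0") (auto simp: mult_le_cancel_left)
qed

text \<open>The resolvent set meets the vertical line through a non-real point far from the real axis;
  the bound \<open>1 / \<bar>Im z\<bar>\<close> on the resolvent propagates invertibility along that line.\<close>

lemma self_adjoint_spectrum_real:
  fixes T :: "'a::chilbert_space \<Rightarrow>\<^sub>L 'a"
  assumes T: "self_adjoint T" and z: "Im z \<noteq> 0"
  shows "z \<notin> op_spectrum T"
proof -
  have resb: "norm (resolvent T w) \<le> 1 / \<bar>Im w\<bar>" if w: "w \<notin> op_spectrum T" "Im w \<noteq> 0" for w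
  proof (rule norm_blinfun_bound)
    fix x
    have "\<bar>Im w\<bar> * norm (resolvent T w x) \<le> norm x"
      using self_adjoint_lower_bound[OF T, of w "resolvent T w x"]
      unfolding resolvent_def op_inverse_apply(2)[OF w(1)[unfolded not_in_spectrum_iff]] .
    then show "norm (resolvent T w x) \<le> 1 / \<bar>Im w\<bar> * norm x"
      using w(2) by (simp add: field_simps)
  qed simp
  \<comment> \<open>The open half-line of imaginary parts on the same side of 0 as
    \<open>Im z\<close>. It is connected, so a nonempty relatively clopen subset \<open>E\<close> of
    it is everything.\<close>
  define D where "D = {y. y * Im z > 0}"
  have conn: "connected D"
  proof (cases "Im z > 0")
    case True
    then have "D = {0<..}"
      by (auto simp: D_def zero_less_mult_iff)
    then show ?thesis by simp
  next
    case False
    then have "D = {..<0}"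
      using z by (auto simp: D_def zero_less_mult_iff)
    then show ?thesis by simp
  qed
  define E where "E = D \<inter> {y. Complex (Re z) y \<notin> op_spectrum T}"
  have cont: "continuous_on UNIV (\<lambda>y. Complex (Re z) y)"
    by (simp add: Complex_eq continuous_intros)
  have "open {y. Complex (Re z) y \<notin> op_spectrum T}"
    using continuous_open_preimage[OF cont open_UNIV open_resolvent_set[of T]] by (simp add: vimage_def)
  moreover have "open D"
    unfolding D_def by (intro open_Collect_less continuous_intros)
  ultimately have "openin (top_of_set D) E"
    unfolding E_def by (metis openin_open_Int)
  moreover have "closedin (top_of_set D) E"
    unfolding closedin_limpt
  proof (intro conjI allI impI)
    show "E \<subseteq> D" by (simp add: E_def)
    fix y assume y: "y islimpt E \<and> y \<in> D"
    then have y0: "y \<noteq> 0" by (auto simp: D_def)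
    \<comment> \<open>A distance below half of \<bar>y\<bar> forces \<bar>y'\<bar> > \<bar>y\<bar> /
      2 > \<bar>y' - y\<bar>, so the shift from \<open>y'\<close> to \<open>y\<close> times the
      resolvent bound \<open>1 / \<bar>y'\<bar>\<close> stays below one.\<close>
    from y obtain y' where y': "y' \<in> E" "\<bar>y' - y\<bar> < \<bar>y\<bar> / 2"
      using y0 islimpt_approachable[of y E] by (metis dist_real_def half_gt_zero zero_less_abs_iff)
    then have y'0: "\<bar>y'\<bar> > \<bar>y\<bar> / 2" by linarith
    let ?w = "Complex (Re z) y" and ?w' = "Complex (Re z) y'"
    have w': "?w' \<notin> op_spectrum T" using y' by (simp add: E_def)
    have y'n: "y' \<noteq> 0" using y'0 y0 by auto
    have "norm (resolvent T ?w') \<le> 1 / \<bar>y'\<bar>"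
      using resb[OF w'] y'n by simp
    have eq: "T - ?w *\<^sub>C id_blinfun - (T - ?w' *\<^sub>C id_blinfun) = (?w' - ?w) *\<^sub>C id_blinfun"
      by (simp add: scaleC_diff_left)
    have "norm ((?w' - ?w) *\<^sub>C (id_blinfun :: 'a \<Rightarrow>\<^sub>L 'a)) \<le> \<bar>y' - y\<bar>"
      unfolding norm_scaleC using norm_id_blinfun_le[where 'a='a] by (simp add: cmod_def mult_left_le)
    then have "norm ((?w' - ?w) *\<^sub>C (id_blinfun :: 'a \<Rightarrow>\<^sub>L 'a)) * norm (resolvent T ?w') \<le> \<bar>y' - y\<bar> * (1 / \<bar>y'\<bar>)"
      using \<open>norm (resolvent T ?w') \<le> 1 / \<bar>y'\<bar>\<close> by (intro mult_mono) auto
    also have "\<dots> < 1"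
      using y' y'0 y'n by (simp add: field_simps)
    finally have "norm (T - ?w *\<^sub>C id_blinfun - (T - ?w' *\<^sub>C id_blinfun)) * norm (op_inverse (T - ?w' *\<^sub>C id_blinfun)) < 1"
      unfolding eq resolvent_def .
    then have "op_invertible (T - ?w *\<^sub>C id_blinfun)"
      by (rule op_invertible_near[OF w'[unfolded not_in_spectrum_iff]])
    then show "y \<in> E"
      using y by (simp add: E_def not_in_spectrum_iff)
  qed
  moreover have "E \<noteq> {}"
  proof -
    \<comment> \<open>A point of the half-line so far from the real axis that the norm bound on the
      spectrum excludes it.\<close>
    let ?y = "(norm T + 1) * sgn (Im z)"
    have "?y \<in> D"
      using z norm_ge_zero[of T]
      by (auto simp: D_def sgn_if mult_less_0_iff zero_less_mult_iff add_nonneg_pos)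
    moreover have "Complex (Re z) ?y \<notin> op_spectrum T"
    proof
      assume "Complex (Re z) ?y \<in> op_spectrum T"
      then have "cmod (Complex (Re z) ?y) \<le> norm T"
        by (rule spectrum_bounded)
      then have "\<bar>?y\<bar> \<le> norm T"
        using abs_Im_le_cmod[of "Complex (Re z) ?y"] by simp
      then show False
        using z norm_ge_zero[of T] by (simp add: abs_mult abs_sgn_eq)
    qed
    ultimately show ?thesis by (auto simp: E_def)
  qed
  ultimately have "E = D"
    using conn unfolding connected_clopen by auto
  moreover have "Im z \<in> D"
    using z by (auto simp: D_def zero_less_mult_iff)
  ultimately have "Im z \<in> E"
    by simp
  then show ?thesis
    by (simp add: E_def complex_surj)
qed

text \<open>Each closed half-plane meets the resolvent set in a set squeezed between the open
  half-plane and its closure, hence connected, and the two pieces share the real point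
  \<open>norm T + 1\<close>. Connectedness makes it possible to join two loops without touching the
  spectrum.\<close>

lemma connected_resolvent_set:
  fixes T :: "'a::chilbert_space \<Rightarrow>\<^sub>L 'a"
  assumes T: "self_adjoint T"
  shows "connected (- op_spectrum T)"
proof -
  let ?S = "- op_spectrum T"
  have cu: "connected {z. Im z > 0}" "connected {z. Im z < 0}"
    by (simp_all add: convex_connected convex_halfspace_Im_gt convex_halfspace_Im_lt)
  have sub: "{z. Im z > 0} \<subseteq> ?S" "{z. Im z < 0} \<subseteq> ?S"
    using self_adjoint_spectrum_real[OF T] by force+
  have "connected (?S \<inter> {z. Im z \<ge> 0})"
    using sub closure_halfspace_gt[of \<i> 0]
    by (intro connected_intermediate_closure[OF cu(1)]) (auto simp: inner_complex_def)
  moreover have "connected (?S \<inter> {z. Im z \<le> 0})"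
    using sub closure_halfspace_lt[of \<i> 0]
    by (intro connected_intermediate_closure[OF cu(2)]) (auto simp: inner_complex_def)
  moreover have "of_real (norm T + 1) \<in> ?S \<inter> {z. Im z \<ge> 0} \<inter> (?S \<inter> {z. Im z \<le> 0})"
    using spectrum_bounded[of "of_real (norm T + 1)" T] norm_ge_zero[of T] by auto
  ultimately have "connected ((?S \<inter> {z. Im z \<ge> 0}) \<union> (?S \<inter> {z. Im z \<le> 0}))"
    by (intro connected_Un) auto
  also have "(?S \<inter> {z. Im z \<ge> 0}) \<union> (?S \<inter> {z. Im z \<le> 0}) = ?S"
    by auto
  finally show ?thesis .
qed

section \<open>Contour integrals of operator-valued holomorphic functions\<close>

text \<open>Continuity of the derivative is part of the notion because the primitives below are
  built by differentiating under the integral sign.\<close>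

definition vholo :: "(complex \<Rightarrow> 'b::complex_normed_vector) \<Rightarrow> complex set \<Rightarrow> bool" where
  "vholo f S \<longleftrightarrow> (\<exists>f'. continuous_on S f' \<and> (\<forall>z\<in>S. (f has_derivative (\<lambda>h. h *\<^sub>C f' z)) (at z)))"

text \<open>A complex derivative in the form of a bounded linear map, as the Leibniz rule for
  parameter integrals takes it.\<close>

lift_definition mul_blinfun :: "'b::complex_normed_vector \<Rightarrow> (complex \<Rightarrow>\<^sub>L 'b)" is "\<lambda>v h. h *\<^sub>C v"
  by (rule bounded_bilinear.bounded_linear_left[OF bounded_bilinear_scaleC])

lemma bounded_linear_mul_blinfun: "bounded_linear (mul_blinfun :: 'b::complex_normed_vector \<Rightarrow> _)"
proof (rule bounded_linear_intro[where K = 1])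
  show "mul_blinfun (x + y) = mul_blinfun x + mul_blinfun y" "mul_blinfun (r *\<^sub>R x) = r *\<^sub>R mul_blinfun x"
    for x y :: 'b and r
    by (intro blinfun_eqI; simp add: mul_blinfun.rep_eq blinfun.bilinear_simps scaleC_add_right scaleC_scaleR)+
  show "norm (mul_blinfun x) \<le> norm x * 1" for x :: 'b
    by (rule norm_blinfun_bound) (auto simp: mul_blinfun.rep_eq norm_scaleC mult.commute)
qed

lemma vholo_continuous: "vholo f S \<Longrightarrow> continuous_on S f"
  unfolding vholo_def by (meson continuous_at_imp_continuous_on has_derivative_continuous)

text \<open>The primitive is the integral of \<open>f\<close> along the segment from the centre
  \<open>z0\<close> to \<open>z\<close>, parametrised over the unit interval so that
  \<open>z\<close> occurs in the integrand only.\<close>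

lemma vholo_local_primitive:
  fixes f :: "complex \<Rightarrow> 'b::{complex_normed_vector, banach}"
  assumes "vholo f S" "ball z0 r \<subseteq> S"
  obtains F where "\<And>z. z \<in> ball z0 r \<Longrightarrow> (F has_derivative (\<lambda>h. h *\<^sub>C f z)) (at z)"
proof -
  obtain f' where f': "continuous_on S f'" "\<And>z. z \<in> S \<Longrightarrow> (f has_derivative (\<lambda>h. h *\<^sub>C f' z)) (at z)"
    using assms(1) unfolding vholo_def by blast
  let ?U = "ball z0 r"
  define p where "p z u = z0 + of_real u * (z - z0)" for z and u :: real
  have pU: "p z u \<in> ?U" if "z \<in> ?U" "u \<in> {0..1}" for z u
  proof -
    have "dist z0 (p z u) = \<bar>u\<bar> * dist z0 z"
      by (simp add: p_def dist_norm norm_mult norm_minus_commute)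
    also have "\<dots> \<le> 1 * dist z0 z"
      using that by (intro mult_right_mono) auto
    finally show ?thesis
      using that by simp
  qed
  have contp: "continuous_on (?U \<times> {0..1}) (\<lambda>(z, u). p z u)"
    unfolding p_def case_prod_unfold by (intro continuous_intros)
  have fp: "continuous_on (?U \<times> {0..1}) (\<lambda>x. f (p (fst x) (snd x)))"
    "continuous_on (?U \<times> {0..1}) (\<lambda>x. f' (p (fst x) (snd x)))"
    using pU assms(2)
    by (auto intro!: continuous_on_compose2[OF vholo_continuous[OF assms(1)]] continuous_on_compose2[OF f'(1)]
        contp[unfolded case_prod_unfold])
  define G where "G z u = (z - z0) *\<^sub>C f (p z u)" for z and u :: real
  define dG where "dG z u = f (p z u) + of_real u *\<^sub>C (z - z0) *\<^sub>C f' (p z u)" for z and u :: real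
  have der: "((\<lambda>z. G z u) has_derivative blinfun_apply (mul_blinfun (dG z u))) (at z within ?U)"
    if z: "z \<in> ?U" and u: "u \<in> cbox 0 1" for z u
  proof -
    have "p z u \<in> S"
      using pU[OF z, of u] u assms(2) by auto
    then have d: "(f has_derivative (\<lambda>h. h *\<^sub>C f' (p z u))) (at (p z u))"
      by (rule f'(2))
    have dp: "((\<lambda>z. p z u) has_derivative (\<lambda>h. of_real u * h)) (at z)"
      unfolding p_def by (auto intro!: derivative_eq_intros)
    have "((\<lambda>z. f (p z u)) has_derivative (\<lambda>h. (of_real u * h) *\<^sub>C f' (p z u))) (at z)"
      using diff_chain_at[OF dp d] by (simp add: o_def)
    moreover have "((\<lambda>z. z - z0) has_derivative (\<lambda>h. h)) (at z)"
      by (auto intro!: derivative_eq_intros)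
    ultimately have "((\<lambda>z. G z u) has_derivative
        (\<lambda>h. (z - z0) *\<^sub>C ((of_real u * h) *\<^sub>C f' (p z u)) + h *\<^sub>C f (p z u))) (at z)"
      unfolding G_def using bounded_bilinear.FDERIV[OF bounded_bilinear_scaleC] by blast
    moreover have "(\<lambda>h. (z - z0) *\<^sub>C ((of_real u * h) *\<^sub>C f' (p z u)) + h *\<^sub>C f (p z u)) =
        blinfun_apply (mul_blinfun (dG z u))"
      by (rule ext) (simp add: mul_blinfun.rep_eq dG_def scaleC_add_right scaleC_scaleC mult_ac)
    ultimately show ?thesis
      by (simp add: has_derivative_at_withinI)
  qed
  have contG: "continuous_on (?U \<times> {0..1}) (\<lambda>x. G (fst x) (snd x))"
    unfolding G_def by (intro continuous_on_scaleC fp continuous_intros)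
  have contdG: "continuous_on (?U \<times> {0..1}) (\<lambda>x. dG (fst x) (snd x))"
    unfolding dG_def by (intro continuous_on_add continuous_on_scaleC fp continuous_intros)
  have sec: "continuous_on {0..1} (\<lambda>u. G z u)" "continuous_on {0..1} (\<lambda>u. dG z u)" if "z \<in> ?U" for z
  proof -
    have "continuous_on {0..1} (\<lambda>u::real. (z, u))" "(\<lambda>u::real. (z, u)) ` {0..1} \<subseteq> ?U \<times> {0..1}"
      using that by (auto intro!: continuous_intros)
    from continuous_on_compose2[OF contG this] continuous_on_compose2[OF contdG this]
    show "continuous_on {0..1} (\<lambda>u. G z u)" "continuous_on {0..1} (\<lambda>u. dG z u)"
      by simp_all
  qed
  have main: "((\<lambda>z. integral {0..1} (G z)) has_derivative (\<lambda>h. h *\<^sub>C f z)) (at z)" if z: "z \<in> ?U" for z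
  proof -
    have "((\<lambda>z. integral (cbox 0 1) (G z)) has_derivative
        blinfun_apply (integral (cbox 0 1) (\<lambda>u. mul_blinfun (dG z u)))) (at z within ?U)"
    proof (rule leibniz_rule[OF der])
      show "G z integrable_on cbox 0 1" if "z \<in> ?U" for z
        using sec(1)[OF that] by (simp add: integrable_continuous_interval)
      show "continuous_on (?U \<times> cbox 0 1) (\<lambda>(z, u). mul_blinfun (dG z u))"
        using contdG by (auto simp: case_prod_unfold intro!: bounded_linear.continuous_on[OF bounded_linear_mul_blinfun])
    qed (use z in auto)
    moreover have "integral (cbox 0 1) (\<lambda>u. mul_blinfun (dG z u)) = mul_blinfun (integral {0..1} (dG z))"
      using integral_linear[OF integrable_continuous_interval[OF sec(2)[OF z]] bounded_linear_mul_blinfun]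
      by (simp add: o_def)
    \<comment> \<open>The differentiated integrand is the \<open>u\<close>-derivative of
      \<open>u *\<^sub>R f (p z u)\<close>, and \<open>p z 1 = z\<close>, so the integral is just an
      increment.\<close>
    moreover have "integral {0..1} (dG z) = f z"
    proof -
      have "((\<lambda>u. u *\<^sub>R f (p z u)) has_vector_derivative dG z u) (at u within {0..1})" if u: "u \<in> {0..1}" for u
      proof -
        have "p z u \<in> S"
          using pU[OF z u] assms(2) by auto
        then have d: "(f has_derivative (\<lambda>h. h *\<^sub>C f' (p z u))) (at (p z u))"
          by (rule f'(2))
        have dp: "((\<lambda>u. p z u) has_derivative (\<lambda>h. of_real h * (z - z0))) (at u)"
          unfolding p_def by (auto intro!: derivative_eq_intros)
        have "((\<lambda>u. f (p z u)) has_derivative (\<lambda>h. (of_real h * (z - z0)) *\<^sub>C f' (p z u))) (at u)"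
          using diff_chain_at[OF dp d] by (simp add: o_def)
        then have "((\<lambda>u. f (p z u)) has_vector_derivative (z - z0) *\<^sub>C f' (p z u)) (at u)"
          unfolding has_vector_derivative_def by (simp add: scaleC_scaleC[symmetric] scaleC_of_real)
        then have "((\<lambda>u. u *\<^sub>R f (p z u)) has_vector_derivative (u *\<^sub>R ((z - z0) *\<^sub>C f' (p z u)) + 1 *\<^sub>R f (p z u))) (at u)"
          by (intro has_vector_derivative_scaleR) (auto intro!: derivative_eq_intros)
        then show ?thesis
          by (simp add: dG_def scaleC_of_real add.commute has_vector_derivative_at_within)
      qed
      then have "(dG z has_integral (1 *\<^sub>R f (p z 1) - 0 *\<^sub>R f (p z 0))) {0..1}"
        by (intro fundamental_theorem_of_calculus) auto
      then show ?thesis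
        by (simp add: p_def integral_unique)
    qed
    ultimately show ?thesis
      using z by (simp add: mul_blinfun.rep_eq[abs_def] at_within_open[OF z open_ball])
  qed
  show ?thesis
    by (rule that[OF main])
qed

text \<open>A valid path need not be rectifiable, so integrability comes from primitives.\<close>

lemma vholo_integrable:
  fixes f :: "complex \<Rightarrow> 'b::{complex_normed_vector, banach}"
  assumes f: "vholo f S" and S: "open S" and \<gamma>: "valid_path \<gamma>" "path_image \<gamma> \<subseteq> S"
  shows "(\<lambda>x. vector_derivative \<gamma> (at x within {0..1}) *\<^sub>C f (\<gamma> x)) integrable_on {0..1}"
proof -
  obtain X where X: "finite X" "\<gamma> C1_differentiable_on {0..1} - X" and cont: "continuous_on {0..1} \<gamma>"
    using \<gamma>(1) unfolding valid_path_def piecewise_C1_differentiable_on_def by blast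
  let ?g = "\<lambda>x. vector_derivative \<gamma> (at x within {0..1}) *\<^sub>C f (\<gamma> x)"
  have "?g integrable_on cbox 0 1"
  \<comment> \<open>On a short interval around \<open>x\<close> the path stays in a ball carrying a
    primitive \<open>F\<close>. There the integrand is the derivative of \<open>F\<close> along the
    path except at finitely many points, so the fundamental theorem gives integrability without a
    bound on the speed of the path.\<close>
  proof (rule integrable_on_little_subintervals, rule ballI)
    fix x :: real assume x: "x \<in> cbox 0 1"
    then have "\<gamma> x \<in> S"
      using \<gamma>(2) by (auto simp: path_image_def)
    then obtain r where r: "r > 0" "ball (\<gamma> x) r \<subseteq> S"
      using S open_contains_ball by blast
    obtain F where F: "\<And>z. z \<in> ball (\<gamma> x) r \<Longrightarrow> (F has_derivative (\<lambda>h. h *\<^sub>C f z)) (at z)"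
      using vholo_local_primitive[OF f r(2)] by blast
    obtain d where d: "d > 0" "\<And>y. y \<in> {0..1} \<Longrightarrow> dist y x < d \<Longrightarrow> dist (\<gamma> y) (\<gamma> x) < r"
      using cont x r(1) unfolding continuous_on_iff by (metis cbox_interval)
    show "\<exists>d>0. \<forall>u v. x \<in> cbox u v \<and> cbox u v \<subseteq> ball x d \<and> cbox u v \<subseteq> cbox 0 1 \<longrightarrow> ?g integrable_on cbox u v"
    proof (intro exI[of _ d] conjI allI impI d(1))
      fix u v assume uv: "x \<in> cbox u v \<and> cbox u v \<subseteq> ball x d \<and> cbox u v \<subseteq> cbox 0 1"
      then have le: "u \<le> v" and uv01: "0 \<le> u" "v \<le> 1"
        by auto
      have in_ball: "\<gamma> y \<in> ball (\<gamma> x) r" if "y \<in> {u..v}" for y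
        using d(2)[of y] that uv by (auto simp: dist_commute subset_iff)
      have "(?g has_integral (F (\<gamma> v) - F (\<gamma> u))) {u..v}"
      proof (rule fundamental_theorem_of_calculus_interior_strong[OF X(1) le, where f = "\<lambda>x. F (\<gamma> x)"])
        fix y assume y: "y \<in> {u<..<v} - X"
        then have y01: "y \<in> {0..1} - X" "y \<in> {0<..<1}"
          using uv01 by auto
        then have "\<gamma> differentiable at y"
          using X(2) C1_differentiable_on_eq by blast
        then have "(\<gamma> has_vector_derivative vector_derivative \<gamma> (at y)) (at y)"
          by (simp add: vector_derivative_works)
        moreover have "vector_derivative \<gamma> (at y within {0..1}) = vector_derivative \<gamma> (at y)"
          using y01(2) at_within_interior[of y "{0..1}"] by simp
        ultimately have d\<gamma>: "(\<gamma> has_derivative (\<lambda>h. h *\<^sub>R vector_derivative \<gamma> (at y within {0..1}))) (at y)"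
          unfolding has_vector_derivative_def by simp
        have "(F has_derivative (\<lambda>h. h *\<^sub>C f (\<gamma> y))) (at (\<gamma> y))"
          using y by (intro F in_ball) auto
        from diff_chain_at[OF d\<gamma> this] show "((\<lambda>x. F (\<gamma> x)) has_vector_derivative ?g y) (at y)"
          unfolding has_vector_derivative_def by (simp add: o_def scaleR_scaleC)
      next
        have "continuous_on (ball (\<gamma> x) r) F"
          using F by (meson continuous_at_imp_continuous_on has_derivative_continuous)
        moreover have "continuous_on {u..v} \<gamma>"
          using uv01 by (intro continuous_on_subset[OF cont]) auto
        ultimately show "continuous_on {u..v} (\<lambda>x. F (\<gamma> x))"
          by (rule continuous_on_compose2) (use in_ball in auto)
      qed
      then show "?g integrable_on cbox u v"
        by auto
    qed
  qed
  then show ?thesis by simp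
qed

text \<open>Bounded complex-linear functionals carry operator-valued contour integrals to scalar
  ones, to which Cauchy's theorem applies. Matrix elements are functionals of this kind and
  determine the operator, see \<open>clfun_cinner\<close> and \<open>operator_eqI\<close>.\<close>

definition clfun :: "('b::complex_normed_vector \<Rightarrow> complex) \<Rightarrow> bool" where
  "clfun \<phi> \<longleftrightarrow> bounded_linear \<phi> \<and> (\<forall>c x. \<phi> (c *\<^sub>C x) = c * \<phi> x)"

lemma vholo_clfun_holomorphic:
  assumes "vholo f S" "clfun \<phi>"
  shows "(\<lambda>z. \<phi> (f z)) holomorphic_on S"
proof -
  obtain f' where f': "\<And>z. z \<in> S \<Longrightarrow> (f has_derivative (\<lambda>h. h *\<^sub>C f' z)) (at z)"
    using assms(1) unfolding vholo_def by blast
  have "((\<lambda>z. \<phi> (f z)) has_field_derivative \<phi> (f' z)) (at z within S)" if "z \<in> S" for z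
  proof -
    have "((\<lambda>z. \<phi> (f z)) has_derivative (\<lambda>h. \<phi> (h *\<^sub>C f' z))) (at z)"
      using bounded_linear.has_derivative[OF _ f'[OF that]] assms(2) unfolding clfun_def by blast
    then show ?thesis
      using assms(2) by (simp add: clfun_def has_field_derivative_def has_derivative_at_withinI mult_commute_abs)
  qed
  then show ?thesis
    unfolding holomorphic_on_def field_differentiable_def by blast
qed

lemma clfun_vector_contour_integral:
  assumes "(\<lambda>x. vector_derivative \<gamma> (at x within {0..1}) *\<^sub>C f (\<gamma> x)) integrable_on {0..1}" "clfun \<phi>"
  shows "((\<lambda>z. \<phi> (f z)) has_contour_integral \<phi> (vector_contour_integral \<gamma> f)) \<gamma>"
  using has_integral_linear[OF integrable_integral[OF assms(1)], of \<phi>] assms(2)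
  by (simp add: has_contour_integral_def vector_contour_integral_def clfun_def o_def mult.commute)

lemma bounded_linear_cinner_right: "bounded_linear (\<lambda>x. cinner y (x :: 'a::complex_inner))"
proof (rule bounded_linear_intro[where K = "2 * norm y"])
  fix x z :: 'a and r
  show "cinner y (x + z) = cinner y x + cinner y z"
    by (rule cinner_add_right)
  show "cinner y (r *\<^sub>R x) = r *\<^sub>R cinner y x"
    by (simp add: scaleC_of_real[symmetric] cinner_scaleC_right scaleC_complex_def)
  have "\<bar>Re (cinner y x)\<bar> \<le> norm y * norm x"
    using Cauchy_Schwarz_ineq2[of y x] by (simp add: Re_cinner)
  then show "norm (cinner y x) \<le> norm x * (2 * norm y)"
    using cmod_le[of "cinner y x"] cinner_norm_le[of y x] by (simp add: mult_ac)
qed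

lemma clfun_cinner:
  fixes A B :: "'a::complex_inner \<Rightarrow>\<^sub>L 'a"
  assumes "clin A"
  shows "clfun (\<lambda>T. cinner y ((A o\<^sub>L T o\<^sub>L B) x))"
  unfolding clfun_def
proof (intro conjI allI)
  have "bounded_linear (\<lambda>T. (A o\<^sub>L T o\<^sub>L B) x)"
    by (intro bounded_linear_compose[OF blinfun.bounded_linear_left]
        bounded_linear_compose[OF bounded_bilinear.bounded_linear_left[OF bounded_bilinear_blinfun_compose]]
        bounded_bilinear.bounded_linear_right[OF bounded_bilinear_blinfun_compose])
  then show "bounded_linear (\<lambda>T. cinner y ((A o\<^sub>L T o\<^sub>L B) x))"
    by (rule bounded_linear_compose[OF bounded_linear_cinner_right])
  show "cinner y ((A o\<^sub>L (c *\<^sub>C T) o\<^sub>L B) x) = c * cinner y ((A o\<^sub>L T o\<^sub>L B) x)" for c T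
    using assms by (simp add: scaleC_blinfun.rep_eq clinD cinner_scaleC_right)
qed

lemmas clfun_cinner_id = clfun_cinner[OF clin_simps(1), where B = id_blinfun, simplified]

lemma operator_eqI:
  fixes A B :: "'a::complex_inner \<Rightarrow>\<^sub>L 'a"
  assumes "\<And>x y. cinner y (A x) = cinner y (B x)"
  shows "A = B"
proof (rule blinfun_eqI)
  fix x
  have "cinner (A x) y = cinner (B x) y" for y
    using assms[of y x] by (metis cinner_commute)
  then show "A x = B x"
    by (rule cinner_ext)
qed

lemma vholo_resolvent:
  fixes A :: "'a::{complex_normed_vector, banach} \<Rightarrow>\<^sub>L 'a"
  assumes "clin A"
  shows "vholo (resolvent A) (- op_spectrum A)"
  unfolding vholo_def
proof (intro exI conjI ballI)
  have "continuous_on (- op_spectrum A) (resolvent A)"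
    using continuous_on_resolvent[of "- op_spectrum A" "\<lambda>_. A" "\<lambda>z. z"] by (simp add: continuous_intros)
  then show "continuous_on (- op_spectrum A) (\<lambda>z. resolvent A z o\<^sub>L resolvent A z)"
    using bounded_bilinear.continuous_on[OF bounded_bilinear_blinfun_compose] by blast
  fix z assume z: "z \<in> - op_spectrum A"
  have "((\<lambda>w. A - w *\<^sub>C id_blinfun) has_derivative (\<lambda>h. - (h *\<^sub>C id_blinfun))) (at z within - op_spectrum A)"
    by (auto intro!: derivative_eq_intros bounded_linear.has_derivative[OF
          bounded_bilinear.bounded_linear_left[OF bounded_bilinear_scaleC]])
  from has_derivative_op_inverse[OF this z]
  have "(resolvent A has_derivative
      (\<lambda>h. - (resolvent A z o\<^sub>L (- (h *\<^sub>C id_blinfun)) o\<^sub>L resolvent A z))) (at z within - op_spectrum A)"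
    unfolding resolvent_def[abs_def] by (simp add: not_in_spectrum_iff)
  moreover have "- (resolvent A z o\<^sub>L (- (h *\<^sub>C id_blinfun)) o\<^sub>L resolvent A z) = h *\<^sub>C (resolvent A z o\<^sub>L resolvent A z)" for h
    using z assms by (simp only: blinfun_compose_linear minus_minus blinfun_compose_id scaleC_blinfun_compose_left
        clin_compose_scaleC[OF clin_resolvent] Compl_iff not_False_eq_True)
  ultimately show "(resolvent A has_derivative (\<lambda>h. h *\<^sub>C (resolvent A z o\<^sub>L resolvent A z))) (at z)"
    using at_within_open[OF z open_resolvent_set] by simp
qed

section \<open>Loops around parts of the spectrum\<close>

text \<open>Joining the loops by a path \<open>p\<close> inside the resolvent set yields one closed
  path, \<gamma> forwards and \<eta> backwards with \<open>p\<close> traversed in both directions,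
  whose winding number vanishes on the spectrum of \<open>T\<close>. For \<open>B\<close> near
  \<open>T\<close> it still vanishes on the spectrum of \<open>B\<close>, so Cauchy's theorem
  applies to this path and the contributions of \<open>p\<close> cancel.\<close>

lemma loop_contour_integral_stable:
  fixes T :: "'a::chilbert_space \<Rightarrow>\<^sub>L 'a"
  assumes T: "self_adjoint T"
    and \<gamma>: "valid_path \<gamma>" "pathfinish \<gamma> = pathstart \<gamma>" "path_image \<gamma> \<inter> op_spectrum T = {}"
    and \<eta>: "valid_path \<eta>" "pathfinish \<eta> = pathstart \<eta>" "path_image \<eta> \<inter> op_spectrum T = {}"
    and w: "\<And>z. z \<in> op_spectrum T \<Longrightarrow> winding_number \<gamma> z = winding_number \<eta> z"
  obtains \<delta> where "\<delta> > 0"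
    "\<And>B f. norm (B - T) < \<delta> \<Longrightarrow> f holomorphic_on - op_spectrum B \<Longrightarrow>
       path_image \<gamma> \<inter> op_spectrum B = {} \<and> path_image \<eta> \<inter> op_spectrum B = {} \<and>
       contour_integral \<gamma> f = contour_integral \<eta> f"
proof -
  have ends: "pathfinish \<gamma> \<in> - op_spectrum T" "pathfinish \<eta> \<in> - op_spectrum T"
    using \<gamma>(3) \<eta>(3) pathfinish_in_path_image by blast+
  obtain p where p: "polynomial_function p" "path_image p \<subseteq> - op_spectrum T"
    "pathstart p = pathfinish \<gamma>" "pathfinish p = pathfinish \<eta>"
    using connected_open_polynomial_connected[OF open_resolvent_set connected_resolvent_set[OF T] ends] by blast
  have vp: "valid_path p"
    using p(1) by (rule valid_path_polynomial_function)
  define \<Gamma> where "\<Gamma> = \<gamma> +++ p +++ reversepath \<eta> +++ reversepath p"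
  have v: "valid_path \<Gamma>" and loop: "pathfinish \<Gamma> = pathstart \<Gamma>"
    and im: "path_image \<Gamma> = path_image \<gamma> \<union> path_image p \<union> path_image \<eta>"
    unfolding \<Gamma>_def using \<gamma> \<eta> p vp by (auto intro!: valid_path_join simp: path_image_join)
  \<comment> \<open>The complement of \<open>Z\<close> consists of the path and the points encircled
    by it. It is closed, and bounded since winding numbers vanish far out; hence a perturbed
    spectrum avoids it as the spectrum of \<open>T\<close> does.\<close>
  define Z where "Z = {z. z \<notin> path_image \<Gamma> \<and> winding_number \<Gamma> z = 0}"
  have "open Z"
    unfolding Z_def by (rule open_winding_number_levelsets) (use v loop valid_path_imp_path in auto)
  moreover obtain b where b: "\<And>z. b \<le> cmod z \<Longrightarrow> winding_number \<Gamma> z = 0"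
    using winding_number_zero_at_infinity[OF valid_path_imp_path[OF v] loop] by blast
  obtain b' where b': "\<And>z. z \<in> path_image \<Gamma> \<Longrightarrow> cmod z \<le> b'"
    using compact_imp_bounded[OF compact_path_image[OF valid_path_imp_path[OF v]]] by (auto simp: bounded_iff)
  have "cmod z \<le> max b b'" if "z \<in> - Z" for z
    using that b[of z] b'[of z] by (cases "b \<le> cmod z") (auto simp: Z_def max_def)
  then have "bounded (- Z)"
    unfolding bounded_iff by blast
  ultimately have "compact (- Z)"
    by (simp add: compact_eq_bounded_closed closed_Compl)
  moreover have "- Z \<inter> op_spectrum T = {}"
  proof -
    have "z \<in> Z" if z: "z \<in> op_spectrum T" for z
    proof -
      have nz: "z \<notin> path_image \<gamma>" "z \<notin> path_image p" "z \<notin> path_image \<eta>"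
        using z \<gamma>(3) \<eta>(3) p(2) by auto
      have "winding_number \<Gamma> z = winding_number \<gamma> z + (winding_number p z + (- winding_number \<eta> z + - winding_number p z))"
        unfolding \<Gamma>_def using nz vp \<gamma> \<eta> p
        by (simp add: winding_number_join winding_number_reversepath valid_path_imp_path path_image_join)
      then show ?thesis
        using nz w[OF z] by (simp add: Z_def im)
    qed
    then show ?thesis by auto
  qed
  ultimately obtain \<delta> where \<delta>: "\<delta> > 0" "\<And>B. norm (B - T) < \<delta> \<Longrightarrow> - Z \<inter> op_spectrum B = {}"
    using spectrum_stable[of "- Z" T] by blast
  show ?thesis
  proof (rule that[OF \<delta>(1)])
    fix B f assume B: "norm (B - T) < \<delta>" and f: "f holomorphic_on - op_spectrum B"
    have sub: "op_spectrum B \<subseteq> Z"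
      using \<delta>(2)[OF B] by auto
    then have im_B: "path_image \<Gamma> \<subseteq> - op_spectrum B"
      by (auto simp: Z_def)
    have "(f has_contour_integral 0) \<Gamma>"
      by (rule Cauchy_theorem_global[OF open_resolvent_set f v loop im_B]) (use sub in \<open>auto simp: Z_def\<close>)
    then have zero: "contour_integral \<Gamma> f = 0"
      by (rule contour_integral_unique)
    have ints: "f contour_integrable_on \<gamma>" "f contour_integrable_on p" "f contour_integrable_on \<eta>"
      using im_B im \<gamma>(1) \<eta>(1) vp
      by (auto intro!: contour_integrable_holomorphic_simple[OF f open_resolvent_set])
    then have "contour_integral \<Gamma> f = contour_integral \<gamma> f + (contour_integral p f + (- contour_integral \<eta> f + - contour_integral p f))"
      unfolding \<Gamma>_def using \<gamma> \<eta> p vp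
      by (simp add: contour_integral_join contour_integral_reversepath contour_integrable_reversepath valid_path_join)
    then show "path_image \<gamma> \<inter> op_spectrum B = {} \<and> path_image \<eta> \<inter> op_spectrum B = {} \<and>
       contour_integral \<gamma> f = contour_integral \<eta> f"
      using zero im_B im by auto
  qed
qed

text \<open>Polynomial loops have continuous velocity, so integrals of continuous functions along
  them can be estimated and differentiated in a parameter. A sufficiently close approximation has
  the same contour integrals of functions holomorphic on \<open>S\<close>, in particular those that
  compute winding numbers about points outside \<open>S\<close>.\<close>

lemma polynomial_loop_exists:
  assumes S: "open S" and \<gamma>: "valid_path \<gamma>" "pathfinish \<gamma> = pathstart \<gamma>" "path_image \<gamma> \<subseteq> S"
  obtains \<eta> where "polynomial_function \<eta>" "pathfinish \<eta> = pathstart \<eta>" "path_image \<eta> \<subseteq> S"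
    "\<And>z. z \<notin> S \<Longrightarrow> winding_number \<eta> z = winding_number \<gamma> z"
proof -
  have path: "path \<gamma>"
    using \<gamma>(1) by (rule valid_path_imp_path)
  obtain d where d: "d > 0" and near: "\<forall>g h. valid_path g \<and> valid_path h \<and>
      (\<forall>t\<in>{0..1}. cmod (g t - \<gamma> t) < d \<and> cmod (h t - \<gamma> t) < d) \<and>
      pathfinish g = pathstart g \<and> pathfinish h = pathstart h \<longrightarrow>
      path_image g \<subseteq> S \<and> path_image h \<subseteq> S \<and>
      (\<forall>f. f holomorphic_on S \<longrightarrow> contour_integral h f = contour_integral g f)"
    using contour_integral_nearby_loops[OF S path \<gamma>(3)] by (elim exE conjE)
  obtain \<eta> where \<eta>: "polynomial_function \<eta>" "pathstart \<eta> = pathstart \<gamma>" "pathfinish \<eta> = pathfinish \<gamma>"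
    "\<And>t. t \<in> {0..1} \<Longrightarrow> norm (\<eta> t - \<gamma> t) < d"
    using path_approx_polynomial_function[OF path d] by blast
  have v: "valid_path \<eta>"
    using \<eta>(1) by (rule valid_path_polynomial_function)
  have *: "path_image \<eta> \<subseteq> S \<and> (\<forall>f. f holomorphic_on S \<longrightarrow> contour_integral \<eta> f = contour_integral \<gamma> f)"
    using near[rule_format, of \<gamma> \<eta>] \<eta> \<gamma> d v by simp
  show ?thesis
  proof
    fix z assume z: "z \<notin> S"
    have "(\<lambda>w. 1 / (w - z)) holomorphic_on S"
      using z by (intro holomorphic_intros) auto
    then show "winding_number \<eta> z = winding_number \<gamma> z"
      using z * \<gamma>(3) by (subst (1 2) winding_number_valid_path) (auto simp: v \<gamma>(1))
  qed (use \<eta> \<gamma> * in auto)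
qed

text \<open>The parts of the resolvent with winding number one continue holomorphically across the
  spectrum after multiplication by \<open>P - 1\<close>, so \<open>P (P - 1) = 0\<close> by Cauchy's theorem.\<close>

lemma spectral_projector_idempotent:
  fixes B :: "'a::chilbert_space \<Rightarrow>\<^sub>L 'a"
  assumes B: "clin B" and poly: "polynomial_function \<eta>" and loop: "pathfinish \<eta> = pathstart \<eta>"
    and im: "path_image \<eta> \<inter> op_spectrum B = {}"
    and wind: "\<And>z. z \<in> op_spectrum B \<Longrightarrow> winding_number \<eta> z \<in> {0, 1}"
  shows "spectral_projector B \<eta> o\<^sub>L spectral_projector B \<eta> = spectral_projector B \<eta>"
proof -
  let ?R = "resolvent B" and ?S = "- op_spectrum B"
  define V where "V = vector_contour_integral \<eta> ?R"
  define c where "c = - (1 / (2 * of_real pi * \<i>))"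
  have c0: "c \<noteq> 0" by (simp add: c_def)
  have P: "spectral_projector B \<eta> = c *\<^sub>C V"
    by (simp add: spectral_projector_def V_def c_def resolvent_def[abs_def])
  have v: "valid_path \<eta>"
    using poly by (rule valid_path_polynomial_function)
  have imS: "path_image \<eta> \<subseteq> ?S"
    using im by auto
  have hol: "vholo ?R ?S"
    using B by (rule vholo_resolvent)
  have int: "(\<lambda>x. vector_derivative \<eta> (at x within {0..1}) *\<^sub>C ?R (\<eta> x)) integrable_on {0..1}"
    by (rule vholo_integrable[OF hol open_resolvent_set v imS])
  have clV: "clin V"
    unfolding V_def vector_contour_integral_def
    by (intro clin_integral clin_simps clin_resolvent B) (use imS in \<open>auto simp: path_image_def image_subset_iff\<close>)
  have ci: "((\<lambda>z. \<phi> (?R z)) has_contour_integral \<phi> V) \<eta>" if "clfun \<phi>" for \<phi>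
    unfolding V_def by (rule clfun_vector_contour_integral[OF int that])
  let ?P = "c *\<^sub>C V"
  have "V o\<^sub>L (?P - id_blinfun) = 0"
  proof (rule operator_eqI)
    fix x y
    define \<phi> :: "('a \<Rightarrow>\<^sub>L 'a) \<Rightarrow> complex" where "\<phi> T = cinner y (T x)" for T
    have \<phi>: "clfun \<phi>"
      unfolding \<phi>_def by (rule clfun_cinner_id)
    have \<phi>s: "\<phi> (a *\<^sub>C T) = a * \<phi> T" "\<phi> (T - T') = \<phi> T - \<phi> T'" for a T T'
      using \<phi> by (auto simp: clfun_def linear_diff bounded_linear.linear)
    have \<phi>hol: "(\<lambda>z. \<phi> (?R z)) holomorphic_on ?S"
      by (rule vholo_clfun_holomorphic[OF hol \<phi>])
    then have \<phi>cont: "continuous_on (path_image \<eta>) (\<lambda>z. \<phi> (?R z))"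
      using holomorphic_on_imp_continuous_on continuous_on_subset imS by blast
    \<comment> \<open>The Cauchy transform of the matrix element along the loop; unlike the
      resolvent it is holomorphic at every point off the loop, spectrum included.\<close>
    define s where "s w = contour_integral \<eta> (\<lambda>z. \<phi> (?R z) / (z - w))" for w
    have s_int: "((\<lambda>z. \<phi> (?R z) / (z - w)) has_contour_integral s w) \<eta>" if "w \<notin> path_image \<eta>" for w
      unfolding s_def
    proof (rule has_contour_integral_integral)
      show "(\<lambda>z. \<phi> (?R z) / (z - w)) contour_integrable_on \<eta>"
        using that imS
        by (intro contour_integrable_holomorphic_simple[of _ "?S - {w}"] v holomorphic_intros
            holomorphic_on_subset[OF \<phi>hol] open_delete open_resolvent_set) auto
    qed
    \<comment> \<open>Differentiating the Cauchy transform requires a bound on the velocity of the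
      loop, which a polynomial loop provides.\<close>
    obtain D where D: "\<And>t. t \<in> {0..1} \<Longrightarrow> cmod (vector_derivative \<eta> (at t)) \<le> D"
    proof -
      obtain p' where p': "polynomial_function p'" "\<And>x. (\<eta> has_vector_derivative p' x) (at x)"
        using has_vector_derivative_polynomial_function[OF poly] by blast
      have "bounded (p' ` {0..1})"
        by (intro compact_imp_bounded compact_continuous_image continuous_on_polymonial_function p') auto
      then obtain a where "\<And>t. t \<in> {0..1} \<Longrightarrow> cmod (p' t) \<le> a"
        unfolding bounded_iff by blast
      then show ?thesis
        using that[of a] vector_derivative_at[OF p'(2)] by simp
    qed
    have s_hol: "s holomorphic_on - path_image \<eta>"
      unfolding holomorphic_on_def field_differentiable_def
    proof (intro ballI exI)
      fix w assume w: "w \<in> - path_image \<eta>"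
      have "(s has_field_derivative of_nat 1 * contour_integral \<eta> (\<lambda>u. \<phi> (?R u) / (u - w) ^ Suc 1)) (at w)"
        by (rule Cauchy_next_derivative(2)[where S = UNIV, OF \<phi>cont D]) (use s_int v w in auto)
      then show "(s has_field_derivative of_nat 1 * contour_integral \<eta> (\<lambda>u. \<phi> (?R u) / (u - w) ^ Suc 1))
          (at w within - path_image \<eta>)"
        by (rule has_field_derivative_at_within)
    qed
    \<comment> \<open>The matrix element of the resolvent times \<open>?P - id_blinfun\<close>, with
      values prescribed on the spectrum. By \<open>key\<close> they continue it holomorphically
      across the part where the winding number is one.\<close>
    define h where "h w = (if w \<notin> op_spectrum B then \<phi> (?R w o\<^sub>L ?P) - \<phi> (?R w) else c * s w)" for w
    \<comment> \<open>Write the product of the resolvents at \<open>w\<close> and \<open>z\<close>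
      as a difference quotient and integrate over \<open>z\<close>: the term with the fixed
      resolvent yields the winding number, the other one the Cauchy transform. Where the winding
      number is one only the latter remains.\<close>
    have key: "\<phi> (?R w o\<^sub>L ?P) - \<phi> (?R w) = (winding_number \<eta> w - 1) * \<phi> (?R w) + c * s w"
      if w: "w \<notin> op_spectrum B" "w \<notin> path_image \<eta>" for w
    proof -
      let ?\<psi> = "\<lambda>T. cinner y ((?R w o\<^sub>L T o\<^sub>L id_blinfun) x)"
      have "clfun ?\<psi>"
        by (rule clfun_cinner) (use B w in auto)
      then have "((\<lambda>z. ?\<psi> (?R z)) has_contour_integral \<phi> (?R w o\<^sub>L V)) \<eta>"
        using ci[of ?\<psi>] by (simp add: \<phi>_def)
      moreover have "?\<psi> (?R z) = - \<phi> (?R w) * (1 / (z - w)) + \<phi> (?R z) / (z - w)" if z: "z \<in> path_image \<eta>" for z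
      proof -
        have zS: "z \<notin> op_spectrum B" and zw: "z \<noteq> w"
          using z imS w by auto
        have "\<phi> (?R w) - \<phi> (?R z) = (w - z) * \<phi> (?R w o\<^sub>L ?R z)"
          using arg_cong[OF resolvent_identity[OF B zS w(1)], of \<phi>] by (simp add: \<phi>s)
        moreover have "?\<psi> (?R z) = \<phi> (?R w o\<^sub>L ?R z)"
          by (simp add: \<phi>_def)
        ultimately have "?\<psi> (?R z) * (z - w) = \<phi> (?R z) - \<phi> (?R w)"
          by (simp add: algebra_simps)
        then have "?\<psi> (?R z) = (\<phi> (?R z) - \<phi> (?R w)) / (z - w)"
          using zw by (intro eq_divide_imp) auto
        then show ?thesis
          by (simp add: diff_divide_distrib)
      qed
      ultimately have "((\<lambda>z. - \<phi> (?R w) * (1 / (z - w)) + \<phi> (?R z) / (z - w)) has_contour_integral \<phi> (?R w o\<^sub>L V)) \<eta>"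
        by (rule has_contour_integral_eq)
      moreover have "((\<lambda>z. 1 / (z - w)) has_contour_integral (2 * of_real pi * \<i> * winding_number \<eta> w)) \<eta>"
        using has_contour_integral_winding_number[OF v w(2)] by (simp add: mult.assoc)
      then have "((\<lambda>z. - \<phi> (?R w) * (1 / (z - w)) + \<phi> (?R z) / (z - w)) has_contour_integral
          (- \<phi> (?R w) * (2 * of_real pi * \<i> * winding_number \<eta> w) + s w)) \<eta>"
        by (intro has_contour_integral_add has_contour_integral_lmul s_int w(2))
      ultimately have "\<phi> (?R w o\<^sub>L V) = - \<phi> (?R w) * (2 * of_real pi * \<i> * winding_number \<eta> w) + s w"
        by (rule has_contour_integral_unique)
      moreover have "\<phi> (?R w o\<^sub>L ?P) = c * \<phi> (?R w o\<^sub>L V)"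
        using clin_compose_scaleC[of "?R w" c V] B w by (simp add: \<phi>s)
      ultimately have "\<phi> (?R w o\<^sub>L ?P) = c * (- \<phi> (?R w) * (2 * of_real pi * \<i> * winding_number \<eta> w) + s w)"
        by simp
      also have "\<dots> = (- c * (2 * of_real pi * \<i>)) * winding_number \<eta> w * \<phi> (?R w) + c * s w"
        by (simp add: right_diff_distrib mult_ac)
      finally have "\<phi> (?R w o\<^sub>L ?P) = (- c * (2 * of_real pi * \<i>)) * winding_number \<eta> w * \<phi> (?R w) + c * s w" .
      moreover have "- c * (2 * of_real pi * \<i>) = 1"
        by (simp add: c_def)
      ultimately have "\<phi> (?R w o\<^sub>L ?P) = 1 * winding_number \<eta> w * \<phi> (?R w) + c * s w"
        by (simp only:)
      then show ?thesis
        by (simp add: left_diff_distrib)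
    qed
    let ?N = "{w. w \<notin> path_image \<eta> \<and> winding_number \<eta> w = 1}"
    have openN: "open ?N"
      by (rule open_winding_number_levelsets) (use v loop valid_path_imp_path in auto)
    have h1: "h holomorphic_on ?N"
    proof (rule holomorphic_transform)
      show "(\<lambda>w. c * s w) holomorphic_on ?N"
        by (intro holomorphic_intros holomorphic_on_subset[OF s_hol]) auto
      show "c * s w = h w" if "w \<in> ?N" for w
        using that key[of w] by (auto simp: h_def)
    qed
    have "clfun (\<lambda>T. cinner y ((id_blinfun o\<^sub>L T o\<^sub>L (?P - id_blinfun)) x))"
      by (rule clfun_cinner) simp
    then have \<chi>: "clfun (\<lambda>T. \<phi> (T o\<^sub>L (?P - id_blinfun)))"
      by (simp add: \<phi>_def)
    have h2: "h holomorphic_on ?S"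
    proof (rule holomorphic_transform)
      show "(\<lambda>w. \<phi> (?R w o\<^sub>L (?P - id_blinfun))) holomorphic_on ?S"
        by (rule vholo_clfun_holomorphic[OF hol \<chi>])
      show "\<phi> (?R w o\<^sub>L (?P - id_blinfun)) = h w" if "w \<in> ?S" for w
        using that by (simp add: h_def blinfun_compose_linear \<phi>s)
    qed
    have "(h has_contour_integral 0) \<eta>"
    proof (rule Cauchy_theorem_global[of "?S \<union> ?N"])
      show "h holomorphic_on ?S \<union> ?N"
        by (intro holomorphic_on_Un h1 h2 open_resolvent_set openN)
      \<comment> \<open>A point outside the domain of \<open>h\<close> lies in the spectrum and does
        not have winding number one, so by hypothesis it has winding number zero, as the global
        Cauchy theorem requires.\<close>
      show "winding_number \<eta> w = 0" if "w \<notin> ?S \<union> ?N" for w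
        using that wind[of w] imS by auto
    qed (use v loop imS openN open_resolvent_set in auto)
    moreover have "(h has_contour_integral \<phi> (V o\<^sub>L (?P - id_blinfun))) \<eta>"
    proof (rule has_contour_integral_eq[OF ci[OF \<chi>]])
      show "\<phi> (?R w o\<^sub>L (?P - id_blinfun)) = h w" if "w \<in> path_image \<eta>" for w
        using that imS by (auto simp: h_def blinfun_compose_linear \<phi>s)
    qed
    ultimately have "\<phi> (V o\<^sub>L (?P - id_blinfun)) = 0"
      using has_contour_integral_unique by blast
    then show "cinner y ((V o\<^sub>L (?P - id_blinfun)) x) = cinner y (blinfun_apply 0 x)"
      using cinner_diff_right[of y 0 0] by (simp add: \<phi>_def)
  qed
  then have "c *\<^sub>C (V o\<^sub>L (?P - id_blinfun)) = 0"
    by (simp add: scaleC_right_simps)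
  then have "?P o\<^sub>L (?P - id_blinfun) = 0"
    by (simp only: scaleC_blinfun_compose_left)
  then show ?thesis
    unfolding P by (simp add: blinfun_compose_linear)
qed

text \<open>One polynomial loop replaces all the loops in \<open>G\<close>, for every complex-linear
  operator near \<open>T\<close>. Each loop of \<open>G\<close> comes with its own admissible
  perturbation size, and finiteness of \<open>G\<close> leaves a positive minimum. Neighbouring
  Hamiltonians and their first-order corrections are the operators to which this is applied.\<close>

lemma spectral_projector_common_loop:
  fixes T :: "'a::chilbert_space \<Rightarrow>\<^sub>L 'a"
  assumes T: "self_adjoint T" and spec: "op_spectrum T = \<sigma> \<union> \<sigma>'" "\<sigma> \<inter> \<sigma>' = {}"
    and G: "finite G" "G \<noteq> {}" "\<And>\<gamma>. \<gamma> \<in> G \<Longrightarrow> encircles_only \<gamma> \<sigma> \<sigma>'"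
  obtains \<eta> \<delta> where "polynomial_function \<eta>" "pathfinish \<eta> = pathstart \<eta>" "\<delta> > 0"
    "\<And>B. clin B \<Longrightarrow> norm (B - T) < \<delta> \<Longrightarrow> path_image \<eta> \<inter> op_spectrum B = {} \<and>
       (\<forall>\<gamma>\<in>G. spectral_projector B \<gamma> = spectral_projector B \<eta>) \<and>
       spectral_projector B \<eta> o\<^sub>L spectral_projector B \<eta> = spectral_projector B \<eta>"
proof -
  obtain \<gamma>0 where \<gamma>0: "\<gamma>0 \<in> G"
    using G(2) by blast
  have enc: "valid_path \<gamma>" "pathfinish \<gamma> = pathstart \<gamma>" "path_image \<gamma> \<inter> op_spectrum T = {}"
    "\<And>z. z \<in> \<sigma> \<Longrightarrow> winding_number \<gamma> z = 1" "\<And>z. z \<in> \<sigma>' \<Longrightarrow> winding_number \<gamma> z = 0" if "\<gamma> \<in> G" for \<gamma>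
    using G(3)[OF that] by (auto simp: encircles_only_def spec(1))
  have "path_image \<gamma>0 \<subseteq> - op_spectrum T"
    using enc(3)[OF \<gamma>0] by auto
  then obtain \<eta> where \<eta>: "polynomial_function \<eta>" "pathfinish \<eta> = pathstart \<eta>" "path_image \<eta> \<subseteq> - op_spectrum T"
    "\<And>z. z \<notin> - op_spectrum T \<Longrightarrow> winding_number \<eta> z = winding_number \<gamma>0 z"
    using polynomial_loop_exists[OF open_resolvent_set enc(1,2)[OF \<gamma>0]] by blast
  have v\<eta>: "valid_path \<eta>"
    using \<eta>(1) by (rule valid_path_polynomial_function)
  have im\<eta>: "path_image \<eta> \<inter> op_spectrum T = {}"
    using \<eta>(3) by auto
  have w\<eta>: "winding_number \<gamma> z = winding_number \<eta> z" if "\<gamma> \<in> G" "z \<in> op_spectrum T" for \<gamma> z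
    using \<eta>(4)[of z] enc(4,5)[OF \<gamma>0, of z] enc(4,5)[OF that(1), of z] that(2) by (auto simp: spec(1))
  have "\<forall>\<gamma>\<in>G. \<exists>\<delta>>0. \<forall>B f. norm (B - T) < \<delta> \<longrightarrow> f holomorphic_on - op_spectrum B \<longrightarrow>
       path_image \<gamma> \<inter> op_spectrum B = {} \<and> path_image \<eta> \<inter> op_spectrum B = {} \<and>
       contour_integral \<gamma> f = contour_integral \<eta> f"
  proof
    fix \<gamma> assume "\<gamma> \<in> G"
    from loop_contour_integral_stable[OF T enc(1-3)[OF this] v\<eta> \<eta>(2) im\<eta> w\<eta>[OF this]]
    show "\<exists>\<delta>>0. \<forall>B f. norm (B - T) < \<delta> \<longrightarrow> f holomorphic_on - op_spectrum B \<longrightarrow>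
       path_image \<gamma> \<inter> op_spectrum B = {} \<and> path_image \<eta> \<inter> op_spectrum B = {} \<and>
       contour_integral \<gamma> f = contour_integral \<eta> f"
      by metis
  qed
  then obtain d where d: "\<And>\<gamma>. \<gamma> \<in> G \<Longrightarrow> d \<gamma> > 0"
    "\<And>\<gamma> B f. \<gamma> \<in> G \<Longrightarrow> norm (B - T) < d \<gamma> \<Longrightarrow> f holomorphic_on - op_spectrum B \<Longrightarrow>
       path_image \<gamma> \<inter> op_spectrum B = {} \<and> path_image \<eta> \<inter> op_spectrum B = {} \<and>
       contour_integral \<gamma> f = contour_integral \<eta> f"
    by metis
  let ?Z = "\<lambda>k. {z. z \<notin> path_image \<eta> \<and> winding_number \<eta> z = k}"
  \<comment> \<open>The points on the loop or with a winding number other than 0 and 1. This set is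
    compact and misses the spectrum of \<open>T\<close>, hence also nearby spectra; their winding
    numbers are then 0 or 1, as idempotence demands.\<close>
  let ?C = "- (?Z 0 \<union> ?Z 1)"
  have "open (?Z 0 \<union> ?Z 1)"
    by (intro open_Un open_winding_number_levelsets valid_path_imp_path v\<eta> \<eta>(2))
  moreover have "bounded ?C"
  proof -
    obtain b where b: "\<And>z. b \<le> cmod z \<Longrightarrow> winding_number \<eta> z = 0"
      using winding_number_zero_at_infinity[OF valid_path_imp_path[OF v\<eta>] \<eta>(2)] by blast
    obtain b' where b': "\<And>z. z \<in> path_image \<eta> \<Longrightarrow> cmod z \<le> b'"
      using compact_imp_bounded[OF compact_path_image[OF valid_path_imp_path[OF v\<eta>]]] by (auto simp: bounded_iff)
    have "cmod z \<le> max b b'" if "z \<in> ?C" for z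
      using that b[of z] b'[of z] by (cases "b \<le> cmod z") (auto simp: max_def)
    then show ?thesis
      unfolding bounded_iff by blast
  qed
  ultimately have "compact ?C"
    unfolding compact_eq_bounded_closed using closed_Compl by blast
  moreover have "?C \<inter> op_spectrum T = {}"
    using w\<eta>[OF \<gamma>0] enc(4,5)[OF \<gamma>0] im\<eta> by (fastforce simp: spec(1))
  ultimately obtain \<delta>0 where \<delta>0: "\<delta>0 > 0" "\<And>B. norm (B - T) < \<delta>0 \<Longrightarrow> ?C \<inter> op_spectrum B = {}"
    using spectrum_stable[of ?C T] by blast
  define \<delta> where "\<delta> = Min (insert \<delta>0 (d ` G))"
  have \<delta>: "\<delta> > 0" "\<delta> \<le> \<delta>0" "\<And>\<gamma>. \<gamma> \<in> G \<Longrightarrow> \<delta> \<le> d \<gamma>"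
    unfolding \<delta>_def using G(1) d(1) \<delta>0(1) by auto
  show ?thesis
  proof (rule that[OF \<eta>(1,2) \<delta>(1)])
    fix B :: "'a \<Rightarrow>\<^sub>L 'a" assume B: "clin B" "norm (B - T) < \<delta>"
    have C: "?C \<inter> op_spectrum B = {}"
      using \<delta>0(2)[of B] B \<delta>(2) by auto
    have imB: "path_image \<eta> \<inter> op_spectrum B = {}"
      using C by auto
    have "spectral_projector B \<gamma> = spectral_projector B \<eta>" if \<gamma>: "\<gamma> \<in> G" for \<gamma>
    proof -
      have Bd: "norm (B - T) < d \<gamma>"
        using B \<delta>(3)[OF \<gamma>] by simp
      note hol = vholo_resolvent[OF B(1)]
      \<comment> \<open>The zero function is holomorphic everywhere and serves to extract the
        statement on the position of the path.\<close>
      have im\<gamma>: "path_image \<gamma> \<subseteq> - op_spectrum B"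
        using d(2)[OF \<gamma> Bd, of "\<lambda>_. 0"] by auto
      have "vector_contour_integral \<gamma> (resolvent B) = vector_contour_integral \<eta> (resolvent B)"
      proof (rule operator_eqI)
        fix x y
        note \<phi> = clfun_cinner_id[of y x]
        have "contour_integral \<gamma> (\<lambda>z. cinner y (resolvent B z x)) = contour_integral \<eta> (\<lambda>z. cinner y (resolvent B z x))"
          using d(2)[OF \<gamma> Bd vholo_clfun_holomorphic[OF hol \<phi>]] by simp
        moreover have "contour_integral \<gamma> (\<lambda>z. cinner y (resolvent B z x)) = cinner y (vector_contour_integral \<gamma> (resolvent B) x)"
          by (rule contour_integral_unique[OF clfun_vector_contour_integral[OF vholo_integrable[OF hol open_resolvent_set enc(1)[OF \<gamma>] im\<gamma>] \<phi>]])
        moreover have "contour_integral \<eta> (\<lambda>z. cinner y (resolvent B z x)) = cinner y (vector_contour_integral \<eta> (resolvent B) x)"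
          by (rule contour_integral_unique[OF clfun_vector_contour_integral[OF vholo_integrable[OF hol open_resolvent_set v\<eta>] \<phi>]]) (use imB in auto)
        ultimately show "cinner y (vector_contour_integral \<gamma> (resolvent B) x) = cinner y (vector_contour_integral \<eta> (resolvent B) x)"
          by simp
      qed
      then show ?thesis
        by (simp add: spectral_projector_def resolvent_def[abs_def])
    qed
    moreover have "spectral_projector B \<eta> o\<^sub>L spectral_projector B \<eta> = spectral_projector B \<eta>"
      by (rule spectral_projector_idempotent[OF B(1) \<eta>(1,2) imB]) (use C in auto)
    ultimately show "path_image \<eta> \<inter> op_spectrum B = {} \<and>
       (\<forall>\<gamma>\<in>G. spectral_projector B \<gamma> = spectral_projector B \<eta>) \<and>
       spectral_projector B \<eta> o\<^sub>L spectral_projector B \<eta> = spectral_projector B \<eta>"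
      using imB by blast
  qed
qed

section \<open>Differential calculus with a parameter\<close>

text \<open>\<open>Ckp k S T f\<close>: the maps \<open>\<lambda>p. f p e\<close> are of class \<open>C\<^sup>k\<close> on \<open>S\<close>, with derivatives jointly
  continuous in \<open>p \<in> S\<close> and the parameter \<open>e \<in> T\<close>.\<close>

primrec Ckp :: "nat \<Rightarrow> (real \<times> real) set \<Rightarrow> 'c::topological_space set \<Rightarrow>
    (real \<times> real \<Rightarrow> 'c \<Rightarrow> 'b::real_normed_vector) \<Rightarrow> bool" where
  "Ckp 0 S T f \<longleftrightarrow> continuous_on (S \<times> T) (\<lambda>x. f (fst x) (snd x))"
| "Ckp (Suc k) S T f \<longleftrightarrow> continuous_on (S \<times> T) (\<lambda>x. f (fst x) (snd x)) \<and>
     (\<exists>f1 f2. (\<forall>p\<in>S. \<forall>e\<in>T. ((\<lambda>p. f p e) has_derivative (\<lambda>h. fst h *\<^sub>R f1 p e + snd h *\<^sub>R f2 p e)) (at p within S)) \<and>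
              Ckp k S T f1 \<and> Ckp k S T f2)"

lemma Ckp_continuous: "Ckp k S T f \<Longrightarrow> continuous_on (S \<times> T) (\<lambda>x. f (fst x) (snd x))"
  by (cases k) auto

lemma Ckp_Suc_imp: "Ckp (Suc k) S T f \<Longrightarrow> Ckp k S T f"
proof (induction k arbitrary: f)
  case (Suc k)
  then show ?case
    unfolding Ckp.simps(2)[of "Suc k"] Ckp.simps(2)[of k] by blast
qed auto

lemma Ckp_SucI:
  assumes "continuous_on (S \<times> T) (\<lambda>x. f (fst x) (snd x))"
    "\<And>p e. p \<in> S \<Longrightarrow> e \<in> T \<Longrightarrow>
      ((\<lambda>p. f p e) has_derivative (\<lambda>h. fst h *\<^sub>R f1 p e + snd h *\<^sub>R f2 p e)) (at p within S)"
    "Ckp k S T f1" "Ckp k S T f2"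
  shows "Ckp (Suc k) S T f"
  unfolding Ckp.simps by (intro conjI exI[of _ f1] exI[of _ f2] ballI assms)

lemma Ckp_SucE:
  assumes "Ckp (Suc k) S T f"
  obtains f1 f2 where
    "\<And>p e. p \<in> S \<Longrightarrow> e \<in> T \<Longrightarrow>
      ((\<lambda>p. f p e) has_derivative (\<lambda>h. fst h *\<^sub>R f1 p e + snd h *\<^sub>R f2 p e)) (at p within S)"
    "Ckp k S T f1" "Ckp k S T f2"
  using assms by auto

lemma Ckp_cong:
  assumes "Ckp k S T f" "\<And>p e. p \<in> S \<Longrightarrow> e \<in> T \<Longrightarrow> g p e = f p e"
  shows "Ckp k S T g"
proof (cases k)
  case 0
  have "continuous_on (S \<times> T) (\<lambda>x. f (fst x) (snd x)) = continuous_on (S \<times> T) (\<lambda>x. g (fst x) (snd x))"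
    by (rule continuous_on_cong) (use assms(2) in auto)
  then show ?thesis using assms(1) 0 by simp
next
  case (Suc m)
  have "continuous_on (S \<times> T) (\<lambda>x. f (fst x) (snd x)) = continuous_on (S \<times> T) (\<lambda>x. g (fst x) (snd x))"
    by (rule continuous_on_cong) (use assms(2) in auto)
  then have cont: "continuous_on (S \<times> T) (\<lambda>x. g (fst x) (snd x))"
    using Ckp_continuous[OF assms(1)] by simp
  obtain f1 f2 where f: "\<And>p e. p \<in> S \<Longrightarrow> e \<in> T \<Longrightarrow>
      ((\<lambda>p. f p e) has_derivative (\<lambda>h. fst h *\<^sub>R f1 p e + snd h *\<^sub>R f2 p e)) (at p within S)"
    "Ckp m S T f1" "Ckp m S T f2"
    using Ckp_SucE[OF assms(1)[unfolded Suc]] by blast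
  show ?thesis
    unfolding Suc
  proof (rule Ckp_SucI[OF cont _ f(2,3)])
    fix p e assume pe: "p \<in> S" "e \<in> T"
    show "((\<lambda>p. g p e) has_derivative (\<lambda>h. fst h *\<^sub>R f1 p e + snd h *\<^sub>R f2 p e)) (at p within S)"
      by (rule has_derivative_transform[OF pe(1) _ f(1)[OF pe]]) (use assms(2) pe in auto)
  qed
qed

lemma Ckp_linear:
  assumes L: "bounded_linear L" and "Ckp k S T f"
  shows "Ckp k S T (\<lambda>p e. L (f p e))"
  using assms(2)
proof (induction k arbitrary: f)
  case 0
  then show ?case using bounded_linear.continuous_on[OF L] by simp
next
  case (Suc k)
  obtain f1 f2 where f: "\<And>p e. p \<in> S \<Longrightarrow> e \<in> T \<Longrightarrow>
      ((\<lambda>p. f p e) has_derivative (\<lambda>h. fst h *\<^sub>R f1 p e + snd h *\<^sub>R f2 p e)) (at p within S)"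
    "Ckp k S T f1" "Ckp k S T f2"
    using Ckp_SucE[OF Suc.prems] by blast
  interpret bounded_linear L by (rule L)
  show ?case
  proof (rule Ckp_SucI[OF _ _ Suc.IH[OF f(2)] Suc.IH[OF f(3)]])
    show "continuous_on (S \<times> T) (\<lambda>x. L (f (fst x) (snd x)))"
      by (rule continuous_on[OF Ckp_continuous[OF Suc.prems]])
    fix p e assume "p \<in> S" "e \<in> T"
    from has_derivative[OF f(1)[OF this]]
    show "((\<lambda>p. L (f p e)) has_derivative (\<lambda>h. fst h *\<^sub>R L (f1 p e) + snd h *\<^sub>R L (f2 p e))) (at p within S)"
      by (simp add: add scaleR)
  qed
qed

lemma Ckp_add:
  assumes "Ckp k S T f" "Ckp k S T g"
  shows "Ckp k S T (\<lambda>p e. f p e + g p e)"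
  using assms
proof (induction k arbitrary: f g)
  case 0
  then show ?case by (simp add: continuous_on_add)
next
  case (Suc k)
  obtain f1 f2 where f: "\<And>p e. p \<in> S \<Longrightarrow> e \<in> T \<Longrightarrow>
      ((\<lambda>p. f p e) has_derivative (\<lambda>h. fst h *\<^sub>R f1 p e + snd h *\<^sub>R f2 p e)) (at p within S)"
    "Ckp k S T f1" "Ckp k S T f2"
    using Ckp_SucE[OF Suc.prems(1)] by blast
  obtain g1 g2 where g: "\<And>p e. p \<in> S \<Longrightarrow> e \<in> T \<Longrightarrow>
      ((\<lambda>p. g p e) has_derivative (\<lambda>h. fst h *\<^sub>R g1 p e + snd h *\<^sub>R g2 p e)) (at p within S)"
    "Ckp k S T g1" "Ckp k S T g2"
    using Ckp_SucE[OF Suc.prems(2)] by blast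
  show ?case
  proof (rule Ckp_SucI[OF _ _ Suc.IH[OF f(2) g(2)] Suc.IH[OF f(3) g(3)]])
    show "continuous_on (S \<times> T) (\<lambda>x. f (fst x) (snd x) + g (fst x) (snd x))"
      by (intro continuous_on_add Ckp_continuous[OF Suc.prems(1)] Ckp_continuous[OF Suc.prems(2)])
    fix p e assume pe: "p \<in> S" "e \<in> T"
    have "(\<lambda>h. fst h *\<^sub>R f1 p e + snd h *\<^sub>R f2 p e + (fst h *\<^sub>R g1 p e + snd h *\<^sub>R g2 p e)) =
        (\<lambda>h. fst h *\<^sub>R (f1 p e + g1 p e) + snd h *\<^sub>R (f2 p e + g2 p e))"
      by (rule ext) (simp add: scaleR_add_right)
    then show "((\<lambda>p. f p e + g p e) has_derivative (\<lambda>h. fst h *\<^sub>R (f1 p e + g1 p e) + snd h *\<^sub>R (f2 p e + g2 p e))) (at p within S)"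
      using has_derivative_add[OF f(1)[OF pe] g(1)[OF pe]] by simp
  qed
qed

lemma Ckp_bilinear:
  assumes B: "bounded_bilinear bop" and "Ckp k S T f" "Ckp k S T g"
  shows "Ckp k S T (\<lambda>p e. bop (f p e) (g p e))"
  using assms(2,3)
proof (induction k arbitrary: f g)
  case 0
  then show ?case using bounded_bilinear.continuous_on[OF B] by simp
next
  case (Suc k)
  obtain f1 f2 where f: "\<And>p e. p \<in> S \<Longrightarrow> e \<in> T \<Longrightarrow>
      ((\<lambda>p. f p e) has_derivative (\<lambda>h. fst h *\<^sub>R f1 p e + snd h *\<^sub>R f2 p e)) (at p within S)"
    "Ckp k S T f1" "Ckp k S T f2"
    using Ckp_SucE[OF Suc.prems(1)] by blast
  obtain g1 g2 where g: "\<And>p e. p \<in> S \<Longrightarrow> e \<in> T \<Longrightarrow>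
      ((\<lambda>p. g p e) has_derivative (\<lambda>h. fst h *\<^sub>R g1 p e + snd h *\<^sub>R g2 p e)) (at p within S)"
    "Ckp k S T g1" "Ckp k S T g2"
    using Ckp_SucE[OF Suc.prems(2)] by blast
  interpret bounded_bilinear bop by (rule B)
  note IH = Suc.IH[OF Ckp_Suc_imp[OF Suc.prems(1)]] Suc.IH[OF _ Ckp_Suc_imp[OF Suc.prems(2)]]
  show ?case
  proof (rule Ckp_SucI[OF _ _ Ckp_add[OF IH(1)[OF g(2)] IH(2)[OF f(2)]] Ckp_add[OF IH(1)[OF g(3)] IH(2)[OF f(3)]]])
    show "continuous_on (S \<times> T) (\<lambda>x. bop (f (fst x) (snd x)) (g (fst x) (snd x)))"
      by (intro continuous_on Ckp_continuous[OF Suc.prems(1)] Ckp_continuous[OF Suc.prems(2)])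
    fix p e assume pe: "p \<in> S" "e \<in> T"
    have "(\<lambda>h. bop (f p e) (fst h *\<^sub>R g1 p e + snd h *\<^sub>R g2 p e) + bop (fst h *\<^sub>R f1 p e + snd h *\<^sub>R f2 p e) (g p e)) =
        (\<lambda>h. fst h *\<^sub>R (bop (f p e) (g1 p e) + bop (f1 p e) (g p e)) + snd h *\<^sub>R (bop (f p e) (g2 p e) + bop (f2 p e) (g p e)))"
      by (rule ext) (simp add: add_left add_right scaleR_left scaleR_right scaleR_add_right)
    then show "((\<lambda>p. bop (f p e) (g p e)) has_derivative
        (\<lambda>h. fst h *\<^sub>R (bop (f p e) (g1 p e) + bop (f1 p e) (g p e)) + snd h *\<^sub>R (bop (f p e) (g2 p e) + bop (f2 p e) (g p e))))
        (at p within S)"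
      using FDERIV[OF f(1)[OF pe] g(1)[OF pe]] by simp
  qed
qed

lemmas Ckp_compose = Ckp_bilinear[OF bounded_bilinear_blinfun_compose]
lemmas Ckp_scaleC = Ckp_bilinear[OF bounded_bilinear_scaleC]
lemmas Ckp_scaleR = Ckp_bilinear[OF bounded_bilinear_scaleR]
lemmas Ckp_minus = Ckp_linear[OF bounded_linear_minus[OF bounded_linear_ident]]

lemma Ckp_diff: "Ckp k S T f \<Longrightarrow> Ckp k S T g \<Longrightarrow> Ckp k S T (\<lambda>p e. f p e - g p e)"
  using Ckp_add[OF _ Ckp_minus, of k S T f g] by simp

lemma Ckp_param:
  fixes c :: "'c::topological_space \<Rightarrow> 'b::real_normed_vector"
  assumes "continuous_on T c"
  shows "Ckp k S T (\<lambda>p e. c e)"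
  using assms
proof (induction k arbitrary: c)
  case 0
  then show ?case
    by (auto intro!: continuous_on_compose2[OF 0] continuous_intros)
next
  case (Suc k)
  have "continuous_on T (\<lambda>_. 0 :: 'b)" by (rule continuous_on_const)
  then have z: "Ckp k S T (\<lambda>p e. 0 :: 'b)" by (rule Suc.IH)
  show ?case
    by (rule Ckp_SucI[OF _ _ z z])
      (auto intro!: continuous_on_compose2[OF Suc.prems] continuous_intros derivative_eq_intros)
qed

lemma Ckp_subset: "Ckp k S T f \<Longrightarrow> S' \<subseteq> S \<Longrightarrow> T' \<subseteq> T \<Longrightarrow> Ckp k S' T' f"
proof (induction k arbitrary: f)
  case 0
  then show ?case by (auto elim: continuous_on_subset)
next
  case (Suc k)
  obtain f1 f2 where f: "\<And>p e. p \<in> S \<Longrightarrow> e \<in> T \<Longrightarrow>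
      ((\<lambda>p. f p e) has_derivative (\<lambda>h. fst h *\<^sub>R f1 p e + snd h *\<^sub>R f2 p e)) (at p within S)"
    "Ckp k S T f1" "Ckp k S T f2"
    using Ckp_SucE[OF Suc.prems(1)] by blast
  show ?case
  proof (rule Ckp_SucI[OF _ _ Suc.IH[OF f(2) Suc.prems(2,3)] Suc.IH[OF f(3) Suc.prems(2,3)]])
    show "continuous_on (S' \<times> T') (\<lambda>x. f (fst x) (snd x))"
      using Ckp_continuous[OF Suc.prems(1)] Suc.prems(2,3) by (auto elim: continuous_on_subset)
    fix p e assume pe: "p \<in> S'" "e \<in> T'"
    then show "((\<lambda>p. f p e) has_derivative (\<lambda>h. fst h *\<^sub>R f1 p e + snd h *\<^sub>R f2 p e)) (at p within S')"
      using f(1)[of p e] Suc.prems(2,3) by (auto intro: has_derivative_subset)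
  qed
qed

text \<open>The derivative of the inverse is built from the inverse and the derivative of
  \<open>f\<close>, so the regularity of the inverse rises by one order at each step of the
  induction.\<close>

lemma Ckp_op_inverse:
  fixes f :: "real \<times> real \<Rightarrow> 'c::topological_space \<Rightarrow> 'a::banach \<Rightarrow>\<^sub>L 'a"
  assumes "Ckp k S T f" and inv: "\<And>p e. p \<in> S \<Longrightarrow> e \<in> T \<Longrightarrow> op_invertible (f p e)"
  shows "Ckp k S T (\<lambda>p e. op_inverse (f p e))"
  using assms(1)
proof (induction k)
  case 0
  then show ?case
    using inv by (auto intro!: continuous_on_op_inverse)
next
  case (Suc k)
  obtain f1 f2 where f: "\<And>p e. p \<in> S \<Longrightarrow> e \<in> T \<Longrightarrow>
      ((\<lambda>p. f p e) has_derivative (\<lambda>h. fst h *\<^sub>R f1 p e + snd h *\<^sub>R f2 p e)) (at p within S)"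
    "Ckp k S T f1" "Ckp k S T f2"
    using Ckp_SucE[OF Suc.prems(1)] by blast
  note J = Suc.IH[OF Ckp_Suc_imp[OF Suc.prems]]
  show ?case
  proof (rule Ckp_SucI[OF _ _ Ckp_minus[OF Ckp_compose[OF Ckp_compose[OF J f(2)] J]]
        Ckp_minus[OF Ckp_compose[OF Ckp_compose[OF J f(3)] J]]])
    show "continuous_on (S \<times> T) (\<lambda>x. op_inverse (f (fst x) (snd x)))"
      using Ckp_continuous[OF Suc.prems] inv by (auto intro!: continuous_on_op_inverse)
    fix p e assume pe: "p \<in> S" "e \<in> T"
    let ?J = "op_inverse (f p e)"
    have "(\<lambda>h. - (?J o\<^sub>L (fst h *\<^sub>R f1 p e + snd h *\<^sub>R f2 p e) o\<^sub>L ?J)) =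
        (\<lambda>h. fst h *\<^sub>R - (?J o\<^sub>L f1 p e o\<^sub>L ?J) + snd h *\<^sub>R - (?J o\<^sub>L f2 p e o\<^sub>L ?J))"
      by (rule ext) (simp add: blinfun_compose_linear)
    then show "((\<lambda>p. op_inverse (f p e)) has_derivative
        (\<lambda>h. fst h *\<^sub>R - (?J o\<^sub>L f1 p e o\<^sub>L ?J) + snd h *\<^sub>R - (?J o\<^sub>L f2 p e o\<^sub>L ?J))) (at p within S)"
      using has_derivative_op_inverse[OF f(1)[OF pe] pe(1) inv[OF _ pe(2)]] by simp
  qed
qed

text \<open>Packs two partial derivatives into the bounded linear map that the Leibniz rule expects.
  It depends linearly on the pair, so it commutes with integration.\<close>

definition pair_blinfun :: "'b::real_normed_vector \<times> 'b \<Rightarrow> ((real \<times> real) \<Rightarrow>\<^sub>L 'b)" where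
  "pair_blinfun v = Blinfun (\<lambda>h. fst h *\<^sub>R fst v + snd h *\<^sub>R snd v)"

lemma pair_blinfun_apply: "blinfun_apply (pair_blinfun v) = (\<lambda>h. fst h *\<^sub>R fst v + snd h *\<^sub>R snd v)"
  unfolding pair_blinfun_def
  by (intro bounded_linear_Blinfun_apply bounded_linear_add
      bounded_linear_compose[OF bounded_linear_scaleR_left] bounded_linear_fst bounded_linear_snd)

lemma bounded_linear_pair_blinfun: "bounded_linear (pair_blinfun :: 'b::real_normed_vector \<times> 'b \<Rightarrow> _)"
proof (rule bounded_linear_intro[where K = 2])
  show "pair_blinfun (x + y) = pair_blinfun x + pair_blinfun y" "pair_blinfun (r *\<^sub>R x) = r *\<^sub>R pair_blinfun x"
    for x y :: "'b \<times> 'b" and r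
    by (intro blinfun_eqI; simp add: pair_blinfun_apply blinfun.bilinear_simps scaleR_add_right mult.commute)+
  show "norm (pair_blinfun x) \<le> norm x * 2" for x :: "'b \<times> 'b"
  proof (rule norm_blinfun_bound)
    fix h :: "real \<times> real"
    have "norm (fst h *\<^sub>R fst x + snd h *\<^sub>R snd x) \<le> norm (fst h) * norm (fst x) + norm (snd h) * norm (snd x)"
      by (metis norm_scaleR norm_triangle_ineq real_norm_def)
    also have "\<dots> \<le> norm h * norm x + norm h * norm x"
      using norm_fst_le[of "fst h" "snd h"] norm_snd_le[of "snd h" "fst h"]
        norm_fst_le[of "fst x" "snd x"] norm_snd_le[of "snd x" "fst x"]
      by (intro add_mono mult_mono) auto
    finally show "norm (pair_blinfun x h) \<le> norm x * 2 * norm h"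
      by (simp add: pair_blinfun_apply mult_ac)
  qed simp
qed

text \<open>The integration variable is counted among the parameters of \<open>f\<close>, so the
  derivatives are jointly continuous in it and may be taken under the integral. The Leibniz rule
  used here works on convex sets.\<close>

lemma Ckp_integral:
  fixes f :: "real \<times> real \<Rightarrow> real \<times> 'c::topological_space \<Rightarrow> 'b::banach"
  assumes "Ckp k S ({0..1} \<times> T) f" and S: "convex S"
  shows "Ckp k S T (\<lambda>p e. integral {0..1} (\<lambda>x. f p (x, e)))"
proof -
  have cont: "continuous_on (S \<times> T) (\<lambda>x. integral {0..1} (\<lambda>u. f (fst x) (u, snd x)))"
    if f: "continuous_on (S \<times> ({0..1} \<times> T)) (\<lambda>x. f (fst x) (snd x))"
    for f :: "real \<times> real \<Rightarrow> real \<times> 'c \<Rightarrow> 'b"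
  proof -
    have "continuous_on ((S \<times> T) \<times> cbox 0 1) (\<lambda>(y, u). f (fst y) (u, snd y))"
      unfolding case_prod_unfold
      by (rule continuous_on_compose2[OF f, where f = "\<lambda>x. (fst (fst x), (snd x, snd (fst x)))", simplified])
        (auto intro!: continuous_intros)
    from integral_continuous_on_param[OF this] show ?thesis by simp
  qed
  show ?thesis
    using assms(1)
proof (induction k arbitrary: f)
  case 0
  then show ?case using cont by simp
next
  case (Suc k)
  obtain f1 f2 where f: "\<And>p e. p \<in> S \<Longrightarrow> e \<in> {0..1} \<times> T \<Longrightarrow>
      ((\<lambda>p. f p e) has_derivative (\<lambda>h. fst h *\<^sub>R f1 p e + snd h *\<^sub>R f2 p e)) (at p within S)"
    "Ckp k S ({0..1} \<times> T) f1" "Ckp k S ({0..1} \<times> T) f2"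
    using Ckp_SucE[OF Suc.prems(1)] by blast
  have sec: "continuous_on (S \<times> cbox 0 1) (\<lambda>(p, u). g p (u, e))"
    if g: "continuous_on (S \<times> ({0..1} \<times> T)) (\<lambda>x. g (fst x) (snd x))" and e: "e \<in> T"
    for g :: "real \<times> real \<Rightarrow> real \<times> 'c \<Rightarrow> 'b" and e
    unfolding case_prod_unfold
    by (rule continuous_on_compose2[OF g, where f = "\<lambda>x. (fst x, (snd x, e))", simplified])
      (auto intro!: continuous_intros simp: e)
  have sec1: "(\<lambda>u. g p (u, e)) integrable_on {0..1}"
    if g: "continuous_on (S \<times> ({0..1} \<times> T)) (\<lambda>x. g (fst x) (snd x))" and e: "e \<in> T" "p \<in> S"
    for g :: "real \<times> real \<Rightarrow> real \<times> 'c \<Rightarrow> 'b" and e p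
  proof (rule integrable_continuous_interval)
    show "continuous_on {0..1} (\<lambda>u. g p (u, e))"
      by (rule continuous_on_compose2[OF g, where f = "\<lambda>x. (p, (x, e))", simplified])
        (simp_all add: image_subset_iff e continuous_intros)
  qed
  note c = Ckp_continuous[OF Suc.prems] Ckp_continuous[OF f(2)] Ckp_continuous[OF f(3)]
  show ?case
  proof (rule Ckp_SucI[OF cont[OF c(1)] _ Suc.IH[OF f(2)] Suc.IH[OF f(3)]])
    fix p e assume pe: "p \<in> S" "e \<in> T"
    let ?D = "\<lambda>p u. pair_blinfun (f1 p (u, e), f2 p (u, e))"
    have "((\<lambda>p. integral (cbox 0 1) (\<lambda>u. f p (u, e))) has_derivative
        blinfun_apply (integral (cbox 0 1) (?D p))) (at p within S)"
    proof (rule leibniz_rule)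
      show "((\<lambda>p. f p (u, e)) has_derivative blinfun_apply (?D q u)) (at q within S)"
        if "q \<in> S" "u \<in> cbox 0 1" for q u
        using f(1)[of q "(u, e)"] that pe by (simp add: pair_blinfun_apply)
      show "(\<lambda>u. f q (u, e)) integrable_on cbox 0 1" if "q \<in> S" for q
        using sec1[OF c(1) pe(2) that] by simp
      have "continuous_on (S \<times> cbox 0 1) (\<lambda>x. (f1 (fst x) (snd x, e), f2 (fst x) (snd x, e)))"
        using sec[OF c(2) pe(2)] sec[OF c(3) pe(2)] by (intro continuous_on_Pair) (simp_all add: case_prod_unfold)
      then show "continuous_on (S \<times> cbox 0 1) (\<lambda>(p, u). ?D p u)"
        unfolding case_prod_unfold by (rule bounded_linear.continuous_on[OF bounded_linear_pair_blinfun])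
    qed (use S pe in auto)
    moreover have "blinfun_apply (integral (cbox 0 1) (?D p)) =
        (\<lambda>h. fst h *\<^sub>R integral {0..1} (\<lambda>u. f1 p (u, e)) + snd h *\<^sub>R integral {0..1} (\<lambda>u. f2 p (u, e)))"
    proof -
      note i = sec1[OF c(2) pe(2,1)] sec1[OF c(3) pe(2,1)]
      let ?L1 = "\<lambda>v :: 'b. pair_blinfun (v, 0 :: 'b)" and ?L2 = "\<lambda>v :: 'b. pair_blinfun (0 :: 'b, v)"
      have L: "bounded_linear ?L1" "bounded_linear ?L2"
        by (intro bounded_linear_compose[OF bounded_linear_pair_blinfun] bounded_linear_Pair
            bounded_linear_ident bounded_linear_zero)+
      have split: "pair_blinfun (v, w) = ?L1 v + ?L2 w" for v w
        by (rule blinfun_eqI) (simp add: pair_blinfun_apply blinfun.add_left)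
      have "(?D p has_integral (?L1 (integral {0..1} (\<lambda>u. f1 p (u, e))) + ?L2 (integral {0..1} (\<lambda>u. f2 p (u, e))))) {0..1}"
        using has_integral_add[OF has_integral_linear[OF integrable_integral[OF i(1)] L(1)]
            has_integral_linear[OF integrable_integral[OF i(2)] L(2)]] by (simp add: o_def split[symmetric])
      then show ?thesis
        by (simp add: integral_unique split[symmetric] pair_blinfun_apply)
    qed
    ultimately show "((\<lambda>p. integral {0..1} (\<lambda>u. f p (u, e))) has_derivative
        (\<lambda>h. fst h *\<^sub>R integral {0..1} (\<lambda>u. f1 p (u, e)) + snd h *\<^sub>R integral {0..1} (\<lambda>u. f2 p (u, e)))) (at p within S)"
      by simp
  qed
qed
qed

section \<open>Functions of class C^k on the unit square and their partial derivatives\<close>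

lemma Ck_on_continuous: "Ck_on k S f \<Longrightarrow> continuous_on S f"
  by (cases k) (auto simp: continuous_on_eq_continuous_within intro: has_derivative_continuous)

lemma Ck_on_imp_Ckp: "Ck_on k S f \<Longrightarrow> Ckp k S T (\<lambda>p e. f p)"
proof (induction k arbitrary: f)
  case 0
  then show ?case
    by (auto intro!: continuous_on_compose2[of S f] continuous_intros)
next
  case (Suc k)
  obtain f1 f2 where f: "\<And>p. p \<in> S \<Longrightarrow> (f has_derivative (\<lambda>h. fst h *\<^sub>R f1 p + snd h *\<^sub>R f2 p)) (at p within S)"
    "Ck_on k S f1" "Ck_on k S f2"
    using Suc.prems by auto
  show ?case
    by (rule Ckp_SucI[OF _ _ Suc.IH[OF f(2)] Suc.IH[OF f(3)]])
      (use f(1) Ck_on_continuous[OF Suc.prems] in \<open>auto intro!: continuous_on_compose2[of S f] continuous_intros\<close>)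
qed

lemma Ckp_imp_Ck_on: "Ckp k S T f \<Longrightarrow> e \<in> T \<Longrightarrow> Ck_on k S (\<lambda>p. f p e)"
proof (induction k arbitrary: f)
  case 0
  then have c: "continuous_on (S \<times> T) (\<lambda>x. f (fst x) (snd x))" by simp
  have "continuous_on S (\<lambda>p. (p, e))" "(\<lambda>p. (p, e)) ` S \<subseteq> S \<times> T"
    using 0 by (auto intro!: continuous_intros)
  from continuous_on_compose2[OF c this] show ?case
    by simp
next
  case (Suc k)
  obtain f1 f2 where f: "\<And>p e. p \<in> S \<Longrightarrow> e \<in> T \<Longrightarrow>
      ((\<lambda>p. f p e) has_derivative (\<lambda>h. fst h *\<^sub>R f1 p e + snd h *\<^sub>R f2 p e)) (at p within S)"
    "Ckp k S T f1" "Ckp k S T f2"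
    using Ckp_SucE[OF Suc.prems(1)] by blast
  show ?case
    unfolding Ck_on.simps
    by (intro exI[of _ "\<lambda>p. f1 p e"] exI[of _ "\<lambda>p. f2 p e"] conjI ballI f(1) Suc.IH f(2,3) Suc.prems(2))
qed

text \<open>The calculus is developed with a parameter; statements without one are recovered from a
  one-point parameter set.\<close>

lemma Ck_on_cong:
  assumes "Ck_on k S f" "\<And>p. p \<in> S \<Longrightarrow> g p = f p"
  shows "Ck_on k S g"
  using Ckp_imp_Ck_on[of k S "{0 :: real}" "\<lambda>p _. g p" "0"] Ckp_cong[OF Ck_on_imp_Ckp[OF assms(1), of "{0 :: real}"], of "\<lambda>p _. g p"] assms(2)
  by simp

lemma Ck_on_Suc_imp: "Ck_on (Suc k) S f \<Longrightarrow> Ck_on k S f"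
  using Ckp_imp_Ck_on[OF Ckp_Suc_imp[OF Ck_on_imp_Ckp[of "Suc k" S f "{0 :: real}"]], of "0"] by simp

abbreviation unit_square :: "(real \<times> real) set" where "unit_square \<equiv> {0..1} \<times> {0..1}"

text \<open>Canonical partial derivatives, one-sided at the boundary. Two neighbourhoods may supply
  different witnesses for \<open>Ck_on\<close>; these expressions are the common value that allows
  patching.\<close>

definition pd1 :: "(real \<times> real \<Rightarrow> 'b::real_normed_vector) \<Rightarrow> real \<times> real \<Rightarrow> 'b" where
  "pd1 f p = deriv01 (\<lambda>t. f (t, snd p)) (fst p)"

definition pd2 :: "(real \<times> real \<Rightarrow> 'b::real_normed_vector) \<Rightarrow> real \<times> real \<Rightarrow> 'b" where
  "pd2 f p = deriv01 (\<lambda>a. f (fst p, a)) (snd p)"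

lemma deriv01_eqI: "(f has_vector_derivative D) (at t within {0..1}) \<Longrightarrow> t \<in> {0..1} \<Longrightarrow> deriv01 f t = D"
  using vector_derivative_within_cbox[of 0 1 t f D] by simp

lemma at_within_Int_open: "open N \<Longrightarrow> x \<in> N \<Longrightarrow> at x within N \<inter> S = at x within S"
  by (rule at_within_nhd[of x N]) auto

text \<open>The chain rule is applied along the coordinate lines through \<open>p\<close>. As
  \<open>N\<close> is open, cutting a line down to its part in \<open>N\<close> does not change the
  derivative at the point, and uniqueness on the unit interval identifies \<open>a\<close> and
  \<open>b\<close>.\<close>

lemma partial_derivatives:
  assumes d: "(f has_derivative (\<lambda>h. fst h *\<^sub>R a + snd h *\<^sub>R b)) (at p within unit_square \<inter> N)"
    and N: "open N" "p \<in> unit_square \<inter> N"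
  shows "((\<lambda>t. f (t, snd p)) has_vector_derivative a) (at (fst p) within {0..1})"
    and "((\<lambda>t. f (fst p, t)) has_vector_derivative b) (at (snd p) within {0..1})"
    and "pd1 f p = a" "pd2 f p = b"
proof -
  have *: "((\<lambda>t. f (j t)) has_vector_derivative (fst v *\<^sub>R a + snd v *\<^sub>R b)) (at x within {0..1})"
    if j: "\<And>t. (j has_derivative (\<lambda>h. h *\<^sub>R v)) (at t)" "j x = p" "\<And>t. t \<in> {0..1} \<Longrightarrow> j t \<in> unit_square" "x \<in> {0..1}"
    for j :: "real \<Rightarrow> real \<times> real" and v x
  proof -
    have cont: "continuous_on UNIV j"
      using j(1) by (meson continuous_at_imp_continuous_on has_derivative_continuous)
    let ?X = "{0..1} \<inter> j -` N"
    have "(f has_derivative (\<lambda>h. fst h *\<^sub>R a + snd h *\<^sub>R b)) (at (j x) within j ` ?X)"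
      using j by (intro has_derivative_subset[OF d[folded j(2)]] subsetI) blast
    from diff_chain_within[OF has_derivative_at_withinI[OF j(1)] this]
    have "((\<lambda>t. f (j t)) has_vector_derivative (fst v *\<^sub>R a + snd v *\<^sub>R b)) (at x within ?X)"
      by (simp add: has_vector_derivative_def o_def scaleR_add_right)
    moreover have "at x within ?X = at x within {0..1}"
      using N cont j(2) by (subst Int_commute, intro at_within_Int_open continuous_open_vimage)
        (auto simp: continuous_on_eq_continuous_at open_vimage)
    ultimately show ?thesis by simp
  qed
  show 1: "((\<lambda>t. f (t, snd p)) has_vector_derivative a) (at (fst p) within {0..1})"
    using *[of "\<lambda>t. (t, snd p)" "(1, 0)" "fst p"] N
      has_derivative_Pair[OF has_derivative_ident has_derivative_const[of "snd p"]] by force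
  show 2: "((\<lambda>t. f (fst p, t)) has_vector_derivative b) (at (snd p) within {0..1})"
    using *[of "\<lambda>t. (fst p, t)" "(0, 1)" "snd p"] N
      has_derivative_Pair[OF has_derivative_const[of "fst p"] has_derivative_ident] by force
  show "pd1 f p = a" "pd2 f p = b"
    unfolding pd1_def pd2_def using N by (auto intro!: deriv01_eqI[OF 1] deriv01_eqI[OF 2])
qed

lemma Ck_on_partials:
  assumes "Ck_on (Suc k) (unit_square \<inter> N) f" "open N"
  shows "Ck_on k (unit_square \<inter> N) (pd1 f)" "Ck_on k (unit_square \<inter> N) (pd2 f)"
    and "\<And>p. p \<in> unit_square \<inter> N \<Longrightarrow>
      (f has_derivative (\<lambda>h. fst h *\<^sub>R pd1 f p + snd h *\<^sub>R pd2 f p)) (at p within unit_square \<inter> N)"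
proof -
  obtain f1 f2 where f: "\<And>p. p \<in> unit_square \<inter> N \<Longrightarrow>
      (f has_derivative (\<lambda>h. fst h *\<^sub>R f1 p + snd h *\<^sub>R f2 p)) (at p within unit_square \<inter> N)"
    "Ck_on k (unit_square \<inter> N) f1" "Ck_on k (unit_square \<inter> N) f2"
    using assms(1) by auto
  note pd = partial_derivatives(3,4)[OF f(1) assms(2)]
  show "Ck_on k (unit_square \<inter> N) (pd1 f)" "Ck_on k (unit_square \<inter> N) (pd2 f)"
    using pd by (auto intro: Ck_on_cong[OF f(2)] Ck_on_cong[OF f(3)])
  show "(f has_derivative (\<lambda>h. fst h *\<^sub>R pd1 f p + snd h *\<^sub>R pd2 f p)) (at p within unit_square \<inter> N)"
    if "p \<in> unit_square \<inter> N" for p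
    using f(1)[OF that] pd[OF that that] by simp
qed

lemmas Ck_on_square_partials = Ck_on_partials[where N = UNIV, unfolded Int_UNIV_right, OF _ open_UNIV]

text \<open>Differentiability is local, and all the local derivatives coincide with
  \<open>pd1 f\<close> and \<open>pd2 f\<close>, to which the induction hypothesis applies in
  turn.\<close>

lemma Ck_on_local:
  assumes "\<And>p. p \<in> unit_square \<Longrightarrow> \<exists>N. open N \<and> p \<in> N \<and> Ck_on k (unit_square \<inter> N) f"
  shows "Ck_on k unit_square f"
  using assms
proof (induction k arbitrary: f)
  case 0
  have "continuous (at p within unit_square) f" if p: "p \<in> unit_square" for p
  proof -
    obtain N where N: "open N" "p \<in> N" "Ck_on 0 (unit_square \<inter> N) f"
      using 0 p by blast
    then have "continuous (at p within unit_square \<inter> N) f"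
      using p by (simp add: continuous_on_eq_continuous_within)
    then show ?thesis
      using at_within_Int_open[of N p unit_square] N by (simp add: Int_commute continuous_within)
  qed
  then show ?case
    by (simp add: continuous_on_eq_continuous_within)
next
  case (Suc k)
  have "(f has_derivative (\<lambda>h. fst h *\<^sub>R pd1 f p + snd h *\<^sub>R pd2 f p)) (at p within unit_square)"
    if p: "p \<in> unit_square" for p
  proof -
    obtain N where N: "open N" "p \<in> N" "Ck_on (Suc k) (unit_square \<inter> N) f"
      using Suc.prems p by blast
    have "(f has_derivative (\<lambda>h. fst h *\<^sub>R pd1 f p + snd h *\<^sub>R pd2 f p)) (at p within unit_square \<inter> N)"
      using Ck_on_partials(3)[OF N(3,1)] p N(2) by blast
    then show ?thesis
      using at_within_Int_open[of N p unit_square] N(1,2) by (simp add: Int_commute)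
  qed
  moreover have "Ck_on k unit_square (pd1 f)"
    using Suc.prems Ck_on_partials(1) by (intro Suc.IH) blast
  moreover have "Ck_on k unit_square (pd2 f)"
    using Suc.prems Ck_on_partials(2) by (intro Suc.IH) blast
  ultimately show ?case
    by auto
qed

section \<open>Linear evolution equations\<close>

lemma norm_increment_le:
  fixes f :: "real \<Rightarrow> 'b::real_normed_vector"
  assumes "a \<le> b" "\<And>x. x \<in> {a..b} \<Longrightarrow> (f has_vector_derivative f' x) (at x within {a..b})"
    and "\<And>x. x \<in> {a..b} \<Longrightarrow> (\<phi> has_vector_derivative \<phi>' x) (at x within {a..b})"
    and "\<And>x. x \<in> {a..b} \<Longrightarrow> norm (f' x) \<le> \<phi>' x"
  shows "norm (f b - f a) \<le> \<phi> b - \<phi> a"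
proof (cases "a = b")
  case False
  show ?thesis
  proof (rule differentiable_bound_general)
    show "a < b" using False assms(1) by simp
    show "continuous_on {a..b} f" "continuous_on {a..b} \<phi>"
      using continuous_on_vector_derivative[of "{a..b}" f f'] continuous_on_vector_derivative[of "{a..b}" \<phi> \<phi>']
        assms(2,3) by blast+
    fix x assume x: "a < x" "x < b"
    then have "at x within {a..b} = at x"
      by (intro at_within_interior) simp
    then show "(f has_vector_derivative f' x) (at x)" "(\<phi> has_vector_derivative \<phi>' x) (at x)" "norm (f' x) \<le> \<phi>' x"
      using assms(2-4)[of x] x by auto
  qed
qed simp

lemma norm_increment_le_const:
  fixes f :: "real \<Rightarrow> 'b::real_normed_vector"
  assumes "a \<le> b" "\<And>x. x \<in> {a..b} \<Longrightarrow> (f has_vector_derivative f' x) (at x within {a..b})"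
    and "\<And>x. x \<in> {a..b} \<Longrightarrow> norm (f' x) \<le> C"
  shows "norm (f b - f a) \<le> C * (b - a)"
  using norm_increment_le[OF assms(1,2), where \<phi> = "\<lambda>x. C * x" and \<phi>' = "\<lambda>_. C"] assms(3)
  by (simp add: right_diff_distrib has_real_derivative_iff_has_vector_derivative[symmetric] DERIV_cmult_Id)

text \<open>A crude form of Gronwall's inequality: compare with the maximum of
  \<open>norm (X t) * exp (- L * t)\<close> for \<open>L = 2 C + 1\<close>.\<close>

lemma gronwall:
  fixes X :: "real \<Rightarrow> 'b::real_normed_vector"
  assumes ab: "a \<le> b" and X: "\<And>s. s \<in> {a..b} \<Longrightarrow> (X has_vector_derivative X' s) (at s within {a..b})"
    and C: "\<And>s. s \<in> {a..b} \<Longrightarrow> norm (X' s) \<le> C * norm (X s)" "C \<ge> 0" and t: "t \<in> {a..b}"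
  shows "norm (X t) \<le> 2 * exp ((2 * C + 1) * (t - a)) * norm (X a)"
proof -
  \<comment> \<open>This choice makes \<open>C / L\<close> at most one half, and keeps
    \<open>L\<close> positive when \<open>C\<close> is 0.\<close>
  define L where "L = 2 * C + 1"
  have L: "L > 0" "C / L \<le> 1 / 2"
    using C(2) by (auto simp: L_def field_simps)
  define m where "m s = norm (X s) * exp (- (L * (s - a)))" for s
  have contX: "continuous_on {a..b} X"
    using continuous_on_vector_derivative[of "{a..b}" X X'] X by blast
  have "continuous_on {a..b} m"
    unfolding m_def by (intro continuous_intros contX)
  then obtain r where r: "r \<in> {a..b}" "\<And>s. s \<in> {a..b} \<Longrightarrow> m s \<le> m r"
    using continuous_attains_sup[of "{a..b}" m] ab by auto
  have Xm: "norm (X s) = m s * exp (L * (s - a))" for s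
    by (simp add: m_def mult.assoc exp_add[symmetric])
  have mr: "m r \<ge> 0"
    by (simp add: m_def)
  \<comment> \<open>Up to the maximum point \<open>r\<close> of the weighted norm, \<open>X\<close>
    is dominated by \<open>m r\<close> times the exponential. Integrating the bound on the
    derivative gives at most \<open>C / L\<close> times \<open>norm (X r)\<close>, which is absorbed
    on the left.\<close>
  have "norm (X r - X a) \<le> C * m r / L * exp (L * (r - a)) - C * m r / L * exp (L * (a - a))"
  proof (rule norm_increment_le)
    show "a \<le> r" using r by simp
    show "(X has_vector_derivative X' x) (at x within {a..r})" if "x \<in> {a..r}" for x
      using X[of x] that r by (auto intro: has_vector_derivative_within_subset)
    show "((\<lambda>s. C * m r / L * exp (L * (s - a))) has_vector_derivative C * (m r * exp (L * (x - a)))) (at x within {a..r})"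
      if "x \<in> {a..r}" for x
      unfolding has_real_derivative_iff_has_vector_derivative[symmetric]
      using L by (auto intro!: derivative_eq_intros)
    show "norm (X' x) \<le> C * (m r * exp (L * (x - a)))" if "x \<in> {a..r}" for x
    proof -
      have x: "x \<in> {a..b}" using that r by auto
      have "norm (X x) \<le> m r * exp (L * (x - a))"
        unfolding Xm using r(2)[OF x] by simp
      then show ?thesis
        using C(1)[OF x] C(2) by (meson mult_left_mono order_trans)
    qed
  qed
  also have "\<dots> \<le> C * m r / L * exp (L * (r - a))"
    using mr L C(2) by simp
  also have "\<dots> = (C / L) * (m r * exp (L * (r - a)))"
    by simp
  also have "\<dots> \<le> (1 / 2) * norm (X r)"
    unfolding Xm[of r] using L mr by (intro mult_right_mono) auto
  finally have "norm (X r) \<le> 2 * norm (X a)"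
    using norm_triangle_sub[of "X r" "X a"] by linarith
  moreover have "m r \<le> norm (X r)"
    using r L by (simp add: m_def mult_left_le)
  ultimately have "m t \<le> 2 * norm (X a)"
    using r(2)[OF t] by linarith
  then show ?thesis
    unfolding Xm[of t] L_def[symmetric] using mult_right_mono[of "m t" "2 * norm (X a)" "exp (L * (t - a))"]
    by (simp add: mult_ac)
qed

section \<open>Evolutions: invertibility, complex linearity, unitarity and products\<close>

lemma is_evolutionD:
  assumes "is_evolution \<epsilon> G V" "\<epsilon> \<noteq> 0"
  shows "V 0 = id_blinfun"
    and "t \<in> {0..1} \<Longrightarrow> (V has_vector_derivative (- (\<i> / of_real \<epsilon>)) *\<^sub>C (G t o\<^sub>L V t)) (at t within {0..1})"
proof -
  show "V 0 = id_blinfun"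
    using assms(1) by (simp add: is_evolution_def)
  assume "t \<in> {0..1}"
  then obtain D where D: "(V has_vector_derivative D) (at t within {0..1})" "(\<i> * of_real \<epsilon>) *\<^sub>C D = G t o\<^sub>L V t"
    using assms(1) unfolding is_evolution_def by blast
  have "(- (\<i> / of_real \<epsilon>)) *\<^sub>C (G t o\<^sub>L V t) = (- (\<i> / of_real \<epsilon>) * (\<i> * of_real \<epsilon>)) *\<^sub>C D"
    unfolding D(2)[symmetric] by (simp add: scaleC_scaleC)
  also have "- (\<i> / of_real \<epsilon>) * (\<i> * of_real \<epsilon>) = 1"
    using assms(2) by (simp add: field_simps)
  finally show "(V has_vector_derivative (- (\<i> / of_real \<epsilon>)) *\<^sub>C (G t o\<^sub>L V t)) (at t within {0..1})"
    using D(1) by simp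
qed

lemma is_evolutionI:
  assumes "V 0 = id_blinfun" "\<epsilon> \<noteq> 0"
    "\<And>t. t \<in> {0..1} \<Longrightarrow> (V has_vector_derivative (- (\<i> / of_real \<epsilon>)) *\<^sub>C (G t o\<^sub>L V t)) (at t within {0..1})"
  shows "is_evolution \<epsilon> G V"
  unfolding is_evolution_def
proof (intro conjI ballI exI)
  fix t :: real assume "t \<in> {0..1}"
  then show "(V has_vector_derivative (- (\<i> / of_real \<epsilon>)) *\<^sub>C (G t o\<^sub>L V t)) (at t within {0..1})"
    by (rule assms(3))
  show "(\<i> * of_real \<epsilon>) *\<^sub>C (- (\<i> / of_real \<epsilon>)) *\<^sub>C (G t o\<^sub>L V t) = G t o\<^sub>L V t"
    using assms(2) by (simp add: scaleC_scaleC)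
qed (rule assms(1))

lemma is_evolution_continuous: "is_evolution \<epsilon> G V \<Longrightarrow> continuous_on {0..1} V"
  unfolding is_evolution_def by (meson continuous_on_vector_derivative)

lemma generator_bound:
  fixes G :: "real \<Rightarrow> 'a::complex_normed_vector \<Rightarrow>\<^sub>L 'a"
  assumes "continuous_on {0..1} G"
  shows "\<exists>C\<ge>0. \<forall>t\<in>{0..1}. \<forall>A :: 'a \<Rightarrow>\<^sub>L 'a. norm (c *\<^sub>C (G t o\<^sub>L A)) \<le> C * norm A"
proof -
  have "bounded (G ` {0..1})"
    using assms by (intro compact_imp_bounded compact_continuous_image) auto
  then obtain M where M: "M > 0" "\<And>t. t \<in> {0..1} \<Longrightarrow> norm (G t) \<le> M"
    unfolding bounded_pos by blast
  show ?thesis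
  proof (intro exI[of _ "cmod c * M"] conjI ballI allI)
    show "cmod c * M \<ge> 0" using M by simp
    show "norm (c *\<^sub>C (G t o\<^sub>L A)) \<le> cmod c * M * norm A" if "t \<in> {0..1}" for t and A :: "'a \<Rightarrow>\<^sub>L 'a"
      using mult_left_mono[OF order_trans[OF norm_blinfun_compose mult_right_mono[OF M(2)[OF that] norm_ge_zero]], of "cmod c" A]
      by (simp add: norm_scaleC mult_ac)
  qed
qed

text \<open>The quotient \<open>V s o\<^sub>L op_inverse (V u)\<close> starts at the identity and
  stays within distance one of it during a time that does not depend on \<open>u\<close>.
  Invertibility thus spreads over the unit interval in finitely many steps, for any continuous
  generator.\<close>

lemma evolution_invertible:
  fixes V :: "real \<Rightarrow> 'a::{complex_normed_vector, banach} \<Rightarrow>\<^sub>L 'a"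
  assumes ev: "is_evolution \<epsilon> G V" "\<epsilon> \<noteq> 0" and G: "continuous_on {0..1} G" and t: "t \<in> {0..1}"
  shows "op_invertible (V t)"
proof -
  define c where "c = - (\<i> / complex_of_real \<epsilon>)"
  note d = is_evolutionD[OF ev, folded c_def]
  obtain C where C: "C \<ge> 0" "\<And>t A :: 'a \<Rightarrow>\<^sub>L 'a. t \<in> {0..1} \<Longrightarrow> norm (c *\<^sub>C (G t o\<^sub>L A)) \<le> C * norm A"
    using generator_bound[OF G, of c] by blast
  define M where "M = 2 * exp (2 * C + 1)"
  have M: "M > 0" by (simp add: M_def)
  \<comment> \<open>\<open>M\<close> bounds the quotient over a time of at most one, so its velocity
    is at most \<open>C * M\<close> and its displacement in a step below 1/2. The summand 1 covers a
    vanishing velocity.\<close>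
  define \<delta> where "\<delta> = 1 / (2 * (C * M + 1))"
  have CM: "C * M \<ge> 0" using C M by simp
  then have \<delta>: "\<delta> > 0" by (simp add: \<delta>_def add_nonneg_pos)
  have step: "op_invertible (V v)" if uv: "0 \<le> u" "u \<le> v" "v \<le> 1" "v - u \<le> \<delta>" and inv: "op_invertible (V u)" for u v
  proof -
    define X where "X s = V s o\<^sub>L op_inverse (V u)" for s
    have Xu: "X u = id_blinfun"
      unfolding X_def by (rule op_inverse_compose(2)[OF inv])
    have dX: "(X has_vector_derivative c *\<^sub>C (G s o\<^sub>L X s)) (at s within {u..v})" if "s \<in> {u..v}" for s
    proof -
      have "(V has_vector_derivative c *\<^sub>C (G s o\<^sub>L V s)) (at s within {u..v})"
        using d(2)[of s] that uv by (auto intro: has_vector_derivative_within_subset)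
      from has_vector_derivative_compose[OF this has_vector_derivative_const[of "op_inverse (V u)"]]
      show ?thesis
        by (simp add: X_def[abs_def] scaleC_blinfun_compose_left blinfun_compose_assoc)
    qed
    have dXb: "norm (c *\<^sub>C (G s o\<^sub>L X s)) \<le> C * norm (X s)" if "s \<in> {u..v}" for s
      using C(2)[of s] that uv by auto
    have "norm (c *\<^sub>C (G s o\<^sub>L X s)) \<le> C * M" if s: "s \<in> {u..v}" for s
    proof -
      have "norm (X s) \<le> 2 * exp ((2 * C + 1) * (s - u)) * norm (X u)"
        by (rule gronwall[OF uv(2) dX dXb C(1) s])
      also have "\<dots> \<le> 2 * exp ((2 * C + 1) * 1) * 1"
        using s uv C(1) norm_id_blinfun_le[where 'a='a] unfolding Xu
        by (intro mult_mono) (auto intro!: mult_left_mono mult_left_le)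
      finally show ?thesis
        using dXb[OF s] C(1) unfolding M_def by (simp add: mult_left_mono order_trans)
    qed
    from norm_increment_le_const[OF uv(2) dX this]
    have "norm (X v - id_blinfun) \<le> C * M * (v - u)"
      by (simp add: Xu)
    also have "\<dots> \<le> C * M * \<delta>"
      using CM uv by (intro mult_left_mono) auto
    also have "\<dots> < 1"
      using CM by (simp add: \<delta>_def divide_less_eq add_nonneg_pos)
    finally have "op_invertible (X v)"
      by (rule op_invertible_near_id)
    then have "op_invertible (X v o\<^sub>L V u)"
      using inv by (rule op_invertible_compose)
    then show ?thesis
      by (simp add: X_def blinfun_compose_assoc op_inverse_compose inv)
  qed
  have "op_invertible (V s)" if "0 \<le> s" "s \<le> 1" "s \<le> real n * \<delta>" for n s
    using that
  proof (induction n arbitrary: s)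
    case 0
    then show ?case by (simp add: d(1))
  next
    case (Suc n)
    have "op_invertible (V (min s (real n * \<delta>)))"
      using Suc \<delta> by (intro Suc.IH) auto
    then show ?case
      using Suc.prems \<delta> by (intro step[of "min s (real n * \<delta>)" s]) (auto simp: algebra_simps min_def)
  qed
  moreover obtain n where "t \<le> real n * \<delta>"
    using reals_Archimedean3[OF \<delta>, rule_format, of t] by (auto intro: less_imp_le)
  ultimately show ?thesis
    using t by auto
qed

text \<open>The defect of complex linearity of \<open>V\<close> solves the same linear equation and
  vanishes at time 0, so Gronwall's inequality makes it zero.\<close>

lemma evolution_clin:
  fixes V :: "real \<Rightarrow> 'a::{complex_normed_vector, banach} \<Rightarrow>\<^sub>L 'a"
  assumes ev: "is_evolution \<epsilon> G V" "\<epsilon> \<noteq> 0" and G: "continuous_on {0..1} G"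
    and cl: "\<And>t. t \<in> {0..1} \<Longrightarrow> clin (G t)" and t: "t \<in> {0..1}"
  shows "clin (V t)"
  unfolding clin_iff_compose
proof
  fix k
  define c where "c = - (\<i> / complex_of_real \<epsilon>)"
  note d = is_evolutionD[OF ev, folded c_def]
  obtain C where C: "C \<ge> 0" "\<And>t A :: 'a \<Rightarrow>\<^sub>L 'a. t \<in> {0..1} \<Longrightarrow> norm (c *\<^sub>C (G t o\<^sub>L A)) \<le> C * norm A"
    using generator_bound[OF G, of c] by blast
  let ?L = "\<lambda>T. (T o\<^sub>L (k *\<^sub>C id_blinfun)) - k *\<^sub>C T"
  have eq: "?L (c *\<^sub>C (G s o\<^sub>L V s)) = c *\<^sub>C (G s o\<^sub>L ?L (V s))" if "s \<in> {0..1}" for s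
    using cl[OF that]
    by (intro blinfun_eqI) (simp add: scaleC_blinfun.rep_eq blinfun.bilinear_simps scaleC_right_simps scaleC_scaleC clinD mult.commute)
  have dX: "((\<lambda>s. ?L (V s)) has_vector_derivative c *\<^sub>C (G s o\<^sub>L ?L (V s))) (at s within {0..1})" if "s \<in> {0..1}" for s
    using bounded_linear.has_vector_derivative[OF bounded_linear_clin_defect[of k] d(2)[OF that]] eq[OF that] by simp
  have "norm (?L (V t)) \<le> 2 * exp ((2 * C + 1) * (t - 0)) * norm (?L (V 0))"
    by (rule gronwall[OF _ dX C(2) C(1) t]) auto
  then show "?L (V t) = 0"
    by (simp add: d(1))
qed

text \<open>The derivative of the squared norm is twice the real part of an imaginary multiple of
  \<open>cinner (V s x) (G s (V s x))\<close>, and this inner product is real.\<close>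

lemma evolution_isometry:
  fixes V :: "real \<Rightarrow> 'a::chilbert_space \<Rightarrow>\<^sub>L 'a"
  assumes ev: "is_evolution \<epsilon> G V" "\<epsilon> \<noteq> 0"
    and sa: "\<And>t. t \<in> {0..1} \<Longrightarrow> self_adjoint (G t)" and t: "t \<in> {0..1}"
  shows "norm (V t x) = norm x"
proof -
  note d = is_evolutionD[OF ev]
  have "((\<lambda>s. V s x \<bullet> V s x) has_vector_derivative 0) (at s within {0..1})" if s: "s \<in> {0..1}" for s
  proof -
    let ?D = "(- (\<i> / of_real \<epsilon>)) *\<^sub>C (G s o\<^sub>L V s)"
    have dv: "((\<lambda>s. V s x) has_vector_derivative ?D x) (at s within {0..1})"
      by (rule bounded_linear.has_vector_derivative[OF blinfun.bounded_linear_left d(2)[OF s]])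
    have "V s x \<bullet> ?D x = Re (- (\<i> / of_real \<epsilon>) * cinner (V s x) (G s (V s x)))"
      unfolding Re_cinner[symmetric] by (simp add: scaleC_blinfun.rep_eq cinner_scaleC_right)
    moreover have "Im (cinner (V s x) (G s (V s x))) = 0"
    proof -
      have "cinner (V s x) (G s (V s x)) = cnj (cinner (V s x) (G s (V s x)))"
        using sa[OF s] by (metis cinner_commute self_adjoint_def)
      then show ?thesis
        by (metis Im_complex_of_real Reals_cnj_iff complex_is_Real_iff)
    qed
    ultimately have "V s x \<bullet> ?D x = 0"
      by (simp add: complex_eq_iff Re_divide)
    then show ?thesis
      using bounded_bilinear.has_vector_derivative[OF bounded_bilinear_inner dv dv] by (simp add: inner_commute)
  qed
  then obtain k where "\<And>s. s \<in> {0..1} \<Longrightarrow> V s x \<bullet> V s x = k"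
    using has_vector_derivative_zero_constant[of "{0..1}" "\<lambda>s. V s x \<bullet> V s x"] by auto
  from this[OF t] this[of 0] show ?thesis
    by (simp add: norm_eq_sqrt_inner d(1))
qed

lemma evolution_norm_le:
  fixes V :: "real \<Rightarrow> 'a::chilbert_space \<Rightarrow>\<^sub>L 'a"
  assumes ev: "is_evolution \<epsilon> G V" "\<epsilon> \<noteq> 0" and G: "continuous_on {0..1} G"
    and sa: "\<And>t. t \<in> {0..1} \<Longrightarrow> self_adjoint (G t)" and t: "t \<in> {0..1}"
  shows "norm (V t) \<le> 1" "norm (op_inverse (V t)) \<le> 1"
proof -
  have iso: "norm (V t x) = norm x" for x
    by (rule evolution_isometry[OF ev sa t])
  then show "norm (V t) \<le> 1"
    by (intro norm_blinfun_bound) auto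
  have "norm (op_inverse (V t) x) = norm x" for x
    using iso[of "op_inverse (V t) x"] op_inverse_apply(2)[OF evolution_invertible[OF ev G t]] by simp
  then show "norm (op_inverse (V t)) \<le> 1"
    by (intro norm_blinfun_bound) auto
qed

text \<open>The equation of \<Phi> carries the factor \<epsilon>, that of \<open>W\<close> does not,
  so \<open>W\<close> contributes \<open>\<epsilon> *\<^sub>R K\<close> to the generator of the
  product; its other contribution undoes the conjugation in the generator of \<Phi>. Both composite
  evolutions of the theorem are treated in this way.\<close>

lemma evolution_product:
  fixes W :: "real \<Rightarrow> 'a::{complex_normed_vector, banach} \<Rightarrow>\<^sub>L 'a"
  assumes W: "is_evolution 1 K W" and K: "continuous_on {0..1} K" "\<And>t. t \<in> {0..1} \<Longrightarrow> clin (K t)"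
    and \<Phi>: "is_evolution \<epsilon> (\<lambda>t. op_inverse (W t) o\<^sub>L G t o\<^sub>L W t) \<Phi>" and \<epsilon>: "\<epsilon> \<noteq> 0"
  shows "is_evolution \<epsilon> (\<lambda>t. G t + \<epsilon> *\<^sub>R K t) (\<lambda>t. W t o\<^sub>L \<Phi> t)"
proof (rule is_evolutionI[OF _ \<epsilon>])
  note dW = is_evolutionD[OF W one_neq_zero] and d\<Phi> = is_evolutionD[OF \<Phi> \<epsilon>]
  show "W 0 o\<^sub>L \<Phi> 0 = id_blinfun"
    using dW(1) d\<Phi>(1) by simp
  fix t :: real assume t: "t \<in> {0..1}"
  let ?c = "- (\<i> / complex_of_real \<epsilon>)"
  have inv: "op_invertible (W t)"
    by (rule evolution_invertible[OF W _ K(1) t]) simp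
  have cl: "clin (W t)"
    by (rule evolution_clin[OF W _ K t]) simp
  have "(W t o\<^sub>L (?c *\<^sub>C ((op_inverse (W t) o\<^sub>L G t o\<^sub>L W t) o\<^sub>L \<Phi> t))) + ((- (\<i> / complex_of_real 1)) *\<^sub>C (K t o\<^sub>L W t) o\<^sub>L \<Phi> t)
      = ?c *\<^sub>C ((G t + \<epsilon> *\<^sub>R K t) o\<^sub>L (W t o\<^sub>L \<Phi> t))"
  proof (rule blinfun_eqI)
    fix x
    have "\<epsilon> *\<^sub>R (?c *\<^sub>C y) = (- \<i>) *\<^sub>C y" for y :: 'a
      using \<epsilon> by (simp add: scaleC_of_real[symmetric] scaleC_scaleC)
    then show "((W t o\<^sub>L (?c *\<^sub>C ((op_inverse (W t) o\<^sub>L G t o\<^sub>L W t) o\<^sub>L \<Phi> t))) + ((- (\<i> / complex_of_real 1)) *\<^sub>C (K t o\<^sub>L W t) o\<^sub>L \<Phi> t)) x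
      = (?c *\<^sub>C ((G t + \<epsilon> *\<^sub>R K t) o\<^sub>L (W t o\<^sub>L \<Phi> t))) x"
      using cl inv by (simp add: blinfun.bilinear_simps scaleC_blinfun.rep_eq scaleC_add_right scaleC_scaleR clinD op_inverse_apply)
  qed
  then show "((\<lambda>t. W t o\<^sub>L \<Phi> t) has_vector_derivative ?c *\<^sub>C ((G t + \<epsilon> *\<^sub>R K t) o\<^sub>L (W t o\<^sub>L \<Phi> t))) (at t within {0..1})"
    using has_vector_derivative_compose[OF dW(2)[OF t] d\<Phi>(2)[OF t]] by simp
qed

lemma evolution_inverse_derivative:
  fixes V :: "real \<Rightarrow> 'a::{complex_normed_vector, banach} \<Rightarrow>\<^sub>L 'a"
  assumes ev: "is_evolution \<epsilon> G V" "\<epsilon> \<noteq> 0" and G: "continuous_on {0..1} G"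
    and cl: "\<And>t. t \<in> {0..1} \<Longrightarrow> clin (G t)" and t: "t \<in> {0..1}"
  shows "((\<lambda>t. op_inverse (V t)) has_vector_derivative (\<i> / of_real \<epsilon>) *\<^sub>C (op_inverse (V t) o\<^sub>L G t)) (at t within {0..1})"
proof -
  let ?c = "- (\<i> / complex_of_real \<epsilon>)"
  note inv = evolution_invertible[OF ev G]
  have clV: "clin (op_inverse (V t))"
    using inv[OF t] evolution_clin[OF ev G cl t] by (rule clin_op_inverse)
  have "- (op_inverse (V t) o\<^sub>L ?c *\<^sub>C (G t o\<^sub>L V t) o\<^sub>L op_inverse (V t)) = (\<i> / of_real \<epsilon>) *\<^sub>C (op_inverse (V t) o\<^sub>L G t)"
    using clV inv[OF t]
    by (intro blinfun_eqI) (simp add: blinfun.bilinear_simps scaleC_blinfun.rep_eq clinD op_inverse_apply scaleC_minus_left)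
  then show ?thesis
    using has_vector_derivative_op_inverse[OF is_evolutionD(2)[OF ev t] t inv] by simp
qed

lemma evolution_inverse_continuous:
  fixes V :: "real \<Rightarrow> 'a::{complex_normed_vector, banach} \<Rightarrow>\<^sub>L 'a"
  assumes ev: "is_evolution \<epsilon> G V" "\<epsilon> \<noteq> 0" and G: "continuous_on {0..1} G"
  shows "continuous_on {0..1} (\<lambda>t. op_inverse (V t))"
  by (rule continuous_on_op_inverse[OF is_evolution_continuous[OF ev(1)] evolution_invertible[OF ev G]])

lemmas continuous_on_compose_op = bounded_bilinear.continuous_on[OF bounded_bilinear_blinfun_compose]

lemma norm_compose2_le: "norm A \<le> a \<Longrightarrow> norm B \<le> b \<Longrightarrow> 0 \<le> b \<Longrightarrow> norm (A o\<^sub>L B) \<le> a * b"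
  by (meson mult_mono norm_blinfun_compose norm_ge_zero order_trans)

text \<open>\<open>\<Theta> = U\<^sup>-\<^sup>1 V\<close> solves \<open>\<Theta>' = - \<i> Z' \<Theta>\<close>; integration by parts bounds \<open>\<Theta> - 1\<close> by \<open>Z\<close>
  rather than by \<open>Z'\<close>.\<close>

lemma evolution_comparison:
  fixes U V :: "real \<Rightarrow> 'a::chilbert_space \<Rightarrow>\<^sub>L 'a"
  assumes U: "is_evolution \<epsilon> H U" and \<epsilon>: "\<epsilon> \<noteq> 0" and H: "continuous_on {0..1} H"
    and sa: "\<And>t. t \<in> {0..1} \<Longrightarrow> self_adjoint (H t)"
    and V: "is_evolution \<epsilon> (\<lambda>t. H t + \<epsilon> *\<^sub>R E t) V"
    and E: "continuous_on {0..1} E" "\<And>t. t \<in> {0..1} \<Longrightarrow> clin (E t)" "\<And>t. t \<in> {0..1} \<Longrightarrow> norm (E t) \<le> m"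
    and q: "\<And>t. t \<in> {0..1} \<Longrightarrow> norm (integral {0..t} (\<lambda>s. op_inverse (U s) o\<^sub>L E s o\<^sub>L U s)) \<le> q"
    and t: "t \<in> {0..1}"
  shows "norm ((op_inverse (U t) o\<^sub>L V t) - id_blinfun) \<le> 2 * exp (2 * m + 1) * (1 + m) * q"
proof -
  have m0: "m \<ge> 0"
    using E(3)[OF t] norm_ge_zero order_trans by blast
  have q0: "q \<ge> 0"
    using q[OF t] norm_ge_zero order_trans by blast
  have clH: "clin (H s)" if "s \<in> {0..1}" for s
    using sa[OF that] by (rule self_adjoint_clin)
  note invU = evolution_invertible[OF U \<epsilon> H] and nU = evolution_norm_le[OF U \<epsilon> H sa]
  have clU: "clin (U s)" "clin (op_inverse (U s))" if "s \<in> {0..1}" for s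
    using evolution_clin[OF U \<epsilon> H clH that] invU[OF that] by auto
  define B where "B s = op_inverse (U s) o\<^sub>L E s o\<^sub>L U s" for s
  define \<Theta> where "\<Theta> s = op_inverse (U s) o\<^sub>L V s" for s
  have Bn: "norm (B s) \<le> m" if "s \<in> {0..1}" for s
  proof -
    have "norm (B s) \<le> 1 * m * 1"
      unfolding B_def by (intro norm_compose2_le nU E that) (use m0 in auto)
    then show ?thesis by simp
  qed
  have clB: "clin (B s)" if "s \<in> {0..1}" for s
    unfolding B_def using clU E(2) that by auto
  have contB: "continuous_on {0..1} B"
    unfolding B_def by (intro continuous_on_compose_op evolution_inverse_continuous[OF U \<epsilon> H] E(1) is_evolution_continuous[OF U])
  have d\<Theta>: "(\<Theta> has_vector_derivative (- \<i>) *\<^sub>C (B s o\<^sub>L \<Theta> s)) (at s within {0..1})" if s: "s \<in> {0..1}" for s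
  proof -
    let ?c = "- (\<i> / complex_of_real \<epsilon>)"
    have "(op_inverse (U s) o\<^sub>L (?c *\<^sub>C ((H s + \<epsilon> *\<^sub>R E s) o\<^sub>L V s))) + ((\<i> / of_real \<epsilon>) *\<^sub>C (op_inverse (U s) o\<^sub>L H s) o\<^sub>L V s)
        = (- \<i>) *\<^sub>C (B s o\<^sub>L \<Theta> s)"
    proof (rule blinfun_eqI)
      fix x
      have *: "\<epsilon> *\<^sub>R (?c *\<^sub>C y) = (- \<i>) *\<^sub>C y" for y :: 'a
        using \<epsilon> by (simp add: scaleC_of_real[symmetric] scaleC_scaleC)
      show "((op_inverse (U s) o\<^sub>L (?c *\<^sub>C ((H s + \<epsilon> *\<^sub>R E s) o\<^sub>L V s))) + ((\<i> / of_real \<epsilon>) *\<^sub>C (op_inverse (U s) o\<^sub>L H s) o\<^sub>L V s)) x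
        = ((- \<i>) *\<^sub>C (B s o\<^sub>L \<Theta> s)) x"
        using clU[OF s] invU[OF s] *
        by (simp add: B_def \<Theta>_def blinfun.bilinear_simps scaleC_blinfun.rep_eq scaleC_add_right scaleC_scaleR clinD op_inverse_apply scaleC_minus_left)
    qed
    then show ?thesis
      using has_vector_derivative_compose[OF evolution_inverse_derivative[OF U \<epsilon> H clH s] is_evolutionD(2)[OF V \<epsilon> s]]
      by (simp add: \<Theta>_def[abs_def])
  qed
  have \<Theta>0: "\<Theta> 0 = id_blinfun"
    using is_evolutionD(1)[OF U \<epsilon>] is_evolutionD(1)[OF V \<epsilon>] by (simp add: \<Theta>_def)
  have d\<Theta>n: "norm ((- \<i>) *\<^sub>C (B s o\<^sub>L \<Theta> s)) \<le> m * norm (\<Theta> s)" if "s \<in> {0..1}" for s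
    using norm_compose2_le[OF Bn[OF that] order_refl, of "\<Theta> s"] by (simp add: norm_scaleC)
  \<comment> \<open>The Gronwall bound for \<Theta> over the whole unit interval.\<close>
  define M where "M = 2 * exp (2 * m + 1)"
  have \<Theta>n: "norm (\<Theta> s) \<le> M" if s: "s \<in> {0..1}" for s
  proof -
    have "norm (\<Theta> s) \<le> 2 * exp ((2 * m + 1) * (s - 0)) * norm (\<Theta> 0)"
      by (rule gronwall[OF _ d\<Theta> d\<Theta>n m0 s]) auto
    also have "\<dots> \<le> 2 * exp ((2 * m + 1) * 1) * 1"
      using s m0 norm_id_blinfun_le[where 'a='a] unfolding \<Theta>0
      by (intro mult_mono) (auto intro!: mult_left_le)
    finally show ?thesis by (simp add: M_def)
  qed
  have M0: "M \<ge> 0" by (simp add: M_def)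
  define Z where "Z s = integral {0..s} B" for s
  have Zn: "norm (Z s) \<le> q" if "s \<in> {0..1}" for s
    using q[OF that] by (simp add: Z_def B_def[abs_def])
  have dZ: "(Z has_vector_derivative B s) (at s within {0..1})" if "s \<in> {0..1}" for s
    unfolding Z_def by (rule integral_has_vector_derivative[OF contB that])
  have clZ: "clin (Z s)" if "s \<in> {0..1}" for s
    unfolding Z_def using that by (intro clin_integral clB) auto
  \<comment> \<open>The correction by \<open>Z\<close> cancels the term linear in \<open>B\<close>
    in the derivative. What remains has a factor \<open>Z\<close>, hence the small bound
    \<open>q\<close>, and \<open>Y\<close> differs from \<Theta> by another term with this factor;
    the two contributions add up to the constant in the claim.\<close>
  define Y where "Y s = \<Theta> s + \<i> *\<^sub>C (Z s o\<^sub>L \<Theta> s)" for s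
  have dY: "(Y has_vector_derivative Z s o\<^sub>L (B s o\<^sub>L \<Theta> s)) (at s within {0..1})" if s: "s \<in> {0..1}" for s
  proof -
    have "(Y has_vector_derivative (- \<i>) *\<^sub>C (B s o\<^sub>L \<Theta> s) + \<i> *\<^sub>C ((Z s o\<^sub>L (- \<i>) *\<^sub>C (B s o\<^sub>L \<Theta> s)) + (B s o\<^sub>L \<Theta> s))) (at s within {0..1})"
      unfolding Y_def
      by (intro has_vector_derivative_add d\<Theta>[OF s] has_vector_derivative_compose[OF dZ[OF s] d\<Theta>[OF s]]
          bounded_linear.has_vector_derivative[OF bounded_bilinear.bounded_linear_right[OF bounded_bilinear_scaleC]])
    moreover have "(- \<i>) *\<^sub>C (B s o\<^sub>L \<Theta> s) + \<i> *\<^sub>C ((Z s o\<^sub>L (- \<i>) *\<^sub>C (B s o\<^sub>L \<Theta> s)) + (B s o\<^sub>L \<Theta> s)) = Z s o\<^sub>L (B s o\<^sub>L \<Theta> s)"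
      using clin_compose_scaleC[OF clZ[OF s], of "- \<i>" "B s o\<^sub>L \<Theta> s"]
      by (simp add: scaleC_add_right scaleC_scaleC scaleC_minus_left scaleC_right_simps)
    ultimately show ?thesis by simp
  qed
  have "norm (Y t - Y 0) \<le> q * (m * M) * (t - 0)"
  proof (rule norm_increment_le_const)
    show "0 \<le> t" using t by simp
    fix s assume "s \<in> {0..t}"
    then have s: "s \<in> {0..1}" using t by auto
    show "(Y has_vector_derivative Z s o\<^sub>L (B s o\<^sub>L \<Theta> s)) (at s within {0..t})"
      using dY[OF s] t by (auto intro: has_vector_derivative_within_subset)
    show "norm (Z s o\<^sub>L (B s o\<^sub>L \<Theta> s)) \<le> q * (m * M)"
      by (intro norm_compose2_le Zn Bn \<Theta>n s) (use m0 M0 in auto)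
  qed
  also have "\<dots> \<le> q * (m * M)"
    using t q0 m0 M0 by (simp add: mult_left_le)
  finally have 1: "norm (Y t - Y 0) \<le> q * (m * M)" .
  have 2: "norm (\<i> *\<^sub>C (Z t o\<^sub>L \<Theta> t)) \<le> q * M"
    using norm_compose2_le[OF Zn[OF t] \<Theta>n[OF t] M0] by (simp add: norm_scaleC)
  have Y0: "Y 0 = id_blinfun"
    by (simp add: Y_def \<Theta>0 Z_def scaleC_right_simps)
  have eq: "\<Theta> t - id_blinfun = (Y t - Y 0) - \<i> *\<^sub>C (Z t o\<^sub>L \<Theta> t)"
    by (simp add: Y0, simp add: Y_def)
  have "norm (\<Theta> t - id_blinfun) \<le> norm (Y t - Y 0) + norm (\<i> *\<^sub>C (Z t o\<^sub>L \<Theta> t))"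
    unfolding eq by (rule norm_triangle_ineq4)
  then have "norm (\<Theta> t - id_blinfun) \<le> q * (m * M) + q * M"
    using 1 2 by linarith
  then show ?thesis
    by (simp add: \<Theta>_def M_def algebra_simps)
qed

section \<open>Regularity of the spectral projectors\<close>

definition cauchy_const :: complex where "cauchy_const = - (1 / (2 * of_real pi * \<i>))"

text \<open>The normalising factor of Cauchy's formula is included, so the projector is the loop
  integral of the resolvent. The integrand is a function of the loop parameter, which suits
  integrals along a fixed loop with varying operators.\<close>

definition loop_integral :: "(real \<Rightarrow> complex) \<Rightarrow> (real \<Rightarrow> 'b::complex_normed_vector) \<Rightarrow> 'b" where
  "loop_integral \<eta> f = cauchy_const *\<^sub>C integral {0..1} (\<lambda>x. deriv01 \<eta> x *\<^sub>C f x)"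

lemma spectral_projector_loop_integral:
  "spectral_projector B \<eta> = loop_integral \<eta> (\<lambda>x. resolvent B (\<eta> x))"
  by (simp add: spectral_projector_def vector_contour_integral_def loop_integral_def cauchy_const_def resolvent_def)

lemma polynomial_path_deriv01:
  fixes \<eta> :: "real \<Rightarrow> complex"
  assumes "polynomial_function \<eta>"
  shows "continuous_on {0..1} (deriv01 \<eta>)" "continuous_on {0..1} \<eta>"
proof -
  obtain p' where p': "polynomial_function p'" "\<And>x. (\<eta> has_vector_derivative p' x) (at x)"
    using has_vector_derivative_polynomial_function[OF assms] by blast
  have "deriv01 \<eta> x = p' x" if "x \<in> {0..1}" for x
    by (rule deriv01_eqI[OF has_vector_derivative_at_within[OF p'(2)] that])
  then show "continuous_on {0..1} (deriv01 \<eta>)"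
    by (intro continuous_on_eq[OF continuous_on_polymonial_function[OF p'(1)]]) simp
  show "continuous_on {0..1} \<eta>"
    using assms by (rule continuous_on_polymonial_function)
qed

lemma loop_integrable:
  fixes f :: "real \<Rightarrow> 'b::{complex_normed_vector, banach}"
  assumes "polynomial_function \<eta>" "continuous_on {0..1} f"
  shows "(\<lambda>x. deriv01 \<eta> x *\<^sub>C f x) integrable_on {0..1}"
  by (intro integrable_continuous_interval continuous_on_scaleC polynomial_path_deriv01 assms)

lemma loop_integral_linear:
  fixes f :: "real \<Rightarrow> 'b::{complex_normed_vector, banach}"
    and L :: "'b \<Rightarrow> 'c::{complex_normed_vector, banach}"
  assumes "polynomial_function \<eta>" "continuous_on {0..1} f" "bounded_linear L" "\<And>c x. L (c *\<^sub>C x) = c *\<^sub>C L x"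
  shows "L (loop_integral \<eta> f) = loop_integral \<eta> (\<lambda>x. L (f x))"
  using integral_linear[OF loop_integrable[OF assms(1,2)] assms(3)]
  by (simp add: loop_integral_def assms(4) o_def)

lemma loop_integral_compose_right:
  fixes f :: "real \<Rightarrow> 'a::{complex_normed_vector, banach} \<Rightarrow>\<^sub>L 'a"
  assumes "polynomial_function \<eta>" "continuous_on {0..1} f"
  shows "loop_integral \<eta> f o\<^sub>L A = loop_integral \<eta> (\<lambda>x. f x o\<^sub>L A)"
  by (rule loop_integral_linear[where L = "\<lambda>T. T o\<^sub>L A", OF assms])
    (simp_all add: bounded_bilinear.bounded_linear_left[OF bounded_bilinear_blinfun_compose] scaleC_blinfun_compose_left)

lemma loop_integral_compose_left:
  fixes f :: "real \<Rightarrow> 'a::{complex_normed_vector, banach} \<Rightarrow>\<^sub>L 'a"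
  assumes "polynomial_function \<eta>" "continuous_on {0..1} f" "clin A"
  shows "A o\<^sub>L loop_integral \<eta> f = loop_integral \<eta> (\<lambda>x. A o\<^sub>L f x)"
  by (rule loop_integral_linear[where L = "\<lambda>T. A o\<^sub>L T", OF assms(1,2)])
    (simp_all add: bounded_bilinear.bounded_linear_right[OF bounded_bilinear_blinfun_compose] clin_compose_scaleC assms(3))

lemma loop_integral_diff:
  fixes f g :: "real \<Rightarrow> 'b::{complex_normed_vector, banach}"
  assumes "polynomial_function \<eta>" "continuous_on {0..1} f" "continuous_on {0..1} g"
  shows "loop_integral \<eta> (\<lambda>x. f x - g x) = loop_integral \<eta> f - loop_integral \<eta> g"
  unfolding loop_integral_def scaleC_right_simps
  using integral_diff[OF loop_integrable[OF assms(1,2)] loop_integrable[OF assms(1,3)]]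
  by (simp add: scaleC_right_simps)

lemma loop_integral_scaleR:
  "loop_integral \<eta> (\<lambda>x. r *\<^sub>R f x) = r *\<^sub>R loop_integral \<eta> f"
  by (simp add: loop_integral_def scaleC_scaleR)

lemma loop_integral_cong:
  "(\<And>x. x \<in> {0..1} \<Longrightarrow> f x = g x) \<Longrightarrow> loop_integral \<eta> f = loop_integral \<eta> g"
  unfolding loop_integral_def by (metis (mono_tags, lifting) Henstock_Kurzweil_Integration.integral_cong)

lemma clin_loop_integral: "(\<And>x. x \<in> {0..1} \<Longrightarrow> clin (f x)) \<Longrightarrow> clin (loop_integral \<eta> f)"
  unfolding loop_integral_def by (intro clin_simps clin_integral) auto

lemma norm_integral01_le:
  fixes f :: "real \<Rightarrow> 'b::banach"
  assumes "continuous_on {0..1} f" "\<And>x. x \<in> {0..1} \<Longrightarrow> norm (f x) \<le> B"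
  shows "norm (integral {0..1} f) \<le> B"
  using integral_norm_bound_integral[OF integrable_continuous_interval[OF assms(1)] integrable_const_ivl, of B] assms(2)
  by simp

text \<open>The constant \<open>L\<close> depends on the loop alone; the same one serves an
  integrand and its time derivative.\<close>

lemma loop_integral_bound:
  assumes "polynomial_function \<eta>"
  obtains L where "L \<ge> 0"
    "\<And>(f :: real \<Rightarrow> 'b::{complex_normed_vector, banach}) B. continuous_on {0..1} f \<Longrightarrow>
       (\<And>x. x \<in> {0..1} \<Longrightarrow> norm (f x) \<le> B) \<Longrightarrow> norm (loop_integral \<eta> f) \<le> L * B"
proof -
  have "bounded (deriv01 \<eta> ` {0..1})"
    using polynomial_path_deriv01[OF assms] by (intro compact_imp_bounded compact_continuous_image) auto
  then obtain M where M: "M > 0" "\<And>x. x \<in> {0..1} \<Longrightarrow> cmod (deriv01 \<eta> x) \<le> M"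
    unfolding bounded_pos by blast
  show ?thesis
  proof (rule that[of "cmod cauchy_const * M"])
    show "cmod cauchy_const * M \<ge> 0" using M by simp
    fix f :: "real \<Rightarrow> 'b" and B
    assume f: "continuous_on {0..1} f" "\<And>x. x \<in> {0..1} \<Longrightarrow> norm (f x) \<le> B"
    have "norm (integral {0..1} (\<lambda>x. deriv01 \<eta> x *\<^sub>C f x)) \<le> M * B"
    proof (rule norm_integral01_le)
      show "continuous_on {0..1} (\<lambda>x. deriv01 \<eta> x *\<^sub>C f x)"
        by (intro continuous_on_scaleC polynomial_path_deriv01(1)[OF assms] f(1))
      show "norm (deriv01 \<eta> x *\<^sub>C f x) \<le> M * B" if "x \<in> {0..1}" for x
        unfolding norm_scaleC using M(2)[OF that] f(2)[OF that] M(1) by (intro mult_mono) auto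
    qed
    then show "norm (loop_integral \<eta> f) \<le> cmod cauchy_const * M * B"
      by (simp add: loop_integral_def norm_scaleC mult.assoc mult_left_mono)
  qed
qed

lemma spectral_projector_polynomial:
  fixes B :: "'a::{complex_normed_vector, banach} \<Rightarrow>\<^sub>L 'a"
  assumes "clin B" "polynomial_function \<eta>" "path_image \<eta> \<inter> op_spectrum B = {}"
  shows "clin (spectral_projector B \<eta>)" "spectral_projector B \<eta> o\<^sub>L B = B o\<^sub>L spectral_projector B \<eta>"
proof -
  have out: "\<eta> x \<notin> op_spectrum B" if "x \<in> {0..1}" for x
    using assms(3) that unfolding path_image_def by (meson disjoint_iff imageI)
  have cont: "continuous_on {0..1} (\<lambda>x. resolvent B (\<eta> x))"
    by (intro continuous_on_resolvent continuous_on_const polynomial_path_deriv01 assms out)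
  show "clin (spectral_projector B \<eta>)"
    unfolding spectral_projector_loop_integral by (intro clin_loop_integral clin_resolvent assms out)
  show "spectral_projector B \<eta> o\<^sub>L B = B o\<^sub>L spectral_projector B \<eta>"
    unfolding spectral_projector_loop_integral loop_integral_compose_right[OF assms(2) cont]
      loop_integral_compose_left[OF assms(2) cont assms(1)]
    by (intro loop_integral_cong resolvent_commute assms out)
qed

lemma Ckp_resolvent:
  fixes B :: "real \<times> real \<Rightarrow> 'c::topological_space \<Rightarrow> 'a::{complex_normed_vector, banach} \<Rightarrow>\<^sub>L 'a"
  assumes "Ckp k S T B" "continuous_on T f" "\<And>p e. p \<in> S \<Longrightarrow> e \<in> T \<Longrightarrow> f e \<notin> op_spectrum (B p e)"
  shows "Ckp k S T (\<lambda>p e. resolvent (B p e) (f e))"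
  unfolding resolvent_def
  by (intro Ckp_op_inverse Ckp_diff assms Ckp_param continuous_on_scaleC continuous_on_const)
    (use assms(3) in \<open>auto simp: not_in_spectrum_iff\<close>)

lemma Ckp_loop_integral:
  fixes f :: "real \<times> real \<Rightarrow> real \<times> 'c::topological_space \<Rightarrow> 'b::{complex_normed_vector, banach}"
  assumes "Ckp k S ({0..1} \<times> T) f" "convex S" "polynomial_function \<eta>"
  shows "Ckp k S T (\<lambda>p e. loop_integral \<eta> (\<lambda>x. f p (x, e)))"
proof -
  have "continuous_on ({0..1} \<times> T) (\<lambda>x. deriv01 \<eta> (fst x))"
    by (rule continuous_on_compose2[OF polynomial_path_deriv01(1)[OF assms(3)] continuous_on_fst[OF continuous_on_id]]) auto
  from Ckp_integral[OF Ckp_scaleC[OF Ckp_param[OF this] assms(1)] assms(2)]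
  have "Ckp k S T (\<lambda>p e. integral {0..1} (\<lambda>x. deriv01 \<eta> x *\<^sub>C f p (x, e)))"
    by simp
  from Ckp_linear[OF bounded_bilinear.bounded_linear_right[OF bounded_bilinear_scaleC] this]
  show ?thesis
    unfolding loop_integral_def .
qed

section \<open>The gapped family, its projectors and the generator of parallel transport\<close>

locale gapped_family =
  fixes H :: "real \<Rightarrow> real \<Rightarrow> ('a::chilbert_space \<Rightarrow>\<^sub>L 'a)"
    and \<sigma> \<sigma>' :: "real \<Rightarrow> real \<Rightarrow> complex set"
    and \<gamma> :: "real \<Rightarrow> real \<Rightarrow> (real \<Rightarrow> complex)"
  assumes selfadj: "\<And>\<alpha> t. \<alpha> \<in> {0..1} \<Longrightarrow> t \<in> {0..1} \<Longrightarrow> self_adjoint (H \<alpha> t)"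
    and regularity: "Ck_on 3 ({0..1} \<times> {0..1}) (\<lambda>(t, \<alpha>). H \<alpha> t)"
    and spectrum: "\<And>\<alpha> t. \<alpha> \<in> {0..1} \<Longrightarrow> t \<in> {0..1} \<Longrightarrow>
          op_spectrum (H \<alpha> t) = \<sigma> \<alpha> t \<union> \<sigma>' \<alpha> t \<and> \<sigma> \<alpha> t \<inter> \<sigma>' \<alpha> t = {}"
    and loops: "\<And>p. p \<in> {0..1} \<times> {0..1} \<Longrightarrow>
          \<exists>N. open N \<and> p \<in> N \<and>
              finite ((\<lambda>(t, \<alpha>). \<gamma> \<alpha> t) ` (N \<inter> {0..1} \<times> {0..1})) \<and>
              (\<forall>(t, \<alpha>) \<in> N \<inter> {0..1} \<times> {0..1}. \<forall>(t', \<alpha>') \<in> N \<inter> {0..1} \<times> {0..1}.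
                 encircles_only (\<gamma> \<alpha> t) (\<sigma> \<alpha>' t') (\<sigma>' \<alpha>' t'))"
begin

definition h :: "real \<times> real \<Rightarrow> 'a \<Rightarrow>\<^sub>L 'a" where "h p = H (snd p) (fst p)"

definition P :: "real \<Rightarrow> real \<Rightarrow> 'a \<Rightarrow>\<^sub>L 'a" where "P \<alpha> t = spectral_projector (H \<alpha> t) (\<gamma> \<alpha> t)"

definition K :: "real \<Rightarrow> real \<Rightarrow> 'a \<Rightarrow>\<^sub>L 'a" where
  "K \<alpha> t = \<i> *\<^sub>C commutator (deriv01 (P \<alpha>) t) (P \<alpha> t)"

definition P1 :: "real \<Rightarrow> real \<Rightarrow> real \<Rightarrow> 'a \<Rightarrow>\<^sub>L 'a" where
  "P1 \<alpha> \<epsilon> t = spectral_projector (H \<alpha> t - \<epsilon> *\<^sub>R K \<alpha> t) (\<gamma> \<alpha> t)"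

lemma h_C3: "Ck_on 3 unit_square h"
  by (rule Ck_on_cong[OF regularity]) (auto simp: h_def)

lemma h_clin: "p \<in> unit_square \<Longrightarrow> clin (h p)"
  unfolding h_def by (intro self_adjoint_clin selfadj) auto

text \<open>The local finiteness of the loops is what allows a single polynomial loop near each
  point of the square. The operator \<open>B\<close> is left free because both \<open>H\<close> and
  its first-order correction are inserted.\<close>

lemma common_loop:
  assumes p0: "p0 \<in> unit_square"
  obtains N \<eta> \<delta> where "open N" "p0 \<in> N" "polynomial_function \<eta>" "\<delta> > 0"
    "\<And>p B. p \<in> unit_square \<inter> N \<Longrightarrow> clin B \<Longrightarrow> norm (B - h p0) < \<delta> \<Longrightarrow>
       path_image \<eta> \<inter> op_spectrum B = {} \<and>
       spectral_projector B (\<gamma> (snd p) (fst p)) = spectral_projector B \<eta> \<and>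
       spectral_projector B \<eta> o\<^sub>L spectral_projector B \<eta> = spectral_projector B \<eta>"
proof -
  obtain N where N: "open N" "p0 \<in> N"
      "finite ((\<lambda>(t, \<alpha>). \<gamma> \<alpha> t) ` (N \<inter> unit_square))"
      "\<forall>(t, \<alpha>) \<in> N \<inter> unit_square. \<forall>(t', \<alpha>') \<in> N \<inter> unit_square.
                 encircles_only (\<gamma> \<alpha> t) (\<sigma> \<alpha>' t') (\<sigma>' \<alpha>' t')"
    using loops[OF p0] by blast
  have N4: "encircles_only (\<gamma> (snd p) (fst p)) (\<sigma> (snd q) (fst q)) (\<sigma>' (snd q) (fst q))"
    if "p \<in> N \<inter> unit_square" "q \<in> N \<inter> unit_square" for p q
    using bspec[OF N(4) that(1)] that(2) unfolding case_prod_unfold by blast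
  define G where "G = (\<lambda>p. \<gamma> (snd p) (fst p)) ` (N \<inter> unit_square)"
  obtain t0 \<alpha>0 where t0: "p0 = (t0, \<alpha>0)" "t0 \<in> {0..1}" "\<alpha>0 \<in> {0..1}"
    using p0 by auto
  have fin: "finite G"
    using N(3) by (simp add: G_def case_prod_unfold)
  have ne: "G \<noteq> {}"
    using N(2) p0 by (auto simp: G_def)
  have enc: "encircles_only g (\<sigma> \<alpha>0 t0) (\<sigma>' \<alpha>0 t0)" if "g \<in> G" for g
    using that N4[of _ p0] N(2) p0 unfolding G_def t0(1) by auto
  note sp = spectrum[OF t0(3,2)]
  obtain \<eta> \<delta> where \<eta>: "polynomial_function \<eta>" "pathfinish \<eta> = pathstart \<eta>" "\<delta> > 0"
    "\<And>B. clin B \<Longrightarrow> norm (B - H \<alpha>0 t0) < \<delta> \<Longrightarrow> path_image \<eta> \<inter> op_spectrum B = {} \<and>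
       (\<forall>\<gamma>\<in>G. spectral_projector B \<gamma> = spectral_projector B \<eta>) \<and>
       spectral_projector B \<eta> o\<^sub>L spectral_projector B \<eta> = spectral_projector B \<eta>"
    using spectral_projector_common_loop[OF selfadj[OF t0(3,2)] conjunct1[OF sp] conjunct2[OF sp] fin ne enc] by blast
  show ?thesis
  proof (rule that[OF N(1,2) \<eta>(1,3)])
    fix p B assume "p \<in> unit_square \<inter> N" "clin B" "norm (B - h p0) < \<delta>"
    then show "path_image \<eta> \<inter> op_spectrum B = {} \<and>
       spectral_projector B (\<gamma> (snd p) (fst p)) = spectral_projector B \<eta> \<and>
       spectral_projector B \<eta> o\<^sub>L spectral_projector B \<eta> = spectral_projector B \<eta>"
      using \<eta>(4)[of B] t0(1) by (auto simp: G_def h_def)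
  qed
qed

lemma h_near:
  assumes "p0 \<in> unit_square" "open N" "p0 \<in> N" "e > 0"
  obtains r where "r > 0" "cball p0 r \<subseteq> N" "\<And>p. p \<in> unit_square \<inter> cball p0 r \<Longrightarrow> norm (h p - h p0) < e"
proof -
  obtain d where d: "d > 0" "\<And>p. p \<in> unit_square \<Longrightarrow> dist p p0 < d \<Longrightarrow> dist (h p) (h p0) < e"
    using Ck_on_continuous[OF h_C3] assms(1,4) unfolding continuous_on_iff by metis
  obtain d' where d': "d' > 0" "cball p0 d' \<subseteq> N"
    using assms(2,3) open_contains_cball by blast
  show ?thesis
  proof (rule that[of "min (d / 2) d'"])
    show "min (d / 2) d' > 0" using d d' by simp
    show "cball p0 (min (d / 2) d') \<subseteq> N" using d' by auto
    show "norm (h p - h p0) < e" if "p \<in> unit_square \<inter> cball p0 (min (d / 2) d')" for p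
      using d(2)[of p] that d(1) by (auto simp: dist_norm norm_minus_commute)
  qed
qed

text \<open>Near each point the projector is an integral of the resolvent over one fixed loop, and
  the resolvent is as smooth as \<open>H\<close>.\<close>

lemma P_C3: "Ck_on 3 unit_square (\<lambda>p. P (snd p) (fst p))"
proof (rule Ck_on_local)
  fix p0 assume p0: "p0 \<in> unit_square"
  obtain N \<eta> \<delta> where N: "open N" "p0 \<in> N" "polynomial_function \<eta>" "\<delta> > 0"
    "\<And>p B. p \<in> unit_square \<inter> N \<Longrightarrow> clin B \<Longrightarrow> norm (B - h p0) < \<delta> \<Longrightarrow>
       path_image \<eta> \<inter> op_spectrum B = {} \<and>
       spectral_projector B (\<gamma> (snd p) (fst p)) = spectral_projector B \<eta> \<and>
       spectral_projector B \<eta> o\<^sub>L spectral_projector B \<eta> = spectral_projector B \<eta>"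
    using common_loop[OF p0] by blast
  obtain r where r: "r > 0" "cball p0 r \<subseteq> N" "\<And>p. p \<in> unit_square \<inter> cball p0 r \<Longrightarrow> norm (h p - h p0) < \<delta>"
    using h_near[OF p0 N(1,2,4)] by blast
  let ?S = "unit_square \<inter> ball p0 r"
  have sub: "?S \<subseteq> unit_square \<inter> cball p0 r" by auto
  have loc: "path_image \<eta> \<inter> op_spectrum (h p) = {} \<and> P (snd p) (fst p) = spectral_projector (h p) \<eta>" if "p \<in> ?S" for p
  proof -
    have "p \<in> unit_square \<inter> N" "clin (h p)" "norm (h p - h p0) < \<delta>"
      using that sub r(2) by (auto intro!: h_clin r(3))
    from N(5)[OF this] show ?thesis
      by (simp add: P_def h_def)
  qed
  \<comment> \<open>The first component is the loop parameter over which the integral runs; the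
    second is a dummy parameter with a single value.\<close>
  let ?T = "{0..1} \<times> {0::real}"
  have "Ckp 3 ?S ?T (\<lambda>p e. resolvent (h p) (\<eta> (fst e)))"
  proof (rule Ckp_resolvent)
    show "Ckp 3 ?S ?T (\<lambda>p e. h p)"
      by (rule Ckp_subset[OF Ck_on_imp_Ckp[OF h_C3]]) auto
    show "continuous_on ?T (\<lambda>e. \<eta> (fst e))"
      by (rule continuous_on_compose2[OF polynomial_path_deriv01(2)[OF N(3)] continuous_on_fst[OF continuous_on_id]]) auto
    show "\<eta> (fst e) \<notin> op_spectrum (h p)" if "p \<in> ?S" "e \<in> ?T" for p e
      using loc[OF that(1)] that(2) by (auto simp: path_image_def)
  qed
  from Ckp_loop_integral[OF this _ N(3)]
  have "Ckp 3 ?S {0::real} (\<lambda>p e. loop_integral \<eta> (\<lambda>x. resolvent (h p) (\<eta> x)))"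
    by (simp add: convex_Int convex_Times)
  then have "Ck_on 3 ?S (\<lambda>p. spectral_projector (h p) \<eta>)"
    unfolding spectral_projector_loop_integral by (rule Ckp_imp_Ck_on) simp
  then have "Ck_on 3 ?S (\<lambda>p. P (snd p) (fst p))"
    by (rule Ck_on_cong) (use loc in auto)
  then show "\<exists>N. open N \<and> p0 \<in> N \<and> Ck_on 3 (unit_square \<inter> N) (\<lambda>p. P (snd p) (fst p))"
    using r(1) by (intro exI[of _ "ball p0 r"]) auto
qed

lemma P_projector:
  assumes "\<alpha> \<in> {0..1}" "t \<in> {0..1}"
  shows "clin (P \<alpha> t)" "P \<alpha> t o\<^sub>L H \<alpha> t = H \<alpha> t o\<^sub>L P \<alpha> t" "P \<alpha> t o\<^sub>L P \<alpha> t = P \<alpha> t"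
proof -
  let ?p = "(t, \<alpha>)"
  have p: "?p \<in> unit_square" using assms by auto
  obtain N \<eta> \<delta> where N: "open N" "?p \<in> N" "polynomial_function \<eta>" "\<delta> > 0"
    "\<And>p B. p \<in> unit_square \<inter> N \<Longrightarrow> clin B \<Longrightarrow> norm (B - h ?p) < \<delta> \<Longrightarrow>
       path_image \<eta> \<inter> op_spectrum B = {} \<and>
       spectral_projector B (\<gamma> (snd p) (fst p)) = spectral_projector B \<eta> \<and>
       spectral_projector B \<eta> o\<^sub>L spectral_projector B \<eta> = spectral_projector B \<eta>"
    using common_loop[OF p] by blast
  have *: "path_image \<eta> \<inter> op_spectrum (H \<alpha> t) = {}" "P \<alpha> t = spectral_projector (H \<alpha> t) \<eta>"
    "P \<alpha> t o\<^sub>L P \<alpha> t = P \<alpha> t"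
    using N(5)[of ?p "h ?p"] p N(2,4) h_clin[OF p] by (auto simp: h_def P_def)
  show "clin (P \<alpha> t)" "P \<alpha> t o\<^sub>L H \<alpha> t = H \<alpha> t o\<^sub>L P \<alpha> t"
    using spectral_projector_polynomial[OF _ N(3) *(1)] h_clin[OF p] *(2) by (simp_all add: h_def)
  show "P \<alpha> t o\<^sub>L P \<alpha> t = P \<alpha> t" by (rule *(3))
qed

definition dP :: "real \<Rightarrow> real \<Rightarrow> 'a \<Rightarrow>\<^sub>L 'a" where "dP \<alpha> = deriv01 (P \<alpha>)"
definition ddP :: "real \<Rightarrow> real \<Rightarrow> 'a \<Rightarrow>\<^sub>L 'a" where "ddP \<alpha> = deriv01 (dP \<alpha>)"

lemma numeral_Suc_unfold: "(3::nat) = Suc 2" "(2::nat) = Suc 1" "(1::nat) = Suc 0"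
  by auto

lemma dP_C2: "Ck_on 2 unit_square (\<lambda>p. dP (snd p) (fst p))"
  using Ck_on_square_partials(1)[OF P_C3[unfolded numeral_Suc_unfold(1)]]
  by (simp add: pd1_def[abs_def] dP_def)

lemma ddP_C1: "Ck_on 1 unit_square (\<lambda>p. ddP (snd p) (fst p))"
  using Ck_on_square_partials(1)[OF dP_C2[unfolded numeral_Suc_unfold(2)]]
  by (simp add: pd1_def[abs_def] ddP_def)

lemma Ck_on_section:
  assumes "Ck_on (Suc k) unit_square f" "\<alpha> \<in> {0..1}" "t \<in> {0..1}"
  shows "((\<lambda>t. f (t, \<alpha>)) has_vector_derivative pd1 f (t, \<alpha>)) (at t within {0..1})"
    and "((\<lambda>a. f (t, a)) has_vector_derivative pd2 f (t, \<alpha>)) (at \<alpha> within {0..1})"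
proof -
  have "(t, \<alpha>) \<in> unit_square" using assms by auto
  from partial_derivatives(1,2)[where N = UNIV, unfolded Int_UNIV_right, OF Ck_on_square_partials(3)[OF assms(1) this] open_UNIV this]
  show "((\<lambda>t. f (t, \<alpha>)) has_vector_derivative pd1 f (t, \<alpha>)) (at t within {0..1})"
    "((\<lambda>a. f (t, a)) has_vector_derivative pd2 f (t, \<alpha>)) (at \<alpha> within {0..1})"
    by auto
qed

lemma Ck_on_section_continuous:
  assumes "Ck_on k unit_square f" "\<alpha> \<in> {0..1}"
  shows "continuous_on {0..1} (\<lambda>t. f (t, \<alpha>))"
  by (rule continuous_on_compose2[OF Ck_on_continuous[OF assms(1)]]) (use assms in \<open>auto intro!: continuous_intros\<close>)

lemma P_derivatives:
  assumes "\<alpha> \<in> {0..1}"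
  shows "t \<in> {0..1} \<Longrightarrow> (P \<alpha> has_vector_derivative dP \<alpha> t) (at t within {0..1})"
    and "t \<in> {0..1} \<Longrightarrow> (dP \<alpha> has_vector_derivative ddP \<alpha> t) (at t within {0..1})"
    and "continuous_on {0..1} (ddP \<alpha>)"
  using Ck_on_section(1)[OF P_C3[unfolded numeral_Suc_unfold(1)] assms, of t]
    Ck_on_section(1)[OF dP_C2[unfolded numeral_Suc_unfold(2)] assms, of t] Ck_on_section_continuous[OF ddP_C1 assms]
  by (simp_all add: pd1_def dP_def ddP_def)

lemma K_eq: "K \<alpha> t = \<i> *\<^sub>C ((dP \<alpha> t o\<^sub>L P \<alpha> t) - (P \<alpha> t o\<^sub>L dP \<alpha> t))"
  by (simp add: K_def commutator_def dP_def)

lemma Ckp_K_expr: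
  fixes A B :: "real \<times> real \<Rightarrow> 'a \<Rightarrow>\<^sub>L 'a"
  assumes "Ck_on k S A" "Ck_on k S B"
  shows "Ck_on k S (\<lambda>p. \<i> *\<^sub>C ((A p o\<^sub>L B p) - (B p o\<^sub>L A p)))"
proof -
  note AB = Ck_on_imp_Ckp[OF assms(1), of "{0 :: real}"] Ck_on_imp_Ckp[OF assms(2), of "{0 :: real}"]
  from Ckp_linear[OF bounded_bilinear.bounded_linear_right[OF bounded_bilinear_scaleC]
      Ckp_diff[OF Ckp_compose[OF AB] Ckp_compose[OF AB(2,1)]], of \<i>]
  show ?thesis
    by (rule Ckp_imp_Ck_on) simp
qed

lemma K_C2: "Ck_on 2 unit_square (\<lambda>p. K (snd p) (fst p))"
  unfolding K_eq by (rule Ckp_K_expr[OF dP_C2 Ck_on_Suc_imp[OF P_C3[unfolded numeral_Suc_unfold(1)]]])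

lemma dP_clin:
  assumes "\<alpha> \<in> {0..1}" "t \<in> {0..1}"
  shows "clin (dP \<alpha> t)"
proof (rule clin_has_vector_derivative[OF P_derivatives(1)[OF assms] assms(2)])
  show "at t within {0..1} \<noteq> bot"
    using assms(2) by (simp add: trivial_limit_within islimpt_Icc)
  show "clin (P \<alpha> s)" if "s \<in> {0..1}" for s
    by (rule P_projector(1)[OF assms(1) that])
qed

lemma K_clin: "\<alpha> \<in> {0..1} \<Longrightarrow> t \<in> {0..1} \<Longrightarrow> clin (K \<alpha> t)"
  unfolding K_eq by (intro clin_simps dP_clin P_projector(1))

end

section \<open>The corrected projector \<open>P1\<close> and its distance from
  \<open>P\<close>\<close>

lemma uniform_on_interval:
  fixes \<Phi> :: "real \<Rightarrow> real \<Rightarrow> real \<Rightarrow> bool"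
  assumes mono: "\<And>C C' \<epsilon> s. \<Phi> C \<epsilon> s \<Longrightarrow> C \<le> C' \<Longrightarrow> 0 < \<epsilon> \<Longrightarrow> \<Phi> C' \<epsilon> s"
    and loc: "\<And>t. t \<in> {0..1} \<Longrightarrow> \<exists>r>0. \<exists>e>0. \<exists>C. \<forall>\<epsilon> s. 0 < \<epsilon> \<longrightarrow> \<epsilon> \<le> e \<longrightarrow> s \<in> {0..1} \<longrightarrow> \<bar>s - t\<bar> < r \<longrightarrow> \<Phi> C \<epsilon> s"
  shows "\<exists>e>0. \<exists>C. \<forall>\<epsilon> s. 0 < \<epsilon> \<longrightarrow> \<epsilon> \<le> e \<longrightarrow> s \<in> {0..1} \<longrightarrow> \<Phi> C \<epsilon> s"
proof -
  \<comment> \<open>Bisection in place of a finite subcover: on adjacent intervals the smaller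
    threshold and the larger constant serve both, the latter by monotonicity in
    \<open>C\<close>.\<close>
  let ?P = "\<lambda>a b. \<exists>e>0. \<exists>C. \<forall>\<epsilon> s. 0 < \<epsilon> \<longrightarrow> \<epsilon> \<le> e \<longrightarrow> s \<in> {0..1} \<inter> {a..b} \<longrightarrow> \<Phi> C \<epsilon> s"
  have "?P 0 (1::real)"
  proof (rule Bolzano[where P = ?P])
    fix a b c :: real
    assume "?P a b" "?P b c" "a \<le> b" "b \<le> c"
    then obtain e1 C1 e2 C2 where e: "e1 > 0" "e2 > 0"
      "\<And>\<epsilon> s. 0 < \<epsilon> \<Longrightarrow> \<epsilon> \<le> e1 \<Longrightarrow> s \<in> {0..1} \<inter> {a..b} \<Longrightarrow> \<Phi> C1 \<epsilon> s"
      "\<And>\<epsilon> s. 0 < \<epsilon> \<Longrightarrow> \<epsilon> \<le> e2 \<Longrightarrow> s \<in> {0..1} \<inter> {b..c} \<Longrightarrow> \<Phi> C2 \<epsilon> s"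
      by blast
    show "?P a c"
    proof (rule exI[of _ "min e1 e2"], rule conjI, goal_cases)
      case 1
      show ?case using e by simp
    next
      case 2
      show ?case
      proof (rule exI[of _ "max C1 C2"], intro allI impI)
      fix \<epsilon> s :: real
      assume *: "0 < \<epsilon>" "\<epsilon> \<le> min e1 e2" "s \<in> {0..1} \<inter> {a..c}"
      show "\<Phi> (max C1 C2) \<epsilon> s"
      proof (cases "s \<le> b")
        case True
        then show ?thesis
          using * by (intro mono[OF e(3)[of \<epsilon> s]]) auto
      next
        case False
        then show ?thesis
          using * by (intro mono[OF e(4)[of \<epsilon> s]]) auto
      qed
      qed
    qed
  next
    fix x :: real assume "0 \<le> x" "x \<le> 1"
    then have "x \<in> {0..1}" by simp
    from loc[OF this] obtain r e C where r: "r > 0" "e > 0"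
      "\<And>\<epsilon> s. 0 < \<epsilon> \<Longrightarrow> \<epsilon> \<le> e \<Longrightarrow> s \<in> {0..1} \<Longrightarrow> \<bar>s - x\<bar> < r \<Longrightarrow> \<Phi> C \<epsilon> s"
      by blast
    show "\<exists>d>0. \<forall>a b. a \<le> x \<and> x \<le> b \<and> b - a < d \<longrightarrow> ?P a b"
    proof (rule exI[of _ r], rule conjI[OF r(1)], rule allI, rule allI, rule impI)
      fix a b assume ab: "a \<le> x \<and> x \<le> b \<and> b - a < r"
      show "?P a b"
        using r(3) ab by - (rule exI[of _ e], rule conjI[OF r(2)], rule exI[of _ C], auto)
    qed
  qed simp
  then show ?thesis by simp
qed

lemma Ckp_compact_bound:
  assumes "Ckp k S T f" "compact S" "compact T"
  shows "\<exists>C\<ge>0. \<forall>p\<in>S. \<forall>e\<in>T. norm (f p e) \<le> C"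
proof -
  have "bounded ((\<lambda>x. f (fst x) (snd x)) ` (S \<times> T))"
    by (intro compact_imp_bounded compact_continuous_image Ckp_continuous[OF assms(1)] compact_Times assms)
  then obtain C where "C > 0" "\<And>x. x \<in> S \<times> T \<Longrightarrow> norm (f (fst x) (snd x)) \<le> C"
    unfolding bounded_pos by blast
  then show ?thesis
    by (intro exI[of _ C]) auto
qed

text \<open>Makes the factor \<open>e\<close> explicit. Integrated over a loop it shows that
  \<open>P1 - P\<close> is \<epsilon> times a smooth family, so the difference of derivatives is of
  order \<epsilon> as well.\<close>

lemma resolvent_perturbation:
  assumes "z \<notin> op_spectrum A" "z \<notin> op_spectrum (A - e *\<^sub>R B)"
  shows "resolvent (A - e *\<^sub>R B) z - resolvent A z = e *\<^sub>R (resolvent A z o\<^sub>L B o\<^sub>L resolvent (A - e *\<^sub>R B) z)"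
proof -
  have "resolvent A z - resolvent (A - e *\<^sub>R B) z =
      - (resolvent A z o\<^sub>L ((A - z *\<^sub>C id_blinfun) - (A - e *\<^sub>R B - z *\<^sub>C id_blinfun)) o\<^sub>L resolvent (A - e *\<^sub>R B) z)"
    unfolding resolvent_def by (rule op_inverse_diff) (use assms in \<open>auto simp: not_in_spectrum_iff\<close>)
  also have "(A - z *\<^sub>C id_blinfun) - (A - e *\<^sub>R B - z *\<^sub>C id_blinfun) = e *\<^sub>R B"
    by simp
  finally show ?thesis
    unfolding blinfun_compose_linear by (metis minus_diff_eq minus_minus)
qed

context gapped_family
begin

definition dP1 :: "real \<Rightarrow> real \<Rightarrow> real \<Rightarrow> 'a \<Rightarrow>\<^sub>L 'a" where "dP1 \<alpha> \<epsilon> = deriv01 (P1 \<alpha> \<epsilon>)"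
definition ddP1 :: "real \<Rightarrow> real \<Rightarrow> real \<Rightarrow> 'a \<Rightarrow>\<^sub>L 'a" where "ddP1 \<alpha> \<epsilon> = deriv01 (dP1 \<alpha> \<epsilon>)"

text \<open>Collects the pointwise facts about \<open>P1\<close> with a single constant and in a
  form monotone in it, so that one compactness argument makes all of them uniform in time. The
  second derivative is included because an oscillatory integral of \<open>E\<close>, which contains
  the first derivative, is integrated by parts.\<close>

definition P1_close :: "real \<Rightarrow> real \<Rightarrow> real \<Rightarrow> real \<Rightarrow> bool" where
  "P1_close \<alpha> C \<epsilon> s \<longleftrightarrow>
     clin (P1 \<alpha> \<epsilon> s) \<and> P1 \<alpha> \<epsilon> s o\<^sub>L P1 \<alpha> \<epsilon> s = P1 \<alpha> \<epsilon> s \<and>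
     P1 \<alpha> \<epsilon> s o\<^sub>L (H \<alpha> s - \<epsilon> *\<^sub>R K \<alpha> s) = (H \<alpha> s - \<epsilon> *\<^sub>R K \<alpha> s) o\<^sub>L P1 \<alpha> \<epsilon> s \<and>
     (P1 \<alpha> \<epsilon> has_vector_derivative dP1 \<alpha> \<epsilon> s) (at s within {0..1}) \<and>
     (dP1 \<alpha> \<epsilon> has_vector_derivative ddP1 \<alpha> \<epsilon> s) (at s within {0..1}) \<and>
     continuous (at s within {0..1}) (ddP1 \<alpha> \<epsilon>) \<and>
     norm (P1 \<alpha> \<epsilon> s - P \<alpha> s) \<le> C * \<epsilon> \<and> norm (dP1 \<alpha> \<epsilon> s - dP \<alpha> s) \<le> C * \<epsilon> \<and>
     norm (ddP1 \<alpha> \<epsilon> s - ddP \<alpha> s) \<le> C * \<epsilon>"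

text \<open>Near the given time both projectors are integrals over the same polynomial loop, so that
  \<open>P1 = P + \<epsilon> *\<^sub>R F\<close>. Here \<open>F\<close> is defined for \<epsilon> =
  0 too, and it and its first two time derivatives are bounded on a compact set of times and
  parameters.\<close>

lemma P1_close_local:
  assumes \<alpha>: "\<alpha> \<in> {0..1}" and t0: "t0 \<in> {0..1}"
  shows "\<exists>r>0. \<exists>e>0. \<exists>C. \<forall>\<epsilon> s. 0 < \<epsilon> \<longrightarrow> \<epsilon> \<le> e \<longrightarrow> s \<in> {0..1} \<longrightarrow> \<bar>s - t0\<bar> < r \<longrightarrow> P1_close \<alpha> C \<epsilon> s"
proof -
  let ?p0 = "(t0, \<alpha>)"
  define k where "k p = K (snd p) (fst p)" for p
  have kC2: "Ck_on 2 unit_square k"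
    using K_C2 by (simp add: k_def[abs_def])
  have p0: "?p0 \<in> unit_square" using assms by auto
  obtain N \<eta> \<delta> where N: "open N" "?p0 \<in> N" "polynomial_function \<eta>" "\<delta> > 0"
    "\<And>p B. p \<in> unit_square \<inter> N \<Longrightarrow> clin B \<Longrightarrow> norm (B - h ?p0) < \<delta> \<Longrightarrow>
       path_image \<eta> \<inter> op_spectrum B = {} \<and>
       spectral_projector B (\<gamma> (snd p) (fst p)) = spectral_projector B \<eta> \<and>
       spectral_projector B \<eta> o\<^sub>L spectral_projector B \<eta> = spectral_projector B \<eta>"
    using common_loop[OF p0] by blast
  have \<delta>2: "\<delta> / 2 > 0" using N(4) by simp
  obtain r where r: "r > 0" "cball ?p0 r \<subseteq> N" "\<And>p. p \<in> unit_square \<inter> cball ?p0 r \<Longrightarrow> norm (h p - h ?p0) < \<delta> / 2"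
    using h_near[OF p0 N(1,2) \<delta>2] by blast
  have "bounded (k ` unit_square)"
    by (intro compact_imp_bounded compact_continuous_image Ck_on_continuous[OF kC2] compact_Times) auto
  then obtain \<kappa> where \<kappa>: "\<kappa> > 0" "\<And>p. p \<in> unit_square \<Longrightarrow> norm (k p) \<le> \<kappa>"
    unfolding bounded_pos by blast
  \<comment> \<open>Half of the tolerance \<delta> is spent on the variation of \<open>h\<close>,
    the other half on \<epsilon> times the bound \<kappa> of \<open>k\<close>.\<close>
  define e where "e = \<delta> / (2 * \<kappa>)"
  have e: "e > 0" using N(4) \<kappa> by (simp add: e_def)
  \<comment> \<open>Compact for the bounds on \<open>F\<close> and convex for differentiation under
    the integral. Time derivatives are taken in the open ball inside.\<close>
  define S where "S = unit_square \<inter> cball ?p0 r"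
  define T where "T = {0..e}"
  have cS: "compact S" "convex S"
    unfolding S_def by (auto intro!: compact_Int_closed compact_Times convex_Int convex_Times)
  have cT: "compact T" by (simp add: T_def)
  define B where "B p x = h p - x *\<^sub>R k p" for p x
  have clk: "clin (k p)" "clin (h p)" "clin (B p x)" if "p \<in> S" for p x
    using that K_clin h_clin[of p] unfolding B_def k_def S_def by auto
  have near: "norm (B p x - h ?p0) < \<delta>" if "p \<in> S" "x \<in> T" for p x
  proof -
    have "norm (x *\<^sub>R k p) \<le> e * \<kappa>"
      using that \<kappa>(2)[of p] e by (auto simp: T_def S_def intro!: mult_mono)
    also have "\<dots> = \<delta> / 2" using \<kappa> by (simp add: e_def)
    finally have 1: "norm (x *\<^sub>R k p) \<le> \<delta> / 2" .
    have eq: "B p x - h ?p0 = (h p - h ?p0) - x *\<^sub>R k p" by (simp add: B_def)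
    have 2: "norm (h p - h ?p0) < \<delta> / 2"
      using that(1) unfolding S_def by (rule r(3))
    have "norm (B p x - h ?p0) \<le> norm (h p - h ?p0) + norm (x *\<^sub>R k p)"
      unfolding eq by (rule norm_triangle_ineq4)
    then show ?thesis
      using 1 2 by linarith
  qed
  have loop: "path_image \<eta> \<inter> op_spectrum (B p x) = {}"
      "spectral_projector (B p x) (\<gamma> (snd p) (fst p)) = spectral_projector (B p x) \<eta>"
      "spectral_projector (B p x) \<eta> o\<^sub>L spectral_projector (B p x) \<eta> = spectral_projector (B p x) \<eta>"
    if "p \<in> S" "x \<in> T" for p x
  proof -
    have "p \<in> unit_square \<inter> N" using that r(2) by (auto simp: S_def)
    from N(5)[OF this clk(3)[OF that(1)] near[OF that]]
    show "path_image \<eta> \<inter> op_spectrum (B p x) = {}"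
      "spectral_projector (B p x) (\<gamma> (snd p) (fst p)) = spectral_projector (B p x) \<eta>"
      "spectral_projector (B p x) \<eta> o\<^sub>L spectral_projector (B p x) \<eta> = spectral_projector (B p x) \<eta>"
      by blast+
  qed
  have out: "\<eta> y \<notin> op_spectrum (B p x)" if "p \<in> S" "x \<in> T" "y \<in> {0..1}" for p x y
    using loop(1)[OF that(1,2)] that(3) unfolding path_image_def by (meson disjoint_iff imageI)
  have B0: "B p 0 = h p" for p by (simp add: B_def)
  have T0: "0 \<in> T" using e by (simp add: T_def)
  have outh: "\<eta> y \<notin> op_spectrum (h p)" if "p \<in> S" "y \<in> {0..1}" for p y
    using out[OF that(1) T0 that(2)] by (simp add: B0)
  define F where "F p x = loop_integral \<eta> (\<lambda>y. resolvent (h p) (\<eta> y) o\<^sub>L k p o\<^sub>L resolvent (B p x) (\<eta> y))" for p x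
  \<comment> \<open>Two derivatives are available because \<open>k\<close> contains one time
    derivative of the projector, which is of class C^3.\<close>
  have FC2: "Ckp 2 S T F"
  proof -
    let ?T = "{0..1} \<times> T"
    have c\<eta>: "continuous_on ?T (\<lambda>e. \<eta> (fst e))"
      by (rule continuous_on_compose2[OF polynomial_path_deriv01(2)[OF N(3)] continuous_on_fst[OF continuous_on_id]]) auto
    have hC: "Ckp 2 S ?T (\<lambda>p e. h p)"
      using Ckp_subset[OF Ck_on_imp_Ckp[OF Ck_on_Suc_imp[OF h_C3[unfolded numeral_Suc_unfold(1)]]], of S ?T ?T] by (auto simp: S_def)
    have kC: "Ckp 2 S ?T (\<lambda>p e. k p)"
      using Ckp_subset[OF Ck_on_imp_Ckp[OF kC2], of S ?T ?T] by (auto simp: S_def)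
    have sC: "Ckp 2 S ?T (\<lambda>p e. snd e)"
      by (rule Ckp_param) (rule continuous_on_snd[OF continuous_on_id])
    have BC: "Ckp 2 S ?T (\<lambda>p e. B p (snd e))"
      unfolding B_def by (rule Ckp_diff[OF hC Ckp_scaleR[OF sC kC]])
    have "Ckp 2 S ?T (\<lambda>p e. resolvent (h p) (\<eta> (fst e)))"
      by (rule Ckp_resolvent[OF hC c\<eta>]) (use outh in auto)
    moreover have "Ckp 2 S ?T (\<lambda>p e. resolvent (B p (snd e)) (\<eta> (fst e)))"
      by (rule Ckp_resolvent[OF BC c\<eta>]) (use out in auto)
    ultimately have "Ckp 2 S ?T (\<lambda>p e. resolvent (h p) (\<eta> (fst e)) o\<^sub>L k p o\<^sub>L resolvent (B p (snd e)) (\<eta> (fst e)))"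
      by (intro Ckp_compose kC)
    from Ckp_loop_integral[OF this cS(2) N(3)] show ?thesis
      by (simp add: F_def[abs_def])
  qed
  obtain F1 F2 where F1': "\<forall>p\<in>S. \<forall>x\<in>T.
      ((\<lambda>p. F p x) has_derivative (\<lambda>h. fst h *\<^sub>R F1 p x + snd h *\<^sub>R F2 p x)) (at p within S)"
      "Ckp 1 S T F1"
    using FC2[unfolded numeral_Suc_unfold(2), unfolded Ckp.simps(2)] by (elim conjE exE) (rule that)
  have F1: "\<And>p x. p \<in> S \<Longrightarrow> x \<in> T \<Longrightarrow>
      ((\<lambda>p. F p x) has_derivative (\<lambda>h. fst h *\<^sub>R F1 p x + snd h *\<^sub>R F2 p x)) (at p within S)" "Ckp 1 S T F1"
    using F1' by blast+
  obtain F11 F12 where F11': "\<forall>p\<in>S. \<forall>x\<in>T.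
      ((\<lambda>p. F1 p x) has_derivative (\<lambda>h. fst h *\<^sub>R F11 p x + snd h *\<^sub>R F12 p x)) (at p within S)"
      "Ckp 0 S T F11"
    using F1(2)[unfolded numeral_Suc_unfold(3), unfolded Ckp.simps(2)] by (elim conjE exE) (rule that)
  have F11: "\<And>p x. p \<in> S \<Longrightarrow> x \<in> T \<Longrightarrow>
      ((\<lambda>p. F1 p x) has_derivative (\<lambda>h. fst h *\<^sub>R F11 p x + snd h *\<^sub>R F12 p x)) (at p within S)" "Ckp 0 S T F11"
    using F11' by blast+
  obtain C0 where C0': "C0 \<ge> 0" "\<forall>p\<in>S. \<forall>x\<in>T. norm (F p x) \<le> C0"
    using Ckp_compact_bound[OF FC2 cS(1) cT] by (elim exE conjE) (rule that)
  have C0: "C0 \<ge> 0" "\<And>p x. p \<in> S \<Longrightarrow> x \<in> T \<Longrightarrow> norm (F p x) \<le> C0"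
    using C0' by blast+
  obtain C1 where C1': "C1 \<ge> 0" "\<forall>p\<in>S. \<forall>x\<in>T. norm (F1 p x) \<le> C1"
    using Ckp_compact_bound[OF F1(2) cS(1) cT] by (elim exE conjE) (rule that)
  have C1: "C1 \<ge> 0" "\<And>p x. p \<in> S \<Longrightarrow> x \<in> T \<Longrightarrow> norm (F1 p x) \<le> C1"
    using C1' by blast+
  obtain C2 where C2': "C2 \<ge> 0" "\<forall>p\<in>S. \<forall>x\<in>T. norm (F11 p x) \<le> C2"
    using Ckp_compact_bound[OF F11(2) cS(1) cT] by (elim exE conjE) (rule that)
  have C2: "C2 \<ge> 0" "\<And>p x. p \<in> S \<Longrightarrow> x \<in> T \<Longrightarrow> norm (F11 p x) \<le> C2"
    using C2' by blast+
  note C = C0 C1 C2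
  let ?I = "{s \<in> {0..1}. \<bar>s - t0\<bar> < r}"
  have inS: "(s, \<alpha>) \<in> S" "(s, \<alpha>) \<in> unit_square \<inter> ball ?p0 r" if "s \<in> ?I" for s
    using that \<alpha> by (auto simp: S_def dist_Pair_Pair dist_real_def abs_minus_commute)
  have der: "((\<lambda>s. G (s, \<alpha>) x) has_vector_derivative G1 (s, \<alpha>) x) (at s within {0..1})"
    if G: "\<And>p x. p \<in> S \<Longrightarrow> x \<in> T \<Longrightarrow>
      ((\<lambda>p. G p x) has_derivative (\<lambda>h. fst h *\<^sub>R G1 p x + snd h *\<^sub>R G2 p x)) (at p within S)"
      and s: "s \<in> ?I" and x: "x \<in> T" for G G1 G2 :: "real \<times> real \<Rightarrow> real \<Rightarrow> 'a \<Rightarrow>\<^sub>L 'a" and s x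
  proof -
    have "((\<lambda>p. G p x) has_derivative (\<lambda>h. fst h *\<^sub>R G1 (s, \<alpha>) x + snd h *\<^sub>R G2 (s, \<alpha>) x)) (at (s, \<alpha>) within unit_square \<inter> ball ?p0 r)"
      by (rule has_derivative_subset[OF G[OF inS(1)[OF s] x]]) (auto simp: S_def)
    from partial_derivatives(1)[OF this open_ball inS(2)[OF s]] show ?thesis by simp
  qed
  have nbhd: "\<exists>d>0. \<forall>s'\<in>{0..1}. dist s' s < d \<longrightarrow> s' \<in> ?I" if "s \<in> ?I" for s
    using that by (intro exI[of _ "r - \<bar>s - t0\<bar>"]) (auto simp: dist_real_def)
  show ?thesis
  proof (rule exI[of _ r], rule conjI[OF r(1)], rule exI[of _ e], rule conjI[OF e],
      rule exI[of _ "max C0 (max C1 C2)"], intro allI impI)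
    fix \<epsilon> s0 :: real
    assume \<epsilon>: "0 < \<epsilon>" "\<epsilon> \<le> e" and "s0 \<in> {0..1}" "\<bar>s0 - t0\<bar> < r"
    then have s0: "s0 \<in> ?I" and s01: "s0 \<in> {0..1}" by auto
    have \<epsilon>T: "\<epsilon> \<in> T" using \<epsilon> by (simp add: T_def)
    have P1_eq: "P1 \<alpha> \<epsilon> s = spectral_projector (B (s, \<alpha>) \<epsilon>) \<eta>" if "s \<in> ?I" for s
      using loop(2)[OF inS(1)[OF that] \<epsilon>T] by (simp add: P1_def B_def h_def k_def)
    have P_eq: "P \<alpha> s = spectral_projector (h (s, \<alpha>)) \<eta>" if "s \<in> ?I" for s
      using loop(2)[OF inS(1)[OF that] T0] by (simp add: P_def B0 h_def)
    have P1_F: "P1 \<alpha> \<epsilon> s = P \<alpha> s + \<epsilon> *\<^sub>R F (s, \<alpha>) \<epsilon>" if s: "s \<in> ?I" for s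
    proof -
      let ?p = "(s, \<alpha>)"
      note p = inS(1)[OF s]
      have c: "continuous_on {0..1} (\<lambda>y. resolvent (B ?p \<epsilon>) (\<eta> y))" "continuous_on {0..1} (\<lambda>y. resolvent (h ?p) (\<eta> y))"
        using out[OF p \<epsilon>T] outh[OF p]
        by (intro continuous_on_resolvent continuous_on_const polynomial_path_deriv01(2)[OF N(3)]; blast)+
      have "P1 \<alpha> \<epsilon> s - P \<alpha> s = loop_integral \<eta> (\<lambda>y. resolvent (B ?p \<epsilon>) (\<eta> y) - resolvent (h ?p) (\<eta> y))"
        unfolding P1_eq[OF s] P_eq[OF s] spectral_projector_loop_integral
        by (rule loop_integral_diff[OF N(3) c, symmetric])
      also have "\<dots> = loop_integral \<eta> (\<lambda>y. \<epsilon> *\<^sub>R (resolvent (h ?p) (\<eta> y) o\<^sub>L k ?p o\<^sub>L resolvent (B ?p \<epsilon>) (\<eta> y)))"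
      proof (rule loop_integral_cong)
        fix y :: real assume y: "y \<in> {0..1}"
        show "resolvent (B ?p \<epsilon>) (\<eta> y) - resolvent (h ?p) (\<eta> y) =
            \<epsilon> *\<^sub>R (resolvent (h ?p) (\<eta> y) o\<^sub>L k ?p o\<^sub>L resolvent (B ?p \<epsilon>) (\<eta> y))"
          unfolding B_def by (rule resolvent_perturbation[OF outh[OF p y] out[OF p \<epsilon>T y, unfolded B_def]])
      qed
      finally show ?thesis
        by (simp add: loop_integral_scaleR F_def algebra_simps)
    qed
    \<comment> \<open>The formula for \<open>P1\<close> holds for all times in a relative
      neighbourhood of \<open>s\<close>, which is what differentiating it requires; the same holds
      one order higher below.\<close>
    have d1: "(P1 \<alpha> \<epsilon> has_vector_derivative dP \<alpha> s + \<epsilon> *\<^sub>R F1 (s, \<alpha>) \<epsilon>) (at s within {0..1})" if s: "s \<in> ?I" for s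
    proof -
      have s01: "s \<in> {0..1}" using s by simp
      obtain d where d: "d > 0" "\<And>s'. s' \<in> {0..1} \<Longrightarrow> dist s' s < d \<Longrightarrow> s' \<in> ?I"
        using nbhd[OF s] by blast
      show ?thesis
      proof (rule has_vector_derivative_transform_within[OF _ d(1) s01])
        show "((\<lambda>s. P \<alpha> s + \<epsilon> *\<^sub>R F (s, \<alpha>) \<epsilon>) has_vector_derivative dP \<alpha> s + \<epsilon> *\<^sub>R F1 (s, \<alpha>) \<epsilon>) (at s within {0..1})"
          by (intro has_vector_derivative_add P_derivatives(1)[OF \<alpha> s01]
              bounded_linear.has_vector_derivative[OF bounded_linear_scaleR_right] der[OF F1(1) s \<epsilon>T])
        show "P \<alpha> s' + \<epsilon> *\<^sub>R F (s', \<alpha>) \<epsilon> = P1 \<alpha> \<epsilon> s'" if "s' \<in> {0..1}" "dist s' s < d" for s'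
          using P1_F[OF d(2)[OF that]] by simp
      qed
    qed
    have e1: "dP1 \<alpha> \<epsilon> s = dP \<alpha> s + \<epsilon> *\<^sub>R F1 (s, \<alpha>) \<epsilon>" if s: "s \<in> ?I" for s
      unfolding dP1_def by (rule deriv01_eqI[OF d1[OF s]]) (use s in simp)
    have d2: "(dP1 \<alpha> \<epsilon> has_vector_derivative ddP \<alpha> s + \<epsilon> *\<^sub>R F11 (s, \<alpha>) \<epsilon>) (at s within {0..1})" if s: "s \<in> ?I" for s
    proof -
      have s01: "s \<in> {0..1}" using s by simp
      obtain d where d: "d > 0" "\<And>s'. s' \<in> {0..1} \<Longrightarrow> dist s' s < d \<Longrightarrow> s' \<in> ?I"
        using nbhd[OF s] by blast
      show ?thesis
      proof (rule has_vector_derivative_transform_within[OF _ d(1) s01])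
        show "((\<lambda>s. dP \<alpha> s + \<epsilon> *\<^sub>R F1 (s, \<alpha>) \<epsilon>) has_vector_derivative ddP \<alpha> s + \<epsilon> *\<^sub>R F11 (s, \<alpha>) \<epsilon>) (at s within {0..1})"
          by (intro has_vector_derivative_add P_derivatives(2)[OF \<alpha> s01]
              bounded_linear.has_vector_derivative[OF bounded_linear_scaleR_right] der[OF F11(1) s \<epsilon>T])
        show "dP \<alpha> s' + \<epsilon> *\<^sub>R F1 (s', \<alpha>) \<epsilon> = dP1 \<alpha> \<epsilon> s'" if "s' \<in> {0..1}" "dist s' s < d" for s'
          using e1[OF d(2)[OF that]] by simp
      qed
    qed
    have e2: "ddP1 \<alpha> \<epsilon> s = ddP \<alpha> s + \<epsilon> *\<^sub>R F11 (s, \<alpha>) \<epsilon>" if s: "s \<in> ?I" for s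
      unfolding ddP1_def by (rule deriv01_eqI[OF d2[OF s]]) (use s in simp)
    have cont: "continuous (at s0 within {0..1}) (ddP1 \<alpha> \<epsilon>)"
    proof -
      obtain d where d: "d > 0" "\<And>s'. s' \<in> {0..1} \<Longrightarrow> dist s' s0 < d \<Longrightarrow> s' \<in> ?I"
        using nbhd[OF s0] by blast
      have "continuous_on ?I (\<lambda>s. F11 (s, \<alpha>) \<epsilon>)"
      proof -
        have "continuous_on ?I (\<lambda>s. ((s, \<alpha>), \<epsilon>))" "(\<lambda>s. ((s, \<alpha>), \<epsilon>)) ` ?I \<subseteq> S \<times> T"
          using inS(1) \<epsilon>T by (auto intro!: continuous_intros)
        from continuous_on_compose2[OF Ckp_continuous[OF F11(2)] this] show ?thesis by simp
      qed
      moreover have "continuous_on ?I (ddP \<alpha>)"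
        by (rule continuous_on_subset[OF P_derivatives(3)[OF \<alpha>]]) auto
      ultimately have "continuous_on ?I (\<lambda>s. ddP \<alpha> s + \<epsilon> *\<^sub>R F11 (s, \<alpha>) \<epsilon>)"
        by (intro continuous_on_add continuous_on_scaleR continuous_on_const)
      then have "continuous (at s0 within ?I) (\<lambda>s. ddP \<alpha> s + \<epsilon> *\<^sub>R F11 (s, \<alpha>) \<epsilon>)"
        using s0 by (simp add: continuous_on_eq_continuous_within)
      then have "continuous (at s0 within ?I) (ddP1 \<alpha> \<epsilon>)"
        by (rule continuous_transform_within[OF _ zero_less_one s0]) (use e2 in simp)
      moreover have "at s0 within ?I = at s0 within {0..1}"
        by (rule at_within_nhd[of _ "ball s0 d"]) (use d s0 in \<open>auto simp: dist_commute\<close>)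
      ultimately show ?thesis by simp
    qed
    have bound: "norm (\<epsilon> *\<^sub>R X) \<le> max C0 (max C1 C2) * \<epsilon>"
      if "norm X \<le> C0 \<or> norm X \<le> C1 \<or> norm X \<le> C2" for X :: "'a \<Rightarrow>\<^sub>L 'a"
      using that \<epsilon> by (auto simp: mult.commute[of _ \<epsilon>])
    note p = inS(1)[OF s0]
    have eB: "B (s0, \<alpha>) \<epsilon> = H \<alpha> s0 - \<epsilon> *\<^sub>R K \<alpha> s0"
      by (simp add: B_def h_def k_def)
    note pr = spectral_projector_polynomial[OF clk(3)[OF p] N(3) loop(1)[OF p \<epsilon>T]]
    show "P1_close \<alpha> (max C0 (max C1 C2)) \<epsilon> s0"
      unfolding P1_close_def
    proof (intro conjI)
      show "clin (P1 \<alpha> \<epsilon> s0)" unfolding P1_eq[OF s0] by (rule pr(1))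
      show "P1 \<alpha> \<epsilon> s0 o\<^sub>L P1 \<alpha> \<epsilon> s0 = P1 \<alpha> \<epsilon> s0" unfolding P1_eq[OF s0] by (rule loop(3)[OF p \<epsilon>T])
      show "P1 \<alpha> \<epsilon> s0 o\<^sub>L (H \<alpha> s0 - \<epsilon> *\<^sub>R K \<alpha> s0) = (H \<alpha> s0 - \<epsilon> *\<^sub>R K \<alpha> s0) o\<^sub>L P1 \<alpha> \<epsilon> s0"
        unfolding P1_eq[OF s0] eB[symmetric] by (rule pr(2))
      show "(P1 \<alpha> \<epsilon> has_vector_derivative dP1 \<alpha> \<epsilon> s0) (at s0 within {0..1})"
        unfolding e1[OF s0] by (rule d1[OF s0])
      show "(dP1 \<alpha> \<epsilon> has_vector_derivative ddP1 \<alpha> \<epsilon> s0) (at s0 within {0..1})"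
        unfolding e2[OF s0] by (rule d2[OF s0])
      show "continuous (at s0 within {0..1}) (ddP1 \<alpha> \<epsilon>)" by (rule cont)
      show "norm (P1 \<alpha> \<epsilon> s0 - P \<alpha> s0) \<le> max C0 (max C1 C2) * \<epsilon>"
        unfolding P1_F[OF s0] add_diff_cancel_left' by (rule bound) (use C(2)[OF p \<epsilon>T] in blast)
      show "norm (dP1 \<alpha> \<epsilon> s0 - dP \<alpha> s0) \<le> max C0 (max C1 C2) * \<epsilon>"
        unfolding e1[OF s0] add_diff_cancel_left' by (rule bound) (use C(4)[OF p \<epsilon>T] in blast)
      show "norm (ddP1 \<alpha> \<epsilon> s0 - ddP \<alpha> s0) \<le> max C0 (max C1 C2) * \<epsilon>"
        unfolding e2[OF s0] add_diff_cancel_left' by (rule bound) (use C(6)[OF p \<epsilon>T] in blast)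
    qed
  qed
qed

lemma P1_close_uniform:
  assumes \<alpha>: "\<alpha> \<in> {0..1}"
  obtains e C where "e > 0" "C \<ge> 0" "\<And>\<epsilon> s. 0 < \<epsilon> \<Longrightarrow> \<epsilon> \<le> e \<Longrightarrow> s \<in> {0..1} \<Longrightarrow> P1_close \<alpha> C \<epsilon> s"
proof -
  have mono: "P1_close \<alpha> C' \<epsilon> s" if "P1_close \<alpha> C \<epsilon> s" "C \<le> C'" "0 < \<epsilon>" for C C' \<epsilon> s
  proof -
    have "C * \<epsilon> \<le> C' * \<epsilon>" using that by (intro mult_right_mono) auto
    then show ?thesis using that(1) unfolding P1_close_def by (meson order_trans)
  qed
  have "\<exists>e>0. \<exists>C. \<forall>\<epsilon> s. 0 < \<epsilon> \<longrightarrow> \<epsilon> \<le> e \<longrightarrow> s \<in> {0..1} \<longrightarrow> P1_close \<alpha> C \<epsilon> s"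
    by (rule uniform_on_interval[where \<Phi> = "P1_close \<alpha>"]) (use mono P1_close_local[OF \<alpha>] in auto)
  then obtain e C where e: "e > 0" "\<forall>\<epsilon> s. 0 < \<epsilon> \<longrightarrow> \<epsilon> \<le> e \<longrightarrow> s \<in> {0..1} \<longrightarrow> P1_close \<alpha> C \<epsilon> s"
    by (elim exE conjE) (rule that)
  show ?thesis
  proof (rule that[OF e(1)])
    show "max 0 C \<ge> 0" by simp
    show "P1_close \<alpha> (max 0 C) \<epsilon> s" if "0 < \<epsilon>" "\<epsilon> \<le> e" "s \<in> {0..1}" for \<epsilon> s
      by (rule mono[of C]) (use e(2) that in auto)
  qed
qed

end

section \<open>Oscillatory integrals\<close>

context gapped_family
begin

text \<open>The constant \<open>M\<close> is chosen before \<epsilon>, \<open>U\<close> and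
  \<open>Z\<close>, which is the uniformity needed later for families depending on \<epsilon>. The
  end points are arbitrary because the bound is proved on short intervals and added up.\<close>

definition osc_bound :: "real \<Rightarrow> real \<Rightarrow> real \<Rightarrow> real \<Rightarrow> bool" where
  "osc_bound \<alpha> M a b \<longleftrightarrow> (\<forall>\<epsilon> U Z Z' C. \<epsilon> > 0 \<longrightarrow> is_evolution \<epsilon> (H \<alpha>) U \<longrightarrow>
     (\<forall>s\<in>{0..1}. (Z has_vector_derivative Z' s) (at s within {0..1}) \<and> clin (Z s) \<and> norm (Z s) \<le> C \<and> norm (Z' s) \<le> C) \<longrightarrow>
     continuous_on {0..1} Z' \<longrightarrow>
     norm (integral {a..b} (\<lambda>s. op_inverse (U s) o\<^sub>L commutator (P \<alpha> s) (Z s) o\<^sub>L U s)) \<le> M * C * \<epsilon>)"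

lemma H_derivative:
  assumes "\<alpha> \<in> {0..1}"
  shows "s \<in> {0..1} \<Longrightarrow> (H \<alpha> has_vector_derivative pd1 h (s, \<alpha>)) (at s within {0..1})"
    and "continuous_on {0..1} (H \<alpha>)" "continuous_on {0..1} (\<lambda>s. pd1 h (s, \<alpha>))"
proof -
  show "s \<in> {0..1} \<Longrightarrow> (H \<alpha> has_vector_derivative pd1 h (s, \<alpha>)) (at s within {0..1})"
    using Ck_on_section(1)[OF h_C3[unfolded numeral_Suc_unfold(1)] assms, of s] by (simp add: h_def)
  show "continuous_on {0..1} (H \<alpha>)"
    using Ck_on_section_continuous[OF h_C3 assms] by (simp add: h_def)
  show "continuous_on {0..1} (\<lambda>s. pd1 h (s, \<alpha>))"
    by (rule Ck_on_section_continuous[OF Ck_on_square_partials(1)[OF h_C3[unfolded numeral_Suc_unfold(1)]] assms])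
qed

lemma P_continuous: "\<alpha> \<in> {0..1} \<Longrightarrow> continuous_on {0..1} (P \<alpha>)"
  by (rule continuous_on_vector_derivative[OF P_derivatives(1)])

lemma oscillation_integrand_continuous:
  assumes \<alpha>: "\<alpha> \<in> {0..1}" and ev: "is_evolution \<epsilon> (H \<alpha>) U" "\<epsilon> > 0"
    and Z: "continuous_on {0..1} Z"
  shows "continuous_on {0..1} (\<lambda>s. op_inverse (U s) o\<^sub>L commutator (P \<alpha> s) (Z s) o\<^sub>L U s)"
  unfolding commutator_def
  by (intro continuous_on_compose_op continuous_on_diff P_continuous[OF \<alpha>] Z is_evolution_continuous[OF ev(1)]
      evolution_inverse_continuous[OF ev(1) _ H_derivative(2)[OF \<alpha>]]) (use ev(2) in simp)

text \<open>The auxiliary operator \<open>Y\<close> is defined by a loop integral and can be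
  differentiated in time only while the loop is fixed, that is, near \<open>t0\<close>; hence the
  restriction to short intervals before the integration by parts.\<close>

lemma osc_bound_local:
  assumes \<alpha>: "\<alpha> \<in> {0..1}" and t0: "t0 \<in> {0..1}"
  shows "\<exists>r>0. \<exists>M\<ge>0. \<forall>a b. 0 \<le> a \<longrightarrow> a \<le> b \<longrightarrow> b \<le> 1 \<longrightarrow> {a..b} \<subseteq> cball t0 r \<longrightarrow> osc_bound \<alpha> M a b"
proof -
  let ?p0 = "(t0, \<alpha>)"
  have p0: "?p0 \<in> unit_square" using assms by auto
  obtain N \<eta> \<delta> where N: "open N" "?p0 \<in> N" "polynomial_function \<eta>" "\<delta> > 0"
    "\<And>p B. p \<in> unit_square \<inter> N \<Longrightarrow> clin B \<Longrightarrow> norm (B - h ?p0) < \<delta> \<Longrightarrow>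
       path_image \<eta> \<inter> op_spectrum B = {} \<and>
       spectral_projector B (\<gamma> (snd p) (fst p)) = spectral_projector B \<eta> \<and>
       spectral_projector B \<eta> o\<^sub>L spectral_projector B \<eta> = spectral_projector B \<eta>"
    using common_loop[OF p0] by blast
  obtain r where r: "r > 0" "cball ?p0 r \<subseteq> N" "\<And>p. p \<in> unit_square \<inter> cball ?p0 r \<Longrightarrow> norm (h p - h ?p0) < \<delta>"
    using h_near[OF p0 N(1,2,4)] by blast
  define J where "J = {0..1} \<inter> cball t0 r"
  have J01: "J \<subseteq> {0..1}" and cJ: "compact J"
    by (auto simp: J_def intro: compact_Int_closed)
  have Hcl: "clin (H \<alpha> s)" if "s \<in> {0..1}" for s
    by (rule self_adjoint_clin[OF selfadj[OF \<alpha> that]])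
  have loc: "path_image \<eta> \<inter> op_spectrum (H \<alpha> s) = {}" "P \<alpha> s = spectral_projector (H \<alpha> s) \<eta>" if s: "s \<in> J" for s
  proof -
    have 1: "(s, \<alpha>) \<in> unit_square \<inter> cball ?p0 r"
      using s \<alpha> by (auto simp: J_def dist_Pair_Pair)
    then have 2: "(s, \<alpha>) \<in> unit_square \<inter> N"
      using r(2) by blast
    have 3: "clin (h (s, \<alpha>))"
      using Hcl[of s] s by (simp add: h_def J_def)
    show "path_image \<eta> \<inter> op_spectrum (H \<alpha> s) = {}" "P \<alpha> s = spectral_projector (H \<alpha> s) \<eta>"
      using N(5)[OF 2 3 r(3)[OF 1]] by (simp_all add: h_def P_def)
  qed
  have out: "\<eta> y \<notin> op_spectrum (H \<alpha> s)" if "s \<in> J" "y \<in> {0..1}" for s y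
    using loc(1)[OF that(1)] that(2) unfolding path_image_def by (meson disjoint_iff imageI)
  define R where "R s y = resolvent (H \<alpha> s) (\<eta> y)" for s y
  have Rcl: "clin (R s y)" if "s \<in> J" "y \<in> {0..1}" for s y
    unfolding R_def using that J01 by (intro clin_resolvent Hcl out) auto
  have cH: "continuous_on (J \<times> {0..1}) (\<lambda>x. H \<alpha> (fst x))"
    by (rule continuous_on_compose2[OF H_derivative(2)[OF \<alpha>] continuous_on_fst[OF continuous_on_id]]) (use J01 in auto)
  have c\<eta>: "continuous_on (J \<times> {0..1}) (\<lambda>x. \<eta> (snd x))"
    by (rule continuous_on_compose2[OF polynomial_path_deriv01(2)[OF N(3)] continuous_on_snd[OF continuous_on_id]]) auto
  have cR: "continuous_on (J \<times> {0..1}) (\<lambda>x. R (fst x) (snd x))"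
    unfolding R_def by (rule continuous_on_resolvent[OF cH c\<eta>]) (use out in auto)
  have "bounded ((\<lambda>x. R (fst x) (snd x)) ` (J \<times> {0..1}))"
    by (intro compact_imp_bounded compact_continuous_image cR compact_Times cJ) auto
  then obtain m where m: "m > 0" "\<forall>x\<in>J \<times> {0..1}. norm (R (fst x) (snd x)) \<le> m"
    unfolding bounded_pos by blast
  have Rm: "norm (R s y) \<le> m" if "s \<in> J" "y \<in> {0..1}" for s y
    using m(2) that by force
  define dH where "dH s = pd1 h (s, \<alpha>)" for s
  have cdH: "continuous_on {0..1} dH"
    unfolding dH_def by (rule H_derivative(3)[OF \<alpha>])
  have "bounded (dH ` {0..1})"
    by (intro compact_imp_bounded compact_continuous_image cdH) auto
  then obtain d where d: "d > 0" "\<And>s. s \<in> {0..1} \<Longrightarrow> norm (dH s) \<le> d"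
    unfolding bounded_pos by blast
  \<comment> \<open>Bounds the time derivative of resolvent times \<open>Z\<close> times resolvent
    per unit of \<open>C\<close>, by the product rule: a differentiated resolvent has norm at most
    \<open>m * d * m\<close>.\<close>
  define m1 where "m1 = m * (m * d * m) + (m + m * d * m) * m"
  have m10: "m1 \<ge> 0" using m d by (simp add: m1_def)
  obtain L where L: "L \<ge> 0" "\<And>(f :: real \<Rightarrow> 'a \<Rightarrow>\<^sub>L 'a) B. continuous_on {0..1} f \<Longrightarrow>
       (\<And>x. x \<in> {0..1} \<Longrightarrow> norm (f x) \<le> B) \<Longrightarrow> norm (loop_integral \<eta> f) \<le> L * B"
    using loop_integral_bound[OF N(3), where 'b = "'a \<Rightarrow>\<^sub>L 'a"] by blast
  \<comment> \<open>The first summand bounds the remaining integral over the derivative of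
    \<open>Y\<close>, the second the boundary terms at both ends.\<close>
  define M where "M = L * m1 + 2 * (L * (m * m))"
  have M0: "M \<ge> 0" using L m m10 by (simp add: M_def)
  have main: "osc_bound \<alpha> M a b" if ab: "0 \<le> a" "a \<le> b" "b \<le> 1" "{a..b} \<subseteq> cball t0 r" for a b
    unfolding osc_bound_def
  proof (intro allI impI)
    fix \<epsilon> C :: real and U Z Z' :: "real \<Rightarrow> 'a \<Rightarrow>\<^sub>L 'a"
    assume \<epsilon>: "\<epsilon> > 0" and ev: "is_evolution \<epsilon> (H \<alpha>) U"
      and Zas: "\<forall>s\<in>{0..1}. (Z has_vector_derivative Z' s) (at s within {0..1}) \<and> clin (Z s) \<and> norm (Z s) \<le> C \<and> norm (Z' s) \<le> C"
      and cZ': "continuous_on {0..1} Z'"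
    have Z: "(Z has_vector_derivative Z' s) (at s within {0..1})" "clin (Z s)" "norm (Z s) \<le> C" "norm (Z' s) \<le> C"
      if "s \<in> {0..1}" for s
      using Zas that by blast+
    have cZ: "continuous_on {0..1} Z"
      by (rule continuous_on_vector_derivative[OF Z(1)])
    have "0 \<in> {0..1::real}" by simp
    from Z(3)[OF this] have C0: "C \<ge> 0"
      using norm_ge_zero order_trans by blast
    have \<epsilon>0: "\<epsilon> \<noteq> 0" using \<epsilon> by simp
    have abJ: "{a..b} \<subseteq> J" "{a..b} \<subseteq> {0..1}"
      using ab by (auto simp: J_def)
    define G where "G s y = R s y o\<^sub>L Z s o\<^sub>L R s y" for s y
    define dR where "dR s y = - (R s y o\<^sub>L dH s o\<^sub>L R s y)" for s y
    define dG where "dG s y = (R s y o\<^sub>L Z s o\<^sub>L dR s y) + ((R s y o\<^sub>L Z' s) + (dR s y o\<^sub>L Z s) o\<^sub>L R s y)" for s y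
    have c1: "continuous_on ({a..b} \<times> {0..1}) (\<lambda>x. R (fst x) (snd x))"
      by (rule continuous_on_subset[OF cR]) (use abJ in auto)
    have lift: "continuous_on ({a..b} \<times> {0..1}) (\<lambda>x. f (fst x))" if "continuous_on {0..1} f"
      for f :: "real \<Rightarrow> 'a \<Rightarrow>\<^sub>L 'a"
      by (rule continuous_on_compose2[OF that continuous_on_fst[OF continuous_on_id]]) (use abJ in auto)
    have cG: "continuous_on ({a..b} \<times> {0..1}) (\<lambda>x. G (fst x) (snd x))"
      unfolding G_def by (intro continuous_on_compose_op c1 lift cZ)
    have cdR: "continuous_on ({a..b} \<times> {0..1}) (\<lambda>x. dR (fst x) (snd x))"
      unfolding dR_def by (intro continuous_on_minus continuous_on_compose_op c1 lift cdH)
    have cdG: "continuous_on ({a..b} \<times> {0..1}) (\<lambda>x. dG (fst x) (snd x))"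
      unfolding dG_def by (intro continuous_on_add continuous_on_compose_op c1 cdR lift cZ cZ')
    have sec: "continuous_on {0..1} (f s)" if "s \<in> {a..b}" "continuous_on ({a..b} \<times> {0..1}) (\<lambda>x. f (fst x) (snd x))"
      for f :: "real \<Rightarrow> real \<Rightarrow> 'a \<Rightarrow>\<^sub>L 'a" and s
    proof -
      have "continuous_on {0..1} (\<lambda>y :: real. (s, y))" "(\<lambda>y :: real. (s, y)) ` {0..1} \<subseteq> {a..b} \<times> {0..1}"
        using that(1) by (auto intro!: continuous_intros)
      from continuous_on_compose2[OF that(2) this] show ?thesis by simp
    qed
    have Gn: "norm (G s y) \<le> m * m * C" if "s \<in> {a..b}" "y \<in> {0..1}" for s y
    proof -
      have "norm (G s y) \<le> m * C * m"
        unfolding G_def using that abJ m(1) C0 by (intro norm_compose2_le Rm Z) auto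
      then show ?thesis by (simp add: mult_ac)
    qed
    have dGn: "norm (dG s y) \<le> m1 * C" if "s \<in> {a..b}" "y \<in> {0..1}" for s y
    proof -
      have sJ: "s \<in> J" "s \<in> {0..1}" using that abJ by auto
      have dRn: "norm (dR s y) \<le> m * d * m"
        unfolding dR_def norm_minus_cancel using that(2) sJ m(1) d(1) by (intro norm_compose2_le Rm d) auto
      have A: "norm (R s y o\<^sub>L Z s o\<^sub>L dR s y) \<le> m * C * (m * d * m)"
        using that(2) sJ m(1) d(1) C0 by (intro norm_compose2_le Rm Z dRn) auto
      have "norm ((R s y o\<^sub>L Z' s) + (dR s y o\<^sub>L Z s)) \<le> m * C + m * d * m * C"
        using that(2) sJ m(1) d(1) C0 by (intro norm_triangle_mono norm_compose2_le Rm Z dRn) auto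
      then have "norm ((R s y o\<^sub>L Z' s) + (dR s y o\<^sub>L Z s) o\<^sub>L R s y) \<le> (m * C + m * d * m * C) * m"
        using that(2) sJ m(1) by (intro norm_compose2_le Rm) auto
      with A have "norm (dG s y) \<le> m * C * (m * d * m) + (m * C + m * d * m * C) * m"
        unfolding dG_def by (rule norm_triangle_mono)
      then show ?thesis by (simp add: m1_def algebra_simps)
    qed
    define Y where "Y s = loop_integral \<eta> (G s)" for s
    define dY where "dY s = loop_integral \<eta> (dG s)" for s
    have Yn: "norm (Y s) \<le> L * (m * m * C)" if "s \<in> {a..b}" for s
      unfolding Y_def by (rule L(2)[OF sec[OF that cG] Gn[OF that]])
    have dYn: "norm (dY s) \<le> L * (m1 * C)" if "s \<in> {a..b}" for s
      unfolding dY_def by (rule L(2)[OF sec[OF that cdG] dGn[OF that]])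
    have Ycl: "clin (Y s)" if "s \<in> {a..b}" for s
      unfolding Y_def G_def using that abJ by (intro clin_loop_integral clin_simps Rcl Z) auto
    have dGder: "((\<lambda>s. G s y) has_vector_derivative dG s y) (at s within {a..b})" if s: "s \<in> {a..b}" and y: "y \<in> {0..1}" for s y
    proof -
      have s01: "s \<in> {0..1}" using s abJ by auto
      have "(H \<alpha> has_vector_derivative dH s) (at s within {a..b})"
        unfolding dH_def by (rule has_vector_derivative_within_subset[OF H_derivative(1)[OF \<alpha> s01] abJ(2)])
      then have "((\<lambda>s. H \<alpha> s - \<eta> y *\<^sub>C id_blinfun) has_vector_derivative dH s) (at s within {a..b})"
        using has_vector_derivative_diff[OF _ has_vector_derivative_const] by fastforce
      moreover have "op_invertible (H \<alpha> s' - \<eta> y *\<^sub>C id_blinfun)" if "s' \<in> {a..b}" for s'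
        using out[OF subsetD[OF abJ(1) that] y] by (simp add: not_in_spectrum_iff)
      ultimately have dRder: "((\<lambda>s. R s y) has_vector_derivative dR s y) (at s within {a..b})"
        unfolding R_def resolvent_def dR_def by (intro has_vector_derivative_op_inverse s)
      have dZder: "(Z has_vector_derivative Z' s) (at s within {a..b})"
        by (rule has_vector_derivative_within_subset[OF Z(1)[OF s01] abJ(2)])
      show ?thesis
        unfolding G_def dG_def
        by (rule has_vector_derivative_compose[OF has_vector_derivative_compose[OF dRder dZder] dRder])
    qed
    have c\<eta>': "continuous_on ({a..b} \<times> {0..1}) (\<lambda>x. deriv01 \<eta> (snd x))"
      by (rule continuous_on_compose2[OF polynomial_path_deriv01(1)[OF N(3)] continuous_on_snd[OF continuous_on_id]]) auto
    have Yder: "(Y has_vector_derivative dY s) (at s within {a..b})" if s: "s \<in> {a..b}" for s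
    proof -
      have "((\<lambda>s. integral (cbox 0 1) (\<lambda>y. deriv01 \<eta> y *\<^sub>C G s y)) has_vector_derivative
          integral (cbox 0 1) (\<lambda>y. deriv01 \<eta> y *\<^sub>C dG s y)) (at s within {a..b})"
      proof (rule leibniz_rule_vector_derivative)
        show "((\<lambda>s. deriv01 \<eta> y *\<^sub>C G s y) has_vector_derivative deriv01 \<eta> y *\<^sub>C dG s' y) (at s' within {a..b})"
          if "s' \<in> {a..b}" "y \<in> cbox 0 1" for s' y
          using that by (intro bounded_linear.has_vector_derivative[OF bounded_bilinear.bounded_linear_right[OF bounded_bilinear_scaleC]] dGder) auto
        show "(\<lambda>y. deriv01 \<eta> y *\<^sub>C G s' y) integrable_on cbox 0 1" if "s' \<in> {a..b}" for s'
          using loop_integrable[OF N(3) sec[OF that cG]] by simp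
        show "continuous_on ({a..b} \<times> cbox 0 1) (\<lambda>(s, y). deriv01 \<eta> y *\<^sub>C dG s y)"
          unfolding case_prod_unfold using continuous_on_scaleC[OF c\<eta>' cdG] by simp
      qed (use s in auto)
      from bounded_linear.has_vector_derivative[OF bounded_bilinear.bounded_linear_right[OF bounded_bilinear_scaleC] this]
      show ?thesis
        by (simp add: Y_def[abs_def] dY_def loop_integral_def)
    qed
    \<comment> \<open>Multiplying resolvent, \<open>Z\<close>, resolvent by
      \<open>H \<alpha> s\<close> on the right or on the left frees one resolvent and leaves the
      same term with the spectral parameter, which cancels in the commutator. The loop integral of
      what remains is the commutator of the projector with \<open>Z s\<close>.\<close>
    have comm: "(Y s o\<^sub>L H \<alpha> s) - (H \<alpha> s o\<^sub>L Y s) = commutator (P \<alpha> s) (Z s)" if s: "s \<in> {a..b}" for s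
    proof -
      have s': "s \<in> J" "s \<in> {0..1}" using s abJ by auto
      have cRs: "continuous_on {0..1} (R s)" by (rule sec[OF s c1])
      have cGs: "continuous_on {0..1} (G s)" by (rule sec[OF s cG])
      have cc: "continuous_on {0..1} (\<lambda>y. R s y o\<^sub>L Z s)" "continuous_on {0..1} (\<lambda>y. Z s o\<^sub>L R s y)"
        "continuous_on {0..1} (\<lambda>y. G s y o\<^sub>L H \<alpha> s)" "continuous_on {0..1} (\<lambda>y. H \<alpha> s o\<^sub>L G s y)"
        by (intro continuous_on_compose_op cRs cGs continuous_on_const)+
      have "(Y s o\<^sub>L H \<alpha> s) - (H \<alpha> s o\<^sub>L Y s) = loop_integral \<eta> (\<lambda>y. (G s y o\<^sub>L H \<alpha> s) - (H \<alpha> s o\<^sub>L G s y))"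
        unfolding Y_def loop_integral_compose_right[OF N(3) cGs] loop_integral_compose_left[OF N(3) cGs Hcl[OF s'(2)]]
        by (rule loop_integral_diff[OF N(3) cc(3,4), symmetric])
      also have "\<dots> = loop_integral \<eta> (\<lambda>y. (R s y o\<^sub>L Z s) - (Z s o\<^sub>L R s y))"
      proof (rule loop_integral_cong)
        fix y :: real assume y: "y \<in> {0..1}"
        note rc = resolvent_compose[OF Hcl[OF s'(2)] out[OF s'(1) y], folded R_def]
        have "G s y o\<^sub>L H \<alpha> s = R s y o\<^sub>L Z s o\<^sub>L (R s y o\<^sub>L H \<alpha> s)"
          by (simp add: G_def blinfun_compose_assoc)
        also have "\<dots> = (R s y o\<^sub>L Z s) + \<eta> y *\<^sub>C G s y"
          unfolding rc(1) G_def blinfun_compose_linear blinfun_compose_id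
          using Rcl[OF s'(1) y] Z(2)[OF s'(2)] by (simp add: clin_compose_scaleC)
        finally have 1: "G s y o\<^sub>L H \<alpha> s = (R s y o\<^sub>L Z s) + \<eta> y *\<^sub>C G s y" .
        have "H \<alpha> s o\<^sub>L G s y = (H \<alpha> s o\<^sub>L R s y) o\<^sub>L (Z s o\<^sub>L R s y)"
          by (simp add: G_def blinfun_compose_assoc)
        also have "\<dots> = (Z s o\<^sub>L R s y) + \<eta> y *\<^sub>C G s y"
          unfolding rc(2) G_def blinfun_compose_linear blinfun_compose_id
          by (simp add: scaleC_blinfun_compose_left blinfun_compose_assoc)
        finally have 2: "H \<alpha> s o\<^sub>L G s y = (Z s o\<^sub>L R s y) + \<eta> y *\<^sub>C G s y" .
        show "(G s y o\<^sub>L H \<alpha> s) - (H \<alpha> s o\<^sub>L G s y) = (R s y o\<^sub>L Z s) - (Z s o\<^sub>L R s y)"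
          unfolding 1 2 by simp
      qed
      also have "\<dots> = (loop_integral \<eta> (R s) o\<^sub>L Z s) - (Z s o\<^sub>L loop_integral \<eta> (R s))"
        unfolding loop_integral_compose_right[OF N(3) cRs] loop_integral_compose_left[OF N(3) cRs Z(2)[OF s'(2)]]
        by (rule loop_integral_diff[OF N(3) cc(1,2)])
      also have "loop_integral \<eta> (R s) = P \<alpha> s"
        unfolding loc(2)[OF s'(1)] spectral_projector_loop_integral R_def ..
      finally show ?thesis
        by (simp add: commutator_def)
    qed
    let ?c = "- (\<i> / complex_of_real \<epsilon>)"
    note invU = evolution_invertible[OF ev \<epsilon>0 H_derivative(2)[OF \<alpha>]]
    have clU: "clin (U s)" "clin (op_inverse (U s))" if "s \<in> {0..1}" for s
      using evolution_clin[OF ev \<epsilon>0 H_derivative(2)[OF \<alpha>] Hcl that] invU[OF that] by auto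
    note nU = evolution_norm_le[OF ev \<epsilon>0 H_derivative(2)[OF \<alpha>] selfadj[OF \<alpha>]]
    define X where "X s = op_inverse (U s) o\<^sub>L commutator (P \<alpha> s) (Z s) o\<^sub>L U s" for s
    have cX: "continuous_on {0..1} X"
      unfolding X_def by (rule oscillation_integrand_continuous[OF \<alpha> ev \<epsilon> cZ])
    have sand: "norm (op_inverse (U s) o\<^sub>L A o\<^sub>L U s) \<le> norm A" if "s \<in> {0..1}" for s A
    proof -
      have "norm (op_inverse (U s) o\<^sub>L A o\<^sub>L U s) \<le> 1 * norm A * 1"
        by (intro norm_compose2_le nU that order_refl) auto
      then show ?thesis by simp
    qed
    define F where "F s = op_inverse (U s) o\<^sub>L Y s o\<^sub>L U s" for s
    have Fder: "(F has_vector_derivative (op_inverse (U s) o\<^sub>L dY s o\<^sub>L U s) + ?c *\<^sub>C X s) (at s within {a..b})" if s: "s \<in> {a..b}" for s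
    proof -
      have s01: "s \<in> {0..1}" using s abJ by auto
      note dU = has_vector_derivative_within_subset[OF is_evolutionD(2)[OF ev \<epsilon>0 s01] abJ(2)]
      note dUi = has_vector_derivative_within_subset[OF evolution_inverse_derivative[OF ev \<epsilon>0 H_derivative(2)[OF \<alpha>] Hcl s01] abJ(2)]
      from has_vector_derivative_compose[OF has_vector_derivative_compose[OF dUi Yder[OF s]] dU]
      have "(F has_vector_derivative (op_inverse (U s) o\<^sub>L Y s o\<^sub>L (?c *\<^sub>C (H \<alpha> s o\<^sub>L U s))) +
          ((op_inverse (U s) o\<^sub>L dY s) + ((\<i> / complex_of_real \<epsilon>) *\<^sub>C (op_inverse (U s) o\<^sub>L H \<alpha> s) o\<^sub>L Y s) o\<^sub>L U s)) (at s within {a..b})"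
        unfolding F_def .
      moreover have "(op_inverse (U s) o\<^sub>L Y s o\<^sub>L (?c *\<^sub>C (H \<alpha> s o\<^sub>L U s))) +
          ((op_inverse (U s) o\<^sub>L dY s) + ((\<i> / complex_of_real \<epsilon>) *\<^sub>C (op_inverse (U s) o\<^sub>L H \<alpha> s) o\<^sub>L Y s) o\<^sub>L U s) =
          (op_inverse (U s) o\<^sub>L dY s o\<^sub>L U s) + ?c *\<^sub>C X s"
        unfolding X_def comm[OF s, symmetric] using clU[OF s01] Ycl[OF s]
        by (intro blinfun_eqI) (simp add: blinfun.bilinear_simps scaleC_blinfun.rep_eq clinD scaleC_minus_left scaleC_right_simps)
      ultimately show ?thesis by simp
    qed
    \<comment> \<open>The subtracted boundary term is chosen so that the integrand \<open>X\<close>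
      drops out of the derivative, leaving \<epsilon> times a conjugated derivative of
      \<open>Y\<close>.\<close>
    define I where "I s = integral {a..s} X - (\<i> * of_real \<epsilon>) *\<^sub>C F s" for s
    have "norm (I b - I a) \<le> \<epsilon> * (L * (m1 * C)) * (b - a)"
    proof (rule norm_increment_le_const[OF ab(2)])
      fix s assume s: "s \<in> {a..b}"
      then have s01: "s \<in> {0..1}" using abJ by auto
      have "((\<lambda>s. integral {a..s} X) has_vector_derivative X s) (at s within {a..b})"
        by (rule integral_has_vector_derivative[OF continuous_on_subset[OF cX abJ(2)] s])
      then have "(I has_vector_derivative X s - (\<i> * of_real \<epsilon>) *\<^sub>C ((op_inverse (U s) o\<^sub>L dY s o\<^sub>L U s) + ?c *\<^sub>C X s)) (at s within {a..b})"
        unfolding I_def by (intro has_vector_derivative_diff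
          bounded_linear.has_vector_derivative[OF bounded_bilinear.bounded_linear_right[OF bounded_bilinear_scaleC]] Fder s)
      moreover have "(\<i> * of_real \<epsilon>) *\<^sub>C ?c *\<^sub>C X s = X s"
        using \<epsilon>0 by (simp add: scaleC_scaleC)
      ultimately show "(I has_vector_derivative - ((\<i> * of_real \<epsilon>) *\<^sub>C (op_inverse (U s) o\<^sub>L dY s o\<^sub>L U s))) (at s within {a..b})"
        by (simp add: scaleC_add_right)
      show "norm (- ((\<i> * of_real \<epsilon>) *\<^sub>C (op_inverse (U s) o\<^sub>L dY s o\<^sub>L U s))) \<le> \<epsilon> * (L * (m1 * C))"
        using order_trans[OF sand[OF s01] dYn[OF s]] \<epsilon> by (simp add: norm_scaleC norm_mult)
    qed
    also have "\<dots> \<le> \<epsilon> * (L * (m1 * C)) * 1"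
      using ab \<epsilon> L m10 C0 by (intro mult_left_mono) auto
    finally have 1: "norm (I b - I a) \<le> \<epsilon> * (L * (m1 * C))" by simp
    have Fn: "norm ((\<i> * of_real \<epsilon>) *\<^sub>C F s) \<le> \<epsilon> * (L * (m * m * C))" if s: "s \<in> {a..b}" for s
    proof -
      have s01: "s \<in> {0..1}" using s abJ by auto
      show ?thesis
        using order_trans[OF sand[OF s01] Yn[OF s]] \<epsilon> by (simp add: norm_scaleC norm_mult F_def)
    qed
    have eq: "integral {a..b} X = (I b - I a) + ((\<i> * of_real \<epsilon>) *\<^sub>C F b - (\<i> * of_real \<epsilon>) *\<^sub>C F a)"
      by (simp add: I_def)
    have "norm (integral {a..b} X) \<le> norm (I b - I a) + (norm ((\<i> * of_real \<epsilon>) *\<^sub>C F b) + norm ((\<i> * of_real \<epsilon>) *\<^sub>C F a))"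
      unfolding eq by (rule norm_triangle_mono[OF order_refl norm_triangle_ineq4])
    also have "\<dots> \<le> \<epsilon> * (L * (m1 * C)) + (\<epsilon> * (L * (m * m * C)) + \<epsilon> * (L * (m * m * C)))"
      using ab(2) by (intro add_mono 1 Fn) auto
    also have "\<dots> = M * C * \<epsilon>"
      by (simp add: M_def algebra_simps)
    finally show "norm (integral {a..b} (\<lambda>s. op_inverse (U s) o\<^sub>L commutator (P \<alpha> s) (Z s) o\<^sub>L U s)) \<le> M * C * \<epsilon>"
      by (simp only: X_def[abs_def])
  qed
  show ?thesis
    by (rule exI[of _ r], rule conjI[OF r(1)], rule exI[of _ M], rule conjI[OF M0], intro allI impI main)
qed

lemma osc_bound_combine:
  assumes \<alpha>: "\<alpha> \<in> {0..1}" and abc: "0 \<le> a" "a \<le> b" "b \<le> c" "c \<le> 1"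
    and "osc_bound \<alpha> M1 a b" "osc_bound \<alpha> M2 b c"
  shows "osc_bound \<alpha> (M1 + M2) a c"
  unfolding osc_bound_def
proof (intro allI impI)
  fix \<epsilon> C :: real and U Z Z' :: "real \<Rightarrow> 'a \<Rightarrow>\<^sub>L 'a"
  assume as: "\<epsilon> > 0" "is_evolution \<epsilon> (H \<alpha>) U"
    "\<forall>s\<in>{0..1}. (Z has_vector_derivative Z' s) (at s within {0..1}) \<and> clin (Z s) \<and> norm (Z s) \<le> C \<and> norm (Z' s) \<le> C"
    "continuous_on {0..1} Z'"
  let ?X = "\<lambda>s. op_inverse (U s) o\<^sub>L commutator (P \<alpha> s) (Z s) o\<^sub>L U s"
  have cZ: "continuous_on {0..1} Z"
    using as(3) continuous_on_vector_derivative[of "{0..1}" Z Z'] by blast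
  have "continuous_on {0..1} ?X"
    by (rule oscillation_integrand_continuous[OF \<alpha> as(2,1) cZ])
  then have "?X integrable_on {a..c}"
    by (rule integrable_continuous_interval[OF continuous_on_subset]) (use abc in auto)
  from Henstock_Kurzweil_Integration.integral_combine[OF abc(2,3) this, symmetric]
  have "integral {a..c} ?X = integral {a..b} ?X + integral {b..c} ?X" .
  moreover have "norm (integral {a..b} ?X) \<le> M1 * C * \<epsilon>" "norm (integral {b..c} ?X) \<le> M2 * C * \<epsilon>"
    using assms(6,7)[unfolded osc_bound_def, rule_format, OF as(1,2) _ as(4)] as(3) by blast+
  ultimately show "norm (integral {a..c} ?X) \<le> (M1 + M2) * C * \<epsilon>"
    using norm_triangle_ineq[of "integral {a..b} ?X" "integral {b..c} ?X"] by (simp add: algebra_simps)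
qed

lemma osc_bound_mono:
  assumes "osc_bound \<alpha> M a b" "M \<le> M'"
  shows "osc_bound \<alpha> M' a b"
  unfolding osc_bound_def
proof (intro allI impI)
  fix \<epsilon> C :: real and U Z Z' :: "real \<Rightarrow> 'a \<Rightarrow>\<^sub>L 'a"
  assume as: "\<epsilon> > 0" "is_evolution \<epsilon> (H \<alpha>) U"
    "\<forall>s\<in>{0..1}. (Z has_vector_derivative Z' s) (at s within {0..1}) \<and> clin (Z s) \<and> norm (Z s) \<le> C \<and> norm (Z' s) \<le> C"
    "continuous_on {0..1} Z'"
  have "norm (Z 0) \<le> C" using as(3) by simp
  then have "C \<ge> 0" using norm_ge_zero order_trans by blast
  then have "M * C * \<epsilon> \<le> M' * C * \<epsilon>"
    using assms(2) as(1) by (intro mult_right_mono) auto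
  then show "norm (integral {a..b} (\<lambda>s. op_inverse (U s) o\<^sub>L commutator (P \<alpha> s) (Z s) o\<^sub>L U s)) \<le> M' * C * \<epsilon>"
    using assms(1)[unfolded osc_bound_def, rule_format, OF as(1,2) _ as(4)] as(3) order_trans by blast
qed

lemma osc_bound_uniform:
  assumes \<alpha>: "\<alpha> \<in> {0..1}"
  shows "\<exists>M\<ge>0. \<forall>t\<in>{0..1}. osc_bound \<alpha> M 0 t"
proof -
  \<comment> \<open>The bound is demanded on all subintervals, so an interval that straddles a cut
    point can be split there and its two pieces estimated separately.\<close>
  let ?P = "\<lambda>a b. \<exists>M\<ge>0. \<forall>a' b'. 0 \<le> a' \<longrightarrow> a \<le> a' \<longrightarrow> a' \<le> b' \<longrightarrow> b' \<le> b \<longrightarrow> b' \<le> 1 \<longrightarrow> osc_bound \<alpha> M a' b'"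
  have "?P 0 (1::real)"
  proof (rule Bolzano[where P = ?P])
    fix a b c :: real assume "?P a b" "?P b c" and abc: "a \<le> b" "b \<le> c"
    then obtain M1 M2 where M: "M1 \<ge> 0" "M2 \<ge> 0"
      "\<And>a' b'. 0 \<le> a' \<Longrightarrow> a \<le> a' \<Longrightarrow> a' \<le> b' \<Longrightarrow> b' \<le> b \<Longrightarrow> b' \<le> 1 \<Longrightarrow> osc_bound \<alpha> M1 a' b'"
      "\<And>a' b'. 0 \<le> a' \<Longrightarrow> b \<le> a' \<Longrightarrow> a' \<le> b' \<Longrightarrow> b' \<le> c \<Longrightarrow> b' \<le> 1 \<Longrightarrow> osc_bound \<alpha> M2 a' b'"
      by blast
    show "?P a c"
    proof (rule exI[of _ "M1 + M2"], rule conjI, goal_cases)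
      case 1
      show ?case using M by simp
    next
      case 2
      show ?case
      proof (intro allI impI)
        fix a' b' assume ab: "0 \<le> a'" "a \<le> a'" "a' \<le> b'" "b' \<le> c" "b' \<le> 1"
        consider "b' \<le> b" | "b \<le> a'" | "a' \<le> b" "b \<le> b'" by linarith
        then show "osc_bound \<alpha> (M1 + M2) a' b'"
        proof cases
          case 1
          then show ?thesis using ab M by (intro osc_bound_mono[OF M(3)]) auto
        next
          case 2
          then show ?thesis using ab M by (intro osc_bound_mono[OF M(4)]) auto
        next
          case 3
          then show ?thesis using ab M(3)[of a' b] M(4)[of b b'] by (intro osc_bound_combine[OF \<alpha>]) auto
        qed
      qed
    qed
  next
    fix x :: real assume "0 \<le> x" "x \<le> 1"
    then have "x \<in> {0..1}" by simp
    from osc_bound_local[OF \<alpha> this] obtain r M where r: "r > 0" "M \<ge> 0"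
      "\<forall>a b. 0 \<le> a \<longrightarrow> a \<le> b \<longrightarrow> b \<le> 1 \<longrightarrow> {a..b} \<subseteq> cball x r \<longrightarrow> osc_bound \<alpha> M a b"
      by blast
    show "\<exists>d>0. \<forall>a b. a \<le> x \<and> x \<le> b \<and> b - a < d \<longrightarrow> ?P a b"
    proof (rule exI[of _ r], rule conjI[OF r(1)], rule allI, rule allI, rule impI)
      fix a b assume ab: "a \<le> x \<and> x \<le> b \<and> b - a < r"
      show "?P a b"
      proof (rule exI[of _ M], rule conjI[OF r(2)], intro allI impI)
        fix a' b' assume *: "0 \<le> a'" "a \<le> a'" "a' \<le> b'" "b' \<le> b" "b' \<le> 1"
        have "{a'..b'} \<subseteq> cball x r"
          using * ab by (auto simp: dist_real_def)
        then show "osc_bound \<alpha> M a' b'"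
          using r(3) * by blast
      qed
    qed
  qed simp
  then obtain M where M: "M \<ge> 0" "\<forall>a' b'. 0 \<le> a' \<longrightarrow> 0 \<le> a' \<longrightarrow> a' \<le> b' \<longrightarrow> b' \<le> 1 \<longrightarrow> b' \<le> 1 \<longrightarrow> osc_bound \<alpha> M a' b'"
    by (elim exE conjE) (rule that)
  show ?thesis
    by (rule exI[of _ M], rule conjI[OF M(1)]) (use M(2) in auto)
qed

end

section \<open>Bounds uniform in time\<close>

text \<open>\<open>Ob k X\<close>: \<open>X = O(\<epsilon>\<^sup>k)\<close> uniformly on the unit interval.  \<open>C1b k X\<close>: the same for \<open>X\<close> and its time
  derivative.\<close>

definition Ob :: "nat \<Rightarrow> (real \<Rightarrow> real \<Rightarrow> 'b::real_normed_vector) \<Rightarrow> bool" where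
  "Ob k X \<longleftrightarrow> (\<exists>C. \<forall>\<^sub>F \<epsilon> in at_right 0. \<forall>s\<in>{0..1}. norm (X \<epsilon> s) \<le> C * \<epsilon> ^ k)"

definition C1b :: "nat \<Rightarrow> (real \<Rightarrow> real \<Rightarrow> 'a::complex_normed_vector \<Rightarrow>\<^sub>L 'a) \<Rightarrow> bool" where
  "C1b k Z \<longleftrightarrow> (\<exists>Z'. Ob k Z \<and> Ob k Z' \<and> (\<forall>\<^sub>F \<epsilon> in at_right 0.
     (\<forall>s\<in>{0..1}. (Z \<epsilon> has_vector_derivative Z' \<epsilon> s) (at s within {0..1}) \<and> clin (Z \<epsilon> s)) \<and>
     continuous_on {0..1} (Z' \<epsilon>)))"

lemma eventually_pos: "\<forall>\<^sub>F \<epsilon> :: real in at_right 0. \<epsilon> > 0"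
  by (rule eventually_at_right_less)

lemma eventually_le: "c > 0 \<Longrightarrow> \<forall>\<^sub>F \<epsilon> :: real in at_right 0. \<epsilon> \<le> c"
  by (rule eventually_mono[OF eventually_at_right_real[of 0 c]]) auto

lemma ObE:
  assumes "Ob k X"
  obtains C where "C \<ge> 0" "\<forall>\<^sub>F \<epsilon> in at_right 0. \<forall>s\<in>{0..1}. norm (X \<epsilon> s) \<le> C * \<epsilon> ^ k"
proof -
  obtain C where C: "\<forall>\<^sub>F \<epsilon> in at_right 0. \<forall>s\<in>{0..1}. norm (X \<epsilon> s) \<le> C * \<epsilon> ^ k"
    using assms unfolding Ob_def by blast
  have "\<forall>\<^sub>F \<epsilon> in at_right 0. \<forall>s\<in>{0..1}. norm (X \<epsilon> s) \<le> max 0 C * \<epsilon> ^ k"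
    using C eventually_pos
  proof eventually_elim
    case (elim \<epsilon>)
    have "C * \<epsilon> ^ k \<le> max 0 C * \<epsilon> ^ k"
      using elim(2) by (intro mult_right_mono) auto
    then show ?case using elim(1) by force
  qed
  then show ?thesis by (intro that[of "max 0 C"]) auto
qed

lemma ObI: "\<forall>\<^sub>F \<epsilon> in at_right 0. \<forall>s\<in>{0..1}. norm (X \<epsilon> s) \<le> C * \<epsilon> ^ k \<Longrightarrow> Ob k X"
  unfolding Ob_def by blast

lemma Ob_cong:
  assumes "Ob k X" "\<forall>\<^sub>F \<epsilon> in at_right 0. \<forall>s\<in>{0..1}. Y \<epsilon> s = X \<epsilon> s"
  shows "Ob k Y"
proof -
  obtain C where "\<forall>\<^sub>F \<epsilon> in at_right 0. \<forall>s\<in>{0..1}. norm (X \<epsilon> s) \<le> C * \<epsilon> ^ k"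
    using assms(1) unfolding Ob_def by blast
  then have "\<forall>\<^sub>F \<epsilon> in at_right 0. \<forall>s\<in>{0..1}. norm (Y \<epsilon> s) \<le> C * \<epsilon> ^ k"
    using assms(2) by eventually_elim simp
  then show ?thesis by (rule ObI)
qed

lemma Ob_add:
  assumes "Ob k X" "Ob k Y"
  shows "Ob k (\<lambda>\<epsilon> s. X \<epsilon> s + Y \<epsilon> s)"
proof -
  obtain C D where C: "\<forall>\<^sub>F \<epsilon> in at_right 0. \<forall>s\<in>{0..1}. norm (X \<epsilon> s) \<le> C * \<epsilon> ^ k"
    and D: "\<forall>\<^sub>F \<epsilon> in at_right 0. \<forall>s\<in>{0..1}. norm (Y \<epsilon> s) \<le> D * \<epsilon> ^ k"
    using assms unfolding Ob_def by blast
  from C D have "\<forall>\<^sub>F \<epsilon> in at_right 0. \<forall>s\<in>{0..1}. norm (X \<epsilon> s + Y \<epsilon> s) \<le> (C + D) * \<epsilon> ^ k"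
    by eventually_elim (auto simp: distrib_right intro!: norm_triangle_mono)
  then show ?thesis by (rule ObI)
qed

lemma Ob_minus: "Ob k X \<Longrightarrow> Ob k (\<lambda>\<epsilon> s. - X \<epsilon> s)"
  unfolding Ob_def by simp

lemma Ob_diff: "Ob k X \<Longrightarrow> Ob k Y \<Longrightarrow> Ob k (\<lambda>\<epsilon> s. X \<epsilon> s - Y \<epsilon> s)"
  using Ob_add[OF _ Ob_minus, of k X Y] by simp

lemma Ob_compose:
  fixes X Y :: "real \<Rightarrow> real \<Rightarrow> 'a::real_normed_vector \<Rightarrow>\<^sub>L 'a"
  assumes "Ob k X" "Ob l Y"
  shows "Ob (k + l) (\<lambda>\<epsilon> s. X \<epsilon> s o\<^sub>L Y \<epsilon> s)"
proof -
  obtain C where C: "C \<ge> 0" "\<forall>\<^sub>F \<epsilon> in at_right 0. \<forall>s\<in>{0..1}. norm (X \<epsilon> s) \<le> C * \<epsilon> ^ k"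
    by (rule ObE[OF assms(1)])
  obtain D where D: "D \<ge> 0" "\<forall>\<^sub>F \<epsilon> in at_right 0. \<forall>s\<in>{0..1}. norm (Y \<epsilon> s) \<le> D * \<epsilon> ^ l"
    by (rule ObE[OF assms(2)])
  have "\<forall>\<^sub>F \<epsilon> in at_right 0. \<forall>s\<in>{0..1}. norm (X \<epsilon> s o\<^sub>L Y \<epsilon> s) \<le> (C * D) * \<epsilon> ^ (k + l)"
    using C(2) D(2) eventually_pos
  proof eventually_elim
    case (elim \<epsilon>)
    show ?case
    proof
      fix s :: real assume s: "s \<in> {0..1}"
      have "norm (X \<epsilon> s o\<^sub>L Y \<epsilon> s) \<le> (C * \<epsilon> ^ k) * (D * \<epsilon> ^ l)"
        using elim s D(1) by (intro norm_compose2_le) auto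
      then show "norm (X \<epsilon> s o\<^sub>L Y \<epsilon> s) \<le> (C * D) * \<epsilon> ^ (k + l)"
        by (simp add: power_add mult_ac)
    qed
  qed
  then show ?thesis by (rule ObI)
qed

lemmas Ob_compose_left = Ob_compose[where k = 0, unfolded add_0_left]
lemmas Ob_compose_right = Ob_compose[where l = 0, unfolded add_0_right]

lemma Ob_mono:
  assumes "Ob k X" "l \<le> k"
  shows "Ob l X"
proof -
  obtain C where C: "C \<ge> 0" "\<forall>\<^sub>F \<epsilon> in at_right 0. \<forall>s\<in>{0..1}. norm (X \<epsilon> s) \<le> C * \<epsilon> ^ k"
    by (rule ObE[OF assms(1)])
  have "\<forall>\<^sub>F \<epsilon> in at_right 0. \<forall>s\<in>{0..1}. norm (X \<epsilon> s) \<le> C * \<epsilon> ^ l"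
    using C(2) eventually_pos eventually_le[OF zero_less_one]
  proof eventually_elim
    case (elim \<epsilon>)
    have "C * \<epsilon> ^ k \<le> C * \<epsilon> ^ l"
      using elim C(1) assms(2) by (intro mult_left_mono power_decreasing) auto
    then show ?case using elim(1) by force
  qed
  then show ?thesis by (rule ObI)
qed

lemma Ob_bounded:
  assumes "\<And>s. s \<in> {0..1} \<Longrightarrow> norm (f s) \<le> C"
  shows "Ob 0 (\<lambda>\<epsilon>. f)"
  by (rule ObI[of _ C]) (simp add: assms)

lemma Ob_continuous:
  assumes "continuous_on {0..1} f"
  shows "Ob 0 (\<lambda>\<epsilon>. f)"
proof -
  have "bounded (f ` {0..1})"
    using assms by (intro compact_imp_bounded compact_continuous_image) auto
  then obtain C where "\<And>s. s \<in> {0..1} \<Longrightarrow> norm (f s) \<le> C"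
    unfolding bounded_iff by blast
  then show ?thesis by (rule Ob_bounded)
qed

lemma Ob_const: "Ob 0 (\<lambda>\<epsilon> s. c)"
  by (rule Ob_bounded[of _ "norm c"]) simp

lemma Ob_scaleR_eps:
  assumes "Ob k X"
  shows "Ob (Suc k) (\<lambda>\<epsilon> s. \<epsilon> *\<^sub>R X \<epsilon> s)"
proof -
  obtain C where C: "\<forall>\<^sub>F \<epsilon> in at_right 0. \<forall>s\<in>{0..1}. norm (X \<epsilon> s) \<le> C * \<epsilon> ^ k"
    using assms unfolding Ob_def by blast
  from C eventually_pos have "\<forall>\<^sub>F \<epsilon> in at_right 0. \<forall>s\<in>{0..1}. norm (\<epsilon> *\<^sub>R X \<epsilon> s) \<le> C * \<epsilon> ^ Suc k"
    by eventually_elim (auto simp: mult.left_commute)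
  then show ?thesis by (rule ObI)
qed

lemma Ob_divide_eps:
  assumes "Ob (Suc k) X"
  shows "Ob k (\<lambda>\<epsilon> s. (1 / \<epsilon>) *\<^sub>R X \<epsilon> s)"
proof -
  obtain C where C: "\<forall>\<^sub>F \<epsilon> in at_right 0. \<forall>s\<in>{0..1}. norm (X \<epsilon> s) \<le> C * \<epsilon> ^ Suc k"
    using assms unfolding Ob_def by blast
  from C eventually_pos have "\<forall>\<^sub>F \<epsilon> in at_right 0. \<forall>s\<in>{0..1}. norm ((1 / \<epsilon>) *\<^sub>R X \<epsilon> s) \<le> C * \<epsilon> ^ k"
    by eventually_elim (auto simp: field_simps)
  then show ?thesis by (rule ObI)
qed

lemma Ob_scaleC:
  assumes "Ob k X"
  shows "Ob k (\<lambda>\<epsilon> s. c *\<^sub>C (X \<epsilon> s :: 'b::complex_normed_vector))"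
proof -
  obtain C where C: "\<forall>\<^sub>F \<epsilon> in at_right 0. \<forall>s\<in>{0..1}. norm (X \<epsilon> s) \<le> C * \<epsilon> ^ k"
    using assms unfolding Ob_def by blast
  from C have "\<forall>\<^sub>F \<epsilon> in at_right 0. \<forall>s\<in>{0..1}. norm (c *\<^sub>C X \<epsilon> s) \<le> (cmod c * C) * \<epsilon> ^ k"
    by eventually_elim (auto simp: norm_scaleC mult.assoc intro!: mult_left_mono)
  then show ?thesis by (rule ObI)
qed

lemma Ob_integral:
  fixes X :: "real \<Rightarrow> real \<Rightarrow> 'b::banach"
  assumes "Ob k X" "\<forall>\<^sub>F \<epsilon> in at_right 0. continuous_on {0..1} (X \<epsilon>)"
  shows "Ob k (\<lambda>\<epsilon> t. integral {0..t} (X \<epsilon>))"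
proof -
  obtain C where C: "C \<ge> 0" "\<forall>\<^sub>F \<epsilon> in at_right 0. \<forall>s\<in>{0..1}. norm (X \<epsilon> s) \<le> C * \<epsilon> ^ k"
    by (rule ObE[OF assms(1)])
  have "\<forall>\<^sub>F \<epsilon> in at_right 0. \<forall>t\<in>{0..1}. norm (integral {0..t} (X \<epsilon>)) \<le> C * \<epsilon> ^ k"
    using C(2) assms(2) eventually_pos
  proof eventually_elim
    case (elim \<epsilon>)
    show ?case
    proof
      fix t :: real assume t: "t \<in> {0..1}"
      have "continuous_on {0..t} (X \<epsilon>)"
        by (rule continuous_on_subset[OF elim(2)]) (use t in auto)
      then have "norm (integral {0..t} (X \<epsilon>)) \<le> integral {0..t} (\<lambda>s. C * \<epsilon> ^ k)"
        using elim(1) t by (intro integral_norm_bound_integral integrable_continuous_interval) auto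
      also have "\<dots> = t * (C * \<epsilon> ^ k)"
        using t by simp
      also have "\<dots> \<le> 1 * (C * \<epsilon> ^ k)"
        using t C(1) elim(3) by (intro mult_right_mono) auto
      finally show "norm (integral {0..t} (X \<epsilon>)) \<le> C * \<epsilon> ^ k" by simp
    qed
  qed
  then show ?thesis by (rule ObI)
qed

section \<open>Families of operators bounded together with their time derivative\<close>

lemma C1b_Ob: "C1b k Z \<Longrightarrow> Ob k Z"
  unfolding C1b_def by blast

lemma C1bE:
  assumes "C1b k Z"
  obtains Z' where "Ob k Z" "Ob k Z'" "\<forall>\<^sub>F \<epsilon> in at_right 0.
     (\<forall>s\<in>{0..1}. (Z \<epsilon> has_vector_derivative Z' \<epsilon> s) (at s within {0..1}) \<and> clin (Z \<epsilon> s)) \<and>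
     continuous_on {0..1} (Z' \<epsilon>)"
  using assms unfolding C1b_def by blast

lemma C1b_continuous:
  assumes "C1b k Z"
  shows "\<forall>\<^sub>F \<epsilon> in at_right 0. continuous_on {0..1} (Z \<epsilon>)"
proof -
  obtain Z' where "\<forall>\<^sub>F \<epsilon> in at_right 0.
     (\<forall>s\<in>{0..1}. (Z \<epsilon> has_vector_derivative Z' \<epsilon> s) (at s within {0..1}) \<and> clin (Z \<epsilon> s)) \<and>
     continuous_on {0..1} (Z' \<epsilon>)"
    using C1bE[OF assms] by blast
  then show ?thesis
  proof eventually_elim
    case (elim \<epsilon>)
    then show ?case using continuous_on_vector_derivative[of "{0..1}" "Z \<epsilon>" "Z' \<epsilon>"] by blast
  qed
qed

lemma C1b_clin:
  assumes "C1b k Z"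
  shows "\<forall>\<^sub>F \<epsilon> in at_right 0. \<forall>s\<in>{0..1}. clin (Z \<epsilon> s)"
proof -
  obtain Z' where "\<forall>\<^sub>F \<epsilon> in at_right 0.
     (\<forall>s\<in>{0..1}. (Z \<epsilon> has_vector_derivative Z' \<epsilon> s) (at s within {0..1}) \<and> clin (Z \<epsilon> s)) \<and>
     continuous_on {0..1} (Z' \<epsilon>)"
    using C1bE[OF assms] by blast
  then show ?thesis
    by eventually_elim blast
qed

lemma C1b_cong:
  assumes "C1b k Z" "\<forall>\<^sub>F \<epsilon> in at_right 0. \<forall>s\<in>{0..1}. Y \<epsilon> s = Z \<epsilon> s"
  shows "C1b k Y"
proof -
  obtain Z' where Z: "Ob k Z" "Ob k Z'" "\<forall>\<^sub>F \<epsilon> in at_right 0.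
     (\<forall>s\<in>{0..1}. (Z \<epsilon> has_vector_derivative Z' \<epsilon> s) (at s within {0..1}) \<and> clin (Z \<epsilon> s)) \<and>
     continuous_on {0..1} (Z' \<epsilon>)"
    by (rule C1bE[OF assms(1)])
  have "\<forall>\<^sub>F \<epsilon> in at_right 0.
     (\<forall>s\<in>{0..1}. (Y \<epsilon> has_vector_derivative Z' \<epsilon> s) (at s within {0..1}) \<and> clin (Y \<epsilon> s)) \<and>
     continuous_on {0..1} (Z' \<epsilon>)"
    using Z(3) assms(2)
  proof eventually_elim
    case (elim \<epsilon>)
    have eq: "Y \<epsilon> s = Z \<epsilon> s" "(Z \<epsilon> has_vector_derivative Z' \<epsilon> s) (at s within {0..1})" if "s \<in> {0..1}" for s
      using elim that by auto
    have "(Y \<epsilon> has_vector_derivative Z' \<epsilon> s) (at s within {0..1})" if s: "s \<in> {0..1}" for s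
      by (rule has_vector_derivative_transform[OF s eq(1) eq(2)[OF s]])
    then show ?case using elim by simp
  qed
  then show ?thesis
    unfolding C1b_def using Z(2) Ob_cong[OF Z(1) assms(2)] by blast
qed

lemma C1bI:
  assumes "Ob k Z" "Ob k Z'"
    "\<forall>\<^sub>F \<epsilon> in at_right 0. \<forall>s\<in>{0..1}. (Z \<epsilon> has_vector_derivative Z' \<epsilon> s) (at s within {0..1})"
    "\<forall>\<^sub>F \<epsilon> in at_right 0. \<forall>s\<in>{0..1}. clin (Z \<epsilon> s)" "\<forall>\<^sub>F \<epsilon> in at_right 0. continuous_on {0..1} (Z' \<epsilon>)"
  shows "C1b k Z"
proof -
  have "\<forall>\<^sub>F \<epsilon> in at_right 0.
     (\<forall>s\<in>{0..1}. (Z \<epsilon> has_vector_derivative Z' \<epsilon> s) (at s within {0..1}) \<and> clin (Z \<epsilon> s)) \<and>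
     continuous_on {0..1} (Z' \<epsilon>)"
    using assms(3-5) by eventually_elim blast
  then show ?thesis
    unfolding C1b_def using assms(1,2) by blast
qed

lemma C1b_compose:
  assumes "C1b k Z" "C1b l Y"
  shows "C1b (k + l) (\<lambda>\<epsilon> s. Z \<epsilon> s o\<^sub>L Y \<epsilon> s)"
proof -
  obtain Z' where Z: "Ob k Z" "Ob k Z'" "\<forall>\<^sub>F \<epsilon> in at_right 0.
     (\<forall>s\<in>{0..1}. (Z \<epsilon> has_vector_derivative Z' \<epsilon> s) (at s within {0..1}) \<and> clin (Z \<epsilon> s)) \<and>
     continuous_on {0..1} (Z' \<epsilon>)"
    by (rule C1bE[OF assms(1)])
  obtain Y' where Y: "Ob l Y" "Ob l Y'" "\<forall>\<^sub>F \<epsilon> in at_right 0.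
     (\<forall>s\<in>{0..1}. (Y \<epsilon> has_vector_derivative Y' \<epsilon> s) (at s within {0..1}) \<and> clin (Y \<epsilon> s)) \<and>
     continuous_on {0..1} (Y' \<epsilon>)"
    by (rule C1bE[OF assms(2)])
  show ?thesis
  proof (rule C1bI)
    show "Ob (k + l) (\<lambda>\<epsilon> s. Z \<epsilon> s o\<^sub>L Y \<epsilon> s)"
      by (rule Ob_compose[OF Z(1) Y(1)])
    show "Ob (k + l) (\<lambda>\<epsilon> s. (Z \<epsilon> s o\<^sub>L Y' \<epsilon> s) + (Z' \<epsilon> s o\<^sub>L Y \<epsilon> s))"
      by (rule Ob_add[OF Ob_compose[OF Z(1) Y(2)] Ob_compose[OF Z(2) Y(1)]])
    show "\<forall>\<^sub>F \<epsilon> in at_right 0. \<forall>s\<in>{0..1}. ((\<lambda>s. Z \<epsilon> s o\<^sub>L Y \<epsilon> s) has_vector_derivative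
        (Z \<epsilon> s o\<^sub>L Y' \<epsilon> s) + (Z' \<epsilon> s o\<^sub>L Y \<epsilon> s)) (at s within {0..1})"
      using Z(3) Y(3) by eventually_elim (blast intro: has_vector_derivative_compose)
    show "\<forall>\<^sub>F \<epsilon> in at_right 0. \<forall>s\<in>{0..1}. clin (Z \<epsilon> s o\<^sub>L Y \<epsilon> s)"
      using Z(3) Y(3) by eventually_elim (blast intro: clin_simps)
    show "\<forall>\<^sub>F \<epsilon> in at_right 0. continuous_on {0..1} (\<lambda>s. (Z \<epsilon> s o\<^sub>L Y' \<epsilon> s) + (Z' \<epsilon> s o\<^sub>L Y \<epsilon> s))"
      using Z(3) Y(3) C1b_continuous[OF assms(1)] C1b_continuous[OF assms(2)]
      by eventually_elim (intro continuous_on_add continuous_on_compose_op; blast)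
  qed
qed

lemmas C1b_compose_left = C1b_compose[where k = 0, unfolded add_0_left]
lemmas C1b_compose_right = C1b_compose[where l = 0, unfolded add_0_right]

lemma C1b_add:
  assumes "C1b k Z" "C1b k Y"
  shows "C1b k (\<lambda>\<epsilon> s. Z \<epsilon> s + Y \<epsilon> s)"
proof -
  obtain Z' where Z: "Ob k Z" "Ob k Z'" "\<forall>\<^sub>F \<epsilon> in at_right 0.
     (\<forall>s\<in>{0..1}. (Z \<epsilon> has_vector_derivative Z' \<epsilon> s) (at s within {0..1}) \<and> clin (Z \<epsilon> s)) \<and>
     continuous_on {0..1} (Z' \<epsilon>)"
    by (rule C1bE[OF assms(1)])
  obtain Y' where Y: "Ob k Y" "Ob k Y'" "\<forall>\<^sub>F \<epsilon> in at_right 0.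
     (\<forall>s\<in>{0..1}. (Y \<epsilon> has_vector_derivative Y' \<epsilon> s) (at s within {0..1}) \<and> clin (Y \<epsilon> s)) \<and>
     continuous_on {0..1} (Y' \<epsilon>)"
    by (rule C1bE[OF assms(2)])
  show ?thesis
  proof (rule C1bI)
    show "\<forall>\<^sub>F \<epsilon> in at_right 0. \<forall>s\<in>{0..1}. ((\<lambda>s. Z \<epsilon> s + Y \<epsilon> s) has_vector_derivative Z' \<epsilon> s + Y' \<epsilon> s) (at s within {0..1})"
      using Z(3) Y(3) by eventually_elim (blast intro: has_vector_derivative_add)
    show "\<forall>\<^sub>F \<epsilon> in at_right 0. \<forall>s\<in>{0..1}. clin (Z \<epsilon> s + Y \<epsilon> s)"
      using Z(3) Y(3) by eventually_elim (blast intro: clin_simps)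
    show "\<forall>\<^sub>F \<epsilon> in at_right 0. continuous_on {0..1} (\<lambda>s. Z' \<epsilon> s + Y' \<epsilon> s)"
      using Z(3) Y(3) by eventually_elim (intro continuous_on_add; blast)
  qed (intro Ob_add Z Y)+
qed

lemma C1b_scaleC:
  assumes "C1b k Z"
  shows "C1b k (\<lambda>\<epsilon> s. c *\<^sub>C Z \<epsilon> s)"
proof -
  obtain Z' where Z: "Ob k Z" "Ob k Z'" "\<forall>\<^sub>F \<epsilon> in at_right 0.
     (\<forall>s\<in>{0..1}. (Z \<epsilon> has_vector_derivative Z' \<epsilon> s) (at s within {0..1}) \<and> clin (Z \<epsilon> s)) \<and>
     continuous_on {0..1} (Z' \<epsilon>)"
    by (rule C1bE[OF assms(1)])
  show ?thesis
  proof (rule C1bI)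
    show "\<forall>\<^sub>F \<epsilon> in at_right 0. \<forall>s\<in>{0..1}. ((\<lambda>s. c *\<^sub>C Z \<epsilon> s) has_vector_derivative c *\<^sub>C Z' \<epsilon> s) (at s within {0..1})"
      using Z(3) by eventually_elim
        (blast intro: bounded_linear.has_vector_derivative[OF bounded_bilinear.bounded_linear_right[OF bounded_bilinear_scaleC]])
    show "\<forall>\<^sub>F \<epsilon> in at_right 0. \<forall>s\<in>{0..1}. clin (c *\<^sub>C Z \<epsilon> s)"
      using Z(3) by eventually_elim (blast intro: clin_simps)
    show "\<forall>\<^sub>F \<epsilon> in at_right 0. continuous_on {0..1} (\<lambda>s. c *\<^sub>C Z' \<epsilon> s)"
      using Z(3) by eventually_elim (intro continuous_on_scaleC continuous_on_const, blast)
  qed (intro Ob_scaleC Z)+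
qed

lemma C1b_minus:
  assumes "C1b k Z"
  shows "C1b k (\<lambda>\<epsilon> s. - Z \<epsilon> s)"
  using C1b_scaleC[OF assms, of "- 1"] by (simp add: scaleC_minus_left)

lemma C1b_diff: "C1b k X \<Longrightarrow> C1b k Y \<Longrightarrow> C1b k (\<lambda>\<epsilon> s. X \<epsilon> s - Y \<epsilon> s)"
  using C1b_add[OF _ C1b_minus, of k X Y] by simp

lemma C1b_const: "clin c \<Longrightarrow> C1b 0 (\<lambda>\<epsilon> s. c)"
  by (rule C1bI[OF Ob_const Ob_const[of 0]]) (auto intro!: always_eventually)

lemma C1b_fixed:
  assumes "\<And>s. s \<in> {0..1} \<Longrightarrow> (f has_vector_derivative f' s) (at s within {0..1})"
    "\<And>s. s \<in> {0..1} \<Longrightarrow> clin (f s)" "continuous_on {0..1} f'"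
  shows "C1b 0 (\<lambda>\<epsilon>. f)"
proof (rule C1bI[where Z' = "\<lambda>\<epsilon>. f'"])
  show "Ob 0 (\<lambda>\<epsilon>. f)"
    by (rule Ob_continuous[OF continuous_on_vector_derivative[OF assms(1)]])
qed (use assms in \<open>auto intro!: Ob_continuous always_eventually\<close>)

lemma C1b_commutator_left: "C1b 0 X \<Longrightarrow> C1b k Y \<Longrightarrow> C1b k (\<lambda>\<epsilon> s. commutator (X \<epsilon> s) (Y \<epsilon> s))"
  unfolding commutator_def by (intro C1b_diff C1b_compose_left C1b_compose_right)

lemma Ob_commutator:
  fixes X Y :: "real \<Rightarrow> real \<Rightarrow> 'a::real_normed_vector \<Rightarrow>\<^sub>L 'a"
  assumes "Ob k X" "Ob l Y"
  shows "Ob (k + l) (\<lambda>\<epsilon> s. commutator (X \<epsilon> s) (Y \<epsilon> s))"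
proof -
  have "Ob (k + l) (\<lambda>\<epsilon> s. Y \<epsilon> s o\<^sub>L X \<epsilon> s)"
    using Ob_compose[OF assms(2,1)] by (simp add: add.commute)
  from Ob_diff[OF Ob_compose[OF assms] this] show ?thesis
    unfolding commutator_def .
qed

text \<open>Writing \<open>V\<close> as \<open>U\<close> times \<Theta> with \<Theta> near the
  identity reduces conjugation by \<open>V\<close> to conjugation by \<open>U\<close>. Norm bounds
  are assumed for \<open>U\<close> alone; the inverse of \<Theta> is controlled by its distance from
  the identity.\<close>

lemma Ob_conjugation:
  fixes U V X :: "real \<Rightarrow> real \<Rightarrow> 'a::banach \<Rightarrow>\<^sub>L 'a"
  assumes U: "\<forall>\<^sub>F \<epsilon> in at_right 0. \<forall>s\<in>{0..1}. op_invertible (U \<epsilon> s) \<and> norm (U \<epsilon> s) \<le> 1 \<and> norm (op_inverse (U \<epsilon> s)) \<le> 1"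
    and V: "\<forall>\<^sub>F \<epsilon> in at_right 0. \<forall>s\<in>{0..1}. op_invertible (V \<epsilon> s)"
    and UV: "Ob k (\<lambda>\<epsilon> s. (op_inverse (U \<epsilon> s) o\<^sub>L V \<epsilon> s) - id_blinfun)" "k \<ge> 1"
    and X: "Ob l X"
  shows "Ob (k + l) (\<lambda>\<epsilon> s. (op_inverse (V \<epsilon> s) o\<^sub>L X \<epsilon> s o\<^sub>L V \<epsilon> s) - (op_inverse (U \<epsilon> s) o\<^sub>L X \<epsilon> s o\<^sub>L U \<epsilon> s))"
    and "Ob l (\<lambda>\<epsilon> s. op_inverse (U \<epsilon> s) o\<^sub>L X \<epsilon> s o\<^sub>L U \<epsilon> s)"
proof -
  define \<Theta> where "\<Theta> \<epsilon> s = op_inverse (U \<epsilon> s) o\<^sub>L V \<epsilon> s" for \<epsilon> s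
  define \<Xi> where "\<Xi> \<epsilon> s = op_inverse (V \<epsilon> s) o\<^sub>L U \<epsilon> s" for \<epsilon> s
  have \<Theta>: "Ob k (\<lambda>\<epsilon> s. \<Theta> \<epsilon> s - id_blinfun)"
    using UV(1) by (simp add: \<Theta>_def)
  obtain C where C: "C \<ge> 0" "\<forall>\<^sub>F \<epsilon> in at_right 0. \<forall>s\<in>{0..1}. norm (\<Theta> \<epsilon> s - id_blinfun) \<le> C * \<epsilon> ^ 1"
    by (rule ObE[OF Ob_mono[OF \<Theta> UV(2)]])
  \<comment> \<open>For \<epsilon> below this threshold \<Theta> is within 1/2 of the identity, so
    its inverse \<Xi> has norm at most 2.\<close>
  have "1 / (2 * (C + 1)) > 0" using C(1) by simp
  from C(2) U V eventually_pos eventually_le[OF this]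
  have "\<forall>\<^sub>F \<epsilon> in at_right 0. \<forall>s\<in>{0..1}. norm (\<Xi> \<epsilon> s) \<le> 2"
  proof eventually_elim
    case (elim \<epsilon>)
    show ?case
    proof
      fix s :: real assume s: "s \<in> {0..1}"
      have inv: "op_invertible (U \<epsilon> s)" "op_invertible (V \<epsilon> s)" using elim s by auto
      have 1: "op_invertible (\<Theta> \<epsilon> s)" "op_inverse (\<Theta> \<epsilon> s) = \<Xi> \<epsilon> s"
        unfolding \<Theta>_def \<Xi>_def
        using op_invertible_compose[OF op_inverse_invertible(1)[OF inv(1)] inv(2)] op_inverse_invertible(2)[OF inv(1)] by auto
      have "C * \<epsilon> \<le> (C + 1) * (1 / (2 * (C + 1)))"
        using elim C(1) by (intro mult_mono) auto
      also have "\<dots> = 1 / 2" using C(1) by (simp add: field_simps)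
      finally have "norm (\<Theta> \<epsilon> s - id_blinfun) \<le> 1 / 2"
        using elim(1) s by force
      then have "norm (\<Theta> \<epsilon> s - id_blinfun) * norm (op_inverse (id_blinfun :: 'a \<Rightarrow>\<^sub>L 'a)) \<le> 1 / 2 * 1"
        using norm_id_blinfun_le[where 'a='a] by (intro mult_mono) auto
      then have "norm (\<Xi> \<epsilon> s) \<le> 2 * norm (op_inverse (id_blinfun :: 'a \<Rightarrow>\<^sub>L 'a))"
        unfolding 1(2)[symmetric] by (intro norm_op_inverse_near 1) auto
      then show "norm (\<Xi> \<epsilon> s) \<le> 2"
        using norm_id_blinfun_le[where 'a='a] by simp
    qed
  qed
  then have \<Xi>0: "Ob 0 \<Xi>"
    by (intro ObI[of _ 2]) simp
  have \<Xi>: "Ob k (\<lambda>\<epsilon> s. \<Xi> \<epsilon> s - id_blinfun)"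
  proof (rule Ob_cong[OF Ob_minus[OF Ob_compose_left[OF \<Xi>0 \<Theta>]]])
    show "\<forall>\<^sub>F \<epsilon> in at_right 0. \<forall>s\<in>{0..1}. \<Xi> \<epsilon> s - id_blinfun = - (\<Xi> \<epsilon> s o\<^sub>L (\<Theta> \<epsilon> s - id_blinfun))"
      using U V by eventually_elim
        (simp add: \<Xi>_def \<Theta>_def blinfun_compose_linear blinfun_compose_assoc op_inverse_compose)
  qed
  have U0: "Ob 0 U" "Ob 0 (\<lambda>\<epsilon> s. op_inverse (U \<epsilon> s))"
    by (rule ObI[of _ 1], rule eventually_mono[OF U], simp)+
  show conj: "Ob l (\<lambda>\<epsilon> s. op_inverse (U \<epsilon> s) o\<^sub>L X \<epsilon> s o\<^sub>L U \<epsilon> s)"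
    by (intro Ob_compose_right[OF Ob_compose_left] U0 X)
  have \<Theta>0: "Ob 0 \<Theta>"
    using Ob_add[OF Ob_mono[OF \<Theta>, of 0] Ob_const[of id_blinfun]] by simp
  \<comment> \<open>With \<open>A\<close> for the conjugate by \<open>U\<close>, the conjugate by
    \<open>V\<close> is \<Xi> \<open>A\<close> \<Theta>. Inserting \<open>A\<close> \<Theta> in the
    middle, each of the two differences acquires a factor of order \<epsilon>^k.\<close>
  have "Ob (k + l) (\<lambda>\<epsilon> s. ((\<Xi> \<epsilon> s - id_blinfun) o\<^sub>L (op_inverse (U \<epsilon> s) o\<^sub>L X \<epsilon> s o\<^sub>L U \<epsilon> s)) o\<^sub>L \<Theta> \<epsilon> s)"
    by (rule Ob_compose_right[OF Ob_compose[OF \<Xi> conj] \<Theta>0])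
  moreover have "Ob (k + l) (\<lambda>\<epsilon> s. (op_inverse (U \<epsilon> s) o\<^sub>L X \<epsilon> s o\<^sub>L U \<epsilon> s) o\<^sub>L (\<Theta> \<epsilon> s - id_blinfun))"
    using Ob_compose[OF conj \<Theta>] by (simp add: add.commute)
  ultimately have "Ob (k + l) (\<lambda>\<epsilon> s. ((\<Xi> \<epsilon> s - id_blinfun) o\<^sub>L (op_inverse (U \<epsilon> s) o\<^sub>L X \<epsilon> s o\<^sub>L U \<epsilon> s) o\<^sub>L \<Theta> \<epsilon> s) +
      (op_inverse (U \<epsilon> s) o\<^sub>L X \<epsilon> s o\<^sub>L U \<epsilon> s o\<^sub>L (\<Theta> \<epsilon> s - id_blinfun)))"
    by (rule Ob_add)
  then show "Ob (k + l) (\<lambda>\<epsilon> s. (op_inverse (V \<epsilon> s) o\<^sub>L X \<epsilon> s o\<^sub>L V \<epsilon> s) - (op_inverse (U \<epsilon> s) o\<^sub>L X \<epsilon> s o\<^sub>L U \<epsilon> s))"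
  proof (rule Ob_cong)
    show "\<forall>\<^sub>F \<epsilon> in at_right 0. \<forall>s\<in>{0..1}. (op_inverse (V \<epsilon> s) o\<^sub>L X \<epsilon> s o\<^sub>L V \<epsilon> s) - (op_inverse (U \<epsilon> s) o\<^sub>L X \<epsilon> s o\<^sub>L U \<epsilon> s) =
      ((\<Xi> \<epsilon> s - id_blinfun) o\<^sub>L (op_inverse (U \<epsilon> s) o\<^sub>L X \<epsilon> s o\<^sub>L U \<epsilon> s) o\<^sub>L \<Theta> \<epsilon> s) +
      (op_inverse (U \<epsilon> s) o\<^sub>L X \<epsilon> s o\<^sub>L U \<epsilon> s o\<^sub>L (\<Theta> \<epsilon> s - id_blinfun))"
      using U by eventually_elim
        (simp add: \<Xi>_def \<Theta>_def blinfun_compose_linear blinfun_compose_assoc)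
  qed
qed

context gapped_family
begin

text \<open>Since \<open>osc_bound\<close> is linear in the common bound of \<open>Z\<close> and its
  derivative, a family already of order \<epsilon>^k gains one more power. \<open>C1b\<close>
  supplies exactly the two bounds.\<close>

lemma osc_Ob:
  assumes \<alpha>: "\<alpha> \<in> {0..1}" and U: "\<And>\<epsilon>. \<epsilon> > 0 \<Longrightarrow> is_evolution \<epsilon> (H \<alpha>) (U \<epsilon>)" and Z: "C1b k Z"
  shows "Ob (Suc k) (\<lambda>\<epsilon> t. integral {0..t} (\<lambda>s. op_inverse (U \<epsilon> s) o\<^sub>L commutator (P \<alpha> s) (Z \<epsilon> s) o\<^sub>L U \<epsilon> s))"
proof -
  obtain M where M: "M \<ge> 0" "\<And>t. t \<in> {0..1} \<Longrightarrow> osc_bound \<alpha> M 0 t"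
    using osc_bound_uniform[OF \<alpha>] by blast
  obtain Z' where Z': "Ob k Z" "Ob k Z'" "\<forall>\<^sub>F \<epsilon> in at_right 0.
     (\<forall>s\<in>{0..1}. (Z \<epsilon> has_vector_derivative Z' \<epsilon> s) (at s within {0..1}) \<and> clin (Z \<epsilon> s)) \<and>
     continuous_on {0..1} (Z' \<epsilon>)"
    by (rule C1bE[OF Z])
  obtain C where C: "C \<ge> 0" "\<forall>\<^sub>F \<epsilon> in at_right 0. \<forall>s\<in>{0..1}. norm (Z \<epsilon> s) \<le> C * \<epsilon> ^ k"
    by (rule ObE[OF Z'(1)])
  obtain D where D: "D \<ge> 0" "\<forall>\<^sub>F \<epsilon> in at_right 0. \<forall>s\<in>{0..1}. norm (Z' \<epsilon> s) \<le> D * \<epsilon> ^ k"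
    by (rule ObE[OF Z'(2)])
  have "\<forall>\<^sub>F \<epsilon> in at_right 0. \<forall>t\<in>{0..1}.
      norm (integral {0..t} (\<lambda>s. op_inverse (U \<epsilon> s) o\<^sub>L commutator (P \<alpha> s) (Z \<epsilon> s) o\<^sub>L U \<epsilon> s)) \<le> (M * (C + D)) * \<epsilon> ^ Suc k"
    using C(2) D(2) Z'(3) eventually_pos
  proof eventually_elim
    case (elim \<epsilon>)
    have e: "\<epsilon> ^ k \<ge> 0" using elim(4) by simp
    have le: "C * \<epsilon> ^ k \<le> (C + D) * \<epsilon> ^ k" "D * \<epsilon> ^ k \<le> (C + D) * \<epsilon> ^ k"
      using C(1) D(1) e by (simp_all add: distrib_right)
    have nZ: "\<forall>s\<in>{0..1}. (Z \<epsilon> has_vector_derivative Z' \<epsilon> s) (at s within {0..1}) \<and> clin (Z \<epsilon> s) \<and>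
        norm (Z \<epsilon> s) \<le> (C + D) * \<epsilon> ^ k \<and> norm (Z' \<epsilon> s) \<le> (C + D) * \<epsilon> ^ k"
      using elim(1-3) le by (meson order_trans)
    show ?case
    proof
      fix t :: real assume t: "t \<in> {0..1}"
      have "norm (integral {0..t} (\<lambda>s. op_inverse (U \<epsilon> s) o\<^sub>L commutator (P \<alpha> s) (Z \<epsilon> s) o\<^sub>L U \<epsilon> s))
          \<le> M * ((C + D) * \<epsilon> ^ k) * \<epsilon>"
        using M(2)[OF t] elim(3,4) U[OF elim(4)] nZ unfolding osc_bound_def by blast
      then show "norm (integral {0..t} (\<lambda>s. op_inverse (U \<epsilon> s) o\<^sub>L commutator (P \<alpha> s) (Z \<epsilon> s) o\<^sub>L U \<epsilon> s))
          \<le> (M * (C + D)) * \<epsilon> ^ Suc k"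
        by (simp add: mult_ac)
    qed
  qed
  then show ?thesis by (rule ObI)
qed

end

section \<open>Expansion of the charge\<close>

lemmas op_ring_simps = blinfun_compose_linear blinfun_compose_assoc scaleC_blinfun_compose_left
  clin_compose_scaleC commutator_def block_diagonal_def

lemma idempotent_absorb:
  assumes "p o\<^sub>L p = p"
  shows "p o\<^sub>L (p o\<^sub>L x) = p o\<^sub>L x"
  using assms by (simp add: blinfun_compose_assoc[symmetric])

text \<open>In both diagonal blocks the two terms of the commutator coincide, or both vanish.
  Applied to \<open>K\<close> and \<open>P\<close>, this says that \<open>K\<close> is
  off-diagonal.\<close>

lemma block_diagonal_commutator:
  assumes "p o\<^sub>L p = p" "clin p"
  shows "block_diagonal p (c *\<^sub>C commutator d p) = 0"
  using assms by (simp add: op_ring_simps idempotent_absorb scaleC_right_simps)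

text \<open>A telescoping expansion with a factor \<open>p1 - p\<close> in each term; the
  complements differ by the same operator up to sign.\<close>

lemma block_diagonal_diff:
  "block_diagonal p1 k - block_diagonal p k =
     (((p1 - p) o\<^sub>L k) o\<^sub>L p1) + ((p o\<^sub>L k) o\<^sub>L (p1 - p)) - (((p1 - p) o\<^sub>L k) o\<^sub>L (id_blinfun - p1))
       - (((id_blinfun - p) o\<^sub>L k) o\<^sub>L (p1 - p))"
  by (simp add: op_ring_simps algebra_simps)

text \<open>For an idempotent \<open>p\<close> the double commutator with \<open>p\<close> extracts
  the off-diagonal part. The operator on the right has no diagonal part: that of
  \<open>commutator d p\<close> vanishes and that of \<open>k\<close> has been removed.\<close>

lemma block_offdiagonal:
  assumes "p o\<^sub>L p = p" "clin p"
  shows "commutator p (commutator p (c *\<^sub>C commutator d p - k + block_diagonal p k)) =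
    c *\<^sub>C commutator d p - k + block_diagonal p k"
  using assms
  by (simp add: op_ring_simps idempotent_absorb scaleC_right_simps scaleC_add_right algebra_simps)

lemma commutator_block:
  assumes "p o\<^sub>L p = p"
  shows "p o\<^sub>L block_diagonal p k = block_diagonal p k o\<^sub>L p"
  using assms by (simp add: op_ring_simps idempotent_absorb)

text \<open>Differentiating idempotence gives the first identity; multiplying it by the projector on
  both sides gives the second, that is, the derivative is off-diagonal.\<close>

lemma idempotent_derivative:
  assumes idem: "\<And>s. s \<in> {0..1} \<Longrightarrow> f s o\<^sub>L f s = f s"
    and f: "(f has_vector_derivative d) (at s within {0..1})" and s: "s \<in> {0..1}"
  shows "(f s o\<^sub>L d) + (d o\<^sub>L f s) = d" "f s o\<^sub>L d o\<^sub>L f s = 0"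
proof -
  have "((\<lambda>s. f s o\<^sub>L f s) has_vector_derivative (f s o\<^sub>L d) + (d o\<^sub>L f s)) (at s within {0..1})"
    by (rule has_vector_derivative_compose[OF f f])
  from has_vector_derivative_transform[OF s idem[symmetric] this]
  have "(f has_vector_derivative (f s o\<^sub>L d) + (d o\<^sub>L f s)) (at s within {0..1})" .
  from deriv01_eqI[OF this s] deriv01_eqI[OF f s] show 1: "(f s o\<^sub>L d) + (d o\<^sub>L f s) = d"
    by simp
  have "(f s o\<^sub>L ((f s o\<^sub>L d) + (d o\<^sub>L f s))) o\<^sub>L f s = f s o\<^sub>L d o\<^sub>L f s"
    unfolding 1 ..
  then show "f s o\<^sub>L d o\<^sub>L f s = 0"
    by (simp add: op_ring_simps idempotent_absorb idem[OF s])
qed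

lemma C1b_mono: "C1b k Z \<Longrightarrow> l \<le> k \<Longrightarrow> C1b l Z"
  unfolding C1b_def using Ob_mono by blast

lemma conjugation_continuous:
  fixes V :: "real \<Rightarrow> 'a::{complex_normed_vector, banach} \<Rightarrow>\<^sub>L 'a"
  assumes "is_evolution \<epsilon> G V" "\<epsilon> \<noteq> 0" "continuous_on {0..1} G" "continuous_on {0..1} X"
  shows "continuous_on {0..1} (\<lambda>s. op_inverse (V s) o\<^sub>L X s o\<^sub>L V s)"
  by (intro continuous_on_compose_op evolution_inverse_continuous[OF assms(1-3)] is_evolution_continuous[OF assms(1)] assms(4))

lemma Ob_integral_split:
  fixes X Y :: "real \<Rightarrow> real \<Rightarrow> 'b::banach"
  assumes "Ob k (\<lambda>\<epsilon> t. integral {0..t} (Y \<epsilon>))" "Ob k (\<lambda>\<epsilon> s. X \<epsilon> s - Y \<epsilon> s)"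
    and cont: "\<forall>\<^sub>F \<epsilon> in at_right 0. continuous_on {0..1} (X \<epsilon>)" "\<forall>\<^sub>F \<epsilon> in at_right 0. continuous_on {0..1} (Y \<epsilon>)"
  shows "Ob k (\<lambda>\<epsilon> t. integral {0..t} (X \<epsilon>))"
proof -
  have "\<forall>\<^sub>F \<epsilon> in at_right 0. continuous_on {0..1} (\<lambda>s. X \<epsilon> s - Y \<epsilon> s)"
    using cont by eventually_elim (rule continuous_on_diff)
  from Ob_add[OF assms(1) Ob_integral[OF assms(2) this]] show ?thesis
  proof (rule Ob_cong)
    show "\<forall>\<^sub>F \<epsilon> in at_right 0. \<forall>t\<in>{0..1}. integral {0..t} (X \<epsilon>) = integral {0..t} (Y \<epsilon>) + integral {0..t} (\<lambda>s. X \<epsilon> s - Y \<epsilon> s)"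
      using cont
    proof eventually_elim
      case (elim \<epsilon>)
      show ?case
      proof
        fix t :: real assume "t \<in> {0..1}"
        then have "{0..t} \<subseteq> {0..1}" by auto
        then have "X \<epsilon> integrable_on {0..t}" "Y \<epsilon> integrable_on {0..t}"
          using elim continuous_on_subset integrable_continuous_interval by blast+
        then show "integral {0..t} (X \<epsilon>) = integral {0..t} (Y \<epsilon>) + integral {0..t} (\<lambda>s. X \<epsilon> s - Y \<epsilon> s)"
          by (simp add: Henstock_Kurzweil_Integration.integral_diff)
      qed
    qed
  qed
qed

text \<open>What decides the order is the integral of the conjugated perturbation, not its size: for
  \<open>E\<close> itself boundedness is enough.\<close>

lemma comparison_Ob:
  fixes U V :: "real \<Rightarrow> real \<Rightarrow> 'a::chilbert_space \<Rightarrow>\<^sub>L 'a"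
  assumes U: "\<And>\<epsilon>. \<epsilon> > 0 \<Longrightarrow> is_evolution \<epsilon> H (U \<epsilon>)" and H: "continuous_on {0..1} H"
    and sa: "\<And>t. t \<in> {0..1} \<Longrightarrow> self_adjoint (H t)"
    and V: "\<forall>\<^sub>F \<epsilon> in at_right 0. is_evolution \<epsilon> (\<lambda>t. H t + \<epsilon> *\<^sub>R E \<epsilon> t) (V \<epsilon>)"
    and E: "Ob 0 E" "\<forall>\<^sub>F \<epsilon> in at_right 0. continuous_on {0..1} (E \<epsilon>)" "\<forall>\<^sub>F \<epsilon> in at_right 0. \<forall>s\<in>{0..1}. clin (E \<epsilon> s)"
    and I: "Ob k (\<lambda>\<epsilon> t. integral {0..t} (\<lambda>s. op_inverse (U \<epsilon> s) o\<^sub>L E \<epsilon> s o\<^sub>L U \<epsilon> s))"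
  shows "Ob k (\<lambda>\<epsilon> s. (op_inverse (U \<epsilon> s) o\<^sub>L V \<epsilon> s) - id_blinfun)"
proof -
  obtain m where m: "m \<ge> 0" "\<forall>\<^sub>F \<epsilon> in at_right 0. \<forall>s\<in>{0..1}. norm (E \<epsilon> s) \<le> m * \<epsilon> ^ 0"
    by (rule ObE[OF E(1)])
  obtain C where C: "C \<ge> 0" "\<forall>\<^sub>F \<epsilon> in at_right 0. \<forall>t\<in>{0..1}.
      norm (integral {0..t} (\<lambda>s. op_inverse (U \<epsilon> s) o\<^sub>L E \<epsilon> s o\<^sub>L U \<epsilon> s)) \<le> C * \<epsilon> ^ k"
    by (rule ObE[OF I])
  have "\<forall>\<^sub>F \<epsilon> in at_right 0. \<forall>s\<in>{0..1}. norm ((op_inverse (U \<epsilon> s) o\<^sub>L V \<epsilon> s) - id_blinfun) \<le>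
      (2 * exp (2 * m + 1) * (1 + m) * C) * \<epsilon> ^ k"
    using V E(2,3) m(2) C(2) eventually_pos
  proof eventually_elim
    case (elim \<epsilon>)
    show ?case
    proof
      fix s :: real assume s: "s \<in> {0..1}"
      have "norm ((op_inverse (U \<epsilon> s) o\<^sub>L V \<epsilon> s) - id_blinfun) \<le> 2 * exp (2 * m + 1) * (1 + m) * (C * \<epsilon> ^ k)"
        by (rule evolution_comparison[OF U _ H sa elim(1,2)]) (use elim s in auto)
      then show "norm ((op_inverse (U \<epsilon> s) o\<^sub>L V \<epsilon> s) - id_blinfun) \<le> (2 * exp (2 * m + 1) * (1 + m) * C) * \<epsilon> ^ k"
        by (simp add: mult.assoc)
    qed
  qed
  then show ?thesis by (rule ObI)
qed

section \<open>The generator of the second-order evolution and the comparison with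
  \<open>U\<close>\<close>

context gapped_family
begin

definition K1 :: "real \<Rightarrow> real \<Rightarrow> real \<Rightarrow> 'a \<Rightarrow>\<^sub>L 'a" where
  "K1 \<alpha> \<epsilon> s = \<i> *\<^sub>C commutator (dP1 \<alpha> \<epsilon> s) (P1 \<alpha> \<epsilon> s)"

text \<open>The generator of the second-order evolution is \<open>H + \<epsilon> E\<close>.\<close>

definition E :: "real \<Rightarrow> real \<Rightarrow> real \<Rightarrow> 'a \<Rightarrow>\<^sub>L 'a" where
  "E \<alpha> \<epsilon> s = K1 \<alpha> \<epsilon> s - K \<alpha> s + block_diagonal (P1 \<alpha> \<epsilon> s) (K \<alpha> s)"

definition dH :: "real \<Rightarrow> real \<Rightarrow> 'a \<Rightarrow>\<^sub>L 'a" where "dH \<alpha> s = deriv01 (\<lambda>a. H a s) \<alpha>"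

definition dK :: "real \<Rightarrow> real \<Rightarrow> 'a \<Rightarrow>\<^sub>L 'a" where "dK \<alpha> s = deriv01 (\<lambda>a. K a s) \<alpha>"

lemma K_commutator: "K \<alpha> s = \<i> *\<^sub>C commutator (dP \<alpha> s) (P \<alpha> s)"
  by (simp add: K_def dP_def)

lemma eventually_P1_close:
  assumes \<alpha>: "\<alpha> \<in> {0..1}"
  shows "\<exists>C. \<forall>\<^sub>F \<epsilon> in at_right 0. \<forall>s\<in>{0..1}. P1_close \<alpha> C \<epsilon> s"
proof (rule P1_close_uniform[OF \<alpha>])
  fix e C :: real
  assume e: "e > 0" "\<And>\<epsilon> s. 0 < \<epsilon> \<Longrightarrow> \<epsilon> \<le> e \<Longrightarrow> s \<in> {0..1} \<Longrightarrow> P1_close \<alpha> C \<epsilon> s"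
  have "\<forall>\<^sub>F \<epsilon> in at_right 0. \<forall>s\<in>{0..1}. P1_close \<alpha> C \<epsilon> s"
    using eventually_pos eventually_le[OF e(1)] by eventually_elim (auto intro: e(2))
  then show ?thesis by blast
qed

lemma P_C1b: "\<alpha> \<in> {0..1} \<Longrightarrow> C1b 0 (\<lambda>\<epsilon>. P \<alpha>)"
  by (rule C1b_fixed[OF P_derivatives(1) _ continuous_on_vector_derivative[OF P_derivatives(2)]])
    (auto intro: P_projector)

lemma dP_C1b: "\<alpha> \<in> {0..1} \<Longrightarrow> C1b 0 (\<lambda>\<epsilon>. dP \<alpha>)"
  by (rule C1b_fixed[OF P_derivatives(2) _ P_derivatives(3)]) (auto intro: dP_clin)

lemma P1_properties:
  assumes \<alpha>: "\<alpha> \<in> {0..1}"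
  shows "\<forall>\<^sub>F \<epsilon> in at_right 0. \<forall>s\<in>{0..1}. clin (P1 \<alpha> \<epsilon> s) \<and> P1 \<alpha> \<epsilon> s o\<^sub>L P1 \<alpha> \<epsilon> s = P1 \<alpha> \<epsilon> s \<and>
     P1 \<alpha> \<epsilon> s o\<^sub>L (H \<alpha> s - \<epsilon> *\<^sub>R K \<alpha> s) = (H \<alpha> s - \<epsilon> *\<^sub>R K \<alpha> s) o\<^sub>L P1 \<alpha> \<epsilon> s \<and>
     (P1 \<alpha> \<epsilon> has_vector_derivative dP1 \<alpha> \<epsilon> s) (at s within {0..1})"
    and "C1b 1 (\<lambda>\<epsilon> s. P1 \<alpha> \<epsilon> s - P \<alpha> s)" "C1b 1 (\<lambda>\<epsilon> s. dP1 \<alpha> \<epsilon> s - dP \<alpha> s)"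
proof -
  obtain C where C: "\<forall>\<^sub>F \<epsilon> in at_right 0. \<forall>s\<in>{0..1}. P1_close \<alpha> C \<epsilon> s"
    using eventually_P1_close[OF \<alpha>] by blast
  then show "\<forall>\<^sub>F \<epsilon> in at_right 0. \<forall>s\<in>{0..1}. clin (P1 \<alpha> \<epsilon> s) \<and> P1 \<alpha> \<epsilon> s o\<^sub>L P1 \<alpha> \<epsilon> s = P1 \<alpha> \<epsilon> s \<and>
     P1 \<alpha> \<epsilon> s o\<^sub>L (H \<alpha> s - \<epsilon> *\<^sub>R K \<alpha> s) = (H \<alpha> s - \<epsilon> *\<^sub>R K \<alpha> s) o\<^sub>L P1 \<alpha> \<epsilon> s \<and>
     (P1 \<alpha> \<epsilon> has_vector_derivative dP1 \<alpha> \<epsilon> s) (at s within {0..1})"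
    by eventually_elim (auto simp: P1_close_def)
  have ob: "Ob 1 (\<lambda>\<epsilon> s. P1 \<alpha> \<epsilon> s - P \<alpha> s)" "Ob 1 (\<lambda>\<epsilon> s. dP1 \<alpha> \<epsilon> s - dP \<alpha> s)" "Ob 1 (\<lambda>\<epsilon> s. ddP1 \<alpha> \<epsilon> s - ddP \<alpha> s)"
    by (rule ObI[of _ C], rule eventually_mono[OF C], simp add: P1_close_def)+
  have d: "\<forall>\<^sub>F \<epsilon> in at_right 0. \<forall>s\<in>{0..1}. (P1 \<alpha> \<epsilon> has_vector_derivative dP1 \<alpha> \<epsilon> s) (at s within {0..1})"
    "\<forall>\<^sub>F \<epsilon> in at_right 0. \<forall>s\<in>{0..1}. (dP1 \<alpha> \<epsilon> has_vector_derivative ddP1 \<alpha> \<epsilon> s) (at s within {0..1})"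
    "\<forall>\<^sub>F \<epsilon> in at_right 0. \<forall>s\<in>{0..1}. clin (P1 \<alpha> \<epsilon> s)"
    "\<forall>\<^sub>F \<epsilon> in at_right 0. continuous_on {0..1} (ddP1 \<alpha> \<epsilon>)"
    by (rule eventually_mono[OF C], simp add: P1_close_def continuous_on_eq_continuous_within)+
  have c1: "\<forall>\<^sub>F \<epsilon> in at_right 0. continuous_on {0..1} (dP1 \<alpha> \<epsilon>)"
    using d(2) by eventually_elim (rule continuous_on_vector_derivative, blast)
  have cl1: "\<forall>\<^sub>F \<epsilon> in at_right 0. \<forall>s\<in>{0..1}. clin (dP1 \<alpha> \<epsilon> s)"
    using d(1,3)
  proof eventually_elim
    case (elim \<epsilon>)
    show ?case
    proof
      fix s :: real assume s: "s \<in> {0..1}"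
      show "clin (dP1 \<alpha> \<epsilon> s)"
        by (rule clin_has_vector_derivative[of "P1 \<alpha> \<epsilon>" _ s "{0..1}"])
          (use elim s in \<open>auto simp: trivial_limit_within islimpt_Icc\<close>)
    qed
  qed
  have cdP: "continuous_on {0..1} (dP \<alpha>)"
    by (rule continuous_on_vector_derivative[OF P_derivatives(2)[OF \<alpha>]])
  show "C1b 1 (\<lambda>\<epsilon> s. P1 \<alpha> \<epsilon> s - P \<alpha> s)"
  proof (rule C1bI[OF ob(1,2)])
    show "\<forall>\<^sub>F \<epsilon> in at_right 0. \<forall>s\<in>{0..1}. ((\<lambda>s. P1 \<alpha> \<epsilon> s - P \<alpha> s) has_vector_derivative dP1 \<alpha> \<epsilon> s - dP \<alpha> s) (at s within {0..1})"
      using d(1) by eventually_elim (auto intro!: has_vector_derivative_diff P_derivatives \<alpha>)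
    show "\<forall>\<^sub>F \<epsilon> in at_right 0. \<forall>s\<in>{0..1}. clin (P1 \<alpha> \<epsilon> s - P \<alpha> s)"
      using d(3) by eventually_elim (auto intro!: clin_simps P_projector \<alpha>)
    show "\<forall>\<^sub>F \<epsilon> in at_right 0. continuous_on {0..1} (\<lambda>s. dP1 \<alpha> \<epsilon> s - dP \<alpha> s)"
      using c1 by eventually_elim (rule continuous_on_diff[OF _ cdP])
  qed
  show "C1b 1 (\<lambda>\<epsilon> s. dP1 \<alpha> \<epsilon> s - dP \<alpha> s)"
  proof (rule C1bI[OF ob(2,3)])
    show "\<forall>\<^sub>F \<epsilon> in at_right 0. \<forall>s\<in>{0..1}. ((\<lambda>s. dP1 \<alpha> \<epsilon> s - dP \<alpha> s) has_vector_derivative ddP1 \<alpha> \<epsilon> s - ddP \<alpha> s) (at s within {0..1})"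
      using d(2) by eventually_elim (auto intro!: has_vector_derivative_diff P_derivatives \<alpha>)
    show "\<forall>\<^sub>F \<epsilon> in at_right 0. \<forall>s\<in>{0..1}. clin (dP1 \<alpha> \<epsilon> s - dP \<alpha> s)"
      using cl1 by eventually_elim (auto intro!: clin_simps dP_clin \<alpha>)
    show "\<forall>\<^sub>F \<epsilon> in at_right 0. continuous_on {0..1} (\<lambda>s. ddP1 \<alpha> \<epsilon> s - ddP \<alpha> s)"
      using d(4) by eventually_elim (rule continuous_on_diff[OF _ P_derivatives(3)[OF \<alpha>]])
  qed
qed

lemma P1_C1b: "\<alpha> \<in> {0..1} \<Longrightarrow> C1b 0 (P1 \<alpha>)"
  using C1b_add[OF C1b_mono[OF P1_properties(2), of \<alpha> 0] P_C1b[of \<alpha>]] by simp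

lemma dP1_C1b: "\<alpha> \<in> {0..1} \<Longrightarrow> C1b 0 (dP1 \<alpha>)"
  using C1b_add[OF C1b_mono[OF P1_properties(3), of \<alpha> 0] dP_C1b[of \<alpha>]] by simp

lemma K_C1b: "\<alpha> \<in> {0..1} \<Longrightarrow> C1b 0 (\<lambda>\<epsilon>. K \<alpha>)"
  using C1b_scaleC[where c = \<i>, OF C1b_commutator_left[OF dP_C1b P_C1b], of \<alpha> \<alpha>] by (simp add: K_commutator[abs_def])

lemma K1_C1b: "\<alpha> \<in> {0..1} \<Longrightarrow> C1b 0 (K1 \<alpha>)"
  using C1b_scaleC[where c = \<i>, OF C1b_commutator_left[OF dP1_C1b P1_C1b], of \<alpha> \<alpha>] by (simp add: K1_def[abs_def])

text \<open>If \<open>P1\<close> were \<open>P\<close>, then \<open>K1\<close> would be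
  \<open>K\<close> and the diagonal part of \<open>K\<close> would vanish, so \<open>E\<close> would
  be zero. Expanding around this case puts into each term a factor \<open>P1 - P\<close> or the
  difference of their time derivatives, both of order \<epsilon> in \<open>C1b\<close>.\<close>

lemma E_C1b:
  assumes \<alpha>: "\<alpha> \<in> {0..1}"
  shows "C1b 1 (E \<alpha>)"
proof -
  note P = P_C1b[OF \<alpha>] and P1 = P1_C1b[OF \<alpha>] and K = K_C1b[OF \<alpha>] and \<delta> = P1_properties(2,3)[OF \<alpha>]
  note I = C1b_const[OF clin_simps(1)]
  have c1: "C1b 1 (\<lambda>\<epsilon> s. \<i> *\<^sub>C commutator (dP1 \<alpha> \<epsilon> s - dP \<alpha> s) (P1 \<alpha> \<epsilon> s))"
    unfolding commutator_def by (intro C1b_scaleC C1b_diff C1b_compose_right C1b_compose_left P1 \<delta>)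
  have c2: "C1b 1 (\<lambda>\<epsilon> s. \<i> *\<^sub>C commutator (dP \<alpha> s) (P1 \<alpha> \<epsilon> s - P \<alpha> s))"
    by (intro C1b_scaleC C1b_commutator_left dP_C1b \<alpha> \<delta>)
  have c3: "C1b 1 (\<lambda>\<epsilon> s. (P1 \<alpha> \<epsilon> s - P \<alpha> s) o\<^sub>L K \<alpha> s o\<^sub>L P1 \<alpha> \<epsilon> s)"
    by (rule C1b_compose_right[OF C1b_compose_right[OF \<delta>(1) K] P1])
  have c4: "C1b 1 (\<lambda>\<epsilon> s. P \<alpha> s o\<^sub>L K \<alpha> s o\<^sub>L (P1 \<alpha> \<epsilon> s - P \<alpha> s))"
    by (rule C1b_compose_left[OF C1b_compose_left[OF P K] \<delta>(1)])
  have c5: "C1b 1 (\<lambda>\<epsilon> s. (P1 \<alpha> \<epsilon> s - P \<alpha> s) o\<^sub>L K \<alpha> s o\<^sub>L (id_blinfun - P1 \<alpha> \<epsilon> s))"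
    by (rule C1b_compose_right[OF C1b_compose_right[OF \<delta>(1) K] C1b_diff[OF I P1]])
  have c6: "C1b 1 (\<lambda>\<epsilon> s. (id_blinfun - P \<alpha> s) o\<^sub>L K \<alpha> s o\<^sub>L (P1 \<alpha> \<epsilon> s - P \<alpha> s))"
    by (rule C1b_compose_left[OF C1b_compose_left[OF C1b_diff[OF I P] K] \<delta>(1)])
  show ?thesis
  proof (rule C1b_cong[OF C1b_add[OF C1b_add[OF c1 c2] C1b_diff[OF C1b_diff[OF C1b_add[OF c3 c4] c5] c6]]],
      rule always_eventually, intro allI ballI)
    fix \<epsilon> s :: real assume s: "s \<in> {0..1}"
    have "block_diagonal (P \<alpha> s) (K \<alpha> s) = 0"
      unfolding K_commutator by (intro block_diagonal_commutator P_projector \<alpha> s)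
    then have "block_diagonal (P1 \<alpha> \<epsilon> s) (K \<alpha> s) =
        ((P1 \<alpha> \<epsilon> s - P \<alpha> s) o\<^sub>L K \<alpha> s o\<^sub>L P1 \<alpha> \<epsilon> s) + (P \<alpha> s o\<^sub>L K \<alpha> s o\<^sub>L (P1 \<alpha> \<epsilon> s - P \<alpha> s))
        - ((P1 \<alpha> \<epsilon> s - P \<alpha> s) o\<^sub>L K \<alpha> s o\<^sub>L (id_blinfun - P1 \<alpha> \<epsilon> s)) - ((id_blinfun - P \<alpha> s) o\<^sub>L K \<alpha> s o\<^sub>L (P1 \<alpha> \<epsilon> s - P \<alpha> s))"
      using block_diagonal_diff[of "P1 \<alpha> \<epsilon> s" "K \<alpha> s" "P \<alpha> s"] by simp
    moreover have "K1 \<alpha> \<epsilon> s - K \<alpha> s = \<i> *\<^sub>C commutator (dP1 \<alpha> \<epsilon> s - dP \<alpha> s) (P1 \<alpha> \<epsilon> s) + \<i> *\<^sub>C commutator (dP \<alpha> s) (P1 \<alpha> \<epsilon> s - P \<alpha> s)"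
      unfolding K_commutator K1_def commutator_def blinfun_compose_linear by (simp add: scaleC_right_simps)
    ultimately show "E \<alpha> \<epsilon> s = \<i> *\<^sub>C commutator (dP1 \<alpha> \<epsilon> s - dP \<alpha> s) (P1 \<alpha> \<epsilon> s) + \<i> *\<^sub>C commutator (dP \<alpha> s) (P1 \<alpha> \<epsilon> s - P \<alpha> s) +
       (((P1 \<alpha> \<epsilon> s - P \<alpha> s) o\<^sub>L K \<alpha> s o\<^sub>L P1 \<alpha> \<epsilon> s) + (P \<alpha> s o\<^sub>L K \<alpha> s o\<^sub>L (P1 \<alpha> \<epsilon> s - P \<alpha> s))
        - ((P1 \<alpha> \<epsilon> s - P \<alpha> s) o\<^sub>L K \<alpha> s o\<^sub>L (id_blinfun - P1 \<alpha> \<epsilon> s)) - ((id_blinfun - P \<alpha> s) o\<^sub>L K \<alpha> s o\<^sub>L (P1 \<alpha> \<epsilon> s - P \<alpha> s)))"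
      unfolding E_def by simp
  qed
qed

text \<open>The perturbation \<open>K\<close> is of order one, but as a commutator with
  \<open>P\<close> it has an oscillating integral of order \<epsilon>, and this integral governs the
  distance of the evolutions.\<close>

lemma first_order_comparison:
  assumes \<alpha>: "\<alpha> \<in> {0..1}" and U: "\<And>\<epsilon>. \<epsilon> > 0 \<Longrightarrow> is_evolution \<epsilon> (H \<alpha>) (U \<epsilon>)"
    and V: "\<forall>\<^sub>F \<epsilon> in at_right 0. is_evolution \<epsilon> (\<lambda>t. H \<alpha> t + \<epsilon> *\<^sub>R K \<alpha> t) (V \<epsilon>)"
  shows "Ob 1 (\<lambda>\<epsilon> s. (op_inverse (U \<epsilon> s) o\<^sub>L V \<epsilon> s) - id_blinfun)"
proof (rule comparison_Ob[OF U H_derivative(2)[OF \<alpha>] selfadj[OF \<alpha>] V])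
  have eq: "K \<alpha> s = commutator (P \<alpha> s) ((- \<i>) *\<^sub>C dP \<alpha> s)" if "s \<in> {0..1}" for s
    using P_projector(1)[OF \<alpha> that] unfolding K_commutator
    by (simp add: commutator_def scaleC_blinfun_compose_left clin_compose_scaleC scaleC_right_simps scaleC_minus_left blinfun_compose_linear)
  have "Ob 1 (\<lambda>\<epsilon> t. integral {0..t} (\<lambda>s. op_inverse (U \<epsilon> s) o\<^sub>L commutator (P \<alpha> s) ((- \<i>) *\<^sub>C dP \<alpha> s) o\<^sub>L U \<epsilon> s))"
    using osc_Ob[OF \<alpha> U C1b_scaleC[OF dP_C1b[OF \<alpha>]]] by simp
  then show "Ob 1 (\<lambda>\<epsilon> t. integral {0..t} (\<lambda>s. op_inverse (U \<epsilon> s) o\<^sub>L K \<alpha> s o\<^sub>L U \<epsilon> s))"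
    by (rule Ob_cong) (auto intro!: always_eventually Henstock_Kurzweil_Integration.integral_cong simp: eq)
qed (use C1b_Ob[OF K_C1b[OF \<alpha>]] C1b_continuous[OF K_C1b[OF \<alpha>]] C1b_clin[OF K_C1b[OF \<alpha>]] in auto)

text \<open>\<open>E\<close> is of order \<open>\<epsilon>\<close> and off-diagonal with respect to \<open>P1\<close>, hence up to \<open>\<epsilon>\<^sup>2\<close> with respect to \<open>P\<close>;
  its oscillating integral gains another factor \<open>\<epsilon>\<close>.\<close>

lemma second_order_comparison:
  assumes \<alpha>: "\<alpha> \<in> {0..1}" and U: "\<And>\<epsilon>. \<epsilon> > 0 \<Longrightarrow> is_evolution \<epsilon> (H \<alpha>) (U \<epsilon>)"
    and V: "\<forall>\<^sub>F \<epsilon> in at_right 0. is_evolution \<epsilon> (\<lambda>t. H \<alpha> t + \<epsilon> *\<^sub>R E \<alpha> \<epsilon> t) (V \<epsilon>)"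
  shows "Ob 2 (\<lambda>\<epsilon> s. (op_inverse (U \<epsilon> s) o\<^sub>L V \<epsilon> s) - id_blinfun)"
proof (rule comparison_Ob[OF U H_derivative(2)[OF \<alpha>] selfadj[OF \<alpha>] V])
  note E = E_C1b[OF \<alpha>]
  show "Ob 0 (E \<alpha>)" by (rule Ob_mono[OF C1b_Ob[OF E]]) simp
  show "\<forall>\<^sub>F \<epsilon> in at_right 0. continuous_on {0..1} (E \<alpha> \<epsilon>)" by (rule C1b_continuous[OF E])
  show "\<forall>\<^sub>F \<epsilon> in at_right 0. \<forall>s\<in>{0..1}. clin (E \<alpha> \<epsilon> s)" by (rule C1b_clin[OF E])
  let ?Z = "\<lambda>\<epsilon> s. commutator (P \<alpha> s) (E \<alpha> \<epsilon> s)"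
  have Z: "C1b 1 ?Z" by (rule C1b_commutator_left[OF P_C1b[OF \<alpha>] E])
  have U1: "\<forall>\<^sub>F \<epsilon> in at_right 0. \<forall>s\<in>{0..1}. norm (U \<epsilon> s) \<le> 1 \<and> norm (op_inverse (U \<epsilon> s)) \<le> 1"
    using eventually_pos
    by eventually_elim (auto intro!: evolution_norm_le[OF U _ H_derivative(2)[OF \<alpha>] selfadj[OF \<alpha>]])
  have U0: "Ob 0 U" "Ob 0 (\<lambda>\<epsilon> s. op_inverse (U \<epsilon> s))"
    by (rule ObI[of _ 1], rule eventually_mono[OF U1], simp)+
  have cont: "\<forall>\<^sub>F \<epsilon> in at_right 0. continuous_on {0..1} (\<lambda>s. op_inverse (U \<epsilon> s) o\<^sub>L X \<epsilon> s o\<^sub>L U \<epsilon> s)"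
    if "\<forall>\<^sub>F \<epsilon> in at_right 0. continuous_on {0..1} (X \<epsilon>)" for X
    using that eventually_pos by eventually_elim (auto intro: conjugation_continuous[OF U _ H_derivative(2)[OF \<alpha>]])
  \<comment> \<open>\<open>E\<close> equals its double commutator with \<open>P1\<close>. Exchanging
    either \<open>P1\<close> for \<open>P\<close> costs a factor of order \<epsilon>, and
    \<open>E\<close> has one already.\<close>
  have rest: "Ob 2 (\<lambda>\<epsilon> s. E \<alpha> \<epsilon> s - commutator (P \<alpha> s) (?Z \<epsilon> s))"
  proof (rule Ob_cong)
    have d: "Ob 1 (\<lambda>\<epsilon> s. P1 \<alpha> \<epsilon> s - P \<alpha> s)" by (rule C1b_Ob[OF P1_properties(2)[OF \<alpha>]])
    have a: "Ob 2 (\<lambda>\<epsilon> s. commutator (P1 \<alpha> \<epsilon> s - P \<alpha> s) (commutator (P1 \<alpha> \<epsilon> s) (E \<alpha> \<epsilon> s)))"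
      using Ob_commutator[OF d Ob_commutator[OF C1b_Ob[OF P1_C1b[OF \<alpha>]] C1b_Ob[OF E]]] by (simp add: numeral_2_eq_2)
    have b: "Ob 2 (\<lambda>\<epsilon> s. commutator (P \<alpha> s) (commutator (P1 \<alpha> \<epsilon> s - P \<alpha> s) (E \<alpha> \<epsilon> s)))"
      using Ob_commutator[OF C1b_Ob[OF P_C1b[OF \<alpha>]] Ob_commutator[OF d C1b_Ob[OF E]]] by (simp add: numeral_2_eq_2)
    show "Ob 2 (\<lambda>\<epsilon> s. commutator (P1 \<alpha> \<epsilon> s - P \<alpha> s) (commutator (P1 \<alpha> \<epsilon> s) (E \<alpha> \<epsilon> s)) +
        commutator (P \<alpha> s) (commutator (P1 \<alpha> \<epsilon> s - P \<alpha> s) (E \<alpha> \<epsilon> s)))"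
      by (rule Ob_add[OF a b])
    show "\<forall>\<^sub>F \<epsilon> in at_right 0. \<forall>s\<in>{0..1}. E \<alpha> \<epsilon> s - commutator (P \<alpha> s) (?Z \<epsilon> s) =
        commutator (P1 \<alpha> \<epsilon> s - P \<alpha> s) (commutator (P1 \<alpha> \<epsilon> s) (E \<alpha> \<epsilon> s)) +
        commutator (P \<alpha> s) (commutator (P1 \<alpha> \<epsilon> s - P \<alpha> s) (E \<alpha> \<epsilon> s))"
      using P1_properties(1)[OF \<alpha>]
    proof eventually_elim
      case (elim \<epsilon>)
      show ?case
      proof
        fix s :: real assume s: "s \<in> {0..1}"
        have "commutator (P1 \<alpha> \<epsilon> s) (commutator (P1 \<alpha> \<epsilon> s) (E \<alpha> \<epsilon> s)) = E \<alpha> \<epsilon> s"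
          unfolding E_def K1_def using elim s by (intro block_offdiagonal) auto
        moreover have "commutator (P1 \<alpha> \<epsilon> s) (commutator (P1 \<alpha> \<epsilon> s) (E \<alpha> \<epsilon> s)) - commutator (P \<alpha> s) (?Z \<epsilon> s) =
            commutator (P1 \<alpha> \<epsilon> s - P \<alpha> s) (commutator (P1 \<alpha> \<epsilon> s) (E \<alpha> \<epsilon> s)) +
            commutator (P \<alpha> s) (commutator (P1 \<alpha> \<epsilon> s - P \<alpha> s) (E \<alpha> \<epsilon> s))"
          unfolding commutator_def blinfun_compose_linear by simp
        ultimately show "E \<alpha> \<epsilon> s - commutator (P \<alpha> s) (?Z \<epsilon> s) =
            commutator (P1 \<alpha> \<epsilon> s - P \<alpha> s) (commutator (P1 \<alpha> \<epsilon> s) (E \<alpha> \<epsilon> s)) +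
            commutator (P \<alpha> s) (commutator (P1 \<alpha> \<epsilon> s - P \<alpha> s) (E \<alpha> \<epsilon> s))"
          by simp
      qed
    qed
  qed
  show "Ob 2 (\<lambda>\<epsilon> t. integral {0..t} (\<lambda>s. op_inverse (U \<epsilon> s) o\<^sub>L E \<alpha> \<epsilon> s o\<^sub>L U \<epsilon> s))"
  proof (rule Ob_integral_split)
    show "Ob 2 (\<lambda>\<epsilon> t. integral {0..t} (\<lambda>s. op_inverse (U \<epsilon> s) o\<^sub>L commutator (P \<alpha> s) (?Z \<epsilon> s) o\<^sub>L U \<epsilon> s))"
      using osc_Ob[OF \<alpha> U Z] by (simp add: numeral_2_eq_2)
    have "Ob 2 (\<lambda>\<epsilon> s. op_inverse (U \<epsilon> s) o\<^sub>L (E \<alpha> \<epsilon> s - commutator (P \<alpha> s) (?Z \<epsilon> s)) o\<^sub>L U \<epsilon> s)"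
      by (rule Ob_compose_right[OF Ob_compose_left[OF U0(2) rest] U0(1)])
    then show "Ob 2 (\<lambda>\<epsilon> s. (op_inverse (U \<epsilon> s) o\<^sub>L E \<alpha> \<epsilon> s o\<^sub>L U \<epsilon> s) - (op_inverse (U \<epsilon> s) o\<^sub>L commutator (P \<alpha> s) (?Z \<epsilon> s) o\<^sub>L U \<epsilon> s))"
      by (simp only: blinfun_compose_linear)
    show "\<forall>\<^sub>F \<epsilon> in at_right 0. continuous_on {0..1} (\<lambda>s. op_inverse (U \<epsilon> s) o\<^sub>L E \<alpha> \<epsilon> s o\<^sub>L U \<epsilon> s)"
      by (rule cont[OF C1b_continuous[OF E]])
    show "\<forall>\<^sub>F \<epsilon> in at_right 0. continuous_on {0..1} (\<lambda>s. op_inverse (U \<epsilon> s) o\<^sub>L commutator (P \<alpha> s) (?Z \<epsilon> s) o\<^sub>L U \<epsilon> s)"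
      by (rule cont[OF C1b_continuous[OF C1b_commutator_left[OF P_C1b[OF \<alpha>] Z]]])
  qed
qed


lemma dH_C1b:
  assumes \<alpha>: "\<alpha> \<in> {0..1}"
  shows "C1b 0 (\<lambda>\<epsilon>. dH \<alpha>)"
proof -
  have eq: "dH \<alpha> = (\<lambda>s. pd2 h (s, \<alpha>))"
    by (simp add: fun_eq_iff dH_def pd2_def h_def)
  note C2 = Ck_on_square_partials(2)[OF h_C3[unfolded numeral_Suc_unfold(1)]]
  show ?thesis
    unfolding eq
  proof (rule C1b_fixed)
    show "((\<lambda>s. pd2 h (s, \<alpha>)) has_vector_derivative pd1 (pd2 h) (s, \<alpha>)) (at s within {0..1})" if "s \<in> {0..1}" for s
      by (rule Ck_on_section(1)[OF C2[unfolded numeral_Suc_unfold(2)] \<alpha> that])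
    show "continuous_on {0..1} (\<lambda>s. pd1 (pd2 h) (s, \<alpha>))"
      by (rule Ck_on_section_continuous[OF Ck_on_square_partials(1)[OF C2[unfolded numeral_Suc_unfold(2)]] \<alpha>])
    show "clin (pd2 h (s, \<alpha>))" if s: "s \<in> {0..1}" for s
      by (rule clin_has_vector_derivative[OF Ck_on_section(2)[OF h_C3[unfolded numeral_Suc_unfold(1)] \<alpha> s] \<alpha>])
        (use s \<alpha> in \<open>auto simp: trivial_limit_within islimpt_Icc intro!: h_clin\<close>)
  qed
qed

lemma dK_continuous:
  assumes \<alpha>: "\<alpha> \<in> {0..1}"
  shows "continuous_on {0..1} (dK \<alpha>)"
proof -
  have eq: "dK \<alpha> = (\<lambda>s. pd2 (\<lambda>p. K (snd p) (fst p)) (s, \<alpha>))"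
    by (simp add: fun_eq_iff dK_def pd2_def)
  show ?thesis
    unfolding eq
    by (rule Ck_on_section_continuous[OF Ck_on_square_partials(2)[OF K_C2[unfolded numeral_Suc_unfold(2)]] \<alpha>])
qed

lemma deriv01_H1:
  assumes \<alpha>: "\<alpha> \<in> {0..1}" and s: "s \<in> {0..1}"
  shows "deriv01 (\<lambda>a. H a s - \<epsilon> *\<^sub>R K a s) \<alpha> = dH \<alpha> s - \<epsilon> *\<^sub>R dK \<alpha> s"
proof (rule deriv01_eqI[OF _ \<alpha>])
  have "((\<lambda>a. H a s) has_vector_derivative dH \<alpha> s) (at \<alpha> within {0..1})"
    using Ck_on_section(2)[OF h_C3[unfolded numeral_Suc_unfold(1)] \<alpha> s] by (simp add: h_def dH_def pd2_def)
  moreover have "((\<lambda>a. K a s) has_vector_derivative dK \<alpha> s) (at \<alpha> within {0..1})"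
    using Ck_on_section(2)[OF K_C2[unfolded numeral_Suc_unfold(2)] \<alpha> s] by (simp add: dK_def pd2_def)
  ultimately show "((\<lambda>a. H a s - \<epsilon> *\<^sub>R K a s) has_vector_derivative dH \<alpha> s - \<epsilon> *\<^sub>R dK \<alpha> s) (at \<alpha> within {0..1})"
    by (intro has_vector_derivative_diff bounded_linear.has_vector_derivative[OF bounded_linear_scaleR_right])
qed

text \<open>The generator is the sum of \<open>H - \<epsilon> *\<^sub>R K\<close> and \<epsilon>
  times the block-diagonal part of \<open>K\<close>, both commuting with \<open>P1\<close>, and
  \<epsilon> times \<open>K1\<close>. The commutator of \<open>K1\<close> with \<open>P1\<close> is
  \<i> times the derivative of \<open>P1\<close>, which makes \<open>op_inverse (V s) o\<^sub>L P1
  \<alpha> \<epsilon> s o\<^sub>L V s\<close> constant in time.\<close>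

lemma intertwining:
  assumes \<alpha>: "\<alpha> \<in> {0..1}" and \<epsilon>: "\<epsilon> > 0"
    and ev: "is_evolution \<epsilon> (\<lambda>t. H \<alpha> t + \<epsilon> *\<^sub>R E \<alpha> \<epsilon> t) V"
    and P1: "\<forall>s\<in>{0..1}. clin (P1 \<alpha> \<epsilon> s) \<and> P1 \<alpha> \<epsilon> s o\<^sub>L P1 \<alpha> \<epsilon> s = P1 \<alpha> \<epsilon> s \<and>
     P1 \<alpha> \<epsilon> s o\<^sub>L (H \<alpha> s - \<epsilon> *\<^sub>R K \<alpha> s) = (H \<alpha> s - \<epsilon> *\<^sub>R K \<alpha> s) o\<^sub>L P1 \<alpha> \<epsilon> s \<and>
     (P1 \<alpha> \<epsilon> has_vector_derivative dP1 \<alpha> \<epsilon> s) (at s within {0..1})"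
    and E: "continuous_on {0..1} (E \<alpha> \<epsilon>)" "\<forall>s\<in>{0..1}. clin (E \<alpha> \<epsilon> s)" and s: "s \<in> {0..1}"
  shows "op_inverse (V s) o\<^sub>L P1 \<alpha> \<epsilon> s = P1 \<alpha> \<epsilon> 0 o\<^sub>L op_inverse (V s)"
    and "P1 \<alpha> \<epsilon> s o\<^sub>L V s = V s o\<^sub>L P1 \<alpha> \<epsilon> 0"
proof -
  define G where "G t = H \<alpha> t + \<epsilon> *\<^sub>R E \<alpha> \<epsilon> t" for t
  let ?p = "P1 \<alpha> \<epsilon>" and ?d = "dP1 \<alpha> \<epsilon>" and ?c = "- (\<i> / complex_of_real \<epsilon>)"
  have \<epsilon>0: "\<epsilon> \<noteq> 0" using \<epsilon> by simp
  have ev: "is_evolution \<epsilon> G V" using ev by (simp add: G_def[abs_def])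
  have cG: "continuous_on {0..1} G"
    unfolding G_def by (intro continuous_on_add H_derivative(2)[OF \<alpha>] continuous_on_scaleR continuous_on_const E(1))
  have clG: "clin (G t)" if "t \<in> {0..1}" for t
    unfolding G_def using E(2) that self_adjoint_clin[OF selfadj[OF \<alpha> that]] by simp
  have p: "clin (?p t)" "?p t o\<^sub>L ?p t = ?p t" "(?p has_vector_derivative ?d t) (at t within {0..1})"
    "?p t o\<^sub>L (H \<alpha> t - \<epsilon> *\<^sub>R K \<alpha> t) = (H \<alpha> t - \<epsilon> *\<^sub>R K \<alpha> t) o\<^sub>L ?p t" if "t \<in> {0..1}" for t
    using P1 that by auto
  note inv = evolution_invertible[OF ev \<epsilon>0 cG]
  have clV: "clin (V t)" "clin (op_inverse (V t))" if "t \<in> {0..1}" for t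
    using evolution_clin[OF ev \<epsilon>0 cG clG that] inv[OF that] by auto
  have comm: "(G t o\<^sub>L ?p t) - (?p t o\<^sub>L G t) = (\<i> * of_real \<epsilon>) *\<^sub>C ?d t" if t: "t \<in> {0..1}" for t
  proof -
    have id: "(?p t o\<^sub>L ?d t) + (?d t o\<^sub>L ?p t) = ?d t" "?p t o\<^sub>L ?d t o\<^sub>L ?p t = 0"
      by (rule idempotent_derivative[OF _ p(3)[OF t] t], rule p(2), assumption)+
    have k1: "(K1 \<alpha> \<epsilon> t o\<^sub>L ?p t) - (?p t o\<^sub>L K1 \<alpha> \<epsilon> t) = \<i> *\<^sub>C ?d t"
    proof -
      have "K1 \<alpha> \<epsilon> t o\<^sub>L ?p t = \<i> *\<^sub>C (?d t o\<^sub>L ?p t)"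
        using id(2) p(2)[OF t] by (simp add: K1_def op_ring_simps)
      moreover have "?p t o\<^sub>L K1 \<alpha> \<epsilon> t = - (\<i> *\<^sub>C (?p t o\<^sub>L ?d t))"
        using id(2) p(1,2)[OF t] by (simp add: K1_def op_ring_simps idempotent_absorb scaleC_right_simps)
      ultimately have "(K1 \<alpha> \<epsilon> t o\<^sub>L ?p t) - (?p t o\<^sub>L K1 \<alpha> \<epsilon> t) = \<i> *\<^sub>C ((?p t o\<^sub>L ?d t) + (?d t o\<^sub>L ?p t))"
        by (simp add: scaleC_add_right)
      then show ?thesis unfolding id(1) .
    qed
    have "G t = (H \<alpha> t - \<epsilon> *\<^sub>R K \<alpha> t) + \<epsilon> *\<^sub>R (K1 \<alpha> \<epsilon> t + block_diagonal (?p t) (K \<alpha> t))"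
      by (simp add: G_def E_def scaleR_add_right scaleR_diff_right)
    then have "(G t o\<^sub>L ?p t) - (?p t o\<^sub>L G t) = \<epsilon> *\<^sub>R ((K1 \<alpha> \<epsilon> t o\<^sub>L ?p t) - (?p t o\<^sub>L K1 \<alpha> \<epsilon> t))"
      using p(4)[OF t] commutator_block[OF p(2)[OF t], of "K \<alpha> t"]
      by (simp add: blinfun_compose_linear scaleR_add_right scaleR_diff_right)
    also have "\<dots> = (\<i> * of_real \<epsilon>) *\<^sub>C ?d t"
      unfolding k1 by (simp add: scaleC_scaleR[symmetric] scaleC_scaleC[symmetric] scaleC_of_real)
    finally show ?thesis .
  qed
  have der: "((\<lambda>t. op_inverse (V t) o\<^sub>L ?p t o\<^sub>L V t) has_vector_derivative 0) (at t within {0..1})" if t: "t \<in> {0..1}" for t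
  proof -
    from has_vector_derivative_compose[OF has_vector_derivative_compose[OF evolution_inverse_derivative[OF ev \<epsilon>0 cG clG t] p(3)[OF t]]
        is_evolutionD(2)[OF ev \<epsilon>0 t]]
    have "((\<lambda>t. op_inverse (V t) o\<^sub>L ?p t o\<^sub>L V t) has_vector_derivative
        (op_inverse (V t) o\<^sub>L ?p t o\<^sub>L (?c *\<^sub>C (G t o\<^sub>L V t))) +
        ((op_inverse (V t) o\<^sub>L ?d t) + ((\<i> / complex_of_real \<epsilon>) *\<^sub>C (op_inverse (V t) o\<^sub>L G t) o\<^sub>L ?p t) o\<^sub>L V t)) (at t within {0..1})" .
    moreover have "(op_inverse (V t) o\<^sub>L ?p t o\<^sub>L (?c *\<^sub>C (G t o\<^sub>L V t))) +
        ((op_inverse (V t) o\<^sub>L ?d t) + ((\<i> / complex_of_real \<epsilon>) *\<^sub>C (op_inverse (V t) o\<^sub>L G t) o\<^sub>L ?p t) o\<^sub>L V t) =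
        op_inverse (V t) o\<^sub>L (?d t + (\<i> / complex_of_real \<epsilon>) *\<^sub>C ((G t o\<^sub>L ?p t) - (?p t o\<^sub>L G t))) o\<^sub>L V t"
      using clV[OF t] p(1)[OF t]
      by (intro blinfun_eqI) (simp add: blinfun.bilinear_simps scaleC_blinfun.rep_eq clinD scaleC_minus_left scaleC_right_simps)
    moreover have "?d t + (\<i> / complex_of_real \<epsilon>) *\<^sub>C ((G t o\<^sub>L ?p t) - (?p t o\<^sub>L G t)) = 0"
      unfolding comm[OF t] using \<epsilon>0 by (simp add: scaleC_scaleC scaleC_minus_left)
    ultimately show ?thesis
      by (simp add: blinfun_compose_zero)
  qed
  then obtain k where k: "\<And>t. t \<in> {0..1} \<Longrightarrow> op_inverse (V t) o\<^sub>L ?p t o\<^sub>L V t = k"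
    using has_vector_derivative_zero_constant[of "{0..1}" "\<lambda>t. op_inverse (V t) o\<^sub>L ?p t o\<^sub>L V t"] by auto
  have "k = ?p 0"
    using k[of 0] is_evolutionD(1)[OF ev \<epsilon>0] by simp
  then have main: "op_inverse (V s) o\<^sub>L ?p s o\<^sub>L V s = ?p 0"
    using k[OF s] by simp
  show "op_inverse (V s) o\<^sub>L ?p s = ?p 0 o\<^sub>L op_inverse (V s)"
    unfolding main[symmetric] using inv[OF s] by (simp add: blinfun_compose_assoc op_inverse_compose)
  show "?p s o\<^sub>L V s = V s o\<^sub>L ?p 0"
    unfolding main[symmetric] using inv[OF s] by (simp add: blinfun_compose_assoc)
qed

text \<open>Split \<open>a - (p o\<^sub>L a o\<^sub>L p)\<close> into the other three blocks of
  \<open>a\<close>. Idempotence of \<open>P0\<close> turns a complement of \<open>p\<close> next to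
  \<open>P0\<close> into the mismatch \<open>n\<close>: the off-diagonal blocks acquire one such
  factor, the remaining block two.\<close>

lemma P1_sandwich:
  fixes P0 p n a :: "'a \<Rightarrow>\<^sub>L 'a"
  assumes "P0 o\<^sub>L P0 = P0" "p o\<^sub>L p = p" "n = P0 - p"
  shows "P0 o\<^sub>L (a - (p o\<^sub>L a o\<^sub>L p)) o\<^sub>L P0 =
     (((P0 o\<^sub>L (p o\<^sub>L a o\<^sub>L (id_blinfun - p))) o\<^sub>L n) o\<^sub>L P0) + (((P0 o\<^sub>L n) o\<^sub>L ((id_blinfun - p) o\<^sub>L a o\<^sub>L p)) o\<^sub>L P0)
       + ((((P0 o\<^sub>L n) o\<^sub>L a) o\<^sub>L n) o\<^sub>L P0)"
  unfolding assms(3) using assms(1,2)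
  by (simp add: blinfun_compose_linear blinfun_compose_assoc idempotent_absorb)

lemma charge_expansion:
  assumes \<alpha>: "\<alpha> \<in> {0..1}" and U: "\<And>\<epsilon>. \<epsilon> > 0 \<Longrightarrow> is_evolution \<epsilon> (H \<alpha>) (U \<epsilon>)"
    and V: "\<forall>\<^sub>F \<epsilon> in at_right 0. is_evolution \<epsilon> (\<lambda>t. H \<alpha> t + \<epsilon> *\<^sub>R K \<alpha> t) (V \<epsilon>)"
    and V1: "\<forall>\<^sub>F \<epsilon> in at_right 0. is_evolution \<epsilon> (\<lambda>t. H \<alpha> t + \<epsilon> *\<^sub>R E \<alpha> \<epsilon> t) (V1 \<epsilon>)"
  defines "X1 \<equiv> \<lambda>\<epsilon> s. dH \<alpha> s - \<epsilon> *\<^sub>R dK \<alpha> s"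
  shows "Ob 1 (\<lambda>\<epsilon> t.
     (P \<alpha> 0 o\<^sub>L ((1 / \<epsilon>) *\<^sub>R integral {0..t} (\<lambda>s. op_inverse (U \<epsilon> s) o\<^sub>L dH \<alpha> s o\<^sub>L U \<epsilon> s)) o\<^sub>L P \<alpha> 0) -
     ((P \<alpha> 0 o\<^sub>L ((1 / \<epsilon>) *\<^sub>R integral {0..t} (\<lambda>s. op_inverse (V1 \<epsilon> s) o\<^sub>L
         (P1 \<alpha> \<epsilon> s o\<^sub>L X1 \<epsilon> s o\<^sub>L P1 \<alpha> \<epsilon> s) o\<^sub>L V1 \<epsilon> s)) o\<^sub>L P \<alpha> 0) +
      (P \<alpha> 0 o\<^sub>L integral {0..t} (\<lambda>s. op_inverse (V \<epsilon> s) o\<^sub>L dK \<alpha> s o\<^sub>L V \<epsilon> s) o\<^sub>L P \<alpha> 0)))"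
proof -
  define Iu where "Iu X \<epsilon> t = integral {0..t} (\<lambda>s. op_inverse (U \<epsilon> s) o\<^sub>L X \<epsilon> s o\<^sub>L U \<epsilon> s)"
    for X :: "real \<Rightarrow> real \<Rightarrow> 'a \<Rightarrow>\<^sub>L 'a" and \<epsilon> t
  define Iv where "Iv X \<epsilon> t = integral {0..t} (\<lambda>s. op_inverse (V \<epsilon> s) o\<^sub>L X \<epsilon> s o\<^sub>L V \<epsilon> s)"
    for X :: "real \<Rightarrow> real \<Rightarrow> 'a \<Rightarrow>\<^sub>L 'a" and \<epsilon> t
  define I1 where "I1 X \<epsilon> t = integral {0..t} (\<lambda>s. op_inverse (V1 \<epsilon> s) o\<^sub>L X \<epsilon> s o\<^sub>L V1 \<epsilon> s)"
    for X :: "real \<Rightarrow> real \<Rightarrow> 'a \<Rightarrow>\<^sub>L 'a" and \<epsilon> t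
  let ?P0 = "P \<alpha> 0" and ?p = "\<lambda>\<epsilon>. P1 \<alpha> \<epsilon> 0" and ?Bk = "\<lambda>\<epsilon> :: real. dK \<alpha>"
  let ?n = "\<lambda>\<epsilon>. ?P0 - ?p \<epsilon>"
  note cH = H_derivative(2)[OF \<alpha>]
  have zero01: "(0::real) \<in> {0..1}" by simp
  have cHE: "\<forall>\<^sub>F \<epsilon> in at_right 0. continuous_on {0..1} (\<lambda>t. H \<alpha> t + \<epsilon> *\<^sub>R E \<alpha> \<epsilon> t)"
    using C1b_continuous[OF E_C1b[OF \<alpha>]] by eventually_elim (intro continuous_on_add cH continuous_on_scaleR continuous_on_const)
  have cHK: "continuous_on {0..1} (\<lambda>t. H \<alpha> t + \<epsilon> *\<^sub>R K \<alpha> t)" for \<epsilon>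
    using C1b_continuous[OF K_C1b[OF \<alpha>]] by (intro continuous_on_add cH continuous_on_scaleR continuous_on_const) simp
  have U1: "\<forall>\<^sub>F \<epsilon> in at_right 0. \<forall>s\<in>{0..1}. op_invertible (U \<epsilon> s) \<and> norm (U \<epsilon> s) \<le> 1 \<and> norm (op_inverse (U \<epsilon> s)) \<le> 1"
    using eventually_pos
    by eventually_elim (auto intro!: evolution_norm_le[OF U _ cH selfadj[OF \<alpha>]] evolution_invertible[OF U _ cH])
  have Vinv: "\<forall>\<^sub>F \<epsilon> in at_right 0. \<forall>s\<in>{0..1}. op_invertible (V \<epsilon> s)"
    using V eventually_pos by eventually_elim (auto intro: evolution_invertible[OF _ _ cHK])
  have V1inv: "\<forall>\<^sub>F \<epsilon> in at_right 0. \<forall>s\<in>{0..1}. op_invertible (V1 \<epsilon> s)"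
    using V1 cHE eventually_pos
  proof eventually_elim
    case (elim \<epsilon>)
    then have "\<epsilon> \<noteq> 0" by simp
    then show ?case using evolution_invertible[OF elim(1) _ elim(2)] by blast
  qed
  have contU: "\<forall>\<^sub>F \<epsilon> in at_right 0. continuous_on {0..1} (\<lambda>s. op_inverse (U \<epsilon> s) o\<^sub>L X \<epsilon> s o\<^sub>L U \<epsilon> s)"
    if "\<forall>\<^sub>F \<epsilon> in at_right 0. continuous_on {0..1} (X \<epsilon>)" for X
    using that eventually_pos by eventually_elim (auto intro: conjugation_continuous[OF U _ cH])
  have contV: "\<forall>\<^sub>F \<epsilon> in at_right 0. continuous_on {0..1} (\<lambda>s. op_inverse (V \<epsilon> s) o\<^sub>L X \<epsilon> s o\<^sub>L V \<epsilon> s)"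
    if "\<forall>\<^sub>F \<epsilon> in at_right 0. continuous_on {0..1} (X \<epsilon>)" for X
    using that V eventually_pos by eventually_elim (auto intro: conjugation_continuous[OF _ _ cHK])
  have contV1: "\<forall>\<^sub>F \<epsilon> in at_right 0. continuous_on {0..1} (\<lambda>s. op_inverse (V1 \<epsilon> s) o\<^sub>L X \<epsilon> s o\<^sub>L V1 \<epsilon> s)"
    if "\<forall>\<^sub>F \<epsilon> in at_right 0. continuous_on {0..1} (X \<epsilon>)" for X
    using that V1 cHE eventually_pos
  proof eventually_elim
    case (elim \<epsilon>)
    then have "\<epsilon> \<noteq> 0" by simp
    then show ?case by (rule conjugation_continuous[OF elim(2) _ elim(3,1)])
  qed
  have UV: "Ob 1 (\<lambda>\<epsilon> s. (op_inverse (U \<epsilon> s) o\<^sub>L V \<epsilon> s) - id_blinfun)"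
    by (rule first_order_comparison[OF \<alpha> U V])
  have UV1: "Ob 2 (\<lambda>\<epsilon> s. (op_inverse (U \<epsilon> s) o\<^sub>L V1 \<epsilon> s) - id_blinfun)"
    by (rule second_order_comparison[OF \<alpha> U V1])
  have dHb: "Ob 0 (\<lambda>\<epsilon>. dH \<alpha>)" "\<forall>\<^sub>F \<epsilon> :: real in at_right 0. continuous_on {0..1} (dH \<alpha>)"
    using C1b_Ob[OF dH_C1b[OF \<alpha>]] C1b_continuous[OF dH_C1b[OF \<alpha>]] by auto
  have Bk: "Ob 0 ?Bk" "\<forall>\<^sub>F \<epsilon> :: real in at_right 0. continuous_on {0..1} (?Bk \<epsilon>)"
    using dK_continuous[OF \<alpha>] by (auto intro: Ob_continuous)
  have dHc: "continuous_on {0..1} (dH \<alpha>)" using dHb(2) by simp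
  have X1: "Ob 0 X1" "Ob 1 (\<lambda>\<epsilon> s. X1 \<epsilon> s - dH \<alpha> s)"
    using Ob_diff[OF dHb(1) Ob_mono[OF Ob_scaleR_eps[OF Bk(1)], of 0]] Ob_minus[OF Ob_scaleR_eps[OF Bk(1)]]
    by (simp_all add: X1_def)
  have X1c: "\<forall>\<^sub>F \<epsilon> in at_right 0. continuous_on {0..1} (X1 \<epsilon>)"
    unfolding X1_def by (intro always_eventually allI continuous_on_diff dHc continuous_on_scaleR continuous_on_const dK_continuous \<alpha>)

  \<comment> \<open>The term with \<open>dK\<close> has no prefactor, so the first-order evolution
    is accurate enough.\<close>
  have T1: "Ob 1 (\<lambda>\<epsilon> t. Iu ?Bk \<epsilon> t - Iv ?Bk \<epsilon> t)"
  proof -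
    have "Ob 1 (\<lambda>\<epsilon> s. (op_inverse (U \<epsilon> s) o\<^sub>L dK \<alpha> s o\<^sub>L U \<epsilon> s) - (op_inverse (V \<epsilon> s) o\<^sub>L dK \<alpha> s o\<^sub>L V \<epsilon> s))"
      using Ob_minus[OF Ob_conjugation(1)[OF U1 Vinv UV _ Bk(1)]] by simp
    moreover have "\<forall>\<^sub>F \<epsilon> in at_right 0. continuous_on {0..1}
        (\<lambda>s. (op_inverse (U \<epsilon> s) o\<^sub>L dK \<alpha> s o\<^sub>L U \<epsilon> s) - (op_inverse (V \<epsilon> s) o\<^sub>L dK \<alpha> s o\<^sub>L V \<epsilon> s))"
      using contU[OF Bk(2)] contV[OF Bk(2)] by eventually_elim (rule continuous_on_diff)
    ultimately have "Ob 1 (\<lambda>\<epsilon> t. integral {0..t} (\<lambda>s. (op_inverse (U \<epsilon> s) o\<^sub>L dK \<alpha> s o\<^sub>L U \<epsilon> s) - (op_inverse (V \<epsilon> s) o\<^sub>L dK \<alpha> s o\<^sub>L V \<epsilon> s)))"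
      by (rule Ob_integral)
    then show ?thesis
    proof (rule Ob_cong)
      show "\<forall>\<^sub>F \<epsilon> in at_right 0. \<forall>t\<in>{0..1}. Iu ?Bk \<epsilon> t - Iv ?Bk \<epsilon> t =
          integral {0..t} (\<lambda>s. (op_inverse (U \<epsilon> s) o\<^sub>L dK \<alpha> s o\<^sub>L U \<epsilon> s) - (op_inverse (V \<epsilon> s) o\<^sub>L dK \<alpha> s o\<^sub>L V \<epsilon> s))"
        using contU[OF Bk(2)] contV[OF Bk(2)]
      proof eventually_elim
        case (elim \<epsilon>)
        show ?case
          unfolding Iu_def Iv_def
          by (intro ballI Henstock_Kurzweil_Integration.integral_diff[symmetric] integrable_continuous_interval
              continuous_on_subset[OF elim(1)] continuous_on_subset[OF elim(2)]) auto
      qed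
    qed
  qed
  \<comment> \<open>Replacing \<open>U\<close> by \<open>V1\<close> costs two powers of \<epsilon>;
    one survives the prefactor of the charge.\<close>
  have diff1: "Ob (2 + l) (\<lambda>\<epsilon> t. Iu X \<epsilon> t - I1 X \<epsilon> t)"
    if X: "Ob l X" "\<forall>\<^sub>F \<epsilon> in at_right 0. continuous_on {0..1} (X \<epsilon>)" for X l
  proof -
    have "Ob (2 + l) (\<lambda>\<epsilon> s. (op_inverse (U \<epsilon> s) o\<^sub>L X \<epsilon> s o\<^sub>L U \<epsilon> s) - (op_inverse (V1 \<epsilon> s) o\<^sub>L X \<epsilon> s o\<^sub>L V1 \<epsilon> s))"
      using Ob_minus[OF Ob_conjugation(1)[OF U1 V1inv UV1 _ X(1)]] by simp
    moreover have "\<forall>\<^sub>F \<epsilon> in at_right 0. continuous_on {0..1}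
        (\<lambda>s. (op_inverse (U \<epsilon> s) o\<^sub>L X \<epsilon> s o\<^sub>L U \<epsilon> s) - (op_inverse (V1 \<epsilon> s) o\<^sub>L X \<epsilon> s o\<^sub>L V1 \<epsilon> s))"
      using contU[OF X(2)] contV1[OF X(2)] by eventually_elim (rule continuous_on_diff)
    ultimately have "Ob (2 + l) (\<lambda>\<epsilon> t. integral {0..t} (\<lambda>s. (op_inverse (U \<epsilon> s) o\<^sub>L X \<epsilon> s o\<^sub>L U \<epsilon> s) - (op_inverse (V1 \<epsilon> s) o\<^sub>L X \<epsilon> s o\<^sub>L V1 \<epsilon> s)))"
      by (rule Ob_integral)
    then show ?thesis
    proof (rule Ob_cong)
      show "\<forall>\<^sub>F \<epsilon> in at_right 0. \<forall>t\<in>{0..1}. Iu X \<epsilon> t - I1 X \<epsilon> t =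
          integral {0..t} (\<lambda>s. (op_inverse (U \<epsilon> s) o\<^sub>L X \<epsilon> s o\<^sub>L U \<epsilon> s) - (op_inverse (V1 \<epsilon> s) o\<^sub>L X \<epsilon> s o\<^sub>L V1 \<epsilon> s))"
        using contU[OF X(2)] contV1[OF X(2)]
      proof eventually_elim
        case (elim \<epsilon>)
        show ?case
          unfolding Iu_def I1_def
          by (intro ballI Henstock_Kurzweil_Integration.integral_diff[symmetric] integrable_continuous_interval
              continuous_on_subset[OF elim(1)] continuous_on_subset[OF elim(2)]) auto
      qed
    qed
  qed
  have T2: "Ob 1 (\<lambda>\<epsilon> t. (1 / \<epsilon>) *\<^sub>R (Iu X1 \<epsilon> t - I1 X1 \<epsilon> t))"
    by (rule Ob_divide_eps) (use diff1[OF X1(1) X1c] in \<open>simp add: numeral_2_eq_2\<close>)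

  \<comment> \<open>A family that is a commutator with \<open>P\<close> up to O(\<epsilon>) averages
    to O(\<epsilon>) along \<open>V1\<close> too: the gain is made along \<open>U\<close>, and the
    passage to \<open>V1\<close> is cheaper.\<close>
  have offd: "Ob 1 (I1 Y)"
    if Y: "Ob 0 Y" "\<forall>\<^sub>F \<epsilon> in at_right 0. continuous_on {0..1} (Y \<epsilon>)"
      and Z: "C1b 0 (\<lambda>\<epsilon>. Z)" and YZ: "Ob 1 (\<lambda>\<epsilon> s. Y \<epsilon> s - commutator (P \<alpha> s) (Z s))" for Y Z
  proof -
    have "Ob 1 (\<lambda>\<epsilon> t. integral {0..t} (\<lambda>s. op_inverse (U \<epsilon> s) o\<^sub>L Y \<epsilon> s o\<^sub>L U \<epsilon> s))"
    proof (rule Ob_integral_split)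
      show "Ob 1 (\<lambda>\<epsilon> t. integral {0..t} (\<lambda>s. op_inverse (U \<epsilon> s) o\<^sub>L commutator (P \<alpha> s) (Z s) o\<^sub>L U \<epsilon> s))"
        using osc_Ob[OF \<alpha> U Z] by simp
      show "Ob 1 (\<lambda>\<epsilon> s. (op_inverse (U \<epsilon> s) o\<^sub>L Y \<epsilon> s o\<^sub>L U \<epsilon> s) - (op_inverse (U \<epsilon> s) o\<^sub>L commutator (P \<alpha> s) (Z s) o\<^sub>L U \<epsilon> s))"
        using Ob_conjugation(2)[OF U1 V1inv UV1 _ YZ] by (simp add: blinfun_compose_linear)
      show "\<forall>\<^sub>F \<epsilon> in at_right 0. continuous_on {0..1} (\<lambda>s. op_inverse (U \<epsilon> s) o\<^sub>L Y \<epsilon> s o\<^sub>L U \<epsilon> s)"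
        by (rule contU[OF Y(2)])
      show "\<forall>\<^sub>F \<epsilon> in at_right 0. continuous_on {0..1} (\<lambda>s. op_inverse (U \<epsilon> s) o\<^sub>L commutator (P \<alpha> s) (Z s) o\<^sub>L U \<epsilon> s)"
        by (rule contU[OF C1b_continuous[OF C1b_commutator_left[OF P_C1b[OF \<alpha>] Z]]])
    qed
    then have "Ob 1 (Iu Y)"
      by (simp add: Iu_def[abs_def])
    from Ob_diff[OF this Ob_mono[OF diff1[OF Y], of 1]] show ?thesis
      by simp
  qed
  have I: "C1b 0 (\<lambda>(\<epsilon>::real) (s::real). id_blinfun :: 'a \<Rightarrow>\<^sub>L 'a)"
    by (rule C1b_const) simp
  note P0C = P_C1b[OF \<alpha>] and P1C = P1_C1b[OF \<alpha>] and dHC = dH_C1b[OF \<alpha>]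
  have \<delta>: "Ob 1 (\<lambda>\<epsilon> s. P1 \<alpha> \<epsilon> s - P \<alpha> s)"
    by (rule C1b_Ob[OF P1_properties(2)[OF \<alpha>]])
  have contc: "\<forall>\<^sub>F \<epsilon> in at_right 0. continuous_on {0..1} (\<lambda>s. A \<epsilon> s o\<^sub>L X1 \<epsilon> s o\<^sub>L B \<epsilon> s)"
    if "C1b 0 A" "C1b 0 B" for A B
    using C1b_continuous[OF that(1)] C1b_continuous[OF that(2)] X1c
    by eventually_elim (intro continuous_on_compose_op)
  have obc: "Ob 0 (\<lambda>\<epsilon> s. A \<epsilon> s o\<^sub>L X1 \<epsilon> s o\<^sub>L B \<epsilon> s)" if "C1b 0 A" "C1b 0 B" for A B
    by (rule Ob_compose_right[OF Ob_compose_right[OF C1b_Ob[OF that(1)] X1(1)] C1b_Ob[OF that(2)]])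
  \<comment> \<open>The three factors are exchanged one at a time for their limits; each exchange is
    of order \<epsilon> and the other factors are bounded.\<close>
  have close: "Ob 1 (\<lambda>\<epsilon> s. (A \<epsilon> s o\<^sub>L X1 \<epsilon> s o\<^sub>L B \<epsilon> s) - (A0 s o\<^sub>L dH \<alpha> s o\<^sub>L B0 s))"
    if "C1b 0 A" "C1b 0 B" "C1b 0 (\<lambda>\<epsilon>. A0)" "Ob 1 (\<lambda>\<epsilon> s. A \<epsilon> s - A0 s)" "Ob 1 (\<lambda>\<epsilon> s. B \<epsilon> s - B0 s)" for A B A0 B0
  proof -
    have 1: "Ob 1 (\<lambda>\<epsilon> s. (A \<epsilon> s - A0 s) o\<^sub>L X1 \<epsilon> s o\<^sub>L B \<epsilon> s)"
      by (rule Ob_compose_right[OF Ob_compose_right[OF that(4) X1(1)] C1b_Ob[OF that(2)]])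
    have 2: "Ob 1 (\<lambda>\<epsilon> s. A0 s o\<^sub>L (X1 \<epsilon> s - dH \<alpha> s) o\<^sub>L B \<epsilon> s)"
      by (rule Ob_compose_right[OF Ob_compose_left[OF C1b_Ob[OF that(3)] X1(2)] C1b_Ob[OF that(2)]])
    have 3: "Ob 1 (\<lambda>\<epsilon> s. A0 s o\<^sub>L dH \<alpha> s o\<^sub>L (B \<epsilon> s - B0 s))"
      by (rule Ob_compose_left[OF Ob_compose_right[OF C1b_Ob[OF that(3)] dHb(1)] that(5)])
    show ?thesis
      by (rule Ob_cong[OF Ob_add[OF Ob_add[OF 1 2] 3]]) (simp add: blinfun_compose_linear)
  qed
  let ?q1 = "\<lambda>\<epsilon> s. id_blinfun - P1 \<alpha> \<epsilon> s" and ?q0 = "\<lambda>s. id_blinfun - P \<alpha> s"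
  have q1C: "C1b 0 ?q1" and q0C: "C1b 0 (\<lambda>\<epsilon>. ?q0)"
    by (rule C1b_diff[OF I P1C], rule C1b_diff[OF I P0C])
  have \<delta>q: "Ob 1 (\<lambda>\<epsilon> s. ?q1 \<epsilon> s - ?q0 s)"
    using Ob_minus[OF \<delta>] by simp
  have T3a: "Ob 1 (I1 (\<lambda>\<epsilon> s. P1 \<alpha> \<epsilon> s o\<^sub>L X1 \<epsilon> s o\<^sub>L ?q1 \<epsilon> s))"
  proof (rule offd[OF obc[OF P1C q1C] contc[OF P1C q1C]])
    show "C1b 0 (\<lambda>\<epsilon> s. P \<alpha> s o\<^sub>L dH \<alpha> s o\<^sub>L ?q0 s)"
      by (rule C1b_compose_right[OF C1b_compose_right[OF P0C dHC] q0C])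
    show "Ob 1 (\<lambda>\<epsilon> s. (P1 \<alpha> \<epsilon> s o\<^sub>L X1 \<epsilon> s o\<^sub>L ?q1 \<epsilon> s) - commutator (P \<alpha> s) (P \<alpha> s o\<^sub>L dH \<alpha> s o\<^sub>L ?q0 s))"
      by (rule Ob_cong[OF close[OF P1C q1C P0C \<delta> \<delta>q]], rule always_eventually)
        (auto simp: commutator_def blinfun_compose_linear blinfun_compose_assoc idempotent_absorb P_projector(3)[OF \<alpha>])
  qed
  have T3b: "Ob 1 (I1 (\<lambda>\<epsilon> s. ?q1 \<epsilon> s o\<^sub>L X1 \<epsilon> s o\<^sub>L P1 \<alpha> \<epsilon> s))"
  proof (rule offd[OF obc[OF q1C P1C] contc[OF q1C P1C]])
    \<comment> \<open>The sign differs from the previous case because in this block \<open>P\<close>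
      acts as the identity from the right and annihilates from the left.\<close>
    show "C1b 0 (\<lambda>\<epsilon> s. - (?q0 s o\<^sub>L dH \<alpha> s o\<^sub>L P \<alpha> s))"
      by (rule C1b_minus[OF C1b_compose_right[OF C1b_compose_right[OF q0C dHC] P0C]])
    show "Ob 1 (\<lambda>\<epsilon> s. (?q1 \<epsilon> s o\<^sub>L X1 \<epsilon> s o\<^sub>L P1 \<alpha> \<epsilon> s) - commutator (P \<alpha> s) (- (?q0 s o\<^sub>L dH \<alpha> s o\<^sub>L P \<alpha> s)))"
      by (rule Ob_cong[OF close[OF q1C P1C q0C \<delta>q \<delta>]], rule always_eventually)
        (auto simp: commutator_def blinfun_compose_linear blinfun_compose_assoc idempotent_absorb P_projector(3)[OF \<alpha>])
  qed
  \<comment> \<open>Intertwining turns the projectors at time \<open>s\<close> into projectors at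
    time 0, which leave the integral. Block integrals along \<open>V1\<close> thus become blocks of
    one integral with respect to \<open>P1 \<alpha> \<epsilon> 0\<close>.\<close>
  have pull: "\<forall>\<^sub>F \<epsilon> in at_right 0. \<forall>t\<in>{0..1}.
      I1 (\<lambda>\<epsilon> s. P1 \<alpha> \<epsilon> s o\<^sub>L X1 \<epsilon> s o\<^sub>L P1 \<alpha> \<epsilon> s) \<epsilon> t = ?p \<epsilon> o\<^sub>L I1 X1 \<epsilon> t o\<^sub>L ?p \<epsilon> \<and>
      I1 (\<lambda>\<epsilon> s. P1 \<alpha> \<epsilon> s o\<^sub>L X1 \<epsilon> s o\<^sub>L ?q1 \<epsilon> s) \<epsilon> t = ?p \<epsilon> o\<^sub>L I1 X1 \<epsilon> t o\<^sub>L (id_blinfun - ?p \<epsilon>) \<and>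
      I1 (\<lambda>\<epsilon> s. ?q1 \<epsilon> s o\<^sub>L X1 \<epsilon> s o\<^sub>L P1 \<alpha> \<epsilon> s) \<epsilon> t = (id_blinfun - ?p \<epsilon>) o\<^sub>L I1 X1 \<epsilon> t o\<^sub>L ?p \<epsilon> \<and> ?p \<epsilon> o\<^sub>L ?p \<epsilon> = ?p \<epsilon>"
    using V1 P1_properties(1)[OF \<alpha>] C1b_continuous[OF E_C1b[OF \<alpha>]] C1b_clin[OF E_C1b[OF \<alpha>]] contV1[OF X1c] eventually_pos
  proof eventually_elim
    case (elim \<epsilon>)
    note int = intertwining[OF \<alpha> elim(6,1-4)]
    have 1: "op_inverse (V1 \<epsilon> s) o\<^sub>L (A' o\<^sub>L X1 \<epsilon> s o\<^sub>L B') o\<^sub>L V1 \<epsilon> s = A o\<^sub>L (op_inverse (V1 \<epsilon> s) o\<^sub>L X1 \<epsilon> s o\<^sub>L V1 \<epsilon> s) o\<^sub>L B"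
      if "op_inverse (V1 \<epsilon> s) o\<^sub>L A' = A o\<^sub>L op_inverse (V1 \<epsilon> s)" "B' o\<^sub>L V1 \<epsilon> s = V1 \<epsilon> s o\<^sub>L B" for s A A' B B'
    proof -
      have "op_inverse (V1 \<epsilon> s) o\<^sub>L (A' o\<^sub>L X1 \<epsilon> s o\<^sub>L B') o\<^sub>L V1 \<epsilon> s = (op_inverse (V1 \<epsilon> s) o\<^sub>L A') o\<^sub>L X1 \<epsilon> s o\<^sub>L (B' o\<^sub>L V1 \<epsilon> s)"
        by (simp only: blinfun_compose_assoc)
      then show ?thesis unfolding that by (simp only: blinfun_compose_assoc)
    qed
    have lin: "integral {0..t} (\<lambda>s. A o\<^sub>L (op_inverse (V1 \<epsilon> s) o\<^sub>L X1 \<epsilon> s o\<^sub>L V1 \<epsilon> s) o\<^sub>L B) = A o\<^sub>L I1 X1 \<epsilon> t o\<^sub>L B"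
      if t: "t \<in> {0..1}" for A B t
    proof -
      have "(\<lambda>s. op_inverse (V1 \<epsilon> s) o\<^sub>L X1 \<epsilon> s o\<^sub>L V1 \<epsilon> s) integrable_on {0..t}"
        by (intro integrable_continuous_interval continuous_on_subset[OF elim(5)]) (use t in auto)
      moreover have "bounded_linear (\<lambda>T. A o\<^sub>L T o\<^sub>L B)"
        by (intro bounded_linear_compose[OF bounded_bilinear.bounded_linear_left[OF bounded_bilinear_blinfun_compose]]
            bounded_bilinear.bounded_linear_right[OF bounded_bilinear_blinfun_compose])
      ultimately show ?thesis
        unfolding I1_def using integral_linear by (fastforce simp: o_def)
    qed
    have eqI: "I1 (\<lambda>\<epsilon> s. A' \<epsilon> s o\<^sub>L X1 \<epsilon> s o\<^sub>L B' \<epsilon> s) \<epsilon> t = A o\<^sub>L I1 X1 \<epsilon> t o\<^sub>L B"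
      if t: "t \<in> {0..1}" and "\<And>s. s \<in> {0..1} \<Longrightarrow> op_inverse (V1 \<epsilon> s) o\<^sub>L A' \<epsilon> s = A o\<^sub>L op_inverse (V1 \<epsilon> s)"
        "\<And>s. s \<in> {0..1} \<Longrightarrow> B' \<epsilon> s o\<^sub>L V1 \<epsilon> s = V1 \<epsilon> s o\<^sub>L B" for t A' B' A B
    proof -
      have "I1 (\<lambda>\<epsilon> s. A' \<epsilon> s o\<^sub>L X1 \<epsilon> s o\<^sub>L B' \<epsilon> s) \<epsilon> t = integral {0..t} (\<lambda>s. A o\<^sub>L (op_inverse (V1 \<epsilon> s) o\<^sub>L X1 \<epsilon> s o\<^sub>L V1 \<epsilon> s) o\<^sub>L B)"
        unfolding I1_def using t by (intro Henstock_Kurzweil_Integration.integral_cong 1 that) auto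
      then show ?thesis unfolding lin[OF t] .
    qed
    have intq: "op_inverse (V1 \<epsilon> s) o\<^sub>L ?q1 \<epsilon> s = (id_blinfun - ?p \<epsilon>) o\<^sub>L op_inverse (V1 \<epsilon> s)"
      "?q1 \<epsilon> s o\<^sub>L V1 \<epsilon> s = V1 \<epsilon> s o\<^sub>L (id_blinfun - ?p \<epsilon>)" if "s \<in> {0..1}" for s
      using int[OF that] by (simp_all add: blinfun_compose_linear)
    have "?p \<epsilon> o\<^sub>L ?p \<epsilon> = ?p \<epsilon>"
      using elim(2) by auto
    then show ?case
      by (intro ballI conjI eqI int intq)
  qed
  have nOb: "Ob 1 (\<lambda>\<epsilon> t. ?n \<epsilon>)"
  proof -
    obtain C where C: "\<forall>\<^sub>F \<epsilon> in at_right 0. \<forall>s\<in>{0..1}. norm (P1 \<alpha> \<epsilon> s - P \<alpha> s) \<le> C * \<epsilon> ^ 1"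
      using \<delta> unfolding Ob_def by blast
    show ?thesis
      by (rule ObI[of _ C], rule eventually_mono[OF C]) (auto simp: norm_minus_commute)
  qed
  have P0b: "Ob 0 (\<lambda>(\<epsilon>::real) (t::real). ?P0)" by (rule Ob_const)
  have paq: "Ob 1 (\<lambda>\<epsilon> t. ?p \<epsilon> o\<^sub>L I1 X1 \<epsilon> t o\<^sub>L (id_blinfun - ?p \<epsilon>))"
    by (rule Ob_cong[OF T3a]) (rule eventually_mono[OF pull], simp)
  have qap: "Ob 1 (\<lambda>\<epsilon> t. (id_blinfun - ?p \<epsilon>) o\<^sub>L I1 X1 \<epsilon> t o\<^sub>L ?p \<epsilon>)"
    by (rule Ob_cong[OF T3b]) (rule eventually_mono[OF pull], simp)
  have aOb: "Ob 0 (I1 X1)"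
  proof -
    have "Ob 0 (\<lambda>\<epsilon> t. integral {0..t} (\<lambda>s. op_inverse (U \<epsilon> s) o\<^sub>L X1 \<epsilon> s o\<^sub>L U \<epsilon> s))"
      by (rule Ob_integral[OF Ob_conjugation(2)[OF U1 V1inv UV1 _ X1(1)] contU[OF X1c]]) simp
    then have "Ob 0 (Iu X1)" by (simp add: Iu_def[abs_def])
    from Ob_diff[OF this Ob_mono[OF diff1[OF X1(1) X1c], of 0]] show ?thesis by simp
  qed
  \<comment> \<open>The second order is needed because of the division by \<epsilon>. The
    off-diagonal blocks contribute an averaged integral and one mismatch, the complementary block
    two mismatches and a bounded integral.\<close>
  have T3: "Ob 2 (\<lambda>\<epsilon> t. ?P0 o\<^sub>L (I1 X1 \<epsilon> t - (?p \<epsilon> o\<^sub>L I1 X1 \<epsilon> t o\<^sub>L ?p \<epsilon>)) o\<^sub>L ?P0)"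
  proof (rule Ob_cong)
    have 1: "Ob 2 (\<lambda>\<epsilon> t. ?P0 o\<^sub>L (?p \<epsilon> o\<^sub>L I1 X1 \<epsilon> t o\<^sub>L (id_blinfun - ?p \<epsilon>)) o\<^sub>L ?n \<epsilon> o\<^sub>L ?P0)"
      using Ob_compose_right[OF Ob_compose[OF Ob_compose_left[OF P0b paq] nOb] P0b] by (simp add: numeral_2_eq_2)
    have 2: "Ob 2 (\<lambda>\<epsilon> t. ?P0 o\<^sub>L ?n \<epsilon> o\<^sub>L ((id_blinfun - ?p \<epsilon>) o\<^sub>L I1 X1 \<epsilon> t o\<^sub>L ?p \<epsilon>) o\<^sub>L ?P0)"
      using Ob_compose_right[OF Ob_compose[OF Ob_compose_left[OF P0b nOb] qap] P0b] by (simp add: numeral_2_eq_2)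
    have 3: "Ob 2 (\<lambda>\<epsilon> t. ?P0 o\<^sub>L ?n \<epsilon> o\<^sub>L I1 X1 \<epsilon> t o\<^sub>L ?n \<epsilon> o\<^sub>L ?P0)"
      using Ob_compose_right[OF Ob_compose[OF Ob_compose_right[OF Ob_compose_left[OF P0b nOb] aOb] nOb] P0b] by (simp add: numeral_2_eq_2)
    show "Ob 2 (\<lambda>\<epsilon> t. (?P0 o\<^sub>L (?p \<epsilon> o\<^sub>L I1 X1 \<epsilon> t o\<^sub>L (id_blinfun - ?p \<epsilon>)) o\<^sub>L ?n \<epsilon> o\<^sub>L ?P0) +
        (?P0 o\<^sub>L ?n \<epsilon> o\<^sub>L ((id_blinfun - ?p \<epsilon>) o\<^sub>L I1 X1 \<epsilon> t o\<^sub>L ?p \<epsilon>) o\<^sub>L ?P0) +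
        (?P0 o\<^sub>L ?n \<epsilon> o\<^sub>L I1 X1 \<epsilon> t o\<^sub>L ?n \<epsilon> o\<^sub>L ?P0))"
      by (rule Ob_add[OF Ob_add[OF 1 2] 3])
    show "\<forall>\<^sub>F \<epsilon> in at_right 0. \<forall>t\<in>{0..1}. ?P0 o\<^sub>L (I1 X1 \<epsilon> t - (?p \<epsilon> o\<^sub>L I1 X1 \<epsilon> t o\<^sub>L ?p \<epsilon>)) o\<^sub>L ?P0 =
        (?P0 o\<^sub>L (?p \<epsilon> o\<^sub>L I1 X1 \<epsilon> t o\<^sub>L (id_blinfun - ?p \<epsilon>)) o\<^sub>L ?n \<epsilon> o\<^sub>L ?P0) +
        (?P0 o\<^sub>L ?n \<epsilon> o\<^sub>L ((id_blinfun - ?p \<epsilon>) o\<^sub>L I1 X1 \<epsilon> t o\<^sub>L ?p \<epsilon>) o\<^sub>L ?P0) +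
        (?P0 o\<^sub>L ?n \<epsilon> o\<^sub>L I1 X1 \<epsilon> t o\<^sub>L ?n \<epsilon> o\<^sub>L ?P0)"
      using pull
    proof eventually_elim
      case (elim \<epsilon>)
      have "?p \<epsilon> o\<^sub>L ?p \<epsilon> = ?p \<epsilon>" using elim zero01 by blast
      from P1_sandwich[OF P_projector(3)[OF \<alpha> zero01] this refl] show ?case by blast
    qed
  qed
  have total: "Ob 1 (\<lambda>\<epsilon> t. (?P0 o\<^sub>L (Iu ?Bk \<epsilon> t - Iv ?Bk \<epsilon> t) o\<^sub>L ?P0) +
      (?P0 o\<^sub>L ((1 / \<epsilon>) *\<^sub>R (Iu X1 \<epsilon> t - I1 X1 \<epsilon> t)) o\<^sub>L ?P0) +
      (1 / \<epsilon>) *\<^sub>R (?P0 o\<^sub>L (I1 X1 \<epsilon> t - (?p \<epsilon> o\<^sub>L I1 X1 \<epsilon> t o\<^sub>L ?p \<epsilon>)) o\<^sub>L ?P0))"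
    using Ob_divide_eps[of 1] T3
    by (intro Ob_add Ob_compose_right[OF Ob_compose_left[OF P0b T1] P0b] Ob_compose_right[OF Ob_compose_left[OF P0b T2] P0b])
      (simp add: numeral_2_eq_2)
  show ?thesis
  proof (rule Ob_cong[OF total])
    show "\<forall>\<^sub>F \<epsilon> in at_right 0. \<forall>t\<in>{0..1}.
       (?P0 o\<^sub>L ((1 / \<epsilon>) *\<^sub>R integral {0..t} (\<lambda>s. op_inverse (U \<epsilon> s) o\<^sub>L dH \<alpha> s o\<^sub>L U \<epsilon> s)) o\<^sub>L ?P0) -
       ((?P0 o\<^sub>L ((1 / \<epsilon>) *\<^sub>R integral {0..t} (\<lambda>s. op_inverse (V1 \<epsilon> s) o\<^sub>L
           (P1 \<alpha> \<epsilon> s o\<^sub>L X1 \<epsilon> s o\<^sub>L P1 \<alpha> \<epsilon> s) o\<^sub>L V1 \<epsilon> s)) o\<^sub>L ?P0) +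
        (?P0 o\<^sub>L integral {0..t} (\<lambda>s. op_inverse (V \<epsilon> s) o\<^sub>L dK \<alpha> s o\<^sub>L V \<epsilon> s) o\<^sub>L ?P0)) =
      (?P0 o\<^sub>L (Iu ?Bk \<epsilon> t - Iv ?Bk \<epsilon> t) o\<^sub>L ?P0) +
      (?P0 o\<^sub>L ((1 / \<epsilon>) *\<^sub>R (Iu X1 \<epsilon> t - I1 X1 \<epsilon> t)) o\<^sub>L ?P0) +
      (1 / \<epsilon>) *\<^sub>R (?P0 o\<^sub>L (I1 X1 \<epsilon> t - (?p \<epsilon> o\<^sub>L I1 X1 \<epsilon> t o\<^sub>L ?p \<epsilon>)) o\<^sub>L ?P0)"
      using pull contU[OF X1c] contU[OF Bk(2)] eventually_pos
    proof eventually_elim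
      case (elim \<epsilon>)
      show ?case
      proof
        fix t :: real assume t: "t \<in> {0..1}"
        have "{0..t} \<subseteq> {0..1}" using t by auto
        then have ints: "(\<lambda>s. op_inverse (U \<epsilon> s) o\<^sub>L X1 \<epsilon> s o\<^sub>L U \<epsilon> s) integrable_on {0..t}"
          "(\<lambda>s. op_inverse (U \<epsilon> s) o\<^sub>L dK \<alpha> s o\<^sub>L U \<epsilon> s) integrable_on {0..t}"
          using elim(2,3) continuous_on_subset integrable_continuous_interval by blast+
        have "integral {0..t} (\<lambda>s. op_inverse (U \<epsilon> s) o\<^sub>L dH \<alpha> s o\<^sub>L U \<epsilon> s) =
            integral {0..t} (\<lambda>s. (op_inverse (U \<epsilon> s) o\<^sub>L X1 \<epsilon> s o\<^sub>L U \<epsilon> s) + \<epsilon> *\<^sub>R (op_inverse (U \<epsilon> s) o\<^sub>L dK \<alpha> s o\<^sub>L U \<epsilon> s))"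
          by (simp add: X1_def blinfun_compose_linear)
        also have "\<dots> = Iu X1 \<epsilon> t + \<epsilon> *\<^sub>R Iu ?Bk \<epsilon> t"
          unfolding Iu_def by (subst Henstock_Kurzweil_Integration.integral_add) (use ints in \<open>auto intro: integrable_cmul\<close>)
        finally have 1: "integral {0..t} (\<lambda>s. op_inverse (U \<epsilon> s) o\<^sub>L dH \<alpha> s o\<^sub>L U \<epsilon> s) = Iu X1 \<epsilon> t + \<epsilon> *\<^sub>R Iu ?Bk \<epsilon> t" .
        have 2: "integral {0..t} (\<lambda>s. op_inverse (V1 \<epsilon> s) o\<^sub>L (P1 \<alpha> \<epsilon> s o\<^sub>L X1 \<epsilon> s o\<^sub>L P1 \<alpha> \<epsilon> s) o\<^sub>L V1 \<epsilon> s) =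
            ?p \<epsilon> o\<^sub>L I1 X1 \<epsilon> t o\<^sub>L ?p \<epsilon>"
          using elim(1) t unfolding I1_def by blast
        have 3: "integral {0..t} (\<lambda>s. op_inverse (V \<epsilon> s) o\<^sub>L dK \<alpha> s o\<^sub>L V \<epsilon> s) = Iv ?Bk \<epsilon> t"
          by (simp add: Iv_def)
        show "(?P0 o\<^sub>L ((1 / \<epsilon>) *\<^sub>R integral {0..t} (\<lambda>s. op_inverse (U \<epsilon> s) o\<^sub>L dH \<alpha> s o\<^sub>L U \<epsilon> s)) o\<^sub>L ?P0) -
         ((?P0 o\<^sub>L ((1 / \<epsilon>) *\<^sub>R integral {0..t} (\<lambda>s. op_inverse (V1 \<epsilon> s) o\<^sub>L
             (P1 \<alpha> \<epsilon> s o\<^sub>L X1 \<epsilon> s o\<^sub>L P1 \<alpha> \<epsilon> s) o\<^sub>L V1 \<epsilon> s)) o\<^sub>L ?P0) +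
          (?P0 o\<^sub>L integral {0..t} (\<lambda>s. op_inverse (V \<epsilon> s) o\<^sub>L dK \<alpha> s o\<^sub>L V \<epsilon> s) o\<^sub>L ?P0)) =
        (?P0 o\<^sub>L (Iu ?Bk \<epsilon> t - Iv ?Bk \<epsilon> t) o\<^sub>L ?P0) +
        (?P0 o\<^sub>L ((1 / \<epsilon>) *\<^sub>R (Iu X1 \<epsilon> t - I1 X1 \<epsilon> t)) o\<^sub>L ?P0) +
        (1 / \<epsilon>) *\<^sub>R (?P0 o\<^sub>L (I1 X1 \<epsilon> t - (?p \<epsilon> o\<^sub>L I1 X1 \<epsilon> t o\<^sub>L ?p \<epsilon>)) o\<^sub>L ?P0)"
          unfolding 1 2 3 using elim(4)
          by (simp add: blinfun_compose_linear scaleR_add_right scaleR_diff_right)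
      qed
    qed
  qed
qed

end

section \<open>The expansion for the given evolutions\<close>

theorem proposition2p1:
  fixes H :: "real \<Rightarrow> real \<Rightarrow> ('a::chilbert_space \<Rightarrow>\<^sub>L 'a)"
    and \<sigma> \<sigma>' :: "real \<Rightarrow> real \<Rightarrow> complex set"
    and g :: real
    and \<gamma> :: "real \<Rightarrow> real \<Rightarrow> (real \<Rightarrow> complex)"
    and P K W :: "real \<Rightarrow> real \<Rightarrow> ('a \<Rightarrow>\<^sub>L 'a)"
    and U Q \<Phi> H1 P1 K1 W1 \<Phi>1 :: "real \<Rightarrow> real \<Rightarrow> real \<Rightarrow> ('a \<Rightarrow>\<^sub>L 'a)"
  assumes separable: "separable_space (euclidean :: 'a topology)"
    and selfadj: "\<And>\<alpha> t. \<alpha> \<in> {0..1} \<Longrightarrow> t \<in> {0..1} \<Longrightarrow> self_adjoint (H \<alpha> t)"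
    and regularity: "Ck_on 3 ({0..1} \<times> {0..1}) (\<lambda>(t, \<alpha>). H \<alpha> t)"
    and spectrum: "\<And>\<alpha> t. \<alpha> \<in> {0..1} \<Longrightarrow> t \<in> {0..1} \<Longrightarrow>
          op_spectrum (H \<alpha> t) = \<sigma> \<alpha> t \<union> \<sigma>' \<alpha> t \<and> \<sigma> \<alpha> t \<inter> \<sigma>' \<alpha> t = {}"
    and gap_pos: "g > 0"
    and gap: "\<And>\<alpha> t z w. \<alpha> \<in> {0..1} \<Longrightarrow> t \<in> {0..1} \<Longrightarrow> z \<in> \<sigma> \<alpha> t \<Longrightarrow> w \<in> \<sigma>' \<alpha> t \<Longrightarrow> g \<le> dist z w"
    and loops: "\<And>p. p \<in> {0..1} \<times> {0..1} \<Longrightarrow>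
          \<exists>N. open N \<and> p \<in> N \<and>
              finite ((\<lambda>(t, \<alpha>). \<gamma> \<alpha> t) ` (N \<inter> {0..1} \<times> {0..1})) \<and>
              (\<forall>(t, \<alpha>) \<in> N \<inter> {0..1} \<times> {0..1}. \<forall>(t', \<alpha>') \<in> N \<inter> {0..1} \<times> {0..1}.
                 encircles_only (\<gamma> \<alpha> t) (\<sigma> \<alpha>' t') (\<sigma>' \<alpha>' t'))"
    and P: "\<And>\<alpha> t. P \<alpha> t = spectral_projector (H \<alpha> t) (\<gamma> \<alpha> t)"
    and U: "\<And>\<epsilon> \<alpha>. \<epsilon> > 0 \<Longrightarrow> \<alpha> \<in> {0..1} \<Longrightarrow> is_evolution \<epsilon> (H \<alpha>) (U \<epsilon> \<alpha>)"
    and Q: "\<And>\<epsilon> \<alpha> t. Q \<epsilon> \<alpha> t =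
          (1 / \<epsilon>) *\<^sub>R integral {0..t}
             (\<lambda>s. op_inverse (U \<epsilon> \<alpha> s) o\<^sub>L deriv01 (\<lambda>a. H a s) \<alpha> o\<^sub>L U \<epsilon> \<alpha> s)"
    and K: "\<And>\<alpha> t. K \<alpha> t = \<i> *\<^sub>C commutator (deriv01 (P \<alpha>) t) (P \<alpha> t)"
    and W: "\<And>\<alpha>. \<alpha> \<in> {0..1} \<Longrightarrow> is_evolution 1 (K \<alpha>) (W \<alpha>)"
    and \<Phi>: "\<And>\<epsilon> \<alpha>. \<epsilon> > 0 \<Longrightarrow> \<alpha> \<in> {0..1} \<Longrightarrow>
          is_evolution \<epsilon> (\<lambda>t. op_inverse (W \<alpha> t) o\<^sub>L H \<alpha> t o\<^sub>L W \<alpha> t) (\<Phi> \<epsilon> \<alpha>)"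
    and H1: "\<And>\<epsilon> \<alpha> t. H1 \<epsilon> \<alpha> t = H \<alpha> t - \<epsilon> *\<^sub>R K \<alpha> t"
    and P1: "\<And>\<epsilon> \<alpha> t. P1 \<epsilon> \<alpha> t = spectral_projector (H1 \<epsilon> \<alpha> t) (\<gamma> \<alpha> t)"
    and K1: "\<And>\<epsilon> \<alpha> t. K1 \<epsilon> \<alpha> t = \<i> *\<^sub>C commutator (deriv01 (P1 \<epsilon> \<alpha>) t) (P1 \<epsilon> \<alpha> t)"
    \<comment> \<open>\<open>P1\<close> is a meaningful differentiable family for small \<open>\<epsilon>\<close> only, hence the restriction to small
        \<open>\<epsilon>\<close> of the equations for \<open>W1\<close> and \<open>\<Phi>1\<close>.\<close>
    and W1: "\<And>\<alpha>. \<alpha> \<in> {0..1} \<Longrightarrow> \<forall>\<^sub>F \<epsilon> in at_right 0. is_evolution 1 (K1 \<epsilon> \<alpha>) (W1 \<epsilon> \<alpha>)"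
    and \<Phi>1: "\<And>\<alpha>. \<alpha> \<in> {0..1} \<Longrightarrow> \<forall>\<^sub>F \<epsilon> in at_right 0.
          is_evolution \<epsilon>
            (\<lambda>t. op_inverse (W1 \<epsilon> \<alpha> t) o\<^sub>L
                 (H1 \<epsilon> \<alpha> t + \<epsilon> *\<^sub>R block_diagonal (P1 \<epsilon> \<alpha> t) (K \<alpha> t)) o\<^sub>L W1 \<epsilon> \<alpha> t)
            (\<Phi>1 \<epsilon> \<alpha>)"
  shows "\<forall>t\<in>{0..1}. \<forall>\<alpha>\<in>{0..1}.
     (\<lambda>\<epsilon>. norm (
        (P \<alpha> 0 o\<^sub>L Q \<epsilon> \<alpha> t o\<^sub>L P \<alpha> 0)
        - ((P \<alpha> 0 o\<^sub>L
              ((1 / \<epsilon>) *\<^sub>R integral {0..t} (\<lambda>s.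
                 op_inverse (\<Phi>1 \<epsilon> \<alpha> s) o\<^sub>L op_inverse (W1 \<epsilon> \<alpha> s) o\<^sub>L P1 \<epsilon> \<alpha> s o\<^sub>L
                 deriv01 (\<lambda>a. H1 \<epsilon> a s) \<alpha> o\<^sub>L
                 P1 \<epsilon> \<alpha> s o\<^sub>L W1 \<epsilon> \<alpha> s o\<^sub>L \<Phi>1 \<epsilon> \<alpha> s))
            o\<^sub>L P \<alpha> 0)
           + (P \<alpha> 0 o\<^sub>L
              integral {0..t} (\<lambda>s.
                 op_inverse (\<Phi> \<epsilon> \<alpha> s) o\<^sub>L op_inverse (W \<alpha> s) o\<^sub>L
                 deriv01 (\<lambda>a. K a s) \<alpha> o\<^sub>L
                 W \<alpha> s o\<^sub>L \<Phi> \<epsilon> \<alpha> s)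
            o\<^sub>L P \<alpha> 0))))
     \<in> O[at_right 0](\<lambda>\<epsilon>. \<epsilon>)"
proof (intro ballI)
  fix t \<alpha> :: real
  assume t: "t \<in> {0..1}" and \<alpha>: "\<alpha> \<in> {0..1}"
  interpret G: gapped_family H \<sigma> \<sigma>' \<gamma>
    by (rule gapped_family.intro[OF selfadj regularity spectrum loops])
  have PG: "P = G.P"
    by (intro ext) (simp add: P G.P_def)
  have KG: "K = G.K"
    by (intro ext) (simp add: K G.K_def PG)
  have P1G: "P1 \<epsilon> \<alpha> = G.P1 \<alpha> \<epsilon>" for \<epsilon>
    by (intro ext) (simp add: P1 G.P1_def H1 KG)
  have K1G: "K1 \<epsilon> \<alpha> s = G.K1 \<alpha> \<epsilon> s" for \<epsilon> s
    by (simp add: K1 G.K1_def G.dP1_def P1G)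
  define V where "V \<epsilon> s = W \<alpha> s o\<^sub>L \<Phi> \<epsilon> \<alpha> s" for \<epsilon> s
  define V1 where "V1 \<epsilon> s = W1 \<epsilon> \<alpha> s o\<^sub>L \<Phi>1 \<epsilon> \<alpha> s" for \<epsilon> s
  have cH: "continuous_on {0..1} (H \<alpha>)"
    by (rule G.H_derivative(2)[OF \<alpha>])
  have cK: "continuous_on {0..1} (G.K \<alpha>)"
    using C1b_continuous[OF G.K_C1b[OF \<alpha>]] by simp
  have evW: "is_evolution 1 (G.K \<alpha>) (W \<alpha>)"
    using W[OF \<alpha>] by (simp add: KG)
  have invW: "op_invertible (W \<alpha> s)" if "s \<in> {0..1}" for s
    by (rule evolution_invertible[OF evW _ cK that]) simp
  have inv\<Phi>: "op_invertible (\<Phi> \<epsilon> \<alpha> s)" if \<epsilon>: "\<epsilon> > 0" and s: "s \<in> {0..1}" for \<epsilon> s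
  proof (rule evolution_invertible[OF \<Phi>[OF \<epsilon> \<alpha>] _ _ s])
    show "continuous_on {0..1} (\<lambda>t. op_inverse (W \<alpha> t) o\<^sub>L H \<alpha> t o\<^sub>L W \<alpha> t)"
      by (rule conjugation_continuous[OF evW _ cK cH]) simp
  qed (use \<epsilon> in simp)
  have evV: "\<forall>\<^sub>F \<epsilon> in at_right 0. is_evolution \<epsilon> (\<lambda>t. H \<alpha> t + \<epsilon> *\<^sub>R G.K \<alpha> t) (V \<epsilon>)"
    using eventually_pos
  proof eventually_elim
    case (elim \<epsilon>)
    then show ?case
      unfolding V_def[abs_def]
      by (intro evolution_product[OF evW cK G.K_clin[OF \<alpha>] \<Phi>[OF _ \<alpha>]]) auto
  qed
  let ?D = "\<lambda>\<epsilon> s. block_diagonal (G.P1 \<alpha> \<epsilon> s) (G.K \<alpha> s)"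
  have D: "\<forall>\<^sub>F \<epsilon> in at_right 0. continuous_on {0..1} (?D \<epsilon>)"
  proof -
    have "C1b 0 ?D"
      unfolding block_diagonal_def
      by (intro C1b_add C1b_compose_left C1b_diff C1b_const clin_simps G.P1_C1b G.K_C1b \<alpha>)
    then show ?thesis by (rule C1b_continuous)
  qed
  note ev1 = W1[OF \<alpha>] \<Phi>1[OF \<alpha>] D C1b_continuous[OF G.K1_C1b[OF \<alpha>]] C1b_clin[OF G.K1_C1b[OF \<alpha>]] eventually_pos
  \<comment> \<open>Invertibility of the two factors is recorded as well, so that the inverse of
    their product can be split in the integrand of the claim.\<close>
  have V1_facts: "\<forall>\<^sub>F \<epsilon> in at_right 0. is_evolution \<epsilon> (\<lambda>t. H \<alpha> t + \<epsilon> *\<^sub>R G.E \<alpha> \<epsilon> t) (V1 \<epsilon>) \<and>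
      (\<forall>s\<in>{0..1}. op_invertible (W1 \<epsilon> \<alpha> s) \<and> op_invertible (\<Phi>1 \<epsilon> \<alpha> s))"
    using ev1
  proof eventually_elim
    case (elim \<epsilon>)
    have \<epsilon>0: "\<epsilon> \<noteq> 0" using elim(6) by simp
    have eW: "is_evolution 1 (G.K1 \<alpha> \<epsilon>) (W1 \<epsilon> \<alpha>)"
      using elim(1) by (simp add: K1G[abs_def])
    let ?G = "\<lambda>s. H1 \<epsilon> \<alpha> s + \<epsilon> *\<^sub>R ?D \<epsilon> s"
    have e\<Phi>: "is_evolution \<epsilon> (\<lambda>t. op_inverse (W1 \<epsilon> \<alpha> t) o\<^sub>L ?G t o\<^sub>L W1 \<epsilon> \<alpha> t) (\<Phi>1 \<epsilon> \<alpha>)"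
      using elim(2) by (simp add: P1G KG)
    have cG: "continuous_on {0..1} ?G"
      unfolding H1 KG by (intro continuous_on_add continuous_on_diff continuous_on_scaleR continuous_on_const cH cK elim(3))
    have i1: "op_invertible (W1 \<epsilon> \<alpha> s)" if "s \<in> {0..1}" for s
      by (rule evolution_invertible[OF eW _ elim(4) that]) simp
    have i2: "op_invertible (\<Phi>1 \<epsilon> \<alpha> s)" if "s \<in> {0..1}" for s
      by (rule evolution_invertible[OF e\<Phi> \<epsilon>0 conjugation_continuous[OF eW _ elim(4) cG] that]) simp
    have "is_evolution \<epsilon> (\<lambda>t. ?G t + \<epsilon> *\<^sub>R G.K1 \<alpha> \<epsilon> t) (V1 \<epsilon>)"
      unfolding V1_def[abs_def] using elim(5) by (intro evolution_product[OF eW elim(4) _ e\<Phi> \<epsilon>0]) auto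
    \<comment> \<open>Here \<open>H1\<close> supplies the \<open>- \<epsilon> *\<^sub>R K\<close>
      that belongs to \<open>G.E\<close>, so the composite generator is exactly the one compared
      with \<open>H\<close>.\<close>
    moreover have "?G s + \<epsilon> *\<^sub>R G.K1 \<alpha> \<epsilon> s = H \<alpha> s + \<epsilon> *\<^sub>R G.E \<alpha> \<epsilon> s" for s
      by (simp add: H1 KG G.E_def scaleR_add_right scaleR_diff_right)
    ultimately show ?case
      using i1 i2 by simp
  qed
  have evV1: "\<forall>\<^sub>F \<epsilon> in at_right 0. is_evolution \<epsilon> (\<lambda>t. H \<alpha> t + \<epsilon> *\<^sub>R G.E \<alpha> \<epsilon> t) (V1 \<epsilon>)"
    using V1_facts by eventually_elim blast
  obtain C where C: "\<forall>\<^sub>F \<epsilon> in at_right 0. \<forall>t\<in>{0..1}. norm (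
     (G.P \<alpha> 0 o\<^sub>L ((1 / \<epsilon>) *\<^sub>R integral {0..t} (\<lambda>s. op_inverse (U \<epsilon> \<alpha> s) o\<^sub>L G.dH \<alpha> s o\<^sub>L U \<epsilon> \<alpha> s)) o\<^sub>L G.P \<alpha> 0) -
     ((G.P \<alpha> 0 o\<^sub>L ((1 / \<epsilon>) *\<^sub>R integral {0..t} (\<lambda>s. op_inverse (V1 \<epsilon> s) o\<^sub>L
         (G.P1 \<alpha> \<epsilon> s o\<^sub>L (G.dH \<alpha> s - \<epsilon> *\<^sub>R G.dK \<alpha> s) o\<^sub>L G.P1 \<alpha> \<epsilon> s) o\<^sub>L V1 \<epsilon> s)) o\<^sub>L G.P \<alpha> 0) +
      (G.P \<alpha> 0 o\<^sub>L integral {0..t} (\<lambda>s. op_inverse (V \<epsilon> s) o\<^sub>L G.dK \<alpha> s o\<^sub>L V \<epsilon> s) o\<^sub>L G.P \<alpha> 0))) \<le> C * \<epsilon> ^ 1"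
    using G.charge_expansion[OF \<alpha> U[OF _ \<alpha>] evV evV1] unfolding Ob_def by blast
  show "(\<lambda>\<epsilon>. norm (
        (P \<alpha> 0 o\<^sub>L Q \<epsilon> \<alpha> t o\<^sub>L P \<alpha> 0)
        - ((P \<alpha> 0 o\<^sub>L
              ((1 / \<epsilon>) *\<^sub>R integral {0..t} (\<lambda>s.
                 op_inverse (\<Phi>1 \<epsilon> \<alpha> s) o\<^sub>L op_inverse (W1 \<epsilon> \<alpha> s) o\<^sub>L P1 \<epsilon> \<alpha> s o\<^sub>L
                 deriv01 (\<lambda>a. H1 \<epsilon> a s) \<alpha> o\<^sub>L
                 P1 \<epsilon> \<alpha> s o\<^sub>L W1 \<epsilon> \<alpha> s o\<^sub>L \<Phi>1 \<epsilon> \<alpha> s))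
            o\<^sub>L P \<alpha> 0)
           + (P \<alpha> 0 o\<^sub>L
              integral {0..t} (\<lambda>s.
                 op_inverse (\<Phi> \<epsilon> \<alpha> s) o\<^sub>L op_inverse (W \<alpha> s) o\<^sub>L
                 deriv01 (\<lambda>a. K a s) \<alpha> o\<^sub>L
                 W \<alpha> s o\<^sub>L \<Phi> \<epsilon> \<alpha> s)
            o\<^sub>L P \<alpha> 0))))
     \<in> O[at_right 0](\<lambda>\<epsilon>. \<epsilon>)"
  proof (rule bigoI[of _ C])
    show "\<forall>\<^sub>F \<epsilon> in at_right 0. norm (norm (
        (P \<alpha> 0 o\<^sub>L Q \<epsilon> \<alpha> t o\<^sub>L P \<alpha> 0)
        - ((P \<alpha> 0 o\<^sub>L
              ((1 / \<epsilon>) *\<^sub>R integral {0..t} (\<lambda>s.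
                 op_inverse (\<Phi>1 \<epsilon> \<alpha> s) o\<^sub>L op_inverse (W1 \<epsilon> \<alpha> s) o\<^sub>L P1 \<epsilon> \<alpha> s o\<^sub>L
                 deriv01 (\<lambda>a. H1 \<epsilon> a s) \<alpha> o\<^sub>L
                 P1 \<epsilon> \<alpha> s o\<^sub>L W1 \<epsilon> \<alpha> s o\<^sub>L \<Phi>1 \<epsilon> \<alpha> s))
            o\<^sub>L P \<alpha> 0)
           + (P \<alpha> 0 o\<^sub>L
              integral {0..t} (\<lambda>s.
                 op_inverse (\<Phi> \<epsilon> \<alpha> s) o\<^sub>L op_inverse (W \<alpha> s) o\<^sub>L
                 deriv01 (\<lambda>a. K a s) \<alpha> o\<^sub>L
                 W \<alpha> s o\<^sub>L \<Phi> \<epsilon> \<alpha> s)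
            o\<^sub>L P \<alpha> 0)))) \<le> C * norm \<epsilon>"
      using C V1_facts eventually_pos
    proof eventually_elim
      case (elim \<epsilon>)
      have s01: "s \<in> {0..1}" if "s \<in> {0..t}" for s
        using that t by auto
      have 1: "integral {0..t} (\<lambda>s.
                 op_inverse (\<Phi>1 \<epsilon> \<alpha> s) o\<^sub>L op_inverse (W1 \<epsilon> \<alpha> s) o\<^sub>L P1 \<epsilon> \<alpha> s o\<^sub>L
                 deriv01 (\<lambda>a. H1 \<epsilon> a s) \<alpha> o\<^sub>L
                 P1 \<epsilon> \<alpha> s o\<^sub>L W1 \<epsilon> \<alpha> s o\<^sub>L \<Phi>1 \<epsilon> \<alpha> s) =
          integral {0..t} (\<lambda>s. op_inverse (V1 \<epsilon> s) o\<^sub>L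
           (G.P1 \<alpha> \<epsilon> s o\<^sub>L (G.dH \<alpha> s - \<epsilon> *\<^sub>R G.dK \<alpha> s) o\<^sub>L G.P1 \<alpha> \<epsilon> s) o\<^sub>L V1 \<epsilon> s)"
      proof (rule Henstock_Kurzweil_Integration.integral_cong)
        fix s assume s: "s \<in> {0..t}"
        have "op_invertible (W1 \<epsilon> \<alpha> s)" "op_invertible (\<Phi>1 \<epsilon> \<alpha> s)"
          using elim(2) s01[OF s] by auto
        from op_invertible_compose(2)[OF this]
        show "op_inverse (\<Phi>1 \<epsilon> \<alpha> s) o\<^sub>L op_inverse (W1 \<epsilon> \<alpha> s) o\<^sub>L P1 \<epsilon> \<alpha> s o\<^sub>L
                 deriv01 (\<lambda>a. H1 \<epsilon> a s) \<alpha> o\<^sub>L P1 \<epsilon> \<alpha> s o\<^sub>L W1 \<epsilon> \<alpha> s o\<^sub>L \<Phi>1 \<epsilon> \<alpha> s =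
            op_inverse (V1 \<epsilon> s) o\<^sub>L
             (G.P1 \<alpha> \<epsilon> s o\<^sub>L (G.dH \<alpha> s - \<epsilon> *\<^sub>R G.dK \<alpha> s) o\<^sub>L G.P1 \<alpha> \<epsilon> s) o\<^sub>L V1 \<epsilon> s"
          unfolding H1 KG G.deriv01_H1[OF \<alpha> s01[OF s]] P1G V1_def by (simp only: blinfun_compose_assoc)
      qed
      have 2: "integral {0..t} (\<lambda>s.
                 op_inverse (\<Phi> \<epsilon> \<alpha> s) o\<^sub>L op_inverse (W \<alpha> s) o\<^sub>L
                 deriv01 (\<lambda>a. K a s) \<alpha> o\<^sub>L W \<alpha> s o\<^sub>L \<Phi> \<epsilon> \<alpha> s) =
          integral {0..t} (\<lambda>s. op_inverse (V \<epsilon> s) o\<^sub>L G.dK \<alpha> s o\<^sub>L V \<epsilon> s)"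
      proof (rule Henstock_Kurzweil_Integration.integral_cong)
        fix s assume s: "s \<in> {0..t}"
        from op_invertible_compose(2)[OF invW[OF s01[OF s]] inv\<Phi>[OF elim(3) s01[OF s]]]
        show "op_inverse (\<Phi> \<epsilon> \<alpha> s) o\<^sub>L op_inverse (W \<alpha> s) o\<^sub>L
                 deriv01 (\<lambda>a. K a s) \<alpha> o\<^sub>L W \<alpha> s o\<^sub>L \<Phi> \<epsilon> \<alpha> s =
            op_inverse (V \<epsilon> s) o\<^sub>L G.dK \<alpha> s o\<^sub>L V \<epsilon> s"
          unfolding KG G.dK_def V_def by (simp only: blinfun_compose_assoc)
      qed
      have 3: "Q \<epsilon> \<alpha> t = (1 / \<epsilon>) *\<^sub>R integral {0..t} (\<lambda>s. op_inverse (U \<epsilon> \<alpha> s) o\<^sub>L G.dH \<alpha> s o\<^sub>L U \<epsilon> \<alpha> s)"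
        by (simp add: Q G.dH_def)
      show ?case
        unfolding 1 2 3 PG using bspec[OF elim(1) t] elim(3) by simp
    qed
  qed
qed

end
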